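(* Let $m,n\geq 1$, let $\mathbb{G}_{m,n}\subset\mathbb{R}^{(m+n)^2}$ be the embedded Grassmannian, let $\lambda$ be a partition of the $(m\times n)$-rectangle and let $\sigma_\lambda\subset\mathbb{G}_{m,n}$ be the Schubert variety defined by the incidence conditions prescribed by $\lambda$ with respect to the canonical complete flag $0\subset\mathbb{R}\subset\mathbb{R}^2\subset\dots\subset\mathbb{R}^{m+n}$ of $\mathbb{R}^{m+n}$. Then $\sigma_\lambda$ admits a $\mathbb{Q}$-desingularization.
   Context: Identify $\mathbb{R}^{(m+n)^2}$ with the real $(m+n)\times(m+n)$ matrices. The embedded Grassmannian is $\mathbb{G}_{m,n}=\{X\in\mathbb{R}^{(m+n)^2}: X^T=X,\ X^2=X,\ \mathrm{tr}(X)=m\}$; $X$ corresponds to the $m$-dimensional subspace $\mathrm{im}(X)\subset\mathbb{R}^{m+n}$ onto which it is the orthogonal projection. For $\ell\le m+n$, $\mathbb{R}^\ell\subset\mathbb{R}^{m+n}$ denotes the span of the first $\ell$ canonical basis vectors, and $D_\ell$ the diagonal matrix with $1$ in the first $\ell$ diagonal entries and $0$ elsewhere. A partition of the $(m\times n)$-rectangle is a sequence of integers $\lambda=(\lambda_1,\dots,\lambda_m)$ with $n\ge\lambda_1\ge\dots\ge\lambda_m\ge0$. The Schubert variety is $$\sigma_\lambda=\{X\in\mathbb{G}_{m,n}: \dim(\mathrm{im}(X)\cap\mathbb{R}^{n+k-\lambda_k})\ge k,\ k=1,\dots,m\},$$ equivalently $\mathrm{rank}((X-\mathrm{id})D_{n+k-\lambda_k})\le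 n-\lambda_k$ for $k=1,\dots,m$. It is a $\mathbb{Q}$-algebraic set. $\mathbb{Q}$-notions. A set $V\subset\mathbb{R}^n$ is $\mathbb{Q}$-algebraic if it is the common zero set in $\mathbb{R}^n$ of a family of polynomials in $\mathbb{Q}[x]=\mathbb{Q}[x_1,\dots,x_n]$. For $K\in\{\mathbb{Q},\mathbb{R}\}$ put $\mathcal{I}_K(V)=\{f\in K[x]: f|_V=0\}$, and for $a\in\mathbb{R}^n$ let $\mathfrak{n}_a=(x_1-a_1,\dots,x_n-a_n)\mathbb{R}[x]$. $V$ is nonsingular if for every $a\in V$ the ring $\mathbb{R}[x]_{\mathfrak{n}_a}/\mathcal{I}_\mathbb{R}(V)\mathbb{R}[x]_{\mathfrak{n}_a}$ is a regular local ring of dimension $\dim V$. A point $a$ of a $\mathbb{Q}$-algebraic set $V$ is $\mathbb{R}|\mathbb{Q}$-regular if $\mathbb{R}[x]_{\mathfrak{n}_a}/\mathcal{I}_\mathbb{Q}(V)\mathbb{R}[x]_{\mathfrak{n}_a}$ is a regular local ring of dimension $\dim V$. A $\mathbb{Q}$-algebraic set is $\mathbb{Q}$-nonsingular if it is nonsingular and all its points are $\mathbb{R}|\mathbb{Q}$-regular. A polynomial $p$ of degree $e$ with homogeneous decomposition $p=\sum_{i=0}^e p_i$ is overt if the real zero set of $p_e$ is either empty or $\{0\}$; $V$ is projectively $\mathbb{Q}$-closed if it is the zero set of an overt polynomial with rational coefficients. Desingularization. Let $V\subset\mathbb{R}^q$ be a $\mathbb{Q}$-algebraic set of dimension $d$.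 A set $V'\subset\mathbb{R}^q\times\mathbb{R}^r$, for some $r\in\mathbb{N}$, is a desingularization of $V$ if $V'$ is a nonsingular algebraic set of dimension $d$ and $\pi|_{V'}:V'\to V$ is a birational map, where $\pi:\mathbb{R}^q\times\mathbb{R}^r\to\mathbb{R}^q$ is the projection onto the first factor (birational: it restricts to a biregular isomorphism between Zariski dense, Zariski open subsets of $V'$ and $V$). If in addition $V'$ is a projectively $\mathbb{Q}$-closed $\mathbb{Q}$-nonsingular $\mathbb{Q}$-algebraic set, $V'$ is called a $\mathbb{Q}$-desingularization of $V$. *)

theory Defs
  imports
    "HOL-Library.Poly_Mapping"
    "HOL-Library.Extended_Real"
    "HOL-Computational_Algebra.Fraction_Field"
    "HOL-Algebra.QuotRing"
    "HOL-Algebra.Ring_Divisibility"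
    "Jordan_Normal_Form.VS_Connect"
begin

section \<open>Polynomials in finitely many variables and their zero sets\<close>

text \<open>
  Points of real affine \<open>N\<close>-space are the elements of \<^term>\<open>carrier_vec N :: real vec set\<close>.
  Polynomials have variables indexed by the natural numbers; those in \<open>N\<close> variables with
  coefficients in \<open>K\<close> are singled out by \<open>polys K N\<close>, used below with \<open>K = \<rat>\<close> and \<open>K = UNIV\<close>.
\<close>

type_synonym 'a mpoly = "(nat \<Rightarrow>\<^sub>0 nat) \<Rightarrow>\<^sub>0 'a"

definition polys :: "real set \<Rightarrow> nat \<Rightarrow> real mpoly set" where
  "polys K N = {p. (\<forall>t\<in>Poly_Mapping.keys p. Poly_Mapping.keys t \<subseteq> {..<N}) \<and>
                   (\<forall>t. Poly_Mapping.lookup p t \<in> K)}"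

definition mpoly_const :: "real \<Rightarrow> real mpoly" where
  "mpoly_const c = Poly_Mapping.single 0 c"

definition mpoly_var :: "nat \<Rightarrow> real mpoly" where
  "mpoly_var i = Poly_Mapping.single (Poly_Mapping.single i 1) 1"

definition eval_mpoly :: "real mpoly \<Rightarrow> real vec \<Rightarrow> real" where
  "eval_mpoly p x = (\<Sum>t\<in>Poly_Mapping.keys p. Poly_Mapping.lookup p t *
                       (\<Prod>i\<in>Poly_Mapping.keys t. (x $ i) ^ Poly_Mapping.lookup t i))"

definition zero_set :: "nat \<Rightarrow> real mpoly set \<Rightarrow> real vec set" where
  "zero_set N F = {x \<in> carrier_vec N. \<forall>f\<in>F. eval_mpoly f x = 0}"

definition algebraic_set :: "real set \<Rightarrow> nat \<Rightarrow> real vec set \<Rightarrow> bool" where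
  "algebraic_set K N V \<longleftrightarrow> (\<exists>F. F \<subseteq> polys K N \<and> V = zero_set N F)"

definition vanishing_ideal :: "real set \<Rightarrow> nat \<Rightarrow> real vec set \<Rightarrow> real mpoly set" where
  "vanishing_ideal K N V = {f \<in> polys K N. \<forall>x\<in>V. eval_mpoly f x = 0}"


section \<open>Krull dimension and regular local rings\<close>

text \<open>
  The supremum is taken in the extended reals, so that the zero ring, which has no prime ideals,
  gets dimension \<open>-\<infinity>\<close> rather than \<open>0\<close>.
\<close>

definition krull_dim :: "('a, 'b) ring_scheme \<Rightarrow> ereal" where
  "krull_dim R = Sup {ereal (real k) | k.
     \<exists>P :: nat \<Rightarrow> 'a set. (\<forall>i\<le>k. primeideal (P i) R) \<and> (\<forall>i<k. P i \<subset> P (Suc i))}"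

definition local_ring :: "('a, 'b) ring_scheme \<Rightarrow> bool" where
  "local_ring R \<longleftrightarrow> cring R \<and> (\<exists>!M. maximalideal M R)"

definition regular_local_ring :: "('a, 'b) ring_scheme \<Rightarrow> bool" where
  "regular_local_ring R \<longleftrightarrow> local_ring R \<and> noetherian_ring R \<and>
     (\<exists>S. S \<subseteq> carrier R \<and> finite S \<and> ereal (real (card S)) = krull_dim R \<and>
          maximalideal (Idl\<^bsub>R\<^esub> S) R)"


section \<open>Local rings and nonsingularity of real algebraic sets\<close>

definition poly_ring :: "nat \<Rightarrow> real mpoly ring" where
  "poly_ring N = \<lparr>carrier = polys UNIV N, mult = (*), one = 1, zero = 0, add = (+)\<rparr>"

definition point_ideal :: "nat \<Rightarrow> real vec \<Rightarrow> real mpoly set" where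
  "point_ideal N a = Idl\<^bsub>poly_ring N\<^esub> {mpoly_var i - mpoly_const (a $ i) | i. i < N}"

text \<open>
  As the polynomial ring is a domain, its localization at the maximal ideal of \<open>a\<close> is realized
  inside the field of fractions.
\<close>

definition localization :: "nat \<Rightarrow> real vec \<Rightarrow> real mpoly fract ring" where
  "localization N a =
     \<lparr>carrier = {Fract f g | f g. f \<in> polys UNIV N \<and> g \<in> polys UNIV N - point_ideal N a},
      mult = (*), one = 1, zero = 0, add = (+)\<rparr>"

definition local_ring_at ::
  "real set \<Rightarrow> nat \<Rightarrow> real vec set \<Rightarrow> real vec \<Rightarrow> real mpoly fract set ring" where
  "local_ring_at K N V a =
     localization N a Quot
       (Idl\<^bsub>localization N a\<^esub> ((\<lambda>f. Fract f 1) ` vanishing_ideal K N V))"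

definition alg_dim :: "nat \<Rightarrow> real vec set \<Rightarrow> ereal" where
  "alg_dim N V = krull_dim (poly_ring N Quot vanishing_ideal UNIV N V)"

text \<open>
  Regularity of \<open>a\<close> with respect to the equations of \<open>V\<close> over \<open>K\<close>: for \<open>K = UNIV\<close> this is
  the usual one, for \<open>K = \<rat>\<close> it is \<open>\<real>|\<rat>\<close>-regularity.  In both cases the local ring has
  real coefficients and the dimension is the real one.
\<close>

definition regular_point :: "real set \<Rightarrow> nat \<Rightarrow> real vec set \<Rightarrow> real vec \<Rightarrow> bool" where
  "regular_point K N V a \<longleftrightarrow> a \<in> V \<and>
     regular_local_ring (local_ring_at K N V a) \<and>
     krull_dim (local_ring_at K N V a) = alg_dim N V"

definition nonsingular :: "nat \<Rightarrow> real vec set \<Rightarrow> bool" where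
  "nonsingular N V \<longleftrightarrow> (\<forall>a\<in>V. regular_point UNIV N V a)"

definition Q_nonsingular :: "nat \<Rightarrow> real vec set \<Rightarrow> bool" where
  "Q_nonsingular N V \<longleftrightarrow>
     algebraic_set \<rat> N V \<and> nonsingular N V \<and> (\<forall>a\<in>V. regular_point \<rat> N V a)"


section \<open>Overt polynomials\<close>

definition monom_degree :: "(nat \<Rightarrow>\<^sub>0 nat) \<Rightarrow> nat" where
  "monom_degree t = (\<Sum>i\<in>Poly_Mapping.keys t. Poly_Mapping.lookup t i)"

text \<open>The zero polynomial gets degree \<open>0\<close>; it is not overt in a positive number of variables.\<close>

definition mpoly_degree :: "real mpoly \<Rightarrow> nat" where
  "mpoly_degree p = Max (insert 0 (monom_degree ` Poly_Mapping.keys p))"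

definition homogeneous_part :: "nat \<Rightarrow> real mpoly \<Rightarrow> real mpoly" where
  "homogeneous_part e p =
     (\<Sum>t\<in>{t \<in> Poly_Mapping.keys p. monom_degree t = e}.
        Poly_Mapping.single t (Poly_Mapping.lookup p t))"

definition overt :: "nat \<Rightarrow> real mpoly \<Rightarrow> bool" where
  "overt N p \<longleftrightarrow>
     (let Z = zero_set N {homogeneous_part (mpoly_degree p) p} in Z = {} \<or> Z = {0\<^sub>v N})"

definition projectively_Q_closed :: "nat \<Rightarrow> real vec set \<Rightarrow> bool" where
  "projectively_Q_closed N V \<longleftrightarrow> (\<exists>p \<in> polys \<rat> N. overt N p \<and> V = zero_set N {p})"


section \<open>Birational maps\<close>

definition zariski_open_in :: "nat \<Rightarrow> real vec set \<Rightarrow> real vec set \<Rightarrow> bool" where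
  "zariski_open_in N V U \<longleftrightarrow> (\<exists>F. F \<subseteq> polys UNIV N \<and> U = V - zero_set N F)"

definition zariski_dense_in :: "nat \<Rightarrow> real vec set \<Rightarrow> real vec set \<Rightarrow> bool" where
  "zariski_dense_in N V U \<longleftrightarrow> U \<subseteq> V \<and>
     (\<forall>W. zariski_open_in N V W \<and> W \<noteq> {} \<longrightarrow> W \<inter> U \<noteq> {})"

definition regular_function :: "nat \<Rightarrow> real vec set \<Rightarrow> (real vec \<Rightarrow> real) \<Rightarrow> bool" where
  "regular_function N U f \<longleftrightarrow>
     (\<forall>a\<in>U. \<exists>p\<in>polys UNIV N. \<exists>q\<in>polys UNIV N. eval_mpoly q a \<noteq> 0 \<and>
        (\<forall>x\<in>U. eval_mpoly q x \<noteq> 0 \<longrightarrow> f x = eval_mpoly p x / eval_mpoly q x))"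

definition regular_map :: "nat \<Rightarrow> nat \<Rightarrow> real vec set \<Rightarrow> (real vec \<Rightarrow> real vec) \<Rightarrow> bool" where
  "regular_map M N U f \<longleftrightarrow>
     f ` U \<subseteq> carrier_vec N \<and> (\<forall>i<N. regular_function M U (\<lambda>x. f x $ i))"

definition biregular_iso ::
  "nat \<Rightarrow> nat \<Rightarrow> real vec set \<Rightarrow> real vec set \<Rightarrow> (real vec \<Rightarrow> real vec) \<Rightarrow> bool" where
  "biregular_iso M N U W f \<longleftrightarrow> bij_betw f U W \<and>
     regular_map M N U f \<and> regular_map N M W (the_inv_into U f)"

definition birational_map ::
  "nat \<Rightarrow> nat \<Rightarrow> real vec set \<Rightarrow> real vec set \<Rightarrow> (real vec \<Rightarrow> real vec) \<Rightarrow> bool" where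
  "birational_map M N V' V f \<longleftrightarrow> f ` V' \<subseteq> V \<and>
     (\<exists>U' U. zariski_open_in M V' U' \<and> zariski_dense_in M V' U' \<and>
             zariski_open_in N V U \<and> zariski_dense_in N V U \<and>
             biregular_iso M N U' U f)"


section \<open>Desingularizations\<close>

text \<open>
  \<open>\<real>\<^sup>q \<times> \<real>\<^sup>r\<close> is identified with \<open>\<real>\<^sup>q\<^sup>+\<^sup>r\<close>, the projection onto the first factor being
  \<open>\<lambda>x. vec_first x q\<close>.
\<close>

definition desingularization :: "nat \<Rightarrow> nat \<Rightarrow> real vec set \<Rightarrow> real vec set \<Rightarrow> bool" where
  "desingularization q r V V' \<longleftrightarrow>
     algebraic_set \<rat> q V \<and>
     algebraic_set UNIV (q + r) V' \<and> nonsingular (q + r) V' \<and>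
     alg_dim (q + r) V' = alg_dim q V \<and>
     birational_map (q + r) q V' V (\<lambda>x. vec_first x q)"

definition Q_desingularization :: "nat \<Rightarrow> nat \<Rightarrow> real vec set \<Rightarrow> real vec set \<Rightarrow> bool" where
  "Q_desingularization q r V V' \<longleftrightarrow> desingularization q r V V' \<and>
     algebraic_set \<rat> (q + r) V' \<and> Q_nonsingular (q + r) V' \<and> projectively_Q_closed (q + r) V'"


section \<open>Embedded Grassmannians and Schubert varieties\<close>

definition mat_trace :: "real mat \<Rightarrow> real" where
  "mat_trace X = (\<Sum>i<dim_row X. X $$ (i, i))"

definition mat_image :: "real mat \<Rightarrow> real vec set" where
  "mat_image X = {X *\<^sub>v v | v. v \<in> carrier_vec (dim_col X)}"

definition subspace_dim :: "nat \<Rightarrow> real vec set \<Rightarrow> nat" where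
  "subspace_dim N W =
     vectorspace.dim class_ring ((module_vec TYPE(real) N)\<lparr>carrier := W\<rparr>)"

definition coord_subspace :: "nat \<Rightarrow> nat \<Rightarrow> real vec set" where
  "coord_subspace N l =
     LinearCombinations.module.span class_ring (module_vec TYPE(real) N) {unit_vec N i | i. i < l}"

definition grassmannian :: "nat \<Rightarrow> nat \<Rightarrow> real mat set" where
  "grassmannian m n = {X \<in> carrier_mat (m + n) (m + n).
     transpose_mat X = X \<and> X * X = X \<and> mat_trace X = real m}"

text \<open>Partitions \<open>\<lambda>\<^sub>1 \<ge> \<dots> \<ge> \<lambda>\<^sub>m\<close> are functions of which only the values at \<open>1, \<dots>, m\<close> matter.\<close>

definition rect_partition :: "nat \<Rightarrow> nat \<Rightarrow> (nat \<Rightarrow> nat) \<Rightarrow> bool" where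
  "rect_partition m n lam \<longleftrightarrow>
     (\<forall>k\<in>{1..m}. lam k \<le> n) \<and> (\<forall>j\<in>{1..m}. \<forall>k\<in>{1..m}. j \<le> k \<longrightarrow> lam k \<le> lam j)"

definition schubert_variety :: "nat \<Rightarrow> nat \<Rightarrow> (nat \<Rightarrow> nat) \<Rightarrow> real mat set" where
  "schubert_variety m n lam = {X \<in> grassmannian m n. \<forall>k\<in>{1..m}.
     subspace_dim (m + n) (mat_image X \<inter> coord_subspace (m + n) (n + k - lam k)) \<ge> k}"

text \<open>Row-major identification of \<open>N \<times> N\<close> matrices with points of affine \<open>N\<^sup>2\<close>-space.\<close>

definition flatten_mat :: "real mat \<Rightarrow> real vec" where
  "flatten_mat X =
     vec (dim_row X * dim_col X) (\<lambda>i. X $$ (i div dim_col X, i mod dim_col X))"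

end

theory Submission
  imports Defs
begin

text \<open>
  A point of \<open>\<sigma>\<^sub>\<lambda>\<close> is an \<open>m\<close>-dimensional subspace \<open>Y\<close> with \<open>dim (Y \<inter> \<real>\<^bsup>a k\<^esup>) > k\<close> for \<open>k < m\<close>, where
  \<open>a k = n + (k + 1) - \<lambda>\<^sub>k\<^sub>+\<^sub>1\<close> increases strictly.  It is resolved by the variety of flags
  \<open>Y\<^sub>1 \<subset> \<dots> \<subset> Y\<^sub>m = Y\<close> with \<open>Y\<^sub>k\<^sub>+\<^sub>1 \<subseteq> \<real>\<^bsup>a k\<^esup>\<close>, embedded by the projection \<open>X\<close> onto \<open>Y\<close> together with the
  projections \<open>L k\<close> onto the lines \<open>Y\<^sub>k\<^sub>+\<^sub>1 \<inter> Y\<^sub>k\<^sup>\<bottom>\<close>; such a tuple also determines the flag.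

  These tuples satisfy rational equations and have constant norm, so that adding a high power of
  \<open>\<bar>x\<bar>\<^sup>2 - c\<close> to a rational equation \<open>g \<ge> 0\<close> makes it overt.  Orthogonalizing echelon bases with given
  pivots yields a map from an affine space onto a neighbourhood of a flag which is rational over
  \<open>\<rat>\<close>, has a rational inverse and a dense image.  Hence the local rings are regular of the
  expected dimension; and as the rational points are dense, every real equation is a real
  combination of rational ones, so that \<open>\<real>|\<rat>\<close>-regularity is ordinary regularity.  For the pivots
  \<open>a k - 1\<close> (the big cell) the lines \<open>L (m - 1), \<dots>, L 0\<close> are recovered rationally from \<open>X\<close> by
  successive elimination, which gives birationality.
\<close>

section \<open>Polynomial and rational functions\<close>

text \<open>One construction carries the linear algebra. For a scaled projection \<open>Q\<close>
  and a vector \<open>w\<close>, \<open>elim\<close> forms \<open><w,Qw> Q - (Qw)(Qw)^T\<close>,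
  which is zero or again a scaled projection, onto the part of the range of \<open>Q\<close>
  orthogonal to \<open>w\<close>. It uses neither division nor square roots, hence is polynomial
  over the rationals, and normalizing the resulting vectors divides only by sums of squares, which
  vanish at no real point where the vector is nonzero. Gram-Schmidt, the reading of echelon
  coordinates, the recovery of the lines from \<open>X\<close> and the equations of the Schubert
  variety are all iterated eliminations.

  Each chart lives on a whole affine space, so the ideal of the variety consists of the polynomials
  that vanish after pullback. Primeness, dimension and generators of maximal ideals are then read
  off from rational functions in \<open>d\<close> variables, without Jacobians. Density of a chart
  is again a question of zero divisors: tuples of independent vectors supported below the
  \<open>a k\<close> parametrize all flags, and on this irreducible space the chart misses only the
  zeros of a function that is not identically zero.\<close>

definition is_subring :: "real set \<Rightarrow> bool" where
  "is_subring K \<longleftrightarrow> 0 \<in> K \<and> 1 \<in> K \<and> (\<forall>a\<in>K. \<forall>b\<in>K. a + b \<in> K \<and> a * b \<in> K) \<and> (\<forall>a\<in>K. - a \<in> K)"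

lemma is_subring_UNIV [simp]: "is_subring UNIV"
  by (simp add: is_subring_def)

lemma is_subring_Rats [simp]: "is_subring \<rat>"
  by (simp add: is_subring_def)

definition monomial_value :: "(nat \<Rightarrow>\<^sub>0 nat) \<Rightarrow> real vec \<Rightarrow> real" where
  "monomial_value t x = (\<Prod>i\<in>Poly_Mapping.keys t. (x $ i) ^ Poly_Mapping.lookup t i)"

lemma monomial_value_superset:
  assumes "finite A" "Poly_Mapping.keys t \<subseteq> A"
  shows "monomial_value t x = (\<Prod>i\<in>A. (x $ i) ^ Poly_Mapping.lookup t i)"
  unfolding monomial_value_def
  by (rule prod.mono_neutral_left) (use assms in \<open>auto simp: in_keys_iff\<close>)

lemma monomial_value_add: "monomial_value (s + t) x = monomial_value s x * monomial_value t x"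
proof -
  let ?A = "Poly_Mapping.keys s \<union> Poly_Mapping.keys t"
  have "monomial_value (s + t) x = (\<Prod>i\<in>?A. (x $ i) ^ Poly_Mapping.lookup (s + t) i)"
    by (rule monomial_value_superset) (use keys_add[of s t] in auto)
  moreover have "monomial_value s x = (\<Prod>i\<in>?A. (x $ i) ^ Poly_Mapping.lookup s i)"
    "monomial_value t x = (\<Prod>i\<in>?A. (x $ i) ^ Poly_Mapping.lookup t i)"
    by (rule monomial_value_superset; auto)+
  ultimately show ?thesis
    by (simp add: lookup_add power_add prod.distrib)
qed

lemma eval_mpoly_superset:
  assumes "finite A" "Poly_Mapping.keys p \<subseteq> A"
  shows "eval_mpoly p x = (\<Sum>t\<in>A. Poly_Mapping.lookup p t * monomial_value t x)"
  unfolding eval_mpoly_def monomial_value_def[symmetric]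
  by (rule sum.mono_neutral_left) (use assms in \<open>auto simp: in_keys_iff\<close>)

lemma eval_mpoly_0 [simp]: "eval_mpoly 0 x = 0"
  by (simp add: eval_mpoly_def)

lemma eval_mpoly_add [simp]: "eval_mpoly (p + q) x = eval_mpoly p x + eval_mpoly q x"
proof -
  let ?A = "Poly_Mapping.keys p \<union> Poly_Mapping.keys q"
  have "eval_mpoly (p + q) x = (\<Sum>t\<in>?A. Poly_Mapping.lookup (p + q) t * monomial_value t x)"
    by (rule eval_mpoly_superset) (use keys_add[of p q] in auto)
  moreover have "eval_mpoly p x = (\<Sum>t\<in>?A. Poly_Mapping.lookup p t * monomial_value t x)"
    "eval_mpoly q x = (\<Sum>t\<in>?A. Poly_Mapping.lookup q t * monomial_value t x)"
    by (rule eval_mpoly_superset; auto)+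
  ultimately show ?thesis
    by (simp add: lookup_add sum.distrib algebra_simps)
qed

lemma eval_mpoly_sum [simp]: "eval_mpoly (sum f A) x = (\<Sum>a\<in>A. eval_mpoly (f a) x)"
  by (induction A rule: infinite_finite_induct) auto

lemma eval_mpoly_single: "eval_mpoly (Poly_Mapping.single t c) x = c * monomial_value t x"
  by (simp add: eval_mpoly_def monomial_value_def)

lemma poly_mapping_sum_single:
  "(\<Sum>t\<in>Poly_Mapping.keys p. Poly_Mapping.single t (Poly_Mapping.lookup p t)) = p"
proof (rule poly_mapping_eqI)
  fix k
  show "Poly_Mapping.lookup (\<Sum>t\<in>Poly_Mapping.keys p. Poly_Mapping.single t (Poly_Mapping.lookup p t)) k
    = Poly_Mapping.lookup p k"
    by (cases "k \<in> Poly_Mapping.keys p")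
       (auto simp: lookup_sum lookup_single when_def in_keys_iff)
qed

lemma mpoly_mult_eq_sum_single:
  "p * q = (\<Sum>s\<in>Poly_Mapping.keys p. \<Sum>t\<in>Poly_Mapping.keys q.
      Poly_Mapping.single (s + t) (Poly_Mapping.lookup p s * Poly_Mapping.lookup q t))"
proof -
  have "p * q = (\<Sum>s\<in>Poly_Mapping.keys p. Poly_Mapping.single s (Poly_Mapping.lookup p s)) *
      (\<Sum>t\<in>Poly_Mapping.keys q. Poly_Mapping.single t (Poly_Mapping.lookup q t))"
    by (simp only: poly_mapping_sum_single)
  then show ?thesis by (simp add: sum_product mult_single)
qed

lemma eval_mpoly_mult [simp]: "eval_mpoly (p * q) x = eval_mpoly p x * eval_mpoly q x"
  unfolding mpoly_mult_eq_sum_single[of p q] eval_mpoly_superset[OF finite_keys subset_refl, of p]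
    eval_mpoly_superset[OF finite_keys subset_refl, of q] sum_product
  by (simp add: eval_mpoly_single monomial_value_add algebra_simps)

lemma eval_mpoly_const [simp]: "eval_mpoly (mpoly_const c) x = c"
  by (simp add: mpoly_const_def eval_mpoly_single monomial_value_def)

lemma eval_mpoly_var [simp]: "eval_mpoly (mpoly_var i) x = x $ i"
  by (simp add: mpoly_var_def eval_mpoly_single monomial_value_def)

lemma mpoly_const_simps: "mpoly_const 0 = 0" "mpoly_const 1 = 1"
  "mpoly_const (a + b) = mpoly_const a + mpoly_const b" "mpoly_const (- a) = - mpoly_const a"
  "mpoly_const (a * b) = mpoly_const a * mpoly_const b"
  by (simp_all add: mpoly_const_def single_add single_uminus mult_single)

lemma eval_mpoly_1 [simp]: "eval_mpoly 1 x = 1"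
  using eval_mpoly_const[of 1 x] by (simp add: mpoly_const_simps)

lemma eval_mpoly_uminus [simp]: "eval_mpoly (- p) x = - eval_mpoly p x"
  using eval_mpoly_add[of p "- p" x] by simp

lemma eval_mpoly_diff [simp]: "eval_mpoly (p - q) x = eval_mpoly p x - eval_mpoly q x"
  using eval_mpoly_add[of p "- q" x] by simp

lemma eval_mpoly_prod [simp]: "eval_mpoly (prod f A) x = (\<Prod>a\<in>A. eval_mpoly (f a) x)"
  by (induction A rule: infinite_finite_induct) auto

lemma eval_mpoly_power [simp]: "eval_mpoly (p ^ k) x = eval_mpoly p x ^ k"
  by (induction k) auto

lemma polys_const [intro]: "c \<in> K \<Longrightarrow> is_subring K \<Longrightarrow> mpoly_const c \<in> polys K N"
  by (auto simp: polys_def mpoly_const_def lookup_single when_def is_subring_def)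

lemma polys_0 [simp, intro]: "is_subring K \<Longrightarrow> 0 \<in> polys K N"
  by (auto simp: polys_def is_subring_def)

lemma polys_1 [simp, intro]: "is_subring K \<Longrightarrow> 1 \<in> polys K N"
  by (auto simp: polys_def is_subring_def lookup_one when_def)

lemma polys_var [intro]: "i < N \<Longrightarrow> is_subring K \<Longrightarrow> mpoly_var i \<in> polys K N"
  by (auto simp: polys_def mpoly_var_def lookup_single when_def is_subring_def)

lemma polys_add [intro]: "p \<in> polys K N \<Longrightarrow> q \<in> polys K N \<Longrightarrow> is_subring K \<Longrightarrow> p + q \<in> polys K N"
  using keys_add[of p q] by (fastforce simp: polys_def lookup_add is_subring_def)

lemma polys_uminus [intro]: "p \<in> polys K N \<Longrightarrow> is_subring K \<Longrightarrow> - p \<in> polys K N"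
  by (auto simp: polys_def is_subring_def in_keys_iff)

lemma polys_diff [intro]: "p \<in> polys K N \<Longrightarrow> q \<in> polys K N \<Longrightarrow> is_subring K \<Longrightarrow> p - q \<in> polys K N"
  using polys_add[of p K N "- q"] by auto

lemma polys_sum [intro]: "(\<And>a. a \<in> A \<Longrightarrow> f a \<in> polys K N) \<Longrightarrow> is_subring K \<Longrightarrow> sum f A \<in> polys K N"
  by (induction A rule: infinite_finite_induct) auto

lemma single_in_polys:
  "c \<in> K \<Longrightarrow> is_subring K \<Longrightarrow> Poly_Mapping.keys t \<subseteq> {..<N} \<Longrightarrow> Poly_Mapping.single t c \<in> polys K N"
  by (auto simp: polys_def lookup_single when_def is_subring_def split: if_splits)

lemma polys_mult [intro]:
  assumes "p \<in> polys K N" "q \<in> polys K N" "is_subring K"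
  shows "p * q \<in> polys K N"
  unfolding mpoly_mult_eq_sum_single[of p q]
proof (intro polys_sum single_in_polys assms(3))
  fix s t assume st: "s \<in> Poly_Mapping.keys p" "t \<in> Poly_Mapping.keys q"
  show "Poly_Mapping.lookup p s * Poly_Mapping.lookup q t \<in> K"
    using assms by (auto simp: polys_def is_subring_def)
  show "Poly_Mapping.keys (s + t) \<subseteq> {..<N}"
    using assms st keys_add[of s t] unfolding polys_def by blast
qed

lemma polys_prod [intro]: "(\<And>a. a \<in> A \<Longrightarrow> f a \<in> polys K N) \<Longrightarrow> is_subring K \<Longrightarrow> prod f A \<in> polys K N"
  by (induction A rule: infinite_finite_induct) auto

lemma polys_power [intro]: "p \<in> polys K N \<Longrightarrow> is_subring K \<Longrightarrow> p ^ k \<in> polys K N"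
  by (induction k) auto

lemma polys_UNIV: "polys K N \<subseteq> polys UNIV N"
  by (auto simp: polys_def)

lemma single_eq_prod_var: "Poly_Mapping.single t (1::real) = (\<Prod>i\<in>Poly_Mapping.keys t. mpoly_var i ^ Poly_Mapping.lookup t i)"
proof -
  have pow: "mpoly_var i ^ n = Poly_Mapping.single (Poly_Mapping.single i n) 1" for i n
    by (induction n) (simp_all add: mpoly_var_def mult_single flip: single_add)
  have "(\<Prod>i\<in>A. mpoly_var i ^ g i) = Poly_Mapping.single (\<Sum>i\<in>A. Poly_Mapping.single i (g i)) 1" for A g
    by (induction A rule: infinite_finite_induct) (simp_all add: pow mult_single)
  then show ?thesis
    by (simp add: poly_mapping_sum_single)
qed

text \<open>A polynomial is a sum of products of coefficients and powers of variables. Membership in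
  \<open>polys K N\<close> is kept for both parts in the inductive cases, so that the coefficients
  stay in \<open>K\<close> throughout.\<close>

lemma polys_induct [consumes 2, case_names const var add mult]:
  assumes "p \<in> polys K N" "is_subring K"
    and const: "\<And>c. c \<in> K \<Longrightarrow> P (mpoly_const c)"
    and var: "\<And>i. i < N \<Longrightarrow> P (mpoly_var i)"
    and add: "\<And>p q. p \<in> polys K N \<Longrightarrow> q \<in> polys K N \<Longrightarrow> P p \<Longrightarrow> P q \<Longrightarrow> P (p + q)"
    and mult: "\<And>p q. p \<in> polys K N \<Longrightarrow> q \<in> polys K N \<Longrightarrow> P p \<Longrightarrow> P q \<Longrightarrow> P (p * q)"
  shows "P p"
proof -
  let ?Q = "\<lambda>p. p \<in> polys K N \<and> P p"
  have K: "is_subring K" by fact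
  have Q1: "?Q 1" "?Q 0"
    using const[of 1] const[of 0] K by (auto simp: mpoly_const_simps is_subring_def)
  have Qmult: "?Q (p * q)" if "?Q p" "?Q q" for p q using that mult K by auto
  have Qpow: "?Q (p ^ k)" if "?Q p" for p k using Q1 that by (induction k) (auto intro!: mult K)
  have Qprod: "?Q (prod f A)" if "\<And>a. a \<in> A \<Longrightarrow> ?Q (f a)" for f and A :: "nat set"
    using that Q1 by (induction A rule: infinite_finite_induct) (auto intro!: mult K)
  have Qsum: "?Q (sum f A)" if "\<And>a. a \<in> A \<Longrightarrow> ?Q (f a)" for f and A :: "(nat \<Rightarrow>\<^sub>0 nat) set"
    using that Q1 by (induction A rule: infinite_finite_induct) (auto intro!: add K)
  have "?Q (\<Sum>t\<in>Poly_Mapping.keys p. Poly_Mapping.single t (Poly_Mapping.lookup p t))"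
  proof (rule Qsum)
    fix t assume t: "t \<in> Poly_Mapping.keys p"
    have "Poly_Mapping.single t (Poly_Mapping.lookup p t) = mpoly_const (Poly_Mapping.lookup p t) * Poly_Mapping.single t 1"
      by (simp add: mpoly_const_def mult_single)
    moreover have "?Q (mpoly_const (Poly_Mapping.lookup p t))"
      using assms(1) K const by (auto simp: polys_def intro!: polys_const[unfolded polys_def, simplified])
    moreover have "?Q (Poly_Mapping.single t 1)"
      unfolding single_eq_prod_var
    proof (intro Qprod Qpow conjI)
      fix i assume "i \<in> Poly_Mapping.keys t"
      then have "i < N" using assms(1) t by (auto simp: polys_def)
      then show "mpoly_var i \<in> polys K N" "P (mpoly_var i)" using K var by auto
    qed
    ultimately show "?Q (Poly_Mapping.single t (Poly_Mapping.lookup p t))"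
      using Qmult by metis
  qed
  then show ?thesis by (simp add: poly_mapping_sum_single)
qed

section \<open>Polynomials vanishing on an infinite grid\<close>

lemma finite_zeros_imp_coeffs_zero:
  fixes c :: "nat \<Rightarrow> real"
  assumes "infinite A" "\<And>s. s \<in> A \<Longrightarrow> (\<Sum>i\<le>n. c i * s ^ i) = 0" "i \<le> n"
  shows "c i = 0"
proof (rule ccontr)
  assume "c i \<noteq> 0"
  then have "finite {z. (\<Sum>i\<le>n. c i * z ^ i) = 0}"
    using polyfun_finite_roots[of c n] assms(3) by blast
  moreover have "A \<subseteq> {z. (\<Sum>i\<le>n. c i * z ^ i) = 0}" using assms(2) by auto
  ultimately show False using assms(1) finite_subset by blast
qed

text \<open>Induction on the number of variables: with the other variables fixed in
  \<open>A\<close>, grouping the monomials by the exponent of the last variable gives a univariate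
  polynomial with infinitely many zeros. Exponents are functions on all naturals here, so the
  monomials have to be told apart by their restrictions to the first \<open>N\<close>
  arguments.\<close>

lemma multivariate_coeffs_zero:
  fixes c :: "(nat \<Rightarrow> nat) \<Rightarrow> real"
  assumes "infinite A" "finite T" "inj_on (\<lambda>t. restrict t {..<N}) T"
    and "\<And>x. (\<forall>i<N. x i \<in> A) \<Longrightarrow> (\<Sum>t\<in>T. c t * (\<Prod>i<N. x i ^ t i)) = 0"
    and "t \<in> T"
  shows "c t = 0"
  using assms(2-)
proof (induction N arbitrary: T t)
  case 0
  have "T = {t}" using 0(2,4) by (auto simp: inj_on_def)
  then show ?case using 0(3)[of "\<lambda>_. 0"] by simp
next
  case (Suc N)
  define n where "n = Max ((\<lambda>t. t N) ` T)"
  have n: "s N \<le> n" if "s \<in> T" for s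
    unfolding n_def using Suc.prems(1) that by auto
  define Te where "Te e = {s \<in> T. s N = e}" for e
  have inj: "inj_on (\<lambda>t. restrict t {..<N}) (Te e)" for e
  proof (rule inj_onI)
    fix s s' assume s: "s \<in> Te e" "s' \<in> Te e" and eq: "restrict s {..<N} = restrict s' {..<N}"
    have "s i = s' i" if "i < Suc N" for i
    proof (cases "i = N")
      case False
      then have "i < N" using that by simp
      then show ?thesis using fun_cong[OF eq, of i] by simp
    qed (use s in \<open>simp add: Te_def\<close>)
    then have "restrict s {..<Suc N} = restrict s' {..<Suc N}"
      by (auto simp: restrict_def fun_eq_iff)
    then show "s = s'" by (rule inj_onD[OF Suc.prems(2)]) (use s in \<open>auto simp: Te_def\<close>)
  qed
  have zero: "(\<Sum>s\<in>Te e. c s * (\<Prod>i<N. x i ^ s i)) = 0" if x: "\<forall>i<N. x i \<in> A" and e: "e \<le> n" for x e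
  proof (rule finite_zeros_imp_coeffs_zero[OF assms(1) _ e])
    fix a assume a: "a \<in> A"
    have "0 = (\<Sum>s\<in>T. c s * (\<Prod>i<Suc N. (x(N := a)) i ^ s i))"
      by (rule Suc.prems(3)[symmetric]) (use x a in \<open>auto simp: less_Suc_eq\<close>)
    also have "\<dots> = (\<Sum>s\<in>T. c s * (\<Prod>i<N. x i ^ s i) * a ^ s N)"
      by (intro sum.cong refl) (auto intro!: prod.cong)
    also have "\<dots> = (\<Sum>e\<le>n. \<Sum>s\<in>Te e. c s * (\<Prod>i<N. x i ^ s i) * a ^ s N)"
      unfolding Te_def by (rule sum.group[symmetric]) (use Suc.prems(1) n in auto)
    also have "\<dots> = (\<Sum>e\<le>n. (\<Sum>s\<in>Te e. c s * (\<Prod>i<N. x i ^ s i)) * a ^ e)"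
      by (intro sum.cong refl) (auto simp: sum_distrib_right Te_def)
    finally show "(\<Sum>e\<le>n. (\<Sum>s\<in>Te e. c s * (\<Prod>i<N. x i ^ s i)) * a ^ e) = 0" by simp
  qed
  have "finite (Te (t N))" "t \<in> Te (t N)" using Suc.prems by (auto simp: Te_def)
  then show ?case
    using Suc.IH[OF _ inj[of "t N"]] zero[OF _ n[OF Suc.prems(4)]] by blast
qed

text \<open>The set \<open>A\<close> is a parameter because the lemma serves both for all real
  points and for rational points, which already detect a real polynomial.\<close>

lemma mpoly_eq_0I:
  assumes "p \<in> polys UNIV N" "infinite A"
    and zero: "\<And>x. x \<in> carrier_vec N \<Longrightarrow> (\<forall>i<N. x $ i \<in> A) \<Longrightarrow> eval_mpoly p x = 0"
  shows "p = 0"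
proof (rule poly_mapping_eqI)
  fix t
  let ?L = "Poly_Mapping.lookup :: (nat \<Rightarrow>\<^sub>0 nat) \<Rightarrow> nat \<Rightarrow> nat"
  have keys: "Poly_Mapping.keys t \<subseteq> {..<N}" if "t \<in> Poly_Mapping.keys p" for t
    using assms(1) that by (auto simp: polys_def)
  have L: "inj ?L" by (rule injI) (simp add: lookup_inject)
  have inv: "inv_into UNIV ?L (?L t) = t" for t by (simp add: inv_f_f[OF L])
  have "Poly_Mapping.lookup p (inv_into UNIV ?L (?L t)) = 0" if t: "t \<in> Poly_Mapping.keys p"
  proof (rule multivariate_coeffs_zero[where T = "?L ` Poly_Mapping.keys p" and N = N and A = A
        and c = "\<lambda>t. Poly_Mapping.lookup p (inv_into UNIV ?L t)"])
    show "inj_on (\<lambda>t. restrict t {..<N}) (?L ` Poly_Mapping.keys p)"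
    proof (rule inj_onI, clarify)
      fix s s' assume s: "s \<in> Poly_Mapping.keys p" "s' \<in> Poly_Mapping.keys p"
        and eq: "restrict (?L s) {..<N} = restrict (?L s') {..<N}"
      show "?L s = ?L s'"
      proof
        fix i
        show "?L s i = ?L s' i"
        proof (cases "i < N")
          case True
          then show ?thesis using fun_cong[OF eq, of i] by simp
        next
          case False
          then have "i \<notin> Poly_Mapping.keys s" "i \<notin> Poly_Mapping.keys s'" using keys s by auto
          then show ?thesis by (simp add: in_keys_iff)
        qed
      qed
    qed
    show "?L t \<in> ?L ` Poly_Mapping.keys p" using t by blast
    fix x :: "nat \<Rightarrow> real" assume x: "\<forall>i<N. x i \<in> A"
    let ?x = "vec N x"
    have "0 = eval_mpoly p ?x" using zero[of ?x] x by simp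
    also have "\<dots> = (\<Sum>t\<in>Poly_Mapping.keys p. Poly_Mapping.lookup p t * (\<Prod>i<N. x i ^ ?L t i))"
      unfolding eval_mpoly_superset[OF finite_keys subset_refl]
      by (intro sum.cong refl) (auto simp: monomial_value_superset[OF _ keys])
    also have "\<dots> = (\<Sum>t\<in>?L ` Poly_Mapping.keys p. Poly_Mapping.lookup p (inv_into UNIV ?L t) * (\<Prod>i<N. x i ^ t i))"
      by (subst sum.reindex) (auto simp: inv inj_on_subset[OF L])
    finally show "(\<Sum>t\<in>?L ` Poly_Mapping.keys p. Poly_Mapping.lookup p (inv_into UNIV ?L t) * (\<Prod>i<N. x i ^ t i)) = 0"
      by simp
  qed (use assms(2) in auto)
  then show "Poly_Mapping.lookup p t = Poly_Mapping.lookup 0 t"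
    by (cases "t \<in> Poly_Mapping.keys p") (auto simp: inv in_keys_iff)
qed

lemma eval_mult_eq_0D:
  assumes "p \<in> polys UNIV N" "q \<in> polys UNIV N"
    and "\<And>x. x \<in> carrier_vec N \<Longrightarrow> eval_mpoly p x * eval_mpoly q x = 0"
  shows "p = 0 \<or> q = 0"
proof -
  have "p * q = 0"
    by (rule mpoly_eq_0I[of _ N UNIV]) (use assms infinite_UNIV_char_0 in auto)
  then show ?thesis by simp
qed

text \<open>Equality is required at vectors of every dimension, so that no carrier condition has to
  accompany the closure rules.\<close>

definition polyfun :: "real set \<Rightarrow> nat \<Rightarrow> (real vec \<Rightarrow> real) \<Rightarrow> bool" where
  "polyfun K N f \<longleftrightarrow> (\<exists>p\<in>polys K N. \<forall>x. f x = eval_mpoly p x)"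

lemma polyfun_const: "c \<in> K \<Longrightarrow> is_subring K \<Longrightarrow> polyfun K N (\<lambda>x. c)"
  unfolding polyfun_def by (rule bexI[of _ "mpoly_const c"]) auto

lemma polyfun_01: "is_subring K \<Longrightarrow> polyfun K N (\<lambda>x. 0)" "is_subring K \<Longrightarrow> polyfun K N (\<lambda>x. 1)"
  by (auto intro!: polyfun_const simp: is_subring_def)

lemma polyfun_index: "i < N \<Longrightarrow> is_subring K \<Longrightarrow> polyfun K N (\<lambda>x. x $ i)"
  unfolding polyfun_def by (rule bexI[of _ "mpoly_var i"]) auto

lemma polyfun_eval: "p \<in> polys K N \<Longrightarrow> polyfun K N (eval_mpoly p)"
  unfolding polyfun_def by auto

lemma polyfun_add: "polyfun K N f \<Longrightarrow> polyfun K N g \<Longrightarrow> is_subring K \<Longrightarrow> polyfun K N (\<lambda>x. f x + g x)"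
  unfolding polyfun_def by (metis eval_mpoly_add polys_add)

lemma polyfun_diff: "polyfun K N f \<Longrightarrow> polyfun K N g \<Longrightarrow> is_subring K \<Longrightarrow> polyfun K N (\<lambda>x. f x - g x)"
  unfolding polyfun_def by (metis eval_mpoly_diff polys_diff)

lemma polyfun_mult: "polyfun K N f \<Longrightarrow> polyfun K N g \<Longrightarrow> is_subring K \<Longrightarrow> polyfun K N (\<lambda>x. f x * g x)"
  unfolding polyfun_def by (metis eval_mpoly_mult polys_mult)

lemma polyfun_power: "polyfun K N f \<Longrightarrow> is_subring K \<Longrightarrow> polyfun K N (\<lambda>x. f x ^ k)"
  unfolding polyfun_def by (metis eval_mpoly_power polys_power)

lemma polyfun_sum: "(\<And>a. a \<in> A \<Longrightarrow> polyfun K N (f a)) \<Longrightarrow> is_subring K \<Longrightarrow> polyfun K N (\<lambda>x. \<Sum>a\<in>A. f a x)"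
  by (induction A rule: infinite_finite_induct) (auto intro: polyfun_01 polyfun_add)

lemma polyfun_prod: "(\<And>a. a \<in> A \<Longrightarrow> polyfun K N (f a)) \<Longrightarrow> is_subring K \<Longrightarrow> polyfun K N (\<lambda>x. \<Prod>a\<in>A. f a x)"
  by (induction A rule: infinite_finite_induct) (auto intro: polyfun_01 polyfun_mult)

text \<open>A single quotient serves the whole of \<open>S\<close>, in contrast to
  \<open>regular_function\<close>, where the quotient may change from point to point. This stronger
  form survives substitution into polynomials.\<close>

definition ratfun :: "real set \<Rightarrow> nat \<Rightarrow> real vec set \<Rightarrow> (real vec \<Rightarrow> real) \<Rightarrow> bool" where
  "ratfun K N S f \<longleftrightarrow> (\<exists>p\<in>polys K N. \<exists>q\<in>polys K N. \<forall>x\<in>S.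
     eval_mpoly q x \<noteq> 0 \<and> f x = eval_mpoly p x / eval_mpoly q x)"

lemma ratfunI:
  "p \<in> polys K N \<Longrightarrow> q \<in> polys K N \<Longrightarrow> (\<And>x. x \<in> S \<Longrightarrow> eval_mpoly q x \<noteq> 0) \<Longrightarrow>
   (\<And>x. x \<in> S \<Longrightarrow> f x = eval_mpoly p x / eval_mpoly q x) \<Longrightarrow> ratfun K N S f"
  unfolding ratfun_def by blast

lemma ratfun_polyfun: "polyfun K N f \<Longrightarrow> is_subring K \<Longrightarrow> ratfun K N S f"
  unfolding polyfun_def by (elim bexE, rule ratfunI[of _ _ _ 1]) auto

lemma ratfun_cong: "(\<And>x. x \<in> S \<Longrightarrow> f x = g x) \<Longrightarrow> ratfun K N S f = ratfun K N S g"
  unfolding ratfun_def by simp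

lemma ratfun_const: "c \<in> K \<Longrightarrow> is_subring K \<Longrightarrow> ratfun K N S (\<lambda>x. c)"
  by (intro ratfun_polyfun polyfun_const)

lemma ratfun_01: "is_subring K \<Longrightarrow> ratfun K N S (\<lambda>x. 0)" "is_subring K \<Longrightarrow> ratfun K N S (\<lambda>x. 1)"
  by (intro ratfun_polyfun polyfun_01; assumption)+

lemma ratfun_add:
  assumes "ratfun K N S f" "ratfun K N S g" "is_subring K"
  shows "ratfun K N S (\<lambda>x. f x + g x)"
proof -
  obtain p q p' q' where "p \<in> polys K N" "q \<in> polys K N" "p' \<in> polys K N" "q' \<in> polys K N"
    and "\<And>x. x \<in> S \<Longrightarrow> eval_mpoly q x \<noteq> 0 \<and> f x = eval_mpoly p x / eval_mpoly q x"
    and "\<And>x. x \<in> S \<Longrightarrow> eval_mpoly q' x \<noteq> 0 \<and> g x = eval_mpoly p' x / eval_mpoly q' x"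
    using assms(1,2) unfolding ratfun_def by metis
  then show ?thesis
    by (intro ratfunI[of "p * q' + p' * q" K N "q * q'"]) (auto simp: assms(3) field_simps intro!: polys_add polys_mult)
qed

lemma ratfun_mult:
  assumes "ratfun K N S f" "ratfun K N S g" "is_subring K"
  shows "ratfun K N S (\<lambda>x. f x * g x)"
proof -
  obtain p q p' q' where "p \<in> polys K N" "q \<in> polys K N" "p' \<in> polys K N" "q' \<in> polys K N"
    and "\<And>x. x \<in> S \<Longrightarrow> eval_mpoly q x \<noteq> 0 \<and> f x = eval_mpoly p x / eval_mpoly q x"
    and "\<And>x. x \<in> S \<Longrightarrow> eval_mpoly q' x \<noteq> 0 \<and> g x = eval_mpoly p' x / eval_mpoly q' x"
    using assms(1,2) unfolding ratfun_def by metis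
  then show ?thesis
    by (intro ratfunI[of "p * p'" K N "q * q'"]) (auto simp: assms(3) field_simps intro!: polys_mult)
qed

lemma ratfun_inverse:
  assumes "ratfun K N S f" "is_subring K" "\<And>x. x \<in> S \<Longrightarrow> f x \<noteq> 0"
  shows "ratfun K N S (\<lambda>x. 1 / f x)"
proof -
  obtain p q where "p \<in> polys K N" "q \<in> polys K N"
    and "\<And>x. x \<in> S \<Longrightarrow> eval_mpoly q x \<noteq> 0 \<and> f x = eval_mpoly p x / eval_mpoly q x"
    using assms(1) unfolding ratfun_def by metis
  then show ?thesis
    using assms(3) by (intro ratfunI[of q K N p]) fastforce+
qed

lemma ratfun_divide:
  "ratfun K N S f \<Longrightarrow> ratfun K N S g \<Longrightarrow> is_subring K \<Longrightarrow> (\<And>x. x \<in> S \<Longrightarrow> g x \<noteq> 0) \<Longrightarrow>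
   ratfun K N S (\<lambda>x. f x / g x)"
  using ratfun_mult[OF _ ratfun_inverse[of K N S g]] by fastforce

lemma ratfun_sum: "(\<And>a. a \<in> A \<Longrightarrow> ratfun K N S (f a)) \<Longrightarrow> is_subring K \<Longrightarrow> ratfun K N S (\<lambda>x. \<Sum>a\<in>A. f a x)"
  by (induction A rule: infinite_finite_induct) (auto intro: ratfun_01 ratfun_add)

lemma ratfun_eval:
  assumes "p \<in> polys K M" "is_subring K" "\<And>i. i < M \<Longrightarrow> ratfun K N S (\<lambda>x. g x $ i)"
  shows "ratfun K N S (\<lambda>x. eval_mpoly p (g x))"
  using assms(1,2)
  by (induction rule: polys_induct) (auto intro: ratfun_const ratfun_add ratfun_mult assms)

lemma polyfun_compose:
  assumes "polyfun K M f" "is_subring K" "\<And>i. i < M \<Longrightarrow> polyfun K N (\<lambda>x. g x $ i)"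
  shows "polyfun K N (\<lambda>x. f (g x))"
proof -
  obtain p where p: "p \<in> polys K M" "\<And>x. f x = eval_mpoly p x"
    using assms(1) by (auto simp: polyfun_def)
  have "polyfun K N (\<lambda>x. eval_mpoly p (g x))" using p(1) assms(2)
    by (induction rule: polys_induct) (auto intro: polyfun_const polyfun_add polyfun_mult assms)
  then show ?thesis by (simp add: p(2))
qed

lemma ratfun_compose:
  assumes "ratfun K M T f" "is_subring K" "\<And>i. i < M \<Longrightarrow> ratfun K N S (\<lambda>x. g x $ i)" "g ` S \<subseteq> T"
  shows "ratfun K N S (\<lambda>x. f (g x))"
proof -
  obtain p q where pq: "p \<in> polys K M" "q \<in> polys K M"
    "\<And>x. x \<in> T \<Longrightarrow> eval_mpoly q x \<noteq> 0 \<and> f x = eval_mpoly p x / eval_mpoly q x"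
    using assms(1) by (auto simp: ratfun_def)
  have "ratfun K N S (\<lambda>x. eval_mpoly p (g x) / eval_mpoly q (g x))"
    by (intro ratfun_divide ratfun_eval[of _ K M] pq assms(2,3)) (use pq(3) assms(4) in auto)
  then show ?thesis
    by (rule back_subst[where P = "\<lambda>P. P"], intro ratfun_cong) (use pq(3) assms(4) in auto)
qed

text \<open>Multiplying both numerators by the equation \<open>h\<close> of the complement makes the
  product vanish on all of affine space, where polynomials have no zero divisors.\<close>

lemma ratfun_mult_eq_0D:
  assumes "ratfun UNIV N S f" "ratfun UNIV N S g" "\<And>x. x \<in> S \<Longrightarrow> f x * g x = 0"
    and "S = {x \<in> carrier_vec N. eval_mpoly h x \<noteq> 0}" "h \<in> polys UNIV N"
  shows "(\<forall>x\<in>S. f x = 0) \<or> (\<forall>x\<in>S. g x = 0)"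
proof -
  obtain p q p' q' where p: "p \<in> polys UNIV N" "p' \<in> polys UNIV N"
    and f: "\<And>x. x \<in> S \<Longrightarrow> eval_mpoly q x \<noteq> 0 \<and> f x = eval_mpoly p x / eval_mpoly q x"
    and g: "\<And>x. x \<in> S \<Longrightarrow> eval_mpoly q' x \<noteq> 0 \<and> g x = eval_mpoly p' x / eval_mpoly q' x"
    using assms(1,2) unfolding ratfun_def by metis
  have "p * h = 0 \<or> p' * h = 0"
  proof (rule eval_mult_eq_0D)
    fix x :: "real vec" assume x: "x \<in> carrier_vec N"
    show "eval_mpoly (p * h) x * eval_mpoly (p' * h) x = 0"
    proof (cases "x \<in> S")
      case True
      then show ?thesis using f[OF True] g[OF True] assms(3)[OF True] by auto
    qed (use assms(4) x in auto)
  qed (use p assms(5) in auto)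
  then show ?thesis
  proof
    assume h: "p * h = 0"
    have "f x = 0" if "x \<in> S" for x
    proof -
      have "eval_mpoly (p * h) x = 0" unfolding h by simp
      then show ?thesis using that f[OF that] assms(4) by auto
    qed
    then show ?thesis by simp
  next
    assume h: "p' * h = 0"
    have "g x = 0" if "x \<in> S" for x
    proof -
      have "eval_mpoly (p' * h) x = 0" unfolding h by simp
      then show ?thesis using that g[OF that] assms(4) by auto
    qed
    then show ?thesis by simp
  qed
qed

section \<open>The polynomial ring is Noetherian\<close>

lemma poly_ring_simps [simp]:
  "carrier (poly_ring N) = polys UNIV N" "x \<otimes>\<^bsub>poly_ring N\<^esub> y = x * y" "\<one>\<^bsub>poly_ring N\<^esub> = 1"
  "x \<oplus>\<^bsub>poly_ring N\<^esub> y = x + y" "\<zero>\<^bsub>poly_ring N\<^esub> = 0"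
  by (simp_all add: poly_ring_def)

lemma cring_poly_ring: "cring (poly_ring N)"
proof (rule cringI)
  show "abelian_group (poly_ring N)"
  proof (rule abelian_groupI)
    fix x assume "x \<in> carrier (poly_ring N)"
    then show "\<exists>y\<in>carrier (poly_ring N). y \<oplus>\<^bsub>poly_ring N\<^esub> x = \<zero>\<^bsub>poly_ring N\<^esub>"
      by (intro bexI[of _ "- x"]) auto
  qed (auto simp: algebra_simps)
  show "comm_monoid (poly_ring N)"
    by (rule comm_monoidI) (auto simp: algebra_simps)
qed (auto simp: algebra_simps)

section \<open>Dickson's lemma and the order of monomials\<close>

lemma nat_seq_mono_subseq:
  fixes s :: "nat \<Rightarrow> nat"
  shows "\<exists>r :: nat \<Rightarrow> nat. strict_mono r \<and> (\<forall>i j. i \<le> j \<longrightarrow> s (r i) \<le> s (r j))"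
proof -
  obtain f where f: "strict_mono f" "monoseq (\<lambda>n. s (f n))"
    using seq_monosub[of s] by blast
  show ?thesis
  proof (cases "\<forall>i j. i \<le> j \<longrightarrow> s (f i) \<le> s (f j)")
    case True
    then show ?thesis by (intro exI[of _ f] conjI f)
  next
    case False
    then have "decseq (\<lambda>n. s (f n))"
      using f(2) by (auto simp: monoseq_iff incseq_def)
    then have dec: "s (f j) \<le> s (f i)" if "i \<le> j" for i j
      using that by (auto simp: decseq_def)
    \<comment> \<open>A decreasing sequence of naturals is constant from the index of its least
      value on.\<close>
    obtain n where n: "\<And>m. s (f n) \<le> s (f m)"
      using ex_has_least_nat[of "\<lambda>_. True" 0 "\<lambda>n. s (f n)"] by auto
    have "strict_mono (\<lambda>i. f (n + i))"
      using f(1) by (simp add: strict_mono_def)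
    moreover have "s (f (n + i)) \<le> s (f (n + j))" for i j
      using dec[of n "n + i"] n[of "n + j"] by simp
    ultimately show ?thesis by (intro exI[of _ "\<lambda>i. f (n + i)"]) simp
  qed
qed

lemma mono_subseq_coordinates:
  fixes g :: "nat \<Rightarrow> nat \<Rightarrow> nat"
  shows "\<exists>r :: nat \<Rightarrow> nat. strict_mono r \<and> (\<forall>k<N. \<forall>i j. i \<le> j \<longrightarrow> g (r i) k \<le> g (r j) k)"
proof (induction N)
  case 0
  show ?case by (intro exI[of _ id]) (simp add: strict_mono_def)
next
  case (Suc N)
  then obtain r :: "nat \<Rightarrow> nat" where r: "strict_mono r" "\<And>k i j. k < N \<Longrightarrow> i \<le> j \<Longrightarrow> g (r i) k \<le> g (r j) k" by blast
  obtain h :: "nat \<Rightarrow> nat" where h: "strict_mono h" "\<And>i j. i \<le> j \<Longrightarrow> g (r (h i)) N \<le> g (r (h j)) N"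
    using nat_seq_mono_subseq[of "\<lambda>n. g (r n) N"] by blast
  have "h i \<le> h j" if "i \<le> j" for i j
    using h(1) that by (simp add: strict_mono_less_eq)
  then have "g (r (h i)) k \<le> g (r (h j)) k" if "k < Suc N" "i \<le> j" for k i j
    using that r(2)[of k "h i" "h j"] h(2)[of i j] by (cases "k = N") auto
  moreover have "strict_mono (\<lambda>i. r (h i))"
    using r(1) h(1) by (simp add: strict_mono_def)
  ultimately show ?case by (intro exI[of _ "\<lambda>i. r (h i)"]) simp
qed

text \<open>Dickson's lemma for sequences: in a subsequence along which every exponent increases
  weakly, the first monomial divides the second.\<close>

lemma dickson:
  fixes f :: "nat \<Rightarrow> nat \<Rightarrow>\<^sub>0 nat"
  assumes "\<And>n. Poly_Mapping.keys (f n) \<subseteq> {..<N}"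
  obtains i j u where "i < j" "f j = f i + u" "Poly_Mapping.keys u \<subseteq> {..<N}"
proof -
  obtain r :: "nat \<Rightarrow> nat" where r: "strict_mono r"
    "\<And>k i j. k < N \<Longrightarrow> i \<le> j \<Longrightarrow> Poly_Mapping.lookup (f (r i)) k \<le> Poly_Mapping.lookup (f (r j)) k"
    using mono_subseq_coordinates[of N "\<lambda>n. Poly_Mapping.lookup (f n)"] by blast
  define u where "u = f (r 1) - f (r 0)"
  have le: "Poly_Mapping.lookup (f (r 0)) k \<le> Poly_Mapping.lookup (f (r 1)) k" for k
  proof (cases "k < N")
    case False
    then have "k \<notin> Poly_Mapping.keys (f (r 0))" using assms by auto
    then show ?thesis by (simp add: in_keys_iff)
  qed (use r(2) in auto)
  have "f (r 1) = f (r 0) + u"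
    by (rule poly_mapping_eqI) (use le in \<open>simp add: u_def lookup_add lookup_minus\<close>)
  moreover have "Poly_Mapping.keys u \<subseteq> Poly_Mapping.keys (f (r 1))"
    by (auto simp: u_def in_keys_iff lookup_minus)
  moreover have "r 0 < r 1" using r(1) by (simp add: strict_mono_def)
  ultimately show ?thesis using that assms by blast
qed

text \<open>The order of \<open>poly_mapping\<close> is lexicographic: the first nonzero exponent
  decides, and it is positive.\<close>

lemma monomial_nonneg: "0 \<le> (u :: nat \<Rightarrow>\<^sub>0 nat)"
proof (cases "u = 0")
  case False
  then obtain k where "Poly_Mapping.lookup u k \<noteq> 0"
    by (metis lookup_zero poly_mapping_eqI)
  then obtain k where "Poly_Mapping.lookup u k \<noteq> 0" "\<forall>k'<k. Poly_Mapping.lookup u k' = 0"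
    using exists_least_iff[of "\<lambda>k. Poly_Mapping.lookup u k \<noteq> 0"] by blast
  then have "0 < u"
    by (auto simp: less_poly_mapping.rep_eq less_fun_def intro!: exI[of _ k])
  then show ?thesis by simp
qed simp

text \<open>In an infinite descent some monomial would divide a later one by \<open>dickson\<close>,
  hence be at most it, since multiplication by a monomial does not decrease the order.\<close>

lemma ex_least_monomial:
  fixes T :: "(nat \<Rightarrow>\<^sub>0 nat) set"
  assumes "T \<noteq> {}" "\<And>t. t \<in> T \<Longrightarrow> Poly_Mapping.keys t \<subseteq> {..<N}"
  obtains t where "t \<in> T" "\<And>s. s \<in> T \<Longrightarrow> t \<le> s"
proof (rule ccontr)
  assume "\<not> thesis"
  then have "\<forall>t\<in>T. \<exists>s\<in>T. s < t" using that by (metis not_le)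
  then obtain d where d: "\<And>t. t \<in> T \<Longrightarrow> d t \<in> T \<and> d t < t" by metis
  obtain t0 where t0: "t0 \<in> T" using assms(1) by blast
  define f where "f n = (d ^^ n) t0" for n
  have fT: "f n \<in> T" for n by (induction n) (auto simp: f_def t0 d)
  have step: "f (Suc n) < f n" for n using d[OF fT[of n]] by (simp add: f_def)
  obtain i j u where u: "i < j" "f j = f i + u" "Poly_Mapping.keys u \<subseteq> {..<N}"
    using dickson[of f N] assms(2) fT by blast
  have "f (i + Suc k) < f i" for k
    by (induction k) (auto intro: less_trans step)
  from this[of "j - Suc i"] have "f j < f i" using u(1) by simp
  moreover have "f i \<le> f j" using add_left_mono[OF monomial_nonneg[of u], of "f i"] by (simp add: u(2))
  ultimately show False by simp
qed

lemma lookup_single_mult: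
  fixes g :: "real mpoly"
  shows "Poly_Mapping.lookup (Poly_Mapping.single u c * g) (u + b) = c * Poly_Mapping.lookup g b"
proof -
  have "Poly_Mapping.single u c * g =
      Poly_Mapping.single u c * (\<Sum>t\<in>Poly_Mapping.keys g. Poly_Mapping.single t (Poly_Mapping.lookup g t))"
    by (simp only: poly_mapping_sum_single)
  then have "Poly_Mapping.lookup (Poly_Mapping.single u c * g) (u + b) =
    (\<Sum>t\<in>Poly_Mapping.keys g. if t = b then c * Poly_Mapping.lookup g t else 0)"
    by (simp add: sum_distrib_left mult_single lookup_sum lookup_single when_def)
  also have "\<dots> = c * Poly_Mapping.lookup g b"
    by (auto simp: in_keys_iff)
  finally show ?thesis .
qed

text \<open>Hilbert's basis theorem by leading monomials. From an ideal that is not finitely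
  generated, pick in turn an element outside the ideal of its predecessors with least leading
  monomial. By \<open>dickson\<close> the leading monomial of some \<open>g i\<close> divides that
  of a later \<open>g j\<close>; cancelling it with a multiple of \<open>g i\<close> leaves an
  element that is still outside but has a smaller leading monomial.\<close>

lemma noetherian_poly_ring: "noetherian_ring (poly_ring N)"
proof -
  interpret R: cring "poly_ring N" by (rule cring_poly_ring)
  show ?thesis
  proof (rule R.noetherian_ringI, rule ccontr)
    fix J assume J: "ideal J (poly_ring N)"
      and nfg: "\<not> (\<exists>A\<subseteq>carrier (poly_ring N). finite A \<and> J = Idl\<^bsub>poly_ring N\<^esub> A)"
    \<comment> \<open>The leading monomial. It is meaningful only for \<open>f \<noteq> 0\<close>,
      which holds for every element outside an ideal.\<close>
    define lm :: "real mpoly \<Rightarrow> nat \<Rightarrow>\<^sub>0 nat" where "lm f = Max (Poly_Mapping.keys f)" for f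
    let ?I = "\<lambda>A. Idl\<^bsub>poly_ring N\<^esub> A"
    have Jsub: "J \<subseteq> polys UNIV N" using ideal.Icarr[OF J] by auto
    have idl: "ideal (?I A) (poly_ring N)" if "A \<subseteq> J" for A
      using R.genideal_ideal[of A] that Jsub by auto
    have "\<exists>g. g \<in> J - ?I A \<and> (\<forall>h\<in>J - ?I A. lm g \<le> lm h)" if A: "finite A" "A \<subseteq> J" for A
    proof -
      have "?I A \<subseteq> J" using R.genideal_minimal[OF J A(2)] .
      moreover have "?I A \<noteq> J" using nfg A Jsub by auto
      ultimately have ne: "lm ` (J - ?I A) \<noteq> {}" by blast
      have "Poly_Mapping.keys t \<subseteq> {..<N}" if t: "t \<in> lm ` (J - ?I A)" for t
      proof -
        obtain f where f: "f \<in> J" "f \<notin> ?I A" "t = lm f" using t by blast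
        have "f \<noteq> 0" using f(2) additive_subgroup.zero_closed[OF ideal.axioms(1)[OF idl[OF A(2)]]] by auto
        then have "t \<in> Poly_Mapping.keys f" unfolding f(3) lm_def by (intro Max_in) auto
        then show ?thesis using f(1) Jsub by (auto simp: polys_def)
      qed
      then show ?thesis using ex_least_monomial[OF ne, of N] by (metis (no_types, lifting) image_iff)
    qed
    then obtain pick where pick: "\<And>A. finite A \<Longrightarrow> A \<subseteq> J \<Longrightarrow>
        pick A \<in> J - ?I A \<and> (\<forall>h\<in>J - ?I A. lm (pick A) \<le> lm h)" by metis
    define B where "B n = ((\<lambda>A. insert (pick A) A) ^^ n) {}" for n
    have B: "finite (B n) \<and> B n \<subseteq> J" for n
      by (induction n) (use pick in \<open>auto simp: B_def\<close>)
    define g where "g n = pick (B n)" for n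
    have BS: "B (Suc n) = insert (g n) (B n)" for n by (simp add: B_def g_def)
    have Bmono: "B i \<subseteq> B j" if "i \<le> j" for i j
      using that by (induction rule: dec_induct) (auto simp: BS)
    have g: "g n \<in> J" "g n \<notin> ?I (B n)" "\<And>h. h \<in> J \<Longrightarrow> h \<notin> ?I (B n) \<Longrightarrow> lm (g n) \<le> lm h" for n
      using pick[of "B n"] B[of n] by (auto simp: g_def)
    have nz: "f \<noteq> 0" if "f \<notin> ?I (B n)" for f n
      using that additive_subgroup.zero_closed[OF ideal.axioms(1)[OF idl[of "B n"]]] B[of n] by auto
    have lmk: "lm f \<in> Poly_Mapping.keys f" if "f \<noteq> 0" for f
      unfolding lm_def using that by (intro Max_in) auto
    have "Poly_Mapping.keys (lm (g n)) \<subseteq> {..<N}" for n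
      using lmk[OF nz[OF g(2)[of n]]] g(1)[of n] Jsub by (auto simp: polys_def)
    then obtain i j u where u: "i < j" "lm (g j) = lm (g i) + u" "Poly_Mapping.keys u \<subseteq> {..<N}"
      by (rule dickson)
    define c where "c = Poly_Mapping.lookup (g j) (lm (g j)) / Poly_Mapping.lookup (g i) (lm (g i))"
    define s where "s = Poly_Mapping.single u c"
    have s: "s \<in> polys UNIV N" unfolding s_def by (rule single_in_polys) (use u in auto)
    define h where "h = g j - s * g i"
    have hJ: "h \<in> J"
    proof -
      have "(- s) * g i \<in> J"
        using ideal.I_l_closed[OF J g(1)[of i], of "- s"] polys_uminus[OF s] by auto
      from additive_subgroup.a_closed[OF ideal.axioms(1)[OF J] g(1)[of j] this] show ?thesis
        by (simp add: h_def)
    qed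
    have hI: "h \<notin> ?I (B j)"
    proof
      assume h: "h \<in> ?I (B j)"
      have "g i \<in> B j" using Bmono[of "Suc i" j] u(1) BS[of i] by auto
      then have "g i \<in> ?I (B j)" using R.genideal_self[of "B j"] B[of j] Jsub by auto
      then have "s * g i \<in> ?I (B j)"
        using ideal.I_l_closed[OF idl[of "B j"], of "g i" s] B[of j] s by auto
      then have "h + s * g i \<in> ?I (B j)"
        using additive_subgroup.a_closed[OF ideal.axioms(1)[OF idl[of "B j"]] h] B[of j] by auto
      then show False using g(2)[of j] by (simp add: h_def)
    qed
    have ne: "h \<noteq> 0" using nz[OF hI] .
    have gi: "Poly_Mapping.lookup (g i) (lm (g i)) \<noteq> 0"
      using lmk[OF nz[OF g(2)[of i]]] by (simp add: in_keys_iff)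
    have "Poly_Mapping.lookup h (lm (g j)) = 0"
      unfolding h_def s_def lookup_minus
      using lookup_single_mult[of u c "g i" "lm (g i)"] gi by (simp add: u(2) c_def add.commute)
    moreover have "t \<le> lm (g j)" if "t \<in> Poly_Mapping.keys h" for t
    proof -
      have "t \<in> Poly_Mapping.keys (g j) \<or> t \<in> Poly_Mapping.keys (s * g i)"
        using that by (auto simp: h_def in_keys_iff lookup_minus)
      then show ?thesis
      proof
        assume "t \<in> Poly_Mapping.keys (s * g i)"
        then obtain b where b: "t = u + b" "b \<in> Poly_Mapping.keys (g i)"
          using keys_mult[of s "g i"] by (auto simp: s_def split: if_splits)
        then have "b \<le> lm (g i)" by (simp add: lm_def)
        then show ?thesis unfolding b(1) u(2) by (metis add.commute add_left_mono)
      qed (simp add: lm_def)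
    qed
    ultimately have "lm h < lm (g j)"
      using lmk[OF ne] by (metis in_keys_iff le_less)
    then show False using g(3)[OF hJ hI] by simp
  qed
qed

section \<open>Rings of fractions of quotients\<close>

text \<open>
  Up to isomorphism the target of such a homomorphism is the localization of \<open>R / ker h\<close> at
  the image of \<open>G\<close>.
\<close>

locale fraction_hom = ring_hom_cring R S h for R (structure) and S (structure) and h +
  fixes G
  assumes G_subset: "G \<subseteq> carrier R"
    and one_in_G: "\<one>\<^bsub>R\<^esub> \<in> G"
    and G_mult: "g \<in> G \<Longrightarrow> g' \<in> G \<Longrightarrow> g \<otimes>\<^bsub>R\<^esub> g' \<in> G"
    and G_unit: "g \<in> G \<Longrightarrow> h g \<in> Units S"
    and fraction: "y \<in> carrier S \<Longrightarrow> \<exists>f\<in>carrier R. \<exists>g\<in>G. y \<otimes>\<^bsub>S\<^esub> h g = h f"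
begin

lemma fraction_in_ideal:
  assumes "ideal Q S" "y \<in> carrier S" "g \<in> G" "y \<otimes>\<^bsub>S\<^esub> h g \<in> Q"
  shows "y \<in> Q"
proof -
  have u: "h g \<in> Units S" using G_unit assms(3) .
  then have "y = (y \<otimes>\<^bsub>S\<^esub> h g) \<otimes>\<^bsub>S\<^esub> inv\<^bsub>S\<^esub> (h g)"
    using assms(2) S.Units_closed[OF u] S.Units_inv_closed[OF u] S.Units_r_inv[OF u] by (simp add: S.m_assoc)
  then show ?thesis
    using ideal.I_r_closed[OF assms(1,4) S.Units_inv_closed[OF u]] by simp
qed

lemma vimage_ideal: "ideal Q S \<Longrightarrow> ideal {f \<in> carrier R. h f \<in> Q} R"
  by (rule ring_hom_ring.ideal_vimage[OF ring_hom_ringI2[OF R.ring_axioms S.ring_axioms homh]])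

lemma vimage_prime:
  assumes "primeideal Q S"
  shows "primeideal {f \<in> carrier R. h f \<in> Q} R" "{f \<in> carrier R. h f \<in> Q} \<inter> G = {}"
    "{f \<in> carrier R. h f = \<zero>\<^bsub>S\<^esub>} \<subseteq> {f \<in> carrier R. h f \<in> Q}"
proof -
  interpret Q: primeideal Q S by fact
  show "primeideal {f \<in> carrier R. h f \<in> Q} R"
    by (rule ring_hom_ring.primeideal_vimage[OF ring_hom_ringI2[OF R.ring_axioms S.ring_axioms homh] R.is_cring assms])
  have one: "\<one>\<^bsub>S\<^esub> \<notin> Q" using Q.one_imp_carrier Q.I_notcarr by auto
  have "h g \<notin> Q" if "g \<in> G" for g
    using fraction_in_ideal[OF Q.is_ideal S.one_closed that] one that G_subset by auto
  then show "{f \<in> carrier R. h f \<in> Q} \<inter> G = {}" by auto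
  show "{f \<in> carrier R. h f = \<zero>\<^bsub>S\<^esub>} \<subseteq> {f \<in> carrier R. h f \<in> Q}"
    using Q.zero_closed by auto
qed

lemma vimage_strict:
  assumes "ideal Q S" "ideal Q' S" "Q \<subset> Q'"
  shows "{f \<in> carrier R. h f \<in> Q} \<subset> {f \<in> carrier R. h f \<in> Q'}"
proof -
  obtain y where y: "y \<in> Q'" "y \<notin> Q" using assms(3) by blast
  have yS: "y \<in> carrier S" using ideal.Icarr[OF assms(2) y(1)] .
  obtain f g where fg: "f \<in> carrier R" "g \<in> G" "y \<otimes>\<^bsub>S\<^esub> h g = h f" using fraction[OF yS] by blast
  have "h f \<in> Q'" unfolding fg(3)[symmetric]
    using ideal.I_r_closed[OF assms(2) y(1)] fg(2) G_subset by auto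
  moreover have "h f \<notin> Q"
    using fraction_in_ideal[OF assms(1) yS fg(2)] y(2) fg(3) by auto
  ultimately show ?thesis using assms(3) fg(1) by blast
qed

text \<open>The ideal of fractions with numerator in \<open>P\<close>, written with cleared
  denominators.\<close>

definition extension :: "'a set \<Rightarrow> 'c set" where
  "extension P = {y \<in> carrier S. \<exists>f\<in>P. \<exists>g\<in>G. y \<otimes>\<^bsub>S\<^esub> h g = h f}"

lemma extensionI:
  "y \<in> carrier S \<Longrightarrow> f \<in> P \<Longrightarrow> g \<in> G \<Longrightarrow> y \<otimes>\<^bsub>S\<^esub> h g = h f \<Longrightarrow> y \<in> extension P"
  unfolding extension_def by blast

lemma extension_ideal:
  assumes "ideal P R"
  shows "ideal (extension P) S"
proof -
  interpret P: ideal P R by fact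
  have Pc: "f \<in> carrier R" if "f \<in> P" for f using P.Icarr that .
  have Gc: "g \<in> carrier R" if "g \<in> G" for g using G_subset that by auto
  have l: "x \<otimes>\<^bsub>S\<^esub> y \<in> extension P" if y: "y \<in> extension P" and x: "x \<in> carrier S" for x y
  proof -
    obtain f g where fg: "f \<in> P" "g \<in> G" "y \<otimes>\<^bsub>S\<^esub> h g = h f" "y \<in> carrier S"
      using y by (auto simp: extension_def)
    obtain f' g' where fg': "f' \<in> carrier R" "g' \<in> G" "x \<otimes>\<^bsub>S\<^esub> h g' = h f'"
      using fraction[OF x] by auto
    have "(x \<otimes>\<^bsub>S\<^esub> y) \<otimes>\<^bsub>S\<^esub> h (g' \<otimes>\<^bsub>R\<^esub> g) = (x \<otimes>\<^bsub>S\<^esub> h g') \<otimes>\<^bsub>S\<^esub> (y \<otimes>\<^bsub>S\<^esub> h g)"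
      using Gc[OF fg(2)] Gc[OF fg'(2)] fg(4) x by (simp add: S.m_ac)
    also have "\<dots> = h (f' \<otimes>\<^bsub>R\<^esub> f)" using fg fg' by (simp add: Pc)
    finally show ?thesis
      by (rule extensionI[rotated 3]) (use fg fg' x in \<open>auto intro: P.I_l_closed G_mult\<close>)
  qed
  show ?thesis
  proof (rule idealI)
    show "ring S" by (rule S.ring_axioms)
    show "subgroup (extension P) (add_monoid S)"
    proof (rule S.add.subgroupI)
      show "extension P \<subseteq> carrier S" by (auto simp: extension_def)
      have "\<zero>\<^bsub>S\<^esub> \<in> extension P"
        by (rule extensionI[OF _ P.zero_closed one_in_G]) simp_all
      then show "extension P \<noteq> {}" by blast
    next
      fix y assume y: "y \<in> extension P"
      then have "y \<in> carrier S" by (simp add: extension_def)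
      then have "\<ominus>\<^bsub>S\<^esub> y = (\<ominus>\<^bsub>S\<^esub> \<one>\<^bsub>S\<^esub>) \<otimes>\<^bsub>S\<^esub> y" by (simp add: S.l_minus)
      then show "\<ominus>\<^bsub>S\<^esub> y \<in> extension P" using l[OF y, of "\<ominus>\<^bsub>S\<^esub> \<one>\<^bsub>S\<^esub>"] by simp
    next
      fix y y' assume "y \<in> extension P" "y' \<in> extension P"
      then obtain f g f' g' where fg: "f \<in> P" "g \<in> G" "y \<otimes>\<^bsub>S\<^esub> h g = h f" "y \<in> carrier S"
        and fg': "f' \<in> P" "g' \<in> G" "y' \<otimes>\<^bsub>S\<^esub> h g' = h f'" "y' \<in> carrier S"
        by (auto simp: extension_def)
      have "(y \<oplus>\<^bsub>S\<^esub> y') \<otimes>\<^bsub>S\<^esub> h (g \<otimes>\<^bsub>R\<^esub> g') = (y \<otimes>\<^bsub>S\<^esub> h g) \<otimes>\<^bsub>S\<^esub> h g' \<oplus>\<^bsub>S\<^esub> (y' \<otimes>\<^bsub>S\<^esub> h g') \<otimes>\<^bsub>S\<^esub> h g"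
        using Gc[OF fg(2)] Gc[OF fg'(2)] fg(4) fg'(4) by (simp add: S.m_ac S.l_distr S.r_distr)
      also have "\<dots> = h (f \<otimes>\<^bsub>R\<^esub> g' \<oplus>\<^bsub>R\<^esub> f' \<otimes>\<^bsub>R\<^esub> g)" using fg fg' by (simp add: Pc Gc)
      finally have "(y \<oplus>\<^bsub>S\<^esub> y') \<otimes>\<^bsub>S\<^esub> h (g \<otimes>\<^bsub>R\<^esub> g') = h (f \<otimes>\<^bsub>R\<^esub> g' \<oplus>\<^bsub>R\<^esub> f' \<otimes>\<^bsub>R\<^esub> g)" .
      moreover have "f \<otimes>\<^bsub>R\<^esub> g' \<oplus>\<^bsub>R\<^esub> f' \<otimes>\<^bsub>R\<^esub> g \<in> P"
        by (intro P.a_closed P.I_r_closed fg fg' Gc)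
      ultimately show "y \<oplus>\<^bsub>S\<^esub> y' \<in> extension P"
        by (intro extensionI[of _ "f \<otimes>\<^bsub>R\<^esub> g' \<oplus>\<^bsub>R\<^esub> f' \<otimes>\<^bsub>R\<^esub> g" P "g \<otimes>\<^bsub>R\<^esub> g'"])
          (use fg fg' in \<open>auto intro: G_mult\<close>)
    qed
    show "y \<otimes>\<^bsub>S\<^esub> x \<in> extension P" if "y \<in> extension P" "x \<in> carrier S" for x y
      using l[OF that] that by (simp add: S.m_comm extension_def)
  qed (use l in auto)
qed

lemma extension_mem_iff:
  assumes "primeideal P R" "{f \<in> carrier R. h f = \<zero>\<^bsub>S\<^esub>} \<subseteq> P" "P \<inter> G = {}" "f \<in> carrier R"
  shows "h f \<in> extension P \<longleftrightarrow> f \<in> P"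
proof
  interpret P: primeideal P R by fact
  show "h f \<in> extension P" if "f \<in> P"
  proof -
    have "h f \<otimes>\<^bsub>S\<^esub> h \<one>\<^bsub>R\<^esub> = h f" using assms(4) by simp
    then show ?thesis using that one_in_G assms(4) unfolding extension_def by blast
  qed
  assume "h f \<in> extension P"
  then obtain f' g where fg: "f' \<in> P" "g \<in> G" "h f \<otimes>\<^bsub>S\<^esub> h g = h f'" by (auto simp: extension_def)
  have c: "f' \<in> carrier R" "g \<in> carrier R" using fg P.Icarr G_subset by auto
  have "h (f \<otimes>\<^bsub>R\<^esub> g \<ominus>\<^bsub>R\<^esub> f') = \<zero>\<^bsub>S\<^esub>"
    using c assms(4) fg(3) by (simp add: R.minus_eq S.r_neg)
  then have "f \<otimes>\<^bsub>R\<^esub> g \<ominus>\<^bsub>R\<^esub> f' \<in> P" using assms(2,4) c by auto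
  then have "(f \<otimes>\<^bsub>R\<^esub> g \<ominus>\<^bsub>R\<^esub> f') \<oplus>\<^bsub>R\<^esub> f' \<in> P" using fg(1) by (rule P.a_closed)
  then have "f \<otimes>\<^bsub>R\<^esub> g \<in> P" using c assms(4) by (simp add: R.minus_eq R.a_assoc R.l_neg)
  then show "f \<in> P" using P.I_prime[OF assms(4) c(2)] fg(2) assms(3) by blast
qed

lemma extension_prime:
  assumes "primeideal P R" "{f \<in> carrier R. h f = \<zero>\<^bsub>S\<^esub>} \<subseteq> P" "P \<inter> G = {}"
  shows "primeideal (extension P) S"
proof -
  interpret P: primeideal P R by fact
  note mem = extension_mem_iff[OF assms]
  have ext: "ideal (extension P) S" by (rule extension_ideal[OF P.is_ideal])
  show ?thesis
  proof (rule primeidealI[OF ext S.is_cring])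
    have "\<one>\<^bsub>R\<^esub> \<notin> P" using one_in_G assms(3) by auto
    then have "\<one>\<^bsub>S\<^esub> \<notin> extension P" using mem[OF R.one_closed] by simp
    then show "carrier S \<noteq> extension P" by auto
    fix y y' assume y: "y \<in> carrier S" "y' \<in> carrier S" "y \<otimes>\<^bsub>S\<^esub> y' \<in> extension P"
    obtain f g f' g' where fg: "f \<in> carrier R" "g \<in> G" "y \<otimes>\<^bsub>S\<^esub> h g = h f"
      and fg': "f' \<in> carrier R" "g' \<in> G" "y' \<otimes>\<^bsub>S\<^esub> h g' = h f'"
      using fraction[OF y(1)] fraction[OF y(2)] by blast
    have Gc: "g \<in> carrier R" "g' \<in> carrier R" using fg fg' G_subset by auto
    have "h (f \<otimes>\<^bsub>R\<^esub> f') = (y \<otimes>\<^bsub>S\<^esub> y') \<otimes>\<^bsub>S\<^esub> h (g \<otimes>\<^bsub>R\<^esub> g')"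
      unfolding hom_mult[OF fg(1) fg'(1)] fg(3)[symmetric] fg'(3)[symmetric]
      using y(1,2) Gc by (simp add: S.m_ac)
    moreover have "(y \<otimes>\<^bsub>S\<^esub> y') \<otimes>\<^bsub>S\<^esub> h (g \<otimes>\<^bsub>R\<^esub> g') \<in> extension P"
      by (rule ideal.I_r_closed[OF ext y(3)]) (use Gc in auto)
    ultimately have "h (f \<otimes>\<^bsub>R\<^esub> f') \<in> extension P" by argo
    then have "f \<otimes>\<^bsub>R\<^esub> f' \<in> P" using mem[of "f \<otimes>\<^bsub>R\<^esub> f'"] fg(1) fg'(1) by blast
    then have "f \<in> P \<or> f' \<in> P" using P.I_prime[OF fg(1) fg'(1)] by blast
    then show "y \<in> extension P \<or> y' \<in> extension P"
      using extensionI[OF y(1) _ fg(2,3)] extensionI[OF y(2) _ fg'(2,3)] by blast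
  qed
qed

text \<open>Up to a unit every element of an ideal of \<open>S\<close> is the image of an element of
  its preimage, so the images of finitely many generators of the preimage generate the
  ideal.\<close>

lemma noetherian_target:
  assumes "noetherian_ring R"
  shows "noetherian_ring S"
proof (rule S.noetherian_ringI)
  fix Q assume Q: "ideal Q S"
  define P where "P = {f \<in> carrier R. h f \<in> Q}"
  have P: "ideal P R" unfolding P_def by (rule vimage_ideal[OF Q])
  obtain A where A: "A \<subseteq> carrier R" "finite A" "P = Idl\<^bsub>R\<^esub> A"
    using noetherian_ring.finetely_gen[OF assms P] by blast
  have AP: "A \<subseteq> P" using R.genideal_self[OF A(1)] A(3) by simp
  have hA: "h ` A \<subseteq> carrier S" using A(1) by auto
  have I: "ideal (Idl\<^bsub>S\<^esub> (h ` A)) S" by (rule S.genideal_ideal[OF hA])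
  have "P \<subseteq> {f \<in> carrier R. h f \<in> Idl\<^bsub>S\<^esub> (h ` A)}"
    unfolding A(3) by (rule R.genideal_minimal[OF vimage_ideal[OF I]])
      (use A(1) S.genideal_self[OF hA] in auto)
  then have "y \<in> Idl\<^bsub>S\<^esub> (h ` A)" if y: "y \<in> Q" for y
  proof -
    have yS: "y \<in> carrier S" using ideal.Icarr[OF Q y] .
    obtain f g where fg: "f \<in> carrier R" "g \<in> G" "y \<otimes>\<^bsub>S\<^esub> h g = h f" using fraction[OF yS] by blast
    have "h f \<in> Q" unfolding fg(3)[symmetric]
      using ideal.I_r_closed[OF Q y] fg(2) G_subset by auto
    then have "h f \<in> Idl\<^bsub>S\<^esub> (h ` A)"
      using \<open>P \<subseteq> {f \<in> carrier R. h f \<in> Idl\<^bsub>S\<^esub> (h ` A)}\<close> fg(1) by (auto simp: P_def)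
    then show ?thesis using fraction_in_ideal[OF I yS fg(2)] fg(3) by simp
  qed
  moreover have "Idl\<^bsub>S\<^esub> (h ` A) \<subseteq> Q"
    by (rule S.genideal_minimal[OF Q]) (use AP in \<open>auto simp: P_def\<close>)
  ultimately have "Q = Idl\<^bsub>S\<^esub> (h ` A)" by blast
  then show "\<exists>B\<subseteq>carrier S. finite B \<and> Q = Idl\<^bsub>S\<^esub> B" using hA A(2) by blast
qed

text \<open>Contraction keeps a chain of primes strict, because every element of \<open>S\<close>
  becomes an image from \<open>R\<close> after multiplication by a unit. So it is enough to bound
  the chains of primes of \<open>R\<close> above the kernel.\<close>

lemma krull_dim_le:
  assumes "\<And>k P. (\<And>i. i \<le> k \<Longrightarrow> primeideal (P i) R) \<Longrightarrow>
      (\<And>i. i \<le> k \<Longrightarrow> {f \<in> carrier R. h f = \<zero>\<^bsub>S\<^esub>} \<subseteq> P i) \<Longrightarrow>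
      (\<And>i. i < k \<Longrightarrow> P i \<subset> P (Suc i)) \<Longrightarrow> k \<le> d"
  shows "krull_dim S \<le> ereal (real d)"
  unfolding krull_dim_def
proof (rule Sup_least, clarify)
  fix k and Q :: "nat \<Rightarrow> 'c set"
  assume Q: "\<forall>i\<le>k. primeideal (Q i) S" "\<forall>i<k. Q i \<subset> Q (Suc i)"
  have "k \<le> d"
  proof (rule assms)
    fix i assume i: "i \<le> k"
    show "primeideal {f \<in> carrier R. h f \<in> Q i} R"
      "{f \<in> carrier R. h f = \<zero>\<^bsub>S\<^esub>} \<subseteq> {f \<in> carrier R. h f \<in> Q i}"
      using vimage_prime[of "Q i"] Q(1) i by auto
  next
    fix i assume i: "i < k"
    show "{f \<in> carrier R. h f \<in> Q i} \<subset> {f \<in> carrier R. h f \<in> Q (Suc i)}"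
      by (rule vimage_strict) (use Q i in \<open>auto intro: primeideal.axioms(1)\<close>)
  qed
  then show "ereal (real k) \<le> ereal (real d)" by simp
qed

text \<open>Primes above the kernel that avoid the denominators extend to primes of
  \<open>S\<close>, and by \<open>extension_mem_iff\<close> they are recovered from their
  extensions, so the inclusions stay strict.\<close>

lemma krull_dim_ge:
  assumes "\<And>i. i \<le> k \<Longrightarrow> primeideal (P i) R"
    and "\<And>i. i \<le> k \<Longrightarrow> {f \<in> carrier R. h f = \<zero>\<^bsub>S\<^esub>} \<subseteq> P i"
    and "\<And>i. i \<le> k \<Longrightarrow> P i \<inter> G = {}"
    and "\<And>i. i < k \<Longrightarrow> P i \<subset> P (Suc i)"
  shows "ereal (real k) \<le> krull_dim S"
  unfolding krull_dim_def
proof (rule Sup_upper, clarify, intro exI conjI allI impI)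
  fix i assume i: "i \<le> k"
  show "primeideal (extension (P i)) S" by (rule extension_prime) (use assms i in auto)
next
  fix i assume i: "i < k"
  have mem: "h f \<in> extension (P j) \<longleftrightarrow> f \<in> P j" if "f \<in> carrier R" "j \<le> k" for f j
    using extension_mem_iff assms that by blast
  obtain f where f: "f \<in> P (Suc i)" "f \<notin> P i" using assms(4)[OF i] by blast
  have "f \<in> carrier R" using ideal.Icarr[OF primeideal.axioms(1)[OF assms(1)[of "Suc i"]] f(1)] i by simp
  then have "h f \<in> extension (P (Suc i))" "h f \<notin> extension (P i)" using mem f i by auto
  moreover have "extension (P i) \<subseteq> extension (P (Suc i))"
    using assms(4)[OF i] by (auto simp: extension_def)
  ultimately show "extension (P i) \<subset> extension (P (Suc i))" by blast
qed (rule refl)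

end

lemma carrier_quotient: "carrier (R Quot I) = (\<Union>f\<in>carrier R. {I +>\<^bsub>R\<^esub> f})"
  by (simp add: FactRing_def A_RCOSETS_def')

text \<open>A quotient is the case of trivial denominators. The transfer of prime chains thereby
  computes \<open>alg_dim\<close> and the dimension of local rings alike.\<close>

lemma fraction_hom_quotient:
  assumes "cring R" "ideal I R"
  shows "fraction_hom R (R Quot I) ((+>\<^bsub>R\<^esub>) I) {\<one>\<^bsub>R\<^esub>}"
proof -
  interpret R: cring R by fact
  interpret I: ideal I R by fact
  interpret H: ring_hom_cring R "R Quot I" "(+>\<^bsub>R\<^esub>) I" by (rule I.rcos_ring_hom_cring[OF assms(1)])
  have one: "I +>\<^bsub>R\<^esub> \<one>\<^bsub>R\<^esub> = \<one>\<^bsub>R Quot I\<^esub>" by (rule H.hom_one)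
  show ?thesis
  proof (intro fraction_hom.intro fraction_hom_axioms.intro)
    show "ring_hom_cring R (R Quot I) ((+>\<^bsub>R\<^esub>) I)" by (rule H.ring_hom_cring_axioms)
    show "I +>\<^bsub>R\<^esub> g \<in> Units (R Quot I)" if "g \<in> {\<one>\<^bsub>R\<^esub>}" for g
      using that H.S.Units_one_closed by (simp only: singleton_iff one)
    fix y assume y: "y \<in> carrier (R Quot I)"
    obtain f where f: "f \<in> carrier R" "y = I +>\<^bsub>R\<^esub> f"
      using y unfolding carrier_quotient by blast
    have "y \<otimes>\<^bsub>R Quot I\<^esub> (I +>\<^bsub>R\<^esub> \<one>\<^bsub>R\<^esub>) = I +>\<^bsub>R\<^esub> f"
      unfolding one H.S.r_one[OF y] by (rule f(2))
    then show "\<exists>f\<in>carrier R. \<exists>g\<in>{\<one>\<^bsub>R\<^esub>}. y \<otimes>\<^bsub>R Quot I\<^esub> (I +>\<^bsub>R\<^esub> g) = I +>\<^bsub>R\<^esub> f"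
      using f(1) by blast
  qed auto
qed

lemma quotient_kernel:
  assumes "cring R" "ideal I R"
  shows "{f \<in> carrier R. I +>\<^bsub>R\<^esub> f = \<zero>\<^bsub>R Quot I\<^esub>} = I"
proof -
  interpret I: ideal I R by fact
  have zero: "\<zero>\<^bsub>R Quot I\<^esub> = I" by (simp add: FactRing_def)
  show ?thesis
    unfolding zero using I.a_rcos_const I.a_rcos_self I.Icarr by blast
qed

section \<open>Local rings of real algebraic sets\<close>

lemma ideal_poly_ringI:
  assumes "I \<subseteq> polys UNIV N" "0 \<in> I" "\<And>f g. f \<in> I \<Longrightarrow> g \<in> I \<Longrightarrow> f + g \<in> I"
    and mult: "\<And>f g. f \<in> I \<Longrightarrow> g \<in> polys UNIV N \<Longrightarrow> g * f \<in> I"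
  shows "ideal I (poly_ring N)"
proof -
  interpret R: cring "poly_ring N" by (rule cring_poly_ring)
  show ?thesis
  proof (rule idealI[OF R.ring_axioms])
    show "subgroup I (add_monoid (poly_ring N))"
    proof (rule R.add.subgroupI)
      fix f assume f: "f \<in> I"
      have "(- 1) * f \<in> I" by (rule mult[OF f]) auto
      moreover have "\<ominus>\<^bsub>poly_ring N\<^esub> f = - f"
        by (rule R.minus_equality) (use f assms(1) in auto)
      ultimately show "\<ominus>\<^bsub>poly_ring N\<^esub> f \<in> I" by simp
    qed (use assms in auto)
  qed (use mult in \<open>auto simp: mult.commute\<close>)
qed

lemma ideal_poly_ringD:
  assumes "ideal I (poly_ring N)"
  shows "I \<subseteq> polys UNIV N" "0 \<in> I" "f \<in> I \<Longrightarrow> g \<in> I \<Longrightarrow> f + g \<in> I"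
    "f \<in> I \<Longrightarrow> g \<in> polys UNIV N \<Longrightarrow> g * f \<in> I"
proof -
  interpret I: ideal I "poly_ring N" by fact
  show "I \<subseteq> polys UNIV N" using I.a_subset by simp
  show "0 \<in> I" using additive_subgroup.zero_closed[OF I.additive_subgroup_axioms] by simp
  show "f \<in> I \<Longrightarrow> g \<in> I \<Longrightarrow> f + g \<in> I" using additive_subgroup.a_closed[OF I.additive_subgroup_axioms, of f g] by simp
  show "f \<in> I \<Longrightarrow> g \<in> polys UNIV N \<Longrightarrow> g * f \<in> I" using ideal.I_l_closed[OF assms, of f g] by simp
qed

lemma ideal_eval_zero: "ideal {f \<in> polys UNIV N. \<forall>x\<in>V. eval_mpoly f x = 0} (poly_ring N)"
  by (rule ideal_poly_ringI) auto

lemma ideal_vanishing_ideal: "ideal (vanishing_ideal UNIV N V) (poly_ring N)"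
  unfolding vanishing_ideal_def by (rule ideal_eval_zero)

text \<open>Modulo the generators every polynomial is congruent to a constant, and this constant can
  only be its value at \<open>a\<close>.\<close>

lemma point_ideal_eq: "point_ideal N a = {f \<in> polys UNIV N. eval_mpoly f a = 0}"
proof -
  interpret R: cring "poly_ring N" by (rule cring_poly_ring)
  let ?X = "{mpoly_var i - mpoly_const (a $ i) | i. i < N}"
  have X: "?X \<subseteq> polys UNIV N" by (auto intro!: polys_diff polys_var polys_const)
  have id: "ideal (point_ideal N a) (poly_ring N)"
    unfolding point_ideal_def by (rule R.genideal_ideal) (use X in simp)
  have Z: "ideal {f \<in> polys UNIV N. eval_mpoly f a = 0} (poly_ring N)"
    using ideal_eval_zero[of N "{a}"] by simp
  have sub: "point_ideal N a \<subseteq> {f \<in> polys UNIV N. eval_mpoly f a = 0}"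
    unfolding point_ideal_def by (rule R.genideal_minimal[OF Z]) (use X in auto)
  have ex: "\<exists>c. f - mpoly_const c \<in> point_ideal N a" if "f \<in> polys UNIV N" for f
    using that is_subring_UNIV
  proof (induction rule: polys_induct)
    case (const c)
    then show ?case using ideal_poly_ringD(2)[OF id] by (intro exI[of _ c]) simp
  next
    case (var i)
    then have "mpoly_var i - mpoly_const (a $ i) \<in> ?X" by blast
    then show ?case
      using R.genideal_self[of ?X] X unfolding point_ideal_def by (intro exI[of _ "a $ i"]) auto
  next
    case (add p q)
    then obtain c d where "p - mpoly_const c \<in> point_ideal N a" "q - mpoly_const d \<in> point_ideal N a" by blast
    then have "(p - mpoly_const c) + (q - mpoly_const d) \<in> point_ideal N a"
      by (rule ideal_poly_ringD(3)[OF id])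
    then show ?case by (intro exI[of _ "c + d"]) (simp add: mpoly_const_simps algebra_simps)
  next
    case (mult p q)
    then obtain c d where cd: "p - mpoly_const c \<in> point_ideal N a" "q - mpoly_const d \<in> point_ideal N a" by blast
    have "p * (q - mpoly_const d) + mpoly_const d * (p - mpoly_const c) \<in> point_ideal N a"
      by (intro ideal_poly_ringD(3,4)[OF id] cd mult polys_const) auto
    then show ?case by (intro exI[of _ "c * d"]) (simp add: mpoly_const_simps algebra_simps)
  qed
  show ?thesis
  proof (intro equalityI sub subsetI)
    fix f assume f: "f \<in> {f \<in> polys UNIV N. eval_mpoly f a = 0}"
    then obtain c where c: "f - mpoly_const c \<in> point_ideal N a" using ex by blast
    then have "eval_mpoly (f - mpoly_const c) a = 0" using sub by blast
    then have "c = 0" using f by simp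
    then show "f \<in> point_ideal N a" using c by (simp add: mpoly_const_simps)
  qed
qed

definition nonzero_at :: "nat \<Rightarrow> real vec \<Rightarrow> real mpoly set" where
  "nonzero_at N a = {g \<in> polys UNIV N. eval_mpoly g a \<noteq> 0}"

lemma nonzero_atD: "g \<in> nonzero_at N a \<Longrightarrow> g \<in> polys UNIV N" "g \<in> nonzero_at N a \<Longrightarrow> g \<noteq> 0"
  by (auto simp: nonzero_at_def)

lemma nonzero_at_mult: "g \<in> nonzero_at N a \<Longrightarrow> g' \<in> nonzero_at N a \<Longrightarrow> g * g' \<in> nonzero_at N a"
  by (auto simp: nonzero_at_def)

lemma nonzero_at_1: "1 \<in> nonzero_at N a"
  by (auto simp: nonzero_at_def)

lemma localization_simps [simp]:
  "x \<otimes>\<^bsub>localization N a\<^esub> y = x * y" "\<one>\<^bsub>localization N a\<^esub> = 1"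
  "x \<oplus>\<^bsub>localization N a\<^esub> y = x + y" "\<zero>\<^bsub>localization N a\<^esub> = 0"
  by (simp_all add: localization_def)

lemma carrier_localization:
  "carrier (localization N a) = {Fract f g | f g. f \<in> polys UNIV N \<and> g \<in> nonzero_at N a}"
  by (auto simp: localization_def nonzero_at_def point_ideal_eq)

lemma cring_localization: "cring (localization N a)"
proof -
  let ?C = "carrier (localization N a)"
  have C: "Fract f g \<in> ?C" if "f \<in> polys UNIV N" "g \<in> nonzero_at N a" for f g
    using that unfolding carrier_localization by blast
  have E: "\<exists>f g. x = Fract f g \<and> f \<in> polys UNIV N \<and> g \<in> nonzero_at N a" if "x \<in> ?C" for x
    using that unfolding carrier_localization by blast
  have c0: "0 \<in> ?C" using C[of 0 1] nonzero_at_1 by (simp add: Zero_fract_def)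
  have c1: "1 \<in> ?C" using C[of 1 1] nonzero_at_1 by (simp add: One_fract_def)
  have add: "x + y \<in> ?C" if xy: "x \<in> ?C" "y \<in> ?C" for x y
  proof -
    obtain f g f' g' where "x = Fract f g" "f \<in> polys UNIV N" "g \<in> nonzero_at N a"
      "y = Fract f' g'" "f' \<in> polys UNIV N" "g' \<in> nonzero_at N a" using E[OF xy(1)] E[OF xy(2)] by blast
    then show ?thesis
      using C[of "f * g' + f' * g" "g * g'"] nonzero_at_mult nonzero_atD by (auto simp: polys_add polys_mult)
  qed
  have mult: "x * y \<in> ?C" if xy: "x \<in> ?C" "y \<in> ?C" for x y
  proof -
    obtain f g f' g' where "x = Fract f g" "f \<in> polys UNIV N" "g \<in> nonzero_at N a"
      "y = Fract f' g'" "f' \<in> polys UNIV N" "g' \<in> nonzero_at N a" using E[OF xy(1)] E[OF xy(2)] by blast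
    then show ?thesis
      using C[of "f * f'" "g * g'"] nonzero_at_mult by (auto simp: polys_mult)
  qed
  have uminus: "- x \<in> ?C" if x: "x \<in> ?C" for x
  proof -
    obtain f g where "x = Fract f g" "f \<in> polys UNIV N" "g \<in> nonzero_at N a" using E[OF x] by blast
    then show ?thesis using C[of "- f" g] by (auto simp: polys_uminus)
  qed
  show ?thesis
  proof (rule cringI)
    show "abelian_group (localization N a)"
    proof (rule abelian_groupI)
      fix x assume "x \<in> ?C"
      then show "\<exists>y\<in>?C. y \<oplus>\<^bsub>localization N a\<^esub> x = \<zero>\<^bsub>localization N a\<^esub>"
        using uminus[of x] by (intro bexI[of _ "- x"]) simp_all
    qed (simp_all add: add c0 algebra_simps)
    show "comm_monoid (localization N a)"
      by (rule comm_monoidI) (simp_all add: mult c1 algebra_simps)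
  qed (simp add: algebra_simps)
qed

lemma fraction_hom_localization:
  "fraction_hom (poly_ring N) (localization N a) (\<lambda>f. Fract f 1) (nonzero_at N a)"
proof -
  interpret R: cring "poly_ring N" by (rule cring_poly_ring)
  interpret L: cring "localization N a" by (rule cring_localization)
  have C: "Fract f g \<in> carrier (localization N a)" if "f \<in> polys UNIV N" "g \<in> nonzero_at N a" for f g
    using that unfolding carrier_localization by blast
  show ?thesis
  proof (intro fraction_hom.intro fraction_hom_axioms.intro ring_hom_cring.intro ring_hom_cring_axioms.intro cring_poly_ring cring_localization)
    show "(\<lambda>f. Fract f 1) \<in> Ring.ring_hom (poly_ring N) (localization N a)"
      by (rule ring_hom_memI) (simp_all add: C nonzero_at_1 One_fract_def)
    show "Fract g 1 \<in> Units (localization N a)" if g: "g \<in> nonzero_at N a" for g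
    proof -
      have g0: "g \<noteq> 0" "g \<in> polys UNIV N" using nonzero_atD[OF g] by auto
      then have "Fract 1 g * Fract g 1 = 1" by (simp add: One_fract_def eq_fract)
      then show ?thesis unfolding Units_def using C[of 1 g] C[of g 1] g g0 nonzero_at_1
        by (auto simp: mult.commute intro!: bexI[of _ "Fract 1 g"])
    qed
    show "\<exists>f\<in>carrier (poly_ring N). \<exists>g\<in>nonzero_at N a. y \<otimes>\<^bsub>localization N a\<^esub> Fract g 1 = Fract f 1"
      if y: "y \<in> carrier (localization N a)" for y
    proof -
      obtain f g where fg: "y = Fract f g" "f \<in> polys UNIV N" "g \<in> nonzero_at N a"
        using y unfolding carrier_localization by blast
      then have "y * Fract g 1 = Fract f 1" using nonzero_atD[OF fg(3)] by (simp add: eq_fract)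
      then show ?thesis using fg by auto
    qed
  qed (use nonzero_atD nonzero_at_mult nonzero_at_1 in auto)
qed

lemma fraction_hom_comp_quotient:
  assumes "fraction_hom R L h G" "ideal I L"
  shows "fraction_hom R (L Quot I) (\<lambda>f. I +>\<^bsub>L\<^esub> h f) G"
proof -
  interpret F: fraction_hom R L h G by fact
  interpret I: ideal I L by fact
  interpret Q: ring_hom_cring L "L Quot I" "(+>\<^bsub>L\<^esub>) I" by (rule I.rcos_ring_hom_cring[OF F.S.is_cring])
  show ?thesis
  proof (intro fraction_hom.intro fraction_hom_axioms.intro ring_hom_cring.intro ring_hom_cring_axioms.intro F.R.is_cring Q.S.is_cring)
    show "(\<lambda>f. I +>\<^bsub>L\<^esub> h f) \<in> Ring.ring_hom R (L Quot I)"
      by (rule ring_hom_memI) simp_all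
    show "I +>\<^bsub>L\<^esub> h g \<in> Units (L Quot I)" if g: "g \<in> G" for g
    proof -
      have u: "h g \<in> Units L" using F.G_unit[OF g] .
      note c = F.S.Units_closed[OF u] F.S.Units_inv_closed[OF u]
      have "(I +>\<^bsub>L\<^esub> inv\<^bsub>L\<^esub> (h g)) \<otimes>\<^bsub>L Quot I\<^esub> (I +>\<^bsub>L\<^esub> h g) = \<one>\<^bsub>L Quot I\<^esub>"
        using Q.hom_mult[OF c(2,1)] F.S.Units_l_inv[OF u] Q.hom_one by argo
      moreover have "(I +>\<^bsub>L\<^esub> h g) \<otimes>\<^bsub>L Quot I\<^esub> (I +>\<^bsub>L\<^esub> inv\<^bsub>L\<^esub> (h g)) = \<one>\<^bsub>L Quot I\<^esub>"
        using Q.hom_mult[OF c] F.S.Units_r_inv[OF u] Q.hom_one by argo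
      ultimately show ?thesis using Q.hom_closed[OF c(1)] Q.hom_closed[OF c(2)]
        unfolding Units_def by blast
    qed
    show "\<exists>f\<in>carrier R. \<exists>g\<in>G. y \<otimes>\<^bsub>L Quot I\<^esub> (I +>\<^bsub>L\<^esub> h g) = I +>\<^bsub>L\<^esub> h f"
      if y: "y \<in> carrier (L Quot I)" for y
    proof -
      obtain l where l: "l \<in> carrier L" "y = I +>\<^bsub>L\<^esub> l" using y unfolding carrier_quotient by blast
      obtain f g where fg: "f \<in> carrier R" "g \<in> G" "l \<otimes>\<^bsub>L\<^esub> h g = h f" using F.fraction[OF l(1)] by blast
      have "y \<otimes>\<^bsub>L Quot I\<^esub> (I +>\<^bsub>L\<^esub> h g) = I +>\<^bsub>L\<^esub> h f"
        unfolding l(2) fg(3)[symmetric] using fg(2) F.G_subset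
        by (intro Q.hom_mult[symmetric] l(1) F.hom_closed) auto
      then show ?thesis using fg by blast
    qed
  qed (use F.G_subset F.one_in_G F.G_mult in auto)
qed

text \<open>The generated ideal consists of fractions with numerator in \<open>J\<close>;
  injectivity of \<open>h\<close> carries the resulting equation back to \<open>R\<close>. The
  contraction is thus the saturation of \<open>J\<close> by the denominators.\<close>

lemma (in fraction_hom) mem_genideal_image_iff:
  assumes "ideal J R" "f \<in> carrier R" "inj_on h (carrier R)"
  shows "h f \<in> Idl\<^bsub>S\<^esub> (h ` J) \<longleftrightarrow> (\<exists>g\<in>G. f \<otimes>\<^bsub>R\<^esub> g \<in> J)"
proof
  interpret J: ideal J R by fact
  have hJ: "h ` J \<subseteq> carrier S" using J.Icarr by auto
  have I: "ideal (Idl\<^bsub>S\<^esub> (h ` J)) S" by (rule S.genideal_ideal[OF hJ])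
  have "Idl\<^bsub>S\<^esub> (h ` J) \<subseteq> extension J"
  proof (rule S.genideal_minimal[OF extension_ideal[OF assms(1)]], clarify)
    fix f assume f: "f \<in> J"
    show "h f \<in> extension J"
      by (rule extensionI[OF _ f one_in_G]) (use J.Icarr[OF f] in simp_all)
  qed
  moreover assume "h f \<in> Idl\<^bsub>S\<^esub> (h ` J)"
  ultimately obtain f' g where fg: "f' \<in> J" "g \<in> G" "h f \<otimes>\<^bsub>S\<^esub> h g = h f'"
    unfolding extension_def by blast
  have c: "g \<in> carrier R" "f' \<in> carrier R" using fg G_subset J.Icarr by auto
  have "h (f \<otimes>\<^bsub>R\<^esub> g) = h f'" using fg(3) c assms(2) by simp
  then have "f \<otimes>\<^bsub>R\<^esub> g = f'" using inj_onD[OF assms(3)] c assms(2) by simp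
  then show "\<exists>g\<in>G. f \<otimes>\<^bsub>R\<^esub> g \<in> J" using fg by blast
next
  interpret J: ideal J R by fact
  have hJ: "h ` J \<subseteq> carrier S" using J.Icarr by auto
  have I: "ideal (Idl\<^bsub>S\<^esub> (h ` J)) S" by (rule S.genideal_ideal[OF hJ])
  assume "\<exists>g\<in>G. f \<otimes>\<^bsub>R\<^esub> g \<in> J"
  then obtain g where g: "g \<in> G" "f \<otimes>\<^bsub>R\<^esub> g \<in> J" by blast
  have "h (f \<otimes>\<^bsub>R\<^esub> g) \<in> Idl\<^bsub>S\<^esub> (h ` J)" using S.genideal_self[OF hJ] g(2) by blast
  then have "h f \<otimes>\<^bsub>S\<^esub> h g \<in> Idl\<^bsub>S\<^esub> (h ` J)" using assms(2) g(1) G_subset by auto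
  then show "h f \<in> Idl\<^bsub>S\<^esub> (h ` J)" using fraction_in_ideal[OF I _ g(1)] assms(2) by simp
qed

definition local_hom :: "nat \<Rightarrow> real vec set \<Rightarrow> real vec \<Rightarrow> real mpoly \<Rightarrow> real mpoly fract set" where
  "local_hom N V a f = Idl\<^bsub>localization N a\<^esub> ((\<lambda>f. Fract f 1) ` vanishing_ideal UNIV N V)
     +>\<^bsub>localization N a\<^esub> Fract f 1"

lemma fraction_hom_local_ring_at:
  "fraction_hom (poly_ring N) (local_ring_at UNIV N V a) (local_hom N V a) (nonzero_at N a)"
proof -
  interpret F: fraction_hom "poly_ring N" "localization N a" "\<lambda>f. Fract f 1" "nonzero_at N a"
    by (rule fraction_hom_localization)
  have "(\<lambda>f. Fract f 1) ` vanishing_ideal UNIV N V \<subseteq> carrier (localization N a)"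
    using ideal_poly_ringD(1)[OF ideal_vanishing_ideal, of N V] F.hom_closed by auto
  then have "ideal (Idl\<^bsub>localization N a\<^esub> ((\<lambda>f. Fract f 1) ` vanishing_ideal UNIV N V)) (localization N a)"
    by (rule F.S.genideal_ideal)
  from fraction_hom_comp_quotient[OF fraction_hom_localization this] show ?thesis
    unfolding local_ring_at_def local_hom_def .
qed

lemma local_hom_eq_zero_iff:
  assumes "f \<in> polys UNIV N"
  shows "local_hom N V a f = \<zero>\<^bsub>local_ring_at UNIV N V a\<^esub> \<longleftrightarrow>
    (\<exists>g\<in>nonzero_at N a. f * g \<in> vanishing_ideal UNIV N V)"
proof -
  interpret F: fraction_hom "poly_ring N" "localization N a" "\<lambda>f. Fract f 1" "nonzero_at N a"
    by (rule fraction_hom_localization)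
  let ?I = "Idl\<^bsub>localization N a\<^esub> ((\<lambda>f. Fract f 1) ` vanishing_ideal UNIV N V)"
  have "(\<lambda>f. Fract f 1) ` vanishing_ideal UNIV N V \<subseteq> carrier (localization N a)"
    using ideal_poly_ringD(1)[OF ideal_vanishing_ideal, of N V] F.hom_closed by auto
  then have id: "ideal ?I (localization N a)" by (rule F.S.genideal_ideal)
  have fc: "Fract f 1 \<in> carrier (localization N a)" using F.hom_closed assms by simp
  have "local_hom N V a f = \<zero>\<^bsub>local_ring_at UNIV N V a\<^esub> \<longleftrightarrow> Fract f 1 \<in> ?I"
    using quotient_kernel[OF cring_localization id] fc unfolding local_ring_at_def local_hom_def by blast
  also have "\<dots> \<longleftrightarrow> (\<exists>g\<in>nonzero_at N a. f \<otimes>\<^bsub>poly_ring N\<^esub> g \<in> vanishing_ideal UNIV N V)"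
    by (rule F.mem_genideal_image_iff[OF ideal_vanishing_ideal])
      (use assms in \<open>auto simp: inj_on_def eq_fract\<close>)
  finally show ?thesis by simp
qed

section \<open>Algebraic dependence and chains of prime ideals\<close>

text \<open>Gaussian elimination for a homogeneous system with more unknowns than equations:
  equation \<open>b\<close> is solved for the unknown \<open>a0\<close>, which is substituted into
  the remaining equations.\<close>

lemma ex_nontrivial_solution:
  fixes c :: "'a \<Rightarrow> 'b \<Rightarrow> real"
  assumes "finite B" "finite A" "card B < card A"
  shows "\<exists>u. (\<exists>a\<in>A. u a \<noteq> 0) \<and> (\<forall>b\<in>B. (\<Sum>a\<in>A. u a * c a b) = 0)"
  using assms
proof (induction B arbitrary: A c rule: finite_induct)
  case empty
  then have "A \<noteq> {}" by auto
  then show ?case by (intro exI[of _ "\<lambda>_. 1"]) auto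
next
  case (insert b B)
  show ?case
  proof (cases "\<forall>a\<in>A. c a b = 0")
    case True
    have "card B < card A" using insert by simp
    then obtain u where "\<exists>a\<in>A. u a \<noteq> 0" "\<forall>b\<in>B. (\<Sum>a\<in>A. u a * c a b) = 0"
      using insert.IH[of A c] insert.prems by auto
    then show ?thesis using True by (intro exI[of _ u]) auto
  next
    case False
    then obtain a0 where a0: "a0 \<in> A" "c a0 b \<noteq> 0" by blast
    let ?A = "A - {a0}"
    have "card B < card ?A" using insert a0 by simp
    then obtain u where u: "\<exists>a\<in>?A. u a \<noteq> 0"
      "\<forall>b'\<in>B. (\<Sum>a\<in>?A. u a * (c a b' - c a b / c a0 b * c a0 b')) = 0"
      using insert.IH[of ?A "\<lambda>a b'. c a b' - c a b / c a0 b * c a0 b'"] insert.prems by auto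
    define v where "v = u(a0 := - (\<Sum>a\<in>?A. u a * c a b) / c a0 b)"
    have sum: "(\<Sum>a\<in>A. v a * c a b') = (\<Sum>a\<in>?A. u a * (c a b' - c a b / c a0 b * c a0 b'))" for b'
    proof -
      have "(\<Sum>a\<in>A. v a * c a b') = v a0 * c a0 b' + (\<Sum>a\<in>?A. v a * c a b')"
        using insert.prems(1) a0(1) by (simp add: sum.remove)
      also have "(\<Sum>a\<in>?A. v a * c a b') = (\<Sum>a\<in>?A. u a * c a b')"
        by (intro sum.cong) (auto simp: v_def)
      also have "v a0 * c a0 b' = - (\<Sum>a\<in>?A. u a * c a b / c a0 b * c a0 b')"
        by (simp add: v_def sum_distrib_right sum_divide_distrib)
      finally show ?thesis by (simp add: algebra_simps sum_subtractf)
    qed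
    have "(\<Sum>a\<in>A. v a * c a b) = 0" unfolding sum using a0(2) by simp
    then have "\<forall>b'\<in>insert b B. (\<Sum>a\<in>A. v a * c a b') = 0" using u(2) sum by auto
    moreover have "\<exists>a\<in>A. v a \<noteq> 0" using u(1) by (auto simp: v_def)
    ultimately show ?thesis by blast
  qed
qed

text \<open>The exponent tuples of monomials in \<open>l\<close> variables with all exponents below
  \<open>s\<close>.\<close>

definition bounded_lists :: "nat \<Rightarrow> nat \<Rightarrow> nat list set" where
  "bounded_lists s l = {bs. set bs \<subseteq> {..<s} \<and> length bs = l}"

lemma finite_bounded_lists: "finite (bounded_lists s l)"
  unfolding bounded_lists_def by (rule finite_lists_length_eq) simp

lemma card_bounded_lists: "card (bounded_lists s l) = s ^ l"
  unfolding bounded_lists_def by (subst card_lists_length_eq) auto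

lemma bounded_lists_0: "bounded_lists s 0 = {[]}"
  by (auto simp: bounded_lists_def)

lemma bounded_lists_Suc:
  "bounded_lists s (Suc l) = (\<lambda>(a, bs). a # bs) ` ({..<s} \<times> bounded_lists s l)"
  by (force simp: bounded_lists_def length_Suc_conv)

lemma sum_bounded_lists_Suc:
  "(\<Sum>bs\<in>bounded_lists s (Suc l). g bs) = (\<Sum>a<s. \<Sum>bs\<in>bounded_lists s l. g (a # bs))"
proof -
  have "inj_on (\<lambda>(a, bs). a # bs) ({..<s} \<times> bounded_lists s l)"
    by (auto simp: inj_on_def)
  then show ?thesis
    by (simp add: bounded_lists_Suc sum.reindex comp_def case_prod_unfold sum.cartesian_product)
qed

fun power_list :: "'a::comm_monoid_mult list \<Rightarrow> nat list \<Rightarrow> 'a" where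
  "power_list (y # ys) (b # bs) = y ^ b * power_list ys bs"
| "power_list ys bs = 1"

text \<open>
  The polynomial with coefficients \<open>u\<close> evaluated at \<open>fs\<close>.  If \<open>fs ! i \<in> P (Suc i) - P i\<close> for a chain
  of primes, a relation modulo \<open>P 0\<close> has its coefficients vanish one variable at a time, whereas
  counting exponents gives a nontrivial relation as soon as \<open>fs\<close> is longer than the dimension.
\<close>

fun nested_poly :: "nat \<Rightarrow> real mpoly list \<Rightarrow> (nat list \<Rightarrow> real) \<Rightarrow> real mpoly" where
  "nested_poly s [] u = mpoly_const (u [])"
| "nested_poly s (f # fs) u = (\<Sum>a<s. f ^ a * nested_poly s fs (\<lambda>bs. u (a # bs)))"

lemma eval_nested_poly:
  "eval_mpoly (nested_poly s fs u) x =
   (\<Sum>bs\<in>bounded_lists s (length fs). u bs * power_list (map (\<lambda>f. eval_mpoly f x) fs) bs)"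
proof (induction s fs u rule: nested_poly.induct)
  case (1 s u)
  then show ?case by (simp add: bounded_lists_0)
next
  case (2 s f fs u)
  show ?case
    by (simp add: 2 sum_bounded_lists_Suc sum_distrib_left mult.left_commute)
qed

lemma nested_poly_in_polys: "set fs \<subseteq> polys UNIV M \<Longrightarrow> nested_poly s fs u \<in> polys UNIV M"
  by (induction s fs u rule: nested_poly.induct) (auto intro!: polys_sum polys_mult polys_power)

lemma nested_poly_0:
  assumes "\<And>bs. bs \<in> bounded_lists s (length fs) \<Longrightarrow> u bs = 0"
  shows "nested_poly s fs u = 0"
  using assms
proof (induction s fs u rule: nested_poly.induct)
  case (1 s u)
  then show ?case by (simp add: bounded_lists_0 mpoly_const_simps)
next
  case (2 s f fs u)
  have "nested_poly s fs (\<lambda>bs. u (a # bs)) = 0" if "a < s" for a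
    by (rule 2(1)) (use that in \<open>auto intro!: 2(2) simp: bounded_lists_Suc\<close>)
  then show ?case by simp
qed

text \<open>Suppose the coefficients of the powers of \<open>f\<close> below \<open>a\<close> are
  already zero. Then \<open>f ^ a\<close> can be cancelled modulo the prime \<open>P 0\<close>,
  which does not contain \<open>f\<close>. Modulo \<open>P 1\<close>, which does contain
  \<open>f\<close>, only the coefficient of \<open>f ^ a\<close> survives, and the induction
  hypothesis applies to it with the chain shifted by one.\<close>

lemma nested_poly_prime_chain:
  assumes "\<And>i. i \<le> length fs \<Longrightarrow> primeideal (P i) (poly_ring M)"
    and "\<And>i. i < length fs \<Longrightarrow> fs ! i \<in> P (Suc i) - P i"
    and "\<And>i. i < length fs \<Longrightarrow> P i \<subseteq> P (Suc i)"
    and "nested_poly s fs u \<in> P 0" "bs \<in> bounded_lists s (length fs)"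
  shows "u bs = 0"
  using assms
proof (induction s fs u arbitrary: P bs rule: nested_poly.induct)
  case (1 s u)
  interpret P0: primeideal "P 0" "poly_ring M" using 1(1)[of 0] by simp
  show ?case
  proof (rule ccontr)
    assume "u bs \<noteq> 0"
    then have u: "u [] \<noteq> 0" using 1(5) by (simp add: bounded_lists_0)
    have "mpoly_const (1 / u []) * mpoly_const (u []) \<in> P 0"
      by (rule ideal_poly_ringD(4)[OF P0.is_ideal]) (use 1(4) in auto)
    then have "1 \<in> P 0" using u by (simp add: mpoly_const_simps flip: mpoly_const_simps(5))
    then show False using P0.one_imp_carrier P0.I_notcarr by simp
  qed
next
  case (2 s f fs u)
  let ?e = "\<lambda>a. nested_poly s fs (\<lambda>bs. u (a # bs))"
  interpret P0: primeideal "P 0" "poly_ring M" using "2.prems"(1)[of 0] by simp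
  have P1: "ideal (P 1) (poly_ring M)" using "2.prems"(1)[of 1] by (auto intro: primeideal.axioms(1))
  have f: "f \<in> P 1" "f \<notin> P 0" using "2.prems"(2)[of 0] by auto
  have fp: "f \<in> polys UNIV M" using f(1) ideal_poly_ringD(1)[OF P1] by blast
  have fsp: "set fs \<subseteq> polys UNIV M"
  proof
    fix g assume "g \<in> set fs"
    then obtain i where i: "i < length fs" "g = fs ! i" by (auto simp: in_set_conv_nth)
    then have "g \<in> P (Suc (Suc i))" using "2.prems"(2)[of "Suc i"] by simp
    moreover have "ideal (P (Suc (Suc i))) (poly_ring M)"
      using "2.prems"(1)[of "Suc (Suc i)"] i by (auto intro: primeideal.axioms(1))
    ultimately show "g \<in> polys UNIV M" using ideal_poly_ringD(1) by blast
  qed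
  have ep: "?e a \<in> polys UNIV M" for a by (rule nested_poly_in_polys[OF fsp])
  have zero: "\<forall>bs\<in>bounded_lists s (length fs). u (a # bs) = 0" if "a < s" for a
    using that
  proof (induction a rule: less_induct)
    case (less a)
    have e0: "?e a' = 0" if "a' < a" for a'
      by (rule nested_poly_0) (use less that in auto)
    define r where "r = (\<Sum>a'\<in>{Suc a..<s}. f ^ (a' - Suc a) * ?e a')"
    have rp: "r \<in> polys UNIV M" unfolding r_def by (intro polys_sum polys_mult polys_power fp ep) auto
    have "nested_poly s (f # fs) u = (\<Sum>a'\<in>{a..<s}. f ^ a' * ?e a')"
      by (simp, rule sum.mono_neutral_right) (auto simp: e0)
    also have "\<dots> = f ^ a * ?e a + (\<Sum>a'\<in>{Suc a..<s}. f ^ a' * ?e a')"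
      using less(2) by (simp add: sum.atLeast_Suc_lessThan)
    also have "(\<Sum>a'\<in>{Suc a..<s}. f ^ a' * ?e a') = (\<Sum>a'\<in>{Suc a..<s}. f ^ a * (f * (f ^ (a' - Suc a) * ?e a')))"
    proof (intro sum.cong refl)
      fix a' assume "a' \<in> {Suc a..<s}"
      then have "a' = a + Suc (a' - Suc a)" by auto
      then have "f ^ a' = f ^ a * (f * f ^ (a' - Suc a))" by (metis power_Suc power_add)
      then show "f ^ a' * ?e a' = f ^ a * (f * (f ^ (a' - Suc a) * ?e a'))" by (simp add: mult.assoc)
    qed
    also have "\<dots> = f ^ a * (f * r)" by (simp add: r_def sum_distrib_left)
    finally have eq: "nested_poly s (f # fs) u = f ^ a * (?e a + f * r)" by (simp add: algebra_simps)
    have "f ^ k * w \<in> P 0 \<Longrightarrow> w \<in> P 0" if "w \<in> polys UNIV M" for k w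
    proof (induction k)
      case (Suc k)
      then have "f * (f ^ k * w) \<in> P 0" by (simp add: mult.assoc)
      then have "f ^ k * w \<in> P 0"
        using P0.I_prime[of f "f ^ k * w"] fp f(2) that by (auto simp: polys_mult polys_power)
      then show ?case by (rule Suc.IH)
    qed simp
    then have "?e a + f * r \<in> P 0"
      using "2.prems"(4) eq ep rp fp by (auto simp: polys_add polys_mult)
    then have "?e a + f * r \<in> P 1" using "2.prems"(3)[of 0] by auto
    moreover have "(- r) * f \<in> P 1"
      by (rule ideal_poly_ringD(4)[OF P1 f(1)]) (use rp in auto)
    ultimately have "(?e a + f * r) + (- r) * f \<in> P 1" by (rule ideal_poly_ringD(3)[OF P1])
    then have e1: "?e a \<in> P 1" by (simp add: algebra_simps)
    show ?case
    proof
      fix bs assume bs: "bs \<in> bounded_lists s (length fs)"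
      show "u (a # bs) = 0"
      proof (rule "2.IH"[where P = "\<lambda>i. P (Suc i)"])
        show "a \<in> {..<s}" using less by simp
        show "nested_poly s fs (\<lambda>bs. u (a # bs)) \<in> P (Suc 0)" using e1 by simp
        show "fs ! i \<in> P (Suc (Suc i)) - P (Suc i)" if "i < length fs" for i
          using "2.prems"(2)[of "Suc i"] that by simp
      qed (use "2.prems"(1,3) bs in auto)
    qed
  qed
  then show ?case using "2.prems"(5) by (auto simp: bounded_lists_Suc)
qed

section \<open>Clearing denominators with control of the exponents\<close>

definition var_degree_le :: "nat \<Rightarrow> real mpoly \<Rightarrow> bool" where
  "var_degree_le e p \<longleftrightarrow> (\<forall>t\<in>Poly_Mapping.keys p. \<forall>i. Poly_Mapping.lookup t i \<le> e)"

lemma var_degree_le_mono: "var_degree_le e p \<Longrightarrow> e \<le> e' \<Longrightarrow> var_degree_le e' p"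
  unfolding var_degree_le_def using le_trans by blast

lemma ex_var_degree_le: "\<exists>e. var_degree_le e p"
proof -
  define e where "e = (\<Sum>t\<in>Poly_Mapping.keys p. \<Sum>i\<in>Poly_Mapping.keys t. Poly_Mapping.lookup t i)"
  have "Poly_Mapping.lookup t i \<le> e" if t: "t \<in> Poly_Mapping.keys p" for t i
  proof (cases "i \<in> Poly_Mapping.keys t")
    case True
    then have "Poly_Mapping.lookup t i \<le> (\<Sum>i\<in>Poly_Mapping.keys t. Poly_Mapping.lookup t i)"
      by (intro member_le_sum) auto
    also have "\<dots> \<le> e" unfolding e_def
      by (rule member_le_sum[where f = "\<lambda>t. \<Sum>i\<in>Poly_Mapping.keys t. Poly_Mapping.lookup t i", OF t]) auto
    finally show ?thesis .
  qed (simp add: in_keys_iff)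
  then show ?thesis unfolding var_degree_le_def by blast
qed

lemma var_degree_le_1: "var_degree_le e 1"
  by (simp add: var_degree_le_def)

lemma var_degree_le_mult:
  assumes "var_degree_le e p" "var_degree_le e' q"
  shows "var_degree_le (e + e') (p * q)"
  unfolding var_degree_le_def
proof (intro ballI allI)
  fix t i assume "t \<in> Poly_Mapping.keys (p * q)"
  then obtain a b where "t = a + b" "a \<in> Poly_Mapping.keys p" "b \<in> Poly_Mapping.keys q"
    using keys_mult[of p q] by blast
  then show "Poly_Mapping.lookup t i \<le> e + e'"
    using assms by (simp add: lookup_add var_degree_le_def add_mono)
qed

lemma var_degree_le_power: "var_degree_le e p \<Longrightarrow> var_degree_le (k * e) (p ^ k)"
  by (induction k) (auto intro: var_degree_le_1 var_degree_le_mult)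

definition bounded_monomials :: "nat \<Rightarrow> nat \<Rightarrow> (nat \<Rightarrow>\<^sub>0 nat) set" where
  "bounded_monomials d e = {t. Poly_Mapping.keys t \<subseteq> {..<d} \<and> (\<forall>i. Poly_Mapping.lookup t i \<le> e)}"

lemma bounded_monomials:
  "finite (bounded_monomials d e)" "card (bounded_monomials d e) \<le> Suc e ^ d"
proof -
  let ?f = "\<lambda>t. map (Poly_Mapping.lookup t) [0..<d]"
  have inj: "inj_on ?f (bounded_monomials d e)"
  proof (rule inj_onI, rule poly_mapping_eqI)
    fix s t i assume st: "s \<in> bounded_monomials d e" "t \<in> bounded_monomials d e" "?f s = ?f t"
    show "Poly_Mapping.lookup s i = Poly_Mapping.lookup t i"
    proof (cases "i < d")
      case True
      then show ?thesis using st(3) by (auto simp: map_eq_conv)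
    next
      case False
      then have "i \<notin> Poly_Mapping.keys s" "i \<notin> Poly_Mapping.keys t"
        using st(1,2) by (auto simp: bounded_monomials_def)
      then show ?thesis by (simp add: in_keys_iff)
    qed
  qed
  have sub: "?f ` bounded_monomials d e \<subseteq> bounded_lists (Suc e) d"
    by (auto simp: bounded_monomials_def bounded_lists_def less_Suc_eq_le)
  show "finite (bounded_monomials d e)"
    by (rule inj_on_finite[OF inj sub finite_bounded_lists])
  show "card (bounded_monomials d e) \<le> Suc e ^ d"
    using card_inj_on_le[OF inj sub finite_bounded_lists] by (simp add: card_bounded_lists)
qed

text \<open>A monomial in the quotients \<open>p / q\<close>, multiplied by the product of all
  \<open>q ^ s\<close>. The multiplier is the same for every exponent tuple, so linear relations are
  preserved, and the degree bound does not depend on the tuple either.\<close>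

fun homogenized :: "nat \<Rightarrow> (real mpoly \<times> real mpoly) list \<Rightarrow> nat list \<Rightarrow> real mpoly" where
  "homogenized s ((p, q) # ps) (b # bs) = p ^ b * q ^ (s - b) * homogenized s ps bs"
| "homogenized s ps bs = 1"

lemma homogenized_in_polys:
  "(\<And>p q. (p, q) \<in> set ps \<Longrightarrow> p \<in> polys UNIV d \<and> q \<in> polys UNIV d) \<Longrightarrow> homogenized s ps bs \<in> polys UNIV d"
  by (induction s ps bs rule: homogenized.induct) (auto intro!: polys_mult polys_power)

lemma homogenized_degree:
  assumes "\<And>p q. (p, q) \<in> set ps \<Longrightarrow> var_degree_le e p \<and> var_degree_le e q" "bs \<in> bounded_lists s (length ps)"
  shows "var_degree_le (length ps * (s * e)) (homogenized s ps bs)"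
  using assms
proof (induction s ps bs rule: homogenized.induct)
  case (1 s p q ps b bs)
  have b: "b \<le> s" "bs \<in> bounded_lists s (length ps)" using 1(3) by (auto simp: bounded_lists_def)
  have "var_degree_le (b * e + (s - b) * e + length ps * (s * e)) (p ^ b * q ^ (s - b) * homogenized s ps bs)"
    by (intro var_degree_le_mult var_degree_le_power 1(1)) (use 1(2) b in auto)
  moreover have "b * e + (s - b) * e = s * e" using b(1) by (metis add_mult_distrib le_add_diff_inverse)
  ultimately show ?case by simp
qed (auto simp: var_degree_le_1)

lemma eval_homogenized:
  assumes "\<And>p q. (p, q) \<in> set ps \<Longrightarrow> eval_mpoly q x \<noteq> 0" "bs \<in> bounded_lists s (length ps)"
  shows "eval_mpoly (homogenized s ps bs) x =
    (\<Prod>(p, q)\<leftarrow>ps. eval_mpoly q x ^ s) * power_list (map (\<lambda>(p, q). eval_mpoly p x / eval_mpoly q x) ps) bs"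
  using assms
proof (induction s ps bs rule: homogenized.induct)
  case (1 s p q ps b bs)
  have b: "b \<le> s" "bs \<in> bounded_lists s (length ps)" using 1(3) by (auto simp: bounded_lists_def)
  have q: "eval_mpoly q x \<noteq> 0" using 1(2) by auto
  have "eval_mpoly q x ^ (s - b) = eval_mpoly q x ^ s * (1 / eval_mpoly q x) ^ b"
    using b(1) q by (simp add: power_diff power_divide)
  moreover have "eval_mpoly (homogenized s ps bs) x =
    (\<Prod>(p, q)\<leftarrow>ps. eval_mpoly q x ^ s) * power_list (map (\<lambda>(p, q). eval_mpoly p x / eval_mpoly q x) ps) bs"
  proof (rule 1(1)[OF _ b(2)])
    fix p' q' assume "(p', q') \<in> set ps"
    then show "eval_mpoly q' x \<noteq> 0" using 1(2)[of p' q'] by simp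
  qed
  ultimately show ?case by (simp add: power_divide)
qed (auto simp: bounded_lists_def)

text \<open>A count of dimensions: after clearing denominators, the \<open>s ^ (d + 1)\<close>
  monomials in the \<open>d + 1\<close> functions lie in the span of at most
  \<open>(C * s) ^ d\<close> monomials in the \<open>d\<close> parameters. For large
  \<open>s\<close> they are linearly dependent.\<close>

lemma algebraic_dependence:
  assumes fs: "length fs = Suc d"
    and rat: "\<And>f. f \<in> set fs \<Longrightarrow> ratfun UNIV d T (\<lambda>t. eval_mpoly f (psi t))"
  obtains s u where "\<exists>bs\<in>bounded_lists s (Suc d). u bs \<noteq> 0"
    "\<forall>t\<in>T. eval_mpoly (nested_poly s fs u) (psi t) = 0"
proof -
  have "\<forall>f\<in>set fs. \<exists>p q. p \<in> polys UNIV d \<and> q \<in> polys UNIV d \<and>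
      (\<forall>t\<in>T. eval_mpoly q t \<noteq> 0 \<and> eval_mpoly f (psi t) = eval_mpoly p t / eval_mpoly q t)"
    using rat unfolding ratfun_def by blast
  then obtain A B where AB: "\<And>f. f \<in> set fs \<Longrightarrow> A f \<in> polys UNIV d \<and> B f \<in> polys UNIV d \<and>
      (\<forall>t\<in>T. eval_mpoly (B f) t \<noteq> 0 \<and> eval_mpoly f (psi t) = eval_mpoly (A f) t / eval_mpoly (B f) t)"
    by metis
  define ps where "ps = map (\<lambda>f. (A f, B f)) fs"
  have lps: "length ps = Suc d" by (simp add: ps_def fs)
  obtain dg where dg: "\<And>p. var_degree_le (dg p) p" using ex_var_degree_le by metis
  define e where "e = (\<Sum>f\<in>set fs. dg (A f) + dg (B f))"
  have e: "var_degree_le e p \<and> var_degree_le e q" if pq: "(p, q) \<in> set ps" for p q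
  proof -
    obtain f where f: "f \<in> set fs" "p = A f" "q = B f" using pq by (auto simp: ps_def)
    have "dg (A f) + dg (B f) \<le> e"
      unfolding e_def by (rule member_le_sum[OF f(1)]) auto
    then show ?thesis using dg[of p] dg[of q] f var_degree_le_mono by (metis add_leD1 add_leD2)
  qed
  \<comment> \<open>\<open>E = (d + 1) * s * e\<close> bounds the exponents that occur, so
    \<open>Suc E \<le> s * C\<close>; and \<open>s > C ^ d\<close> makes \<open>(s * C) ^ d\<close>
    smaller than \<open>s ^ (d + 1)\<close>.\<close>
  define C where "C = Suc (Suc d * e)"
  define s where "s = Suc (C ^ d)"
  define E where "E = Suc d * (s * e)"
  define L where "L = bounded_lists s (Suc d)"
  let ?Mon = "bounded_monomials d E"
  have "Suc E \<le> s * C" unfolding E_def C_def s_def by (simp add: algebra_simps)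
  then have "Suc E ^ d \<le> (s * C) ^ d" by (rule power_mono) simp
  also have "\<dots> = s ^ d * C ^ d" by (simp add: power_mult_distrib)
  also have "\<dots> < s ^ d * s" unfolding s_def by (intro mult_strict_left_mono) auto
  also have "\<dots> = card L" unfolding L_def card_bounded_lists by simp
  finally have card: "card ?Mon < card L" using bounded_monomials(2)[of d E] by linarith
  define h where "h bs = homogenized s ps bs" for bs
  have fL: "finite L" unfolding L_def by (rule finite_bounded_lists)
  from ex_nontrivial_solution[OF bounded_monomials(1) fL card, of "\<lambda>bs. Poly_Mapping.lookup (h bs)"]
  obtain u where u: "\<exists>bs\<in>L. u bs \<noteq> 0"
    "\<forall>t\<in>?Mon. (\<Sum>bs\<in>L. u bs * Poly_Mapping.lookup (h bs) t) = 0"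
    by (elim exE conjE)
  have hkeys: "Poly_Mapping.keys (h bs) \<subseteq> ?Mon" if bs: "bs \<in> L" for bs
  proof
    fix t assume t: "t \<in> Poly_Mapping.keys (h bs)"
    have "h bs \<in> polys UNIV d" unfolding h_def
      by (rule homogenized_in_polys) (use AB in \<open>auto simp: ps_def\<close>)
    moreover have "var_degree_le E (h bs)" unfolding h_def E_def
      using homogenized_degree[of ps e bs s] e bs by (simp add: lps L_def)
    ultimately show "t \<in> ?Mon" using t by (auto simp: bounded_monomials_def var_degree_le_def polys_def)
  qed
  have "eval_mpoly (nested_poly s fs u) (psi t) = 0" if t: "t \<in> T" for t
  proof -
    define D where "D = (\<Prod>(p, q)\<leftarrow>ps. eval_mpoly q t ^ s)"
    have nz: "eval_mpoly q t \<noteq> 0" if "(p, q) \<in> set ps" for p q using that AB t by (auto simp: ps_def)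
    have D: "D \<noteq> 0" unfolding D_def using nz by (auto simp: prod_list_zero_iff)
    have vals: "map (\<lambda>f. eval_mpoly f (psi t)) fs = map (\<lambda>(p, q). eval_mpoly p t / eval_mpoly q t) ps"
      unfolding ps_def using AB t by simp
    have "D * eval_mpoly (nested_poly s fs u) (psi t) =
      (\<Sum>bs\<in>L. u bs * (D * power_list (map (\<lambda>f. eval_mpoly f (psi t)) fs) bs))"
      by (simp add: eval_nested_poly fs L_def sum_distrib_left algebra_simps)
    also have "\<dots> = (\<Sum>bs\<in>L. u bs * eval_mpoly (h bs) t)"
      by (intro sum.cong refl) (simp add: h_def D_def vals eval_homogenized[OF nz] L_def lps)
    also have "\<dots> = (\<Sum>bs\<in>L. \<Sum>m\<in>?Mon. u bs * (Poly_Mapping.lookup (h bs) m * monomial_value m t))"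
      by (intro sum.cong refl) (simp add: eval_mpoly_superset[OF bounded_monomials(1) hkeys] sum_distrib_left)
    also have "\<dots> = (\<Sum>m\<in>?Mon. (\<Sum>bs\<in>L. u bs * Poly_Mapping.lookup (h bs) m) * monomial_value m t)"
      by (subst sum.swap) (simp add: sum_distrib_right mult.assoc)
    also have "\<dots> = 0" using u(2) by simp
    finally show ?thesis using D by simp
  qed
  then show ?thesis using that[OF u(1)[unfolded L_def]] by blast
qed

text \<open>The bound by transcendence degree. From a longer chain, take \<open>d + 1\<close>
  elements that separate consecutive primes: they satisfy no nontrivial relation modulo
  \<open>P 0\<close>, although their pullbacks to \<open>d\<close> parameters are algebraically
  dependent.\<close>

lemma prime_chain_length_le:
  assumes prime: "\<And>i. i \<le> k \<Longrightarrow> primeideal (P i) (poly_ring M)"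
    and strict: "\<And>i. i < k \<Longrightarrow> P i \<subset> P (Suc i)"
    and vanish: "\<And>f. f \<in> polys UNIV M \<Longrightarrow> (\<And>t. t \<in> T \<Longrightarrow> eval_mpoly f (psi t) = 0) \<Longrightarrow> f \<in> P 0"
    and rat: "\<And>i. i < M \<Longrightarrow> ratfun UNIV d T (\<lambda>t. psi t $ i)"
  shows "k \<le> d"
proof (rule ccontr)
  assume "\<not> k \<le> d"
  then have k: "Suc d \<le> k" by simp
  have "\<forall>i. \<exists>f. i < k \<longrightarrow> f \<in> P (Suc i) - P i" using strict by blast
  then obtain F where F: "\<And>i. i < k \<Longrightarrow> F i \<in> P (Suc i) - P i" by metis
  define fs where "fs = map F [0..<Suc d]"
  have Fp: "F i \<in> polys UNIV M" if "i < k" for i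
    using F[OF that] ideal_poly_ringD(1)[OF primeideal.axioms(1)[OF prime[of "Suc i"]]] that by auto
  have fs: "length fs = Suc d" "set fs \<subseteq> polys UNIV M" using Fp k by (auto simp: fs_def)
  have rat': "ratfun UNIV d T (\<lambda>t. eval_mpoly f (psi t))" if "f \<in> set fs" for f
    by (rule ratfun_eval[of _ UNIV M]) (use rat fs(2) that in auto)
  obtain s u where su: "\<exists>bs\<in>bounded_lists s (Suc d). u bs \<noteq> 0"
    "\<forall>t\<in>T. eval_mpoly (nested_poly s fs u) (psi t) = 0"
    by (rule algebraic_dependence[OF fs(1) rat'])
  have "nested_poly s fs u \<in> P 0"
    by (rule vanish[OF nested_poly_in_polys[OF fs(2)]]) (use su(2) in blast)
  moreover have "fs ! i = F i" if "i < Suc d" for i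
    using that nth_map_upt[of i "Suc d" 0 F] by (simp add: fs_def del: upt_Suc)
  ultimately have "u bs = 0" if "bs \<in> bounded_lists s (Suc d)" for bs
    using nested_poly_prime_chain[of fs P M s u bs] prime strict F k fs(1) that by (simp add: less_imp_le)
  then show False using su(1) by blast
qed

section \<open>Varieties with a dense rational chart\<close>

text \<open>The polynomials vanishing at \<open>b\<close> are combinations of the differences
  \<open>t_i - b_i\<close>; this lets the parameters of a chart generate the maximal ideal.\<close>

lemma polys_taylor:
  assumes "p \<in> polys UNIV d"
  shows "\<exists>G. (\<forall>i<d. G i \<in> polys UNIV d) \<and>
    p - mpoly_const (eval_mpoly p b) = (\<Sum>i<d. (mpoly_var i - mpoly_const (b $ i)) * G i)"
  using assms is_subring_UNIV
proof (induction rule: polys_induct)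
  case (const c)
  show ?case by (intro exI[of _ "\<lambda>_. 0"]) simp
next
  case (var j)
  have "(\<Sum>i<d. (mpoly_var i - mpoly_const (b $ i)) * (if i = j then 1 else 0)) =
    (\<Sum>i<d. if i = j then mpoly_var i - mpoly_const (b $ i) else 0)"
    by (intro sum.cong) auto
  also have "\<dots> = mpoly_var j - mpoly_const (b $ j)" using var by simp
  finally show ?case by (intro exI[of _ "\<lambda>i. if i = j then 1 else 0"]) simp
next
  case (add p q)
  then obtain G H where GH: "\<forall>i<d. G i \<in> polys UNIV d" "\<forall>i<d. H i \<in> polys UNIV d"
    and p: "p - mpoly_const (eval_mpoly p b) = (\<Sum>i<d. (mpoly_var i - mpoly_const (b $ i)) * G i)"
    and q: "q - mpoly_const (eval_mpoly q b) = (\<Sum>i<d. (mpoly_var i - mpoly_const (b $ i)) * H i)" by blast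
  have "p + q - mpoly_const (eval_mpoly (p + q) b) =
    (p - mpoly_const (eval_mpoly p b)) + (q - mpoly_const (eval_mpoly q b))"
    by (simp add: mpoly_const_simps algebra_simps)
  also have "\<dots> = (\<Sum>i<d. (mpoly_var i - mpoly_const (b $ i)) * (G i + H i))"
    by (simp only: p q distrib_left sum.distrib)
  finally show ?case using GH by (intro exI[of _ "\<lambda>i. G i + H i"] conjI) (simp_all add: polys_add)
next
  case (mult p q)
  then obtain G H where GH: "\<forall>i<d. G i \<in> polys UNIV d" "\<forall>i<d. H i \<in> polys UNIV d"
    and p: "p - mpoly_const (eval_mpoly p b) = (\<Sum>i<d. (mpoly_var i - mpoly_const (b $ i)) * G i)"
    and q: "q - mpoly_const (eval_mpoly q b) = (\<Sum>i<d. (mpoly_var i - mpoly_const (b $ i)) * H i)" by blast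
  have "p * q - mpoly_const (eval_mpoly (p * q) b) =
    p * (q - mpoly_const (eval_mpoly q b)) + mpoly_const (eval_mpoly q b) * (p - mpoly_const (eval_mpoly p b))"
    by (simp add: mpoly_const_simps algebra_simps)
  also have "\<dots> = (\<Sum>i<d. (mpoly_var i - mpoly_const (b $ i)) * (p * H i + mpoly_const (eval_mpoly q b) * G i))"
    by (simp only: p q distrib_left sum.distrib sum_distrib_left mult.left_commute)
  finally show ?case using GH mult(1)
    by (intro exI[of _ "\<lambda>i. p * H i + mpoly_const (eval_mpoly q b) * G i"])
      (auto intro!: polys_add polys_mult polys_const)
qed

lemma ratfun_common_denominator:
  fixes n :: nat
  assumes "\<And>i. i < n \<Longrightarrow> ratfun UNIV M S (F i)"
  shows "\<exists>q p. q \<in> polys UNIV M \<and> (\<forall>x\<in>S. eval_mpoly q x \<noteq> 0) \<and>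
    (\<forall>i<n. p i \<in> polys UNIV M \<and> (\<forall>x\<in>S. eval_mpoly q x * F i x = eval_mpoly (p i) x))"
proof -
  have "\<forall>i. \<exists>p q. i < n \<longrightarrow> p \<in> polys UNIV M \<and> q \<in> polys UNIV M \<and>
      (\<forall>x\<in>S. eval_mpoly q x \<noteq> 0 \<and> F i x = eval_mpoly p x / eval_mpoly q x)"
    using assms unfolding ratfun_def by blast
  then obtain P Q where PQ: "\<And>i. i < n \<Longrightarrow> P i \<in> polys UNIV M \<and> Q i \<in> polys UNIV M \<and>
      (\<forall>x\<in>S. eval_mpoly (Q i) x \<noteq> 0 \<and> F i x = eval_mpoly (P i) x / eval_mpoly (Q i) x)"
    by metis
  then have P: "P i \<in> polys UNIV M" and Q: "Q i \<in> polys UNIV M"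
    and Qnz: "x \<in> S \<Longrightarrow> eval_mpoly (Q i) x \<noteq> 0"
    and F: "x \<in> S \<Longrightarrow> F i x = eval_mpoly (P i) x / eval_mpoly (Q i) x" if "i < n" for i x
    using that by simp_all
  let ?q = "\<Prod>i<n. Q i" and ?p = "\<lambda>i. P i * (\<Prod>j\<in>{..<n} - {i}. Q j)"
  show ?thesis
  proof (intro exI[of _ ?q] exI[of _ ?p] conjI allI impI ballI)
    show "?q \<in> polys UNIV M" using Q by (intro polys_prod) auto
    show "eval_mpoly ?q x \<noteq> 0" if "x \<in> S" for x using Qnz that by simp
    show "?p i \<in> polys UNIV M" if "i < n" for i using P[OF that] Q by (intro polys_mult polys_prod) auto
    show "eval_mpoly ?q x * F i x = eval_mpoly (?p i) x" if "i < n" "x \<in> S" for i x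
      using F[OF that] Qnz[OF that] that by (simp add: prod.remove[of "{..<n}" i])
  qed
qed

text \<open>A rational parametrization by all of affine \<open>d\<close>-space, with rational
  inverse on its image and Zariski dense image. The image is not assumed to be open: regularity at
  its points follows from comparing ideals.\<close>

locale rational_chart =
  fixes M d :: nat and V :: "real vec set" and psi :: "real vec \<Rightarrow> real vec"
    and phi :: "real vec \<Rightarrow> nat \<Rightarrow> real"
  assumes V_carrier: "V \<subseteq> carrier_vec M"
    and psi_in: "t \<in> carrier_vec d \<Longrightarrow> psi t \<in> V"
    and psi_rat: "i < M \<Longrightarrow> ratfun UNIV d (carrier_vec d) (\<lambda>t. psi t $ i)"
    and phi_rat: "i < d \<Longrightarrow> ratfun UNIV M (psi ` carrier_vec d) (\<lambda>x. phi x i)"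
    and phi_psi: "t \<in> carrier_vec d \<Longrightarrow> i < d \<Longrightarrow> phi (psi t) i = t $ i"
    and dense: "f \<in> polys UNIV M \<Longrightarrow> (\<And>t. t \<in> carrier_vec d \<Longrightarrow> eval_mpoly f (psi t) = 0) \<Longrightarrow>
      x \<in> V \<Longrightarrow> eval_mpoly f x = 0"
begin

text \<open>The ideal of the image of the slice on which the first \<open>k\<close> parameters agree
  with those of \<open>b\<close>. For \<open>k = 0, ..., d\<close> these ideals form a chain of
  primes from the ideal of \<open>V\<close> up to the ideal of the point
  \<open>psi b\<close>.\<close>

definition slice_ideal :: "real vec \<Rightarrow> nat \<Rightarrow> real mpoly set" where
  "slice_ideal b k = {f \<in> polys UNIV M. \<forall>t\<in>carrier_vec d. (\<forall>i<k. t $ i = b $ i) \<longrightarrow> eval_mpoly f (psi t) = 0}"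

lemma vanishing_ideal_subset_slice: "vanishing_ideal UNIV M V \<subseteq> slice_ideal b k"
  using psi_in by (auto simp: vanishing_ideal_def slice_ideal_def)

lemma slice_ideal_0: "slice_ideal b 0 = vanishing_ideal UNIV M V"
  using dense psi_in by (auto simp: vanishing_ideal_def slice_ideal_def)

text \<open>Overwriting the first \<open>k\<close> parameters by those of \<open>b\<close> retracts
  affine space onto the slice. Polynomials on the slice thereby become rational functions on all of
  affine space, where a product vanishes only if a factor does.\<close>

lemma prime_slice_ideal:
  assumes b: "b \<in> carrier_vec d"
  shows "primeideal (slice_ideal b k) (poly_ring M)"
proof (rule primeidealI[OF _ cring_poly_ring])
  show "ideal (slice_ideal b k) (poly_ring M)"
    by (rule ideal_poly_ringI) (auto simp: slice_ideal_def)
  have "1 \<notin> slice_ideal b k" using b by (auto simp: slice_ideal_def)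
  then show "carrier (poly_ring M) \<noteq> slice_ideal b k"
      using polys_1[OF is_subring_UNIV, of M] unfolding poly_ring_simps by blast
  fix f g assume "f \<in> carrier (poly_ring M)" "g \<in> carrier (poly_ring M)"
    and fg: "f \<otimes>\<^bsub>poly_ring M\<^esub> g \<in> slice_ideal b k"
  then have f: "f \<in> polys UNIV M" and g: "g \<in> polys UNIV M" by simp_all
  define sl where "sl t = vec d (\<lambda>i. if i < k then b $ i else t $ i)" for t :: "real vec"
  have sl: "sl t \<in> carrier_vec d" "\<And>i. i < k \<Longrightarrow> i < d \<Longrightarrow> sl t $ i = b $ i" for t by (auto simp: sl_def)
  have slk: "\<forall>i<k. sl t $ i = b $ i" if "k \<le> d" for t using sl(2) that by auto
  have slp: "ratfun UNIV d (carrier_vec d) (\<lambda>t. sl t $ i)" if "i < d" for i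
    using that by (cases "i < k") (auto simp: sl_def intro!: ratfun_polyfun polyfun_const polyfun_index)
  have rat: "ratfun UNIV d (carrier_vec d) (\<lambda>t. eval_mpoly h (psi (sl t)))" if "h \<in> polys UNIV M" for h
    by (rule ratfun_eval[OF that is_subring_UNIV])
      (rule ratfun_compose[OF psi_rat is_subring_UNIV slp], use sl in auto)
  have sl_id: "sl t = t" if "t \<in> carrier_vec d" "\<forall>i<k. t $ i = b $ i" for t
    using that by (auto simp: sl_def)
  have "eval_mpoly f (psi (sl t)) * eval_mpoly g (psi (sl t)) = 0" for t
  proof (cases "k \<le> d")
    case True
    then show ?thesis using fg sl(1)[of t] slk[OF True, of t] by (auto simp: slice_ideal_def)
  next
    case False
    \<comment> \<open>For \<open>k\<close> above \<open>d\<close> the slice condition also mentions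
      entries beyond the dimension; these agree because the two vectors are equal.\<close>
    have "sl t = b" using False b by (auto simp: sl_def)
    then show ?thesis using fg b by (auto simp: slice_ideal_def)
  qed
  then have "(\<forall>t\<in>carrier_vec d. eval_mpoly f (psi (sl t)) = 0) \<or> (\<forall>t\<in>carrier_vec d. eval_mpoly g (psi (sl t)) = 0)"
    by (intro ratfun_mult_eq_0D[OF rat[OF f] rat[OF g], where h = 1]) auto
  then show "f \<in> slice_ideal b k \<or> g \<in> slice_ideal b k"
  proof
    assume *: "\<forall>t\<in>carrier_vec d. eval_mpoly f (psi (sl t)) = 0"
    have "eval_mpoly f (psi t) = 0" if "t \<in> carrier_vec d" "\<forall>i<k. t $ i = b $ i" for t
      using * that sl_id[OF that] by force
    then show ?thesis using f by (simp add: slice_ideal_def)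
  next
    assume *: "\<forall>t\<in>carrier_vec d. eval_mpoly g (psi (sl t)) = 0"
    have "eval_mpoly g (psi t) = 0" if "t \<in> carrier_vec d" "\<forall>i<k. t $ i = b $ i" for t
      using * that sl_id[OF that] by force
    then show ?thesis using g by (simp add: slice_ideal_def)
  qed
qed

lemma slice_ideal_strict:
  assumes b: "b \<in> carrier_vec d" and k: "k < d"
  shows "slice_ideal b k \<subset> slice_ideal b (Suc k)"
proof
  show "slice_ideal b k \<subseteq> slice_ideal b (Suc k)"
    unfolding slice_ideal_def by (auto simp: less_Suc_eq)
  obtain p q where pq: "p \<in> polys UNIV M" "q \<in> polys UNIV M"
    "\<And>t. t \<in> carrier_vec d \<Longrightarrow> eval_mpoly q (psi t) \<noteq> 0 \<and> phi (psi t) k = eval_mpoly p (psi t) / eval_mpoly q (psi t)"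
    using phi_rat[OF k] unfolding ratfun_def by auto
  \<comment> \<open>The numerator of \<open>phi x k - b $ k\<close>: on the image it vanishes
    exactly where parameter \<open>k\<close> equals that of \<open>b\<close>.\<close>
  define f where "f = p - mpoly_const (b $ k) * q"
  have f: "eval_mpoly f (psi t) = (t $ k - b $ k) * eval_mpoly q (psi t)" if "t \<in> carrier_vec d" for t
    using pq(3)[OF that] phi_psi[OF that k] by (simp add: f_def field_simps)
  have fp: "f \<in> polys UNIV M" unfolding f_def by (intro polys_diff polys_mult polys_const pq) auto
  define t where "t = vec d (\<lambda>i. if i = k then b $ k + 1 else b $ i)"
  have t: "t \<in> carrier_vec d" "t $ k = b $ k + 1" "\<forall>i<k. t $ i = b $ i" using k by (auto simp: t_def)
  have "eval_mpoly f (psi t) \<noteq> 0" using f[OF t(1)] pq(3)[OF t(1)] t(2) by simp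
  then have "f \<notin> slice_ideal b k" using t by (auto simp: slice_ideal_def)
  moreover have "f \<in> slice_ideal b (Suc k)" using f fp by (auto simp: slice_ideal_def)
  ultimately show "slice_ideal b k \<noteq> slice_ideal b (Suc k)" by blast
qed

lemma prime_chain_le:
  assumes "\<And>i. i \<le> k \<Longrightarrow> primeideal (P i) (poly_ring M)" "\<And>i. i < k \<Longrightarrow> P i \<subset> P (Suc i)"
    and "vanishing_ideal UNIV M V \<subseteq> P 0"
  shows "k \<le> d"
  using assms(1,2)
proof (rule prime_chain_length_le[where T = "carrier_vec d" and psi = psi])
  fix f assume "f \<in> polys UNIV M" "\<And>t. t \<in> carrier_vec d \<Longrightarrow> eval_mpoly f (psi t) = 0"
  then show "f \<in> P 0" using assms(3) dense by (auto simp: vanishing_ideal_def)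
qed (use psi_rat in auto)

text \<open>Stated for a general target so that it covers both the coordinate ring and the local
  ring at \<open>psi b\<close>. The denominators need only be nonzero at \<open>psi b\<close>, since
  this point lies on all the slices.\<close>

lemma krull_dim_fraction_hom:
  assumes "fraction_hom (poly_ring M) S h G" "b \<in> carrier_vec d"
    and ker: "{f \<in> polys UNIV M. h f = \<zero>\<^bsub>S\<^esub>} = vanishing_ideal UNIV M V"
    and G: "\<And>g. g \<in> G \<Longrightarrow> eval_mpoly g (psi b) \<noteq> 0"
  shows "krull_dim S = ereal (real d)"
proof (rule antisym)
  interpret F: fraction_hom "poly_ring M" S h G by fact
  show "krull_dim S \<le> ereal (real d)"
  proof (rule F.krull_dim_le)
    fix k and P :: "nat \<Rightarrow> real mpoly set"
    assume "\<And>i. i \<le> k \<Longrightarrow> primeideal (P i) (poly_ring M)" "\<And>i. i < k \<Longrightarrow> P i \<subset> P (Suc i)"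
      and "\<And>i. i \<le> k \<Longrightarrow> {f \<in> carrier (poly_ring M). h f = \<zero>\<^bsub>S\<^esub>} \<subseteq> P i"
    then show "k \<le> d" using prime_chain_le[of k P] ker by simp
  qed
  show "ereal (real d) \<le> krull_dim S"
  proof (rule F.krull_dim_ge[where P = "slice_ideal b"])
    show "{f \<in> carrier (poly_ring M). h f = \<zero>\<^bsub>S\<^esub>} \<subseteq> slice_ideal b i" for i
      using ker vanishing_ideal_subset_slice by simp
    show "slice_ideal b i \<inter> G = {}" for i using G assms(2) by (auto simp: slice_ideal_def)
  qed (use prime_slice_ideal slice_ideal_strict assms(2) in auto)
qed

lemma alg_dim_eq: "alg_dim M V = ereal (real d)"
  unfolding alg_dim_def
  by (rule krull_dim_fraction_hom[OF fraction_hom_quotient[OF cring_poly_ring ideal_vanishing_ideal] zero_carrier_vec])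
    (use quotient_kernel[OF cring_poly_ring ideal_vanishing_ideal] in auto)

text \<open>The pullback of \<open>f\<close> is a quotient whose numerator vanishes at
  \<open>b\<close>, hence is a combination of the \<open>t_i - b_i\<close>. Substituting
  \<open>t = phi x\<close> and clearing denominators gives
  \<open>u * f = (\<Sum>i<d. s i * g i)\<close> on the image, and on \<open>V\<close> by density,
  where \<open>s i\<close> is the numerator of \<open>phi x i - b $ i\<close>. The differences
  \<open>s i - s j\<close> are kept off the ideal because regularity counts generators.\<close>

lemma maximal_ideal_generators:
  assumes b: "b \<in> carrier_vec d"
  shows "\<exists>s. (\<forall>i<d. s i \<in> polys UNIV M \<and> eval_mpoly (s i) (psi b) = 0) \<and>
    (\<forall>i<d. \<forall>j<d. i \<noteq> j \<longrightarrow> s i - s j \<notin> vanishing_ideal UNIV M V) \<and>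
    (\<forall>f\<in>polys UNIV M. eval_mpoly f (psi b) = 0 \<longrightarrow>
      (\<exists>u g. u \<in> nonzero_at M (psi b) \<and> (\<forall>i<d. g i \<in> polys UNIV M) \<and>
        u * f - (\<Sum>i<d. s i * g i) \<in> vanishing_ideal UNIV M V))"
proof -
  let ?Im = "psi ` carrier_vec d"
  have "\<forall>i. \<exists>p q. i < d \<longrightarrow> p \<in> polys UNIV M \<and> q \<in> polys UNIV M \<and>
      (\<forall>x\<in>?Im. eval_mpoly q x \<noteq> 0 \<and> phi x i = eval_mpoly p x / eval_mpoly q x)"
    using phi_rat unfolding ratfun_def by blast
  then obtain P Q where PQ: "\<And>i. i < d \<Longrightarrow> P i \<in> polys UNIV M \<and> Q i \<in> polys UNIV M \<and>
      (\<forall>x\<in>?Im. eval_mpoly (Q i) x \<noteq> 0 \<and> phi x i = eval_mpoly (P i) x / eval_mpoly (Q i) x)"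
    by metis
  define s where "s i = P i - mpoly_const (b $ i) * Q i" for i
  have sp: "s i \<in> polys UNIV M" if "i < d" for i
    unfolding s_def by (intro polys_diff polys_mult polys_const) (use PQ that in auto)
  have Q: "eval_mpoly (Q i) (psi t) \<noteq> 0" if "i < d" "t \<in> carrier_vec d" for i t
    using PQ that by auto
  have s: "eval_mpoly (s i) (psi t) = (t $ i - b $ i) * eval_mpoly (Q i) (psi t)"
    if "i < d" "t \<in> carrier_vec d" for i t
  proof -
    have "t $ i = eval_mpoly (P i) (psi t) / eval_mpoly (Q i) (psi t)"
      using PQ[OF that(1)] phi_psi[OF that(2,1)] that(2) by auto
    then show ?thesis using Q[OF that] by (simp add: s_def field_simps)
  qed
  show ?thesis
  proof (intro exI[of _ s] conjI allI impI ballI)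
    show "s i \<in> polys UNIV M" if "i < d" for i using sp[OF that] .
    show "eval_mpoly (s i) (psi b) = 0" if "i < d" for i using s[OF that b] by simp
    show "s i - s j \<notin> vanishing_ideal UNIV M V" if "i < d" "j < d" "i \<noteq> j" for i j
    proof -
      define t where "t = vec d (\<lambda>l. if l = i then b $ i + 1 else b $ l)"
      have t: "t \<in> carrier_vec d" "t $ i = b $ i + 1" "t $ j = b $ j" using that by (auto simp: t_def)
      have "eval_mpoly (s i - s j) (psi t) \<noteq> 0" using s[OF _ t(1)] that t Q[OF that(1) t(1)] by simp
      then show ?thesis using psi_in[OF t(1)] by (auto simp: vanishing_ideal_def)
    qed
    fix f assume f: "f \<in> polys UNIV M" "eval_mpoly f (psi b) = 0"
    have "ratfun UNIV d (carrier_vec d) (\<lambda>t. eval_mpoly f (psi t))"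
      by (rule ratfun_eval[OF f(1) is_subring_UNIV psi_rat])
    then obtain A B where AB: "A \<in> polys UNIV d" "B \<in> polys UNIV d"
      "\<And>t. t \<in> carrier_vec d \<Longrightarrow> eval_mpoly B t \<noteq> 0 \<and> eval_mpoly f (psi t) = eval_mpoly A t / eval_mpoly B t"
      unfolding ratfun_def by blast
    have "eval_mpoly A b = 0" using AB(3)[OF b] f(2) by auto
    then obtain G where G: "\<forall>i<d. G i \<in> polys UNIV d"
      "A = (\<Sum>i<d. (mpoly_var i - mpoly_const (b $ i)) * G i)"
      using polys_taylor[OF AB(1), of b] by (auto simp: mpoly_const_simps)
    let ?phi = "\<lambda>x. vec d (phi x)"
    have phirat: "ratfun UNIV M ?Im (\<lambda>x. ?phi x $ i)" if "i < d" for i using phi_rat that by simp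
    have phi_id: "?phi (psi t) = t" if "t \<in> carrier_vec d" for t using phi_psi[OF that] that by auto
    \<comment> \<open>Index \<open>d\<close> holds the denominator \<open>B\<close>, so that one
      common denominator serves it and all coefficients. The division by \<open>Q i\<close>
      compensates the factor by which \<open>s i\<close> differs from
      \<open>t_i - b_i\<close>.\<close>
    define F where "F i = (\<lambda>x. if i < d then eval_mpoly (G i) (?phi x) / eval_mpoly (Q i) x else eval_mpoly B (?phi x))" for i
    have Frat: "ratfun UNIV M ?Im (F i)" if "i < Suc d" for i
    proof (cases "i < d")
      case True
      have "ratfun UNIV M ?Im (\<lambda>x. eval_mpoly (G i) (?phi x) / eval_mpoly (Q i) x)"
        by (intro ratfun_divide ratfun_eval[OF _ is_subring_UNIV phirat] ratfun_polyfun polyfun_eval)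
          (use PQ True G in auto)
      then show ?thesis using True by (simp add: F_def)
    next
      case False
      have "ratfun UNIV M ?Im (\<lambda>x. eval_mpoly B (?phi x))"
        by (rule ratfun_eval[OF AB(2) is_subring_UNIV phirat])
      then show ?thesis using False by (simp add: F_def)
    qed
    have "\<exists>q p. q \<in> polys UNIV M \<and> (\<forall>x\<in>?Im. eval_mpoly q x \<noteq> 0) \<and>
      (\<forall>i<Suc d. p i \<in> polys UNIV M \<and> (\<forall>x\<in>?Im. eval_mpoly q x * F i x = eval_mpoly (p i) x))"
      by (rule ratfun_common_denominator[OF Frat])
    then obtain q p where "q \<in> polys UNIV M" and q: "\<forall>x\<in>?Im. eval_mpoly q x \<noteq> 0"
      and p: "\<forall>i<Suc d. p i \<in> polys UNIV M \<and> (\<forall>x\<in>?Im. eval_mpoly q x * F i x = eval_mpoly (p i) x)"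
      by (elim exE conjE)
    have qp: "x \<in> ?Im \<Longrightarrow> eval_mpoly q x \<noteq> 0" "i < Suc d \<Longrightarrow> p i \<in> polys UNIV M"
      "i < Suc d \<Longrightarrow> x \<in> ?Im \<Longrightarrow> eval_mpoly q x * F i x = eval_mpoly (p i) x" for i x
      using q p by blast+
    have "eval_mpoly (p d) (psi b) = eval_mpoly q (psi b) * eval_mpoly B b"
      using qp(3)[of d "psi b"] b phi_id[OF b] by (simp add: F_def)
    then have u: "p d \<in> nonzero_at M (psi b)"
      using qp(1)[of "psi b"] qp(2)[of d] AB(3)[OF b] b by (auto simp: nonzero_at_def)
    have "eval_mpoly (p d * f - (\<Sum>i<d. s i * p i)) (psi t) = 0" if t: "t \<in> carrier_vec d" for t
    proof -
      let ?x = "psi t"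
      have x: "?x \<in> ?Im" using t by blast
      have "eval_mpoly (p d) ?x * eval_mpoly f ?x = eval_mpoly q ?x * (eval_mpoly B t * eval_mpoly f ?x)"
        using qp(3)[OF _ x, of d] phi_id[OF t] by (simp add: F_def)
      also have "eval_mpoly B t * eval_mpoly f ?x = (\<Sum>i<d. (t $ i - b $ i) * eval_mpoly (G i) t)"
        using AB(3)[OF t] by (simp add: G(2))
      also have "eval_mpoly q ?x * \<dots> = (\<Sum>i<d. eval_mpoly (s i) ?x * eval_mpoly (p i) ?x)"
        unfolding sum_distrib_left
      proof (intro sum.cong refl)
        fix i assume "i \<in> {..<d}"
        then have i: "i < d" "i < Suc d" by auto
        show "eval_mpoly q ?x * ((t $ i - b $ i) * eval_mpoly (G i) t) = eval_mpoly (s i) ?x * eval_mpoly (p i) ?x"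
          using qp(3)[OF i(2) x] s[OF i(1) t] Q[OF i(1) t] i(1) phi_id[OF t]
          by (simp add: F_def flip: qp(3)[OF i(2) x])
      qed
      finally show ?thesis by simp
    qed
    then have "p d * f - (\<Sum>i<d. s i * p i) \<in> slice_ideal b 0"
      using f(1) sp qp(2) by (auto simp: slice_ideal_def intro!: polys_diff polys_mult polys_sum)
    then have "p d * f - (\<Sum>i<d. s i * p i) \<in> vanishing_ideal UNIV M V" unfolding slice_ideal_0 .
    moreover have "\<forall>i<d. p i \<in> polys UNIV M" using qp(2) by auto
    ultimately show "\<exists>u g. u \<in> nonzero_at M (psi b) \<and> (\<forall>i<d. g i \<in> polys UNIV M) \<and>
        u * f - (\<Sum>i<d. s i * g i) \<in> vanishing_ideal UNIV M V"
      using u by blast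
  qed
qed

text \<open>The ideal of \<open>V\<close> is prime and contains no denominator, so localizing does
  not enlarge the kernel. The ideal \<open>T\<close> generated by the images of the
  \<open>s i\<close> is the extension of the ideal of the point; an ideal not contained in it
  contains the image of a denominator, hence a unit. Thus \<open>T\<close> is the only maximal ideal
  and has as many generators as the dimension.\<close>

lemma regular_point_chart:
  assumes b: "b \<in> carrier_vec d"
  shows "regular_point UNIV M V (psi b)"
proof -
  define a where "a = psi b"
  define S where "S = local_ring_at UNIV M V a"
  define h where "h = local_hom M V a"
  define G where "G = nonzero_at M a"
  interpret F: fraction_hom "poly_ring M" S h G
    unfolding S_def h_def G_def by (rule fraction_hom_local_ring_at)
  have aV: "a \<in> V" using psi_in[OF b] by (simp add: a_def)
  interpret I: primeideal "vanishing_ideal UNIV M V" "poly_ring M"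
    using prime_slice_ideal[OF b, of 0] unfolding slice_ideal_0 .
  have ker: "{f \<in> polys UNIV M. h f = \<zero>\<^bsub>S\<^esub>} = vanishing_ideal UNIV M V"
  proof (intro equalityI subsetI)
    fix f assume "f \<in> {f \<in> polys UNIV M. h f = \<zero>\<^bsub>S\<^esub>}"
    then obtain g where g: "f \<in> polys UNIV M" "g \<in> G" "f * g \<in> vanishing_ideal UNIV M V"
      using local_hom_eq_zero_iff[of f M V a] unfolding h_def S_def G_def by blast
    moreover have "g \<notin> vanishing_ideal UNIV M V"
      using g(2) aV by (auto simp: G_def nonzero_at_def vanishing_ideal_def)
    ultimately show "f \<in> vanishing_ideal UNIV M V"
      using I.I_prime[of f g] nonzero_atD(1) unfolding G_def by auto
  next
    fix f assume f: "f \<in> vanishing_ideal UNIV M V"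
    then have fp: "f \<in> polys UNIV M" by (simp add: vanishing_ideal_def)
    have "f * 1 \<in> vanishing_ideal UNIV M V" using f by simp
    then show "f \<in> {f \<in> polys UNIV M. h f = \<zero>\<^bsub>S\<^esub>}"
      using local_hom_eq_zero_iff[OF fp, of V a] fp nonzero_at_1 unfolding h_def S_def by blast
  qed
  have dimS: "krull_dim S = ereal (real d)"
    by (rule krull_dim_fraction_hom[OF F.fraction_hom_axioms b ker])
      (simp add: G_def nonzero_at_def a_def)
  obtain s where s01: "\<forall>i<d. s i \<in> polys UNIV M \<and> eval_mpoly (s i) a = 0"
    and s2: "\<forall>i<d. \<forall>j<d. i \<noteq> j \<longrightarrow> s i - s j \<notin> vanishing_ideal UNIV M V"
    and s3: "\<forall>f\<in>polys UNIV M. eval_mpoly f a = 0 \<longrightarrow>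
      (\<exists>u g. u \<in> G \<and> (\<forall>i<d. g i \<in> polys UNIV M) \<and>
        u * f - (\<Sum>i<d. s i * g i) \<in> vanishing_ideal UNIV M V)"
    using maximal_ideal_generators[OF b] unfolding a_def G_def by (elim exE conjE)
  have s: "i < d \<Longrightarrow> s i \<in> polys UNIV M" "i < d \<Longrightarrow> eval_mpoly (s i) a = 0" for i
    using s01 by simp_all
  define X where "X = (\<lambda>i. h (s i)) ` {..<d}"
  have X: "X \<subseteq> carrier S" using s(1) F.hom_closed by (auto simp: X_def)
  define T where "T = Idl\<^bsub>S\<^esub> X"
  have T: "ideal T S" unfolding T_def by (rule F.S.genideal_ideal[OF X])
  have XT: "X \<subseteq> T" unfolding T_def by (rule F.S.genideal_self[OF X])
  define Pa where "Pa = {f \<in> polys UNIV M. eval_mpoly f a = 0}"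
  have Pa: "primeideal Pa (poly_ring M)"
  proof (rule primeidealI[OF _ cring_poly_ring])
    show "ideal Pa (poly_ring M)" unfolding Pa_def using ideal_eval_zero[of M "{a}"] by simp
    have "1 \<notin> Pa" by (simp add: Pa_def)
    then show "carrier (poly_ring M) \<noteq> Pa"
      using polys_1[OF is_subring_UNIV, of M] unfolding poly_ring_simps by blast
  qed (auto simp: Pa_def)
  have kerPa: "{f \<in> carrier (poly_ring M). h f = \<zero>\<^bsub>S\<^esub>} \<subseteq> Pa"
    using ker aV by (auto simp: Pa_def vanishing_ideal_def)
  have PaG: "Pa \<inter> G = {}" by (auto simp: Pa_def G_def nonzero_at_def)
  let ?E = "F.extension Pa"
  have E: "primeideal ?E S" by (rule F.extension_prime[OF Pa kerPa PaG])
  have Eid: "ideal ?E S" by (rule primeideal.axioms(1)[OF E])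
  have heq: "h f = h g" if "f \<in> polys UNIV M" "g \<in> polys UNIV M" "f - g \<in> vanishing_ideal UNIV M V" for f g
  proof -
    have "h (f - g) = \<zero>\<^bsub>S\<^esub>" using that(3) ker by blast
    moreover have "h ((f - g) + g) = h (f - g) \<oplus>\<^bsub>S\<^esub> h g"
      using F.hom_add[of "f - g" g] that by (auto simp: polys_diff)
    ultimately show ?thesis using F.hom_closed[of g] that(2) by simp
  qed
  have ET: "y \<in> T" if y: "y \<in> ?E" for y
  proof -
    obtain f g where fg: "f \<in> Pa" "g \<in> G" "y \<otimes>\<^bsub>S\<^esub> h g = h f" "y \<in> carrier S"
      using y unfolding F.extension_def by blast
    have f: "f \<in> polys UNIV M" "eval_mpoly f a = 0" using fg(1) by (auto simp: Pa_def)
    obtain u c where u: "u \<in> G" "\<forall>i<d. c i \<in> polys UNIV M"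
      "u * f - (\<Sum>i<d. s i * c i) \<in> vanishing_ideal UNIV M V"
      using s3 f by blast
    have up: "u \<in> polys UNIV M" using u(1) nonzero_atD(1) unfolding G_def by blast
    have sumT: "h (\<Sum>i<n. s i * c i) \<in> T" if "n \<le> d" for n
      using that
    proof (induction n)
      case 0
      then show ?case using additive_subgroup.zero_closed[OF ideal.axioms(1)[OF T]] F.hom_zero by simp
    next
      case (Suc n)
      have p: "s n \<in> polys UNIV M" "c n \<in> polys UNIV M" "(\<Sum>i<n. s i * c i) \<in> polys UNIV M"
        using Suc(2) s(1) u(2) by (auto intro!: polys_sum polys_mult)
      have "h (s n) \<otimes>\<^bsub>S\<^esub> h (c n) \<in> T"
        using XT Suc(2) p by (intro ideal.I_r_closed[OF T]) (auto simp: X_def)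
      then have "h (s n * c n) \<in> T" using F.hom_mult[of "s n" "c n"] p by simp
      moreover have "h (\<Sum>i<n. s i * c i) \<in> T" using Suc by simp
      ultimately have "h (\<Sum>i<n. s i * c i) \<oplus>\<^bsub>S\<^esub> h (s n * c n) \<in> T"
        by (intro additive_subgroup.a_closed[OF ideal.axioms(1)[OF T]])
      then show ?case using F.hom_add[of "\<Sum>i<n. s i * c i" "s n * c n"] p by (simp add: polys_mult)
    qed
    have "h (u * f) = h (\<Sum>i<d. s i * c i)"
      by (rule heq[OF _ _ u(3)]) (use up f s(1) u(2) in \<open>auto intro!: polys_sum polys_mult\<close>)
    then have "h (f * u) \<in> T" using sumT[of d] by (simp add: mult.commute)
    then have "h f \<otimes>\<^bsub>S\<^esub> h u \<in> T" using F.hom_mult[of f u] f up by simp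
    then have "h f \<in> T" using F.fraction_in_ideal[OF T _ u(1)] F.hom_closed[of f] f by simp
    then show "y \<in> T" using F.fraction_in_ideal[OF T fg(4,2)] fg(3) by simp
  qed
  have "T \<subseteq> ?E" unfolding T_def
  proof (rule F.S.genideal_minimal[OF Eid])
    show "X \<subseteq> ?E"
    proof
      fix x assume "x \<in> X"
      then obtain i where i: "i < d" "x = h (s i)" by (auto simp: X_def)
      then have "s i \<in> Pa" using s(1,2) by (simp add: Pa_def)
      then show "x \<in> ?E" using F.extension_mem_iff[OF Pa kerPa PaG, of "s i"] i s(1) by simp
    qed
  qed
  with ET have TE: "T = ?E" by blast
  have unit: "J = carrier S" if J: "ideal J S" "\<not> J \<subseteq> T" for J
  proof -
    obtain y where y: "y \<in> J" "y \<notin> ?E" using J(2) unfolding TE by blast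
    have yS: "y \<in> carrier S" using ideal.Icarr[OF J(1) y(1)] .
    obtain f g where fg: "f \<in> polys UNIV M" "g \<in> G" "y \<otimes>\<^bsub>S\<^esub> h g = h f"
      using F.fraction[OF yS] by auto
    have "f \<notin> Pa" using y(2) F.extensionI[OF yS _ fg(2,3)] by blast
    then have fG: "f \<in> G" using fg(1) by (auto simp: Pa_def G_def nonzero_at_def)
    have gp: "g \<in> polys UNIV M" using fg(2) nonzero_atD(1) unfolding G_def by blast
    have "h f \<in> J" unfolding fg(3)[symmetric]
      using ideal.I_r_closed[OF J(1) y(1)] F.hom_closed[of g] gp by simp
    then have "\<one>\<^bsub>S\<^esub> \<otimes>\<^bsub>S\<^esub> h f \<in> J" using F.hom_closed[of f] fg(1) by simp
    then have "\<one>\<^bsub>S\<^esub> \<in> J" using F.fraction_in_ideal[OF J(1) F.S.one_closed fG] by blast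
    then show ?thesis using ideal.one_imp_carrier[OF J(1)] by blast
  qed
  have Tne: "carrier S \<noteq> T" unfolding TE using primeideal.I_notcarr[OF E] .
  have maxT: "maximalideal T S"
    by (rule maximalidealI[OF T Tne]) (use unit in blast)
  have "M' = T" if M': "maximalideal M' S" for M'
  proof -
    have "M' \<subseteq> T" using unit[OF maximalideal.axioms(1)[OF M']] maximalideal.I_notcarr[OF M'] by blast
    then show ?thesis using maximalideal.I_maximal[OF M' T] Tne ideal.Icarr[OF T] by blast
  qed
  then have loc: "local_ring S" unfolding local_ring_def using F.S.is_cring maxT by blast
  \<comment> \<open>The definition of regularity demands exactly \<open>d\<close> generators, so
    their images must be pairwise distinct.\<close>
  have inj: "inj_on (\<lambda>i. h (s i)) {..<d}"
  proof (rule inj_onI, rule ccontr)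
    fix i j assume ij: "i \<in> {..<d}" "j \<in> {..<d}" "h (s i) = h (s j)" "i \<noteq> j"
    have p: "s i \<in> polys UNIV M" "s j \<in> polys UNIV M" "s i - s j \<in> polys UNIV M"
      using ij s(1) by auto
    have "h (s i - s j) \<oplus>\<^bsub>S\<^esub> h (s j) = \<zero>\<^bsub>S\<^esub> \<oplus>\<^bsub>S\<^esub> h (s j)"
      using F.hom_add[of "s i - s j" "s j"] p ij(3) F.hom_closed[of "s j"] by simp
    then have "h (s i - s j) = \<zero>\<^bsub>S\<^esub>"
      using F.S.add.r_cancel[of "h (s j)" "h (s i - s j)" "\<zero>\<^bsub>S\<^esub>"] F.hom_closed p by simp
    then show False using ker s2 ij p by blast
  qed
  have "card X = d" unfolding X_def using card_image[OF inj] by simp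
  then have "regular_local_ring S"
    unfolding regular_local_ring_def using loc F.noetherian_target[OF noetherian_poly_ring] X maxT dimS
    by (intro conjI exI[of _ X]) (auto simp: X_def T_def)
  then show ?thesis
    unfolding regular_point_def using aV dimS alg_dim_eq unfolding S_def a_def by simp
qed

end

section \<open>Rational equations\<close>

lemma eval_mpoly_rational:
  assumes "p \<in> polys \<rat> M" "\<forall>i<M. x $ i \<in> \<rat>"
  shows "eval_mpoly p x \<in> \<rat>"
  using assms(1) is_subring_Rats by (induction rule: polys_induct) (use assms(2) in auto)

text \<open>
  A relation with real coefficients between the values of rational polynomials at rational points
  is a real combination of rational relations: eliminate one polynomial at a time.
\<close>

lemma vanishing_combination_in_ideal:
  assumes J: "ideal J (poly_ring M)"
    and A: "\<And>a i. a \<in> A \<Longrightarrow> i < M \<Longrightarrow> a $ i \<in> \<rat>"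
    and Z: "\<And>g. g \<in> polys \<rat> M \<Longrightarrow> (\<And>a. a \<in> A \<Longrightarrow> eval_mpoly g a = 0) \<Longrightarrow> g \<in> J"
    and "finite T" "\<And>t. t \<in> T \<Longrightarrow> g t \<in> polys \<rat> M"
    and "\<And>a. a \<in> A \<Longrightarrow> (\<Sum>t\<in>T. c t * eval_mpoly (g t) a) = 0"
  shows "(\<Sum>t\<in>T. mpoly_const (c t) * g t) \<in> J"
  using assms(4-)
proof (induction T arbitrary: g rule: finite_induct)
  case empty
  then show ?case using ideal_poly_ringD(2)[OF J] by simp
next
  case (insert t T)
  show ?case
  proof (cases "\<forall>a\<in>A. eval_mpoly (g t) a = 0")
    case True
    have gt: "g t \<in> J" using Z[of "g t"] insert.prems(1) True by blast
    have "mpoly_const (c t) * g t \<in> J" by (rule ideal_poly_ringD(4)[OF J gt]) auto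
    moreover have "(\<Sum>t\<in>T. mpoly_const (c t) * g t) \<in> J"
    proof (rule insert.IH)
      fix a assume a: "a \<in> A"
      then show "(\<Sum>t\<in>T. c t * eval_mpoly (g t) a) = 0"
        using insert.prems(2)[OF a] insert.hyps True by simp
    qed (use insert.prems(1) in auto)
    ultimately show ?thesis using insert.hyps ideal_poly_ringD(3)[OF J] by simp
  next
    case False
    then obtain a where a: "a \<in> A" "eval_mpoly (g t) a \<noteq> 0" by blast
    \<comment> \<open>Subtracting \<open>r s * g t\<close> makes \<open>g s\<close> vanish at the
      rational point \<open>a\<close> and keeps it rational. The relation at \<open>a\<close>
      expresses \<open>c t\<close> through the other coefficients, so the new sum equals the old
      one.\<close>
    define r where "r s = eval_mpoly (g s) a / eval_mpoly (g t) a" for s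
    have gT: "g s \<in> polys \<rat> M" if "s = t \<or> s \<in> T" for s using insert.prems(1) that by auto
    have r: "r s \<in> \<rat>" if "s \<in> T" for s
      unfolding r_def by (intro Rats_divide eval_mpoly_rational[of _ M] gT) (use A[OF a(1)] that in auto)
    have ct: "c t = - (\<Sum>s\<in>T. c s * r s)"
    proof -
      have "c t * eval_mpoly (g t) a + (\<Sum>s\<in>T. c s * eval_mpoly (g s) a) = 0"
        using insert.prems(2)[OF a(1)] insert.hyps by simp
      then have "c t = - (\<Sum>s\<in>T. c s * eval_mpoly (g s) a) / eval_mpoly (g t) a"
        using a(2) by (simp add: field_simps)
      then show ?thesis by (simp add: r_def sum_divide_distrib)
    qed
    let ?g = "\<lambda>s. g s - mpoly_const (r s) * g t"
    have "(\<Sum>s\<in>T. mpoly_const (c s) * ?g s) \<in> J"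
    proof (rule insert.IH)
      show "?g s \<in> polys \<rat> M" if "s \<in> T" for s
        by (intro polys_diff polys_mult polys_const gT r) (use that in auto)
      fix b assume b: "b \<in> A"
      have "0 = c t * eval_mpoly (g t) b + (\<Sum>s\<in>T. c s * eval_mpoly (g s) b)"
        using insert.prems(2)[OF b] insert.hyps by simp
      also have "\<dots> = (\<Sum>s\<in>T. c s * eval_mpoly (?g s) b)"
        by (simp add: ct sum_distrib_right sum_distrib_left sum_subtractf algebra_simps)
      finally show "(\<Sum>s\<in>T. c s * eval_mpoly (?g s) b) = 0" by simp
    qed
    also have "mpoly_const (c t) = - (\<Sum>s\<in>T. mpoly_const (c s) * mpoly_const (r s))"
    proof -
      have "mpoly_const (sum h T) = (\<Sum>s\<in>T. mpoly_const (h s))" for h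
        using insert.hyps(1) by (induction rule: finite_induct) (simp_all add: mpoly_const_simps)
      then show ?thesis unfolding ct by (simp add: mpoly_const_simps)
    qed
    then have "(\<Sum>s\<in>T. mpoly_const (c s) * ?g s) = (\<Sum>s\<in>insert t T. mpoly_const (c s) * g s)"
      using insert.hyps by (simp add: sum_distrib_right sum_distrib_left sum_subtractf algebra_simps)
    finally show ?thesis .
  qed
qed

text \<open>A real polynomial vanishing on \<open>V\<close> is a real combination of monomials,
  which are rational polynomials, and it vanishes at the rational points \<open>A\<close>. So it
  lies in the ideal of the rational polynomials that vanish on \<open>A\<close>, and by density
  these vanish on \<open>V\<close>.\<close>

lemma local_ring_at_Rats_eq:
  assumes "A \<subseteq> V" "\<And>a i. a \<in> A \<Longrightarrow> i < M \<Longrightarrow> a $ i \<in> \<rat>"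
    and dense: "\<And>f x. f \<in> polys UNIV M \<Longrightarrow> \<forall>a\<in>A. eval_mpoly f a = 0 \<Longrightarrow> x \<in> V \<Longrightarrow> eval_mpoly f x = 0"
  shows "local_ring_at \<rat> M V a = local_ring_at UNIV M V a"
proof -
  interpret F: fraction_hom "poly_ring M" "localization M a" "\<lambda>f. Fract f 1" "nonzero_at M a"
    by (rule fraction_hom_localization)
  let ?h = "\<lambda>f. Fract f 1 :: real mpoly fract"
  let ?Q = "vanishing_ideal \<rat> M V" and ?R = "vanishing_ideal UNIV M V"
  let ?I = "\<lambda>X. Idl\<^bsub>localization M a\<^esub> (?h ` X)"
  have sub: "?Q \<subseteq> ?R" using polys_UNIV by (auto simp: vanishing_ideal_def)
  have "?R \<subseteq> polys UNIV M" by (auto simp: vanishing_ideal_def)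
  then have R: "?h ` ?R \<subseteq> carrier (localization M a)" using F.hom_closed by auto
  then have Q: "?h ` ?Q \<subseteq> carrier (localization M a)" using sub by blast
  have IQ: "ideal (?I ?Q) (localization M a)" by (rule F.S.genideal_ideal[OF Q])
  have IR: "ideal (?I ?R) (localization M a)" by (rule F.S.genideal_ideal[OF R])
  have "?I ?Q \<subseteq> ?I ?R"
    by (rule F.S.genideal_minimal[OF IR]) (use sub F.S.genideal_self[OF R] in blast)
  moreover have "?I ?R \<subseteq> ?I ?Q"
  proof (rule F.S.genideal_minimal[OF IQ], rule image_subsetI)
    fix f assume f: "f \<in> ?R"
    let ?J = "{f \<in> carrier (poly_ring M). ?h f \<in> ?I ?Q}"
    have J: "ideal ?J (poly_ring M)" by (rule F.vimage_ideal[OF IQ])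
    have "(\<Sum>t\<in>Poly_Mapping.keys f. mpoly_const (Poly_Mapping.lookup f t) * Poly_Mapping.single t 1) \<in> ?J"
    proof (rule vanishing_combination_in_ideal[OF J, where A = A])
      fix g assume g: "g \<in> polys \<rat> M" "\<And>a. a \<in> A \<Longrightarrow> eval_mpoly g a = 0"
      have gU: "g \<in> polys UNIV M" using g(1) polys_UNIV by blast
      have "g \<in> ?Q" unfolding vanishing_ideal_def using g dense[OF gU] by blast
      then show "g \<in> ?J" using F.S.genideal_self[OF Q] gU by auto
    next
      show "Poly_Mapping.single t 1 \<in> polys \<rat> M" if "t \<in> Poly_Mapping.keys f" for t
        by (rule single_in_polys) (use f that in \<open>auto simp: vanishing_ideal_def polys_def\<close>)
    next
      fix a assume "a \<in> A"
      then have "eval_mpoly f a = 0" using f assms(1) by (auto simp: vanishing_ideal_def)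
      then show "(\<Sum>t\<in>Poly_Mapping.keys f. Poly_Mapping.lookup f t * eval_mpoly (Poly_Mapping.single t 1) a) = 0"
        by (simp add: eval_mpoly_single eval_mpoly_superset[OF finite_keys subset_refl, of f])
    qed (use assms(2) in auto)
    then have "f \<in> ?J" by (simp add: mpoly_const_def mult_single poly_mapping_sum_single)
    then show "?h f \<in> ?I ?Q" by simp
  qed
  ultimately have "?I ?Q = ?I ?R" by blast
  then show ?thesis unfolding local_ring_at_def by simp
qed

lemma Q_nonsingularI:
  assumes "algebraic_set \<rat> M V" "\<And>a. a \<in> V \<Longrightarrow> regular_point UNIV M V a"
    and "A \<subseteq> V" "\<And>a i. a \<in> A \<Longrightarrow> i < M \<Longrightarrow> a $ i \<in> \<rat>"
    and "\<And>f x. f \<in> polys UNIV M \<Longrightarrow> \<forall>a\<in>A. eval_mpoly f a = 0 \<Longrightarrow> x \<in> V \<Longrightarrow> eval_mpoly f x = 0"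
  shows "Q_nonsingular M V"
proof -
  have "local_ring_at \<rat> M V a = local_ring_at UNIV M V a" for a
    by (rule local_ring_at_Rats_eq[of A]) (fact assms)+
  then show ?thesis
    using assms(1,2) unfolding Q_nonsingular_def nonsingular_def regular_point_def by simp
qed

text \<open>Requiring a nonnegative equation turns a conjunction into a sum, so that finitely many
  conditions become a single rational equation; an overt equation will be built from it.\<close>

definition rational_condition :: "nat \<Rightarrow> (real vec \<Rightarrow> bool) \<Rightarrow> bool" where
  "rational_condition M P \<longleftrightarrow> (\<exists>g\<in>polys \<rat> M. \<forall>x\<in>carrier_vec M.
     0 \<le> eval_mpoly g x \<and> (P x \<longleftrightarrow> eval_mpoly g x = 0))"

lemma rational_condition_eq:
  assumes "polyfun \<rat> M f" "polyfun \<rat> M g"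
  shows "rational_condition M (\<lambda>x. f x = g x)"
proof -
  have "polyfun \<rat> M (\<lambda>x. (f x - g x)^2)"
    by (intro polyfun_power polyfun_diff assms is_subring_Rats)
  then obtain p where "p \<in> polys \<rat> M" "\<And>x. (f x - g x)^2 = eval_mpoly p x"
    by (auto simp: polyfun_def)
  then show ?thesis unfolding rational_condition_def
    by (intro bexI[of _ p]) (simp_all flip: \<open>\<And>x. (f x - g x)^2 = eval_mpoly p x\<close>)
qed

lemma rational_condition_True: "rational_condition M (\<lambda>x. True)"
  unfolding rational_condition_def by (intro bexI[of _ 0]) auto

lemma rational_condition_conj:
  assumes "rational_condition M P" "rational_condition M Q"
  shows "rational_condition M (\<lambda>x. P x \<and> Q x)"
proof -
  obtain p q where pq: "p \<in> polys \<rat> M" "q \<in> polys \<rat> M"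
    "\<forall>x\<in>carrier_vec M. 0 \<le> eval_mpoly p x \<and> (P x \<longleftrightarrow> eval_mpoly p x = 0)"
    "\<forall>x\<in>carrier_vec M. 0 \<le> eval_mpoly q x \<and> (Q x \<longleftrightarrow> eval_mpoly q x = 0)"
    using assms unfolding rational_condition_def by blast
  then show ?thesis unfolding rational_condition_def
    by (intro bexI[of _ "p + q"]) (auto simp: add_nonneg_eq_0_iff)
qed

lemma rational_condition_imp:
  "(c \<Longrightarrow> rational_condition M P) \<Longrightarrow> rational_condition M (\<lambda>x. c \<longrightarrow> P x)"
  by (cases c) (simp_all add: rational_condition_True)

lemma rational_condition_ball:
  assumes "finite A" "\<And>a. a \<in> A \<Longrightarrow> rational_condition M (P a)"
  shows "rational_condition M (\<lambda>x. \<forall>a\<in>A. P a x)"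
  using assms by (induction A rule: finite_induct) (auto intro: rational_condition_True rational_condition_conj)

lemma rational_condition_less:
  "(\<And>i. i < n \<Longrightarrow> rational_condition M (P i)) \<Longrightarrow> rational_condition M (\<lambda>x. \<forall>i<n::nat. P i x)"
  using rational_condition_ball[of "{..<n}" M P] by (simp add: Ball_def)

lemma algebraic_set_rational_condition:
  assumes "rational_condition M P"
  shows "algebraic_set \<rat> M {x \<in> carrier_vec M. P x}"
proof -
  obtain g where "g \<in> polys \<rat> M"
    "\<forall>x\<in>carrier_vec M. 0 \<le> eval_mpoly g x \<and> (P x \<longleftrightarrow> eval_mpoly g x = 0)"
    using assms unfolding rational_condition_def by blast
  then show ?thesis unfolding algebraic_set_def zero_set_def
    by (intro exI[of _ "{g}"]) auto
qed

section \<open>Overt equations of bounded sets\<close>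

definition degree_le :: "nat \<Rightarrow> real mpoly \<Rightarrow> bool" where
  "degree_le e p \<longleftrightarrow> (\<forall>t\<in>Poly_Mapping.keys p. monom_degree t \<le> e)"

lemma monom_degree_superset:
  "finite A \<Longrightarrow> Poly_Mapping.keys t \<subseteq> A \<Longrightarrow> monom_degree t = (\<Sum>i\<in>A. Poly_Mapping.lookup t i)"
  unfolding monom_degree_def by (rule sum.mono_neutral_left) (auto simp: in_keys_iff)

lemma monom_degree_add: "monom_degree (s + t) = monom_degree s + monom_degree t"
proof -
  let ?A = "Poly_Mapping.keys s \<union> Poly_Mapping.keys t"
  have "monom_degree (s + t) = (\<Sum>i\<in>?A. Poly_Mapping.lookup (s + t) i)"
    by (rule monom_degree_superset) (use keys_add[of s t] in auto)
  moreover have "monom_degree s = (\<Sum>i\<in>?A. Poly_Mapping.lookup s i)"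
    "monom_degree t = (\<Sum>i\<in>?A. Poly_Mapping.lookup t i)"
    by (rule monom_degree_superset; auto)+
  ultimately show ?thesis by (simp add: lookup_add sum.distrib)
qed

lemma degree_le_mono: "degree_le e p \<Longrightarrow> e \<le> e' \<Longrightarrow> degree_le e' p"
  unfolding degree_le_def using le_trans by blast

lemma degree_le_add: "degree_le e p \<Longrightarrow> degree_le e q \<Longrightarrow> degree_le e (p + q)"
  using keys_add[of p q] unfolding degree_le_def by blast

lemma degree_le_uminus: "degree_le e p \<Longrightarrow> degree_le e (- p)"
  by (auto simp: degree_le_def in_keys_iff)

lemma degree_le_diff: "degree_le e p \<Longrightarrow> degree_le e q \<Longrightarrow> degree_le e (p - q)"
  using degree_le_add[OF _ degree_le_uminus, of e p q] by simp

lemma degree_le_mult: "degree_le e p \<Longrightarrow> degree_le e' q \<Longrightarrow> degree_le (e + e') (p * q)"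
  using keys_mult[of p q] unfolding degree_le_def by (fastforce simp: monom_degree_add intro: add_mono)

lemma degree_le_const: "degree_le e (mpoly_const c)"
  by (simp add: degree_le_def mpoly_const_def monom_degree_def)

lemma degree_le_1: "degree_le e 1"
  by (simp add: degree_le_def monom_degree_def)

lemma degree_le_var: "degree_le 1 (mpoly_var i)"
  by (simp add: degree_le_def mpoly_var_def monom_degree_def)

lemma degree_le_power: "degree_le e p \<Longrightarrow> degree_le (k * e) (p ^ k)"
  by (induction k) (auto intro: degree_le_1 degree_le_mult)

lemma degree_le_0: "degree_le e 0"
  by (simp add: degree_le_def)

lemma degree_le_sum: "(\<And>a. a \<in> A \<Longrightarrow> degree_le e (f a)) \<Longrightarrow> degree_le e (sum f A)"
  by (induction A rule: infinite_finite_induct) (auto intro: degree_le_add degree_le_0)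

lemma degree_le_mpoly_degree: "degree_le (mpoly_degree p) p"
  unfolding degree_le_def mpoly_degree_def by simp

lemma mpoly_degree_le: "degree_le e p \<Longrightarrow> mpoly_degree p \<le> e"
  unfolding degree_le_def mpoly_degree_def by (subst Max_le_iff) auto

lemma monomial_value_smult:
  assumes "Poly_Mapping.keys t \<subseteq> {..<M}" "x \<in> carrier_vec M"
  shows "monomial_value t (s \<cdot>\<^sub>v x) = s ^ monom_degree t * monomial_value t x"
proof -
  have "monomial_value t (s \<cdot>\<^sub>v x) = (\<Prod>i\<in>Poly_Mapping.keys t. s ^ Poly_Mapping.lookup t i * (x $ i) ^ Poly_Mapping.lookup t i)"
    unfolding monomial_value_def using assms by (intro prod.cong) (auto simp: power_mult_distrib)
  then show ?thesis by (simp add: prod.distrib monomial_value_def monom_degree_def power_sum)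
qed

lemma eval_mpoly_smult:
  assumes "p \<in> polys UNIV M" "x \<in> carrier_vec M" "degree_le D p"
  shows "eval_mpoly p (s \<cdot>\<^sub>v x) = (\<Sum>j\<le>D. s ^ j * eval_mpoly (homogeneous_part j p) x)"
proof -
  have "eval_mpoly p (s \<cdot>\<^sub>v x) = (\<Sum>t\<in>Poly_Mapping.keys p. Poly_Mapping.lookup p t * (s ^ monom_degree t * monomial_value t x))"
    unfolding eval_mpoly_superset[OF finite_keys subset_refl]
    by (intro sum.cong refl) (use assms in \<open>auto simp: polys_def monomial_value_smult[of _ M]\<close>)
  also have "\<dots> = (\<Sum>j\<le>D. \<Sum>t\<in>{t \<in> Poly_Mapping.keys p. monom_degree t = j}.
      Poly_Mapping.lookup p t * (s ^ monom_degree t * monomial_value t x))"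
    by (rule sum.group[symmetric]) (use assms(3) in \<open>auto simp: degree_le_def\<close>)
  also have "\<dots> = (\<Sum>j\<le>D. s ^ j * eval_mpoly (homogeneous_part j p) x)"
    by (intro sum.cong refl) (auto simp: homogeneous_part_def eval_mpoly_single sum_distrib_left intro!: sum.cong)
  finally show ?thesis .
qed

text \<open>Since \<open>g \<ge> 0\<close>, along the ray through \<open>x \<noteq> 0\<close> the
  polynomial eventually exceeds a positive multiple of \<open>s ^ (4 * k)\<close>. Its degree is at
  most \<open>4 * k\<close>, so if the leading form vanished at \<open>x\<close>, only growth of
  order \<open>s ^ (4 * k - 1)\<close> would remain.\<close>

lemma overt_sum_growing:
  assumes g: "g \<in> polys UNIV M" "\<And>x. x \<in> carrier_vec M \<Longrightarrow> 0 \<le> eval_mpoly g x"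
    and k: "degree_le (4 * k) g" "0 < k"
  shows "overt M (g + ((\<Sum>i<M. mpoly_var i ^ 2) - mpoly_const c) ^ (2 * k))" (is "overt M ?p")
proof -
  let ?q = "(\<Sum>i<M. mpoly_var i ^ 2) - mpoly_const c"
  have q: "degree_le 2 ?q"
    using degree_le_power[OF degree_le_var, of 2] by (intro degree_le_diff degree_le_sum degree_le_const) simp
  have p: "degree_le (4 * k) ?p"
    using degree_le_power[OF q, of "2 * k"] k by (intro degree_le_add) (simp_all add: mult.commute)
  define D where "D = mpoly_degree ?p"
  have D: "D \<le> 4 * k" unfolding D_def by (rule mpoly_degree_le[OF p])
  have pp: "?p \<in> polys UNIV M"
    by (intro polys_add polys_power polys_diff polys_sum polys_var polys_const g) auto
  have "x = 0\<^sub>v M" if x: "x \<in> carrier_vec M" and top: "eval_mpoly (homogeneous_part D ?p) x = 0" for x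
  proof (rule ccontr)
    assume "x \<noteq> 0\<^sub>v M"
    then obtain i where i: "i < M" "x $ i \<noteq> 0" using x by (metis carrier_vecD eq_vecI index_zero_vec)
    define n where "n = (\<Sum>i<M. (x $ i)^2)"
    have "0 < (x $ i)^2" using i(2) by simp
    also have "\<dots> \<le> n" unfolding n_def by (rule member_le_sum) (use i in auto)
    finally have n: "0 < n" .
    define B where "B = (\<Sum>j<D. \<bar>eval_mpoly (homogeneous_part j ?p) x\<bar>)"
    have B: "0 \<le> B" unfolding B_def by (rule sum_nonneg) simp
    define w where "w = (n / 2) ^ (2 * k)"
    have w: "0 < w" using n by (simp add: w_def)
    \<comment> \<open>The second summand ensures \<open>s^2 * n - c \<ge> s^2 * n / 2\<close>, hence
      the lower bound \<open>s ^ (4 * k) * w\<close>; the third makes the bound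
      \<open>s ^ (4 * k - 1) * B\<close> for the remaining terms smaller than that.\<close>
    define s where "s = 1 + 2 * \<bar>c\<bar> / n + B / w"
    have "0 \<le> 2 * \<bar>c\<bar> / n" "0 \<le> B / w" using n w B by simp_all
    then have s: "1 \<le> s" "2 * \<bar>c\<bar> / n \<le> s" "B / w < s" unfolding s_def by linarith+
    have "s * 1 \<le> s * s" using s(1) by (intro mult_left_mono) auto
    then have "2 * \<bar>c\<bar> / n \<le> s^2" using s(2) by (simp add: power2_eq_square)
    then have "2 * \<bar>c\<bar> \<le> s^2 * n" using n by (simp add: field_simps)
    then have half: "s^2 * (n / 2) \<le> s^2 * n - c" "0 \<le> s^2 * (n / 2)"
      using abs_ge_self[of c] n unfolding times_divide_eq_right by (linarith, simp)
    have ev: "eval_mpoly ?p (s \<cdot>\<^sub>v x) = eval_mpoly g (s \<cdot>\<^sub>v x) + (s^2 * n - c) ^ (2 * k)"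
      using x by (simp add: n_def sum_distrib_left power_mult_distrib)
    have "s ^ (4 * k) = (s^2) ^ (2 * k)" unfolding power_mult[symmetric] by simp
    then have "s ^ (4 * k) * w = (s^2 * (n / 2)) ^ (2 * k)"
      by (simp only: w_def power_mult_distrib)
    also have "\<dots> \<le> (s^2 * n - c) ^ (2 * k)" by (rule power_mono[OF half])
    also have "\<dots> \<le> eval_mpoly ?p (s \<cdot>\<^sub>v x)" using ev g(2)[of "s \<cdot>\<^sub>v x"] x by simp
    also have "\<dots> = (\<Sum>j\<le>D. s ^ j * eval_mpoly (homogeneous_part j ?p) x)"
      unfolding D_def by (rule eval_mpoly_smult[OF pp x degree_le_mpoly_degree])
    also have "\<dots> = (\<Sum>j<D. s ^ j * eval_mpoly (homogeneous_part j ?p) x)"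
      by (simp only: lessThan_Suc_atMost[symmetric] sum.lessThan_Suc top mult_zero_right add_0_right)
    also have "\<dots> \<le> (\<Sum>j<D. s ^ (4 * k - 1) * \<bar>eval_mpoly (homogeneous_part j ?p) x\<bar>)"
    proof (rule sum_mono)
      fix j assume "j \<in> {..<D}"
      then have "s ^ j \<le> s ^ (4 * k - 1)" using D s(1) by (intro power_increasing) auto
      then show "s ^ j * eval_mpoly (homogeneous_part j ?p) x \<le> s ^ (4 * k - 1) * \<bar>eval_mpoly (homogeneous_part j ?p) x\<bar>"
        using s(1) by (intro order_trans[OF mult_left_mono[OF abs_ge_self] mult_right_mono]) auto
    qed
    also have "\<dots> = s ^ (4 * k - 1) * B" by (simp add: B_def sum_distrib_left)
    also have "\<dots> < s ^ (4 * k - 1) * (s * w)"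
      using s w by (intro mult_strict_left_mono) (auto simp: field_simps)
    also have "\<dots> = s ^ (4 * k) * w"
      using k(2) power_Suc2[of s "4 * k - 1"] by simp
    finally show False by simp
  qed
  then show ?thesis unfolding overt_def Let_def zero_set_def D_def[symmetric] by auto
qed

text \<open>The added even power vanishes on the set because the norm is constant there; as both
  summands are nonnegative, the zero set does not change.\<close>

lemma projectively_Q_closedI:
  assumes P: "rational_condition M P" and "c \<in> \<rat>"
    and norm: "\<And>x. x \<in> carrier_vec M \<Longrightarrow> P x \<Longrightarrow> (\<Sum>i<M. (x $ i)^2) = c"
  shows "projectively_Q_closed M {x \<in> carrier_vec M. P x}"
proof -
  obtain g where g: "g \<in> polys \<rat> M"
    "\<And>x. x \<in> carrier_vec M \<Longrightarrow> 0 \<le> eval_mpoly g x" "\<And>x. x \<in> carrier_vec M \<Longrightarrow> P x \<longleftrightarrow> eval_mpoly g x = 0"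
    using P unfolding rational_condition_def by blast
  \<comment> \<open>Large enough for \<open>4 * k\<close> to bound the degree of \<open>g\<close>;
    the \<open>Suc\<close> keeps the exponent positive, so that the added power really vanishes on
    the set.\<close>
  define k where "k = Suc (mpoly_degree g)"
  let ?q = "(\<Sum>i<M. mpoly_var i ^ 2) - mpoly_const c"
  let ?p = "g + ?q ^ (2 * k)"
  have "?p \<in> polys \<rat> M"
    by (intro polys_add polys_power polys_diff polys_sum polys_var polys_const g assms(2)) auto
  moreover have "overt M ?p"
    by (rule overt_sum_growing)
      (use g subsetD[OF polys_UNIV g(1)] in \<open>auto simp: k_def intro: degree_le_mono[OF degree_le_mpoly_degree]\<close>)
  moreover have "{x \<in> carrier_vec M. P x} = zero_set M {?p}"
  proof -
    have "P x \<longleftrightarrow> eval_mpoly ?p x = 0" if x: "x \<in> carrier_vec M" for x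
    proof -
      have "0 \<le> eval_mpoly ?q x ^ (2 * k)" by (simp add: power_mult)
      moreover have "eval_mpoly ?q x ^ (2 * k) = 0" if "P x"
        using norm[OF x that] by (simp add: k_def)
      ultimately show ?thesis using g(2,3)[OF x] add_nonneg_eq_0_iff[OF g(2)[OF x], of "eval_mpoly ?q x ^ (2 * k)"]
        by (auto simp del: eval_mpoly_diff)
    qed
    then show ?thesis unfolding zero_set_def by auto
  qed
  ultimately show ?thesis unfolding projectively_Q_closed_def by blast
qed

lemma zariski_open_in_principal:
  "h \<in> polys UNIV M \<Longrightarrow> V \<subseteq> carrier_vec M \<Longrightarrow> zariski_open_in M V {x \<in> V. eval_mpoly h x \<noteq> 0}"
  unfolding zariski_open_in_def zero_set_def by (intro exI[of _ "{h}"]) auto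

lemma (in rational_chart) zariski_dense_in_chart:
  assumes "U \<subseteq> V" "psi ` carrier_vec d \<subseteq> U"
  shows "zariski_dense_in M V U"
  unfolding zariski_dense_in_def
proof (intro conjI assms(1) allI impI)
  fix W assume W: "zariski_open_in M V W \<and> W \<noteq> {}"
  then obtain F where F: "F \<subseteq> polys UNIV M" "W = V - zero_set M F" unfolding zariski_open_in_def by blast
  obtain x where x: "x \<in> V" "x \<notin> zero_set M F" using W F(2) by blast
  then obtain f where f: "f \<in> F" "eval_mpoly f x \<noteq> 0" using V_carrier unfolding zero_set_def by blast
  then obtain t where t: "t \<in> carrier_vec d" "eval_mpoly f (psi t) \<noteq> 0"
    using dense[of f x] F(1) x(1) by blast
  then have "psi t \<in> W \<inter> U" using psi_in[OF t(1)] f(1) F(2) assms(2) by (auto simp: zero_set_def)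
  then show "W \<inter> U \<noteq> {}" by blast
qed

lemma regular_function_ratfun: "ratfun UNIV M U f \<Longrightarrow> regular_function M U f"
  unfolding ratfun_def regular_function_def by blast

section \<open>Scaled orthogonal projections\<close>

text \<open>
  Vectors and matrices of size \<open>N\<close> are functions of which only the values at indices below \<open>N\<close>
  matter.  The predicate \<open>scaled_projection N Q c r\<close> says that \<open>Q / c\<close> is an orthogonal
  projection of rank \<open>r\<close>.
\<close>

definition ip :: "nat \<Rightarrow> (nat \<Rightarrow> real) \<Rightarrow> (nat \<Rightarrow> real) \<Rightarrow> real" where
  "ip N u v = (\<Sum>i<N. u i * v i)"

definition app :: "nat \<Rightarrow> (nat \<Rightarrow> nat \<Rightarrow> real) \<Rightarrow> (nat \<Rightarrow> real) \<Rightarrow> nat \<Rightarrow> real" where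
  "app N Q v i = (\<Sum>j<N. Q i j * v j)"

definition std :: "nat \<Rightarrow> nat \<Rightarrow> real" where
  "std i j = (if j = i then 1 else 0)"

definition symm :: "nat \<Rightarrow> (nat \<Rightarrow> nat \<Rightarrow> real) \<Rightarrow> bool" where
  "symm N Q \<longleftrightarrow> (\<forall>i<N. \<forall>j<N. Q i j = Q j i)"

text \<open>For a scaled projection with factor \<open>c\<close>, \<open>eig N Q c\<close> is
  membership in the range and \<open>eig N Q 0\<close> membership in the kernel; the zero vector is
  allowed in both.\<close>

definition eig :: "nat \<Rightarrow> (nat \<Rightarrow> nat \<Rightarrow> real) \<Rightarrow> real \<Rightarrow> (nat \<Rightarrow> real) \<Rightarrow> bool" where
  "eig N Q c v \<longleftrightarrow> (\<forall>i<N. app N Q v i = c * v i)"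

definition scaled_projection :: "nat \<Rightarrow> (nat \<Rightarrow> nat \<Rightarrow> real) \<Rightarrow> real \<Rightarrow> real \<Rightarrow> bool" where
  "scaled_projection N Q c r \<longleftrightarrow> 0 < c \<and> symm N Q \<and> (\<Sum>i<N. Q i i) = c * r \<and>
     (\<forall>i<N. \<forall>j<N. (\<Sum>l<N. Q i l * Q l j) = c * Q i j)"

lemma ip_commute: "ip N u v = ip N v u"
  by (simp add: ip_def mult.commute)

lemma ip_cong: "(\<And>i. i < N \<Longrightarrow> v i = v' i) \<Longrightarrow> ip N u v = ip N u v'"
  by (simp add: ip_def)

lemma ip_scale: "ip N u (\<lambda>i. c * v i) = c * ip N u v"
  by (simp add: ip_def sum_distrib_left mult.left_commute)

lemma ip_std: "i < N \<Longrightarrow> ip N (std i) v = v i"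
  by (simp add: ip_def std_def if_distrib[of "\<lambda>x. x * _"] cong: if_cong)

lemma ip_self_nonneg: "0 \<le> ip N v v"
  by (simp add: ip_def sum_nonneg)

lemma ip_self_eq_0: "ip N v v = 0 \<longleftrightarrow> (\<forall>i<N. v i = 0)"
  by (auto simp: ip_def sum_nonneg_eq_0_iff)

lemma ip_eq_0: "(\<And>i. i < N \<Longrightarrow> v i = 0) \<Longrightarrow> ip N u v = 0"
  by (simp add: ip_def)

lemma app_std: "j < N \<Longrightarrow> app N Q (std j) i = Q i j"
  by (simp add: app_def std_def if_distrib[of "\<lambda>x. _ * x"] cong: if_cong)

lemma app_scale: "app N Q (\<lambda>i. c * v i) i = c * app N Q v i"
  by (simp add: app_def sum_distrib_left mult.left_commute)

lemma app_cong: "(\<And>j. j < N \<Longrightarrow> v j = v' j) \<Longrightarrow> app N Q v i = app N Q v' i"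
  by (simp add: app_def)

lemma ip_app: "symm N Q \<Longrightarrow> ip N u (app N Q v) = ip N (app N Q u) v"
proof -
  assume sym: "symm N Q"
  have "ip N u (app N Q v) = (\<Sum>i<N. \<Sum>j<N. u i * Q i j * v j)"
    by (simp add: ip_def app_def sum_distrib_left mult.assoc)
  also have "\<dots> = (\<Sum>j<N. \<Sum>i<N. u i * Q i j * v j)" by (rule sum.swap)
  also have "\<dots> = (\<Sum>j<N. \<Sum>i<N. Q j i * u i * v j)"
    by (intro sum.cong refl) (use sym in \<open>simp add: symm_def mult.commute\<close>)
  finally show ?thesis by (simp add: ip_def app_def sum_distrib_right)
qed

lemma eig_std_0: "j < N \<Longrightarrow> eig N Q 0 (std j) \<longleftrightarrow> (\<forall>i<N. Q i j = 0)"
  by (simp add: eig_def app_std)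

lemma scaled_projectionD:
  assumes "scaled_projection N Q c r"
  shows "0 < c" "symm N Q" "(\<Sum>i<N. Q i i) = c * r"
    "i < N \<Longrightarrow> j < N \<Longrightarrow> (\<Sum>l<N. Q i l * Q l j) = c * Q i j"
  using assms by (auto simp: scaled_projection_def)

lemma app_app:
  assumes "scaled_projection N Q c r"
  shows "eig N Q c (app N Q v)"
  unfolding eig_def
proof (intro allI impI)
  fix i assume i: "i < N"
  have "app N Q (app N Q v) i = (\<Sum>l<N. \<Sum>j<N. Q i l * Q l j * v j)"
    by (simp add: app_def sum_distrib_left mult.assoc)
  also have "\<dots> = (\<Sum>j<N. (\<Sum>l<N. Q i l * Q l j) * v j)"
    by (subst sum.swap) (simp add: sum_distrib_right)
  also have "\<dots> = c * app N Q v i"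
    using scaled_projectionD(4)[OF assms i] by (simp add: app_def sum_distrib_left mult.assoc)
  finally show "app N Q (app N Q v) i = c * app N Q v i" .
qed

lemma ip_app_app:
  assumes "scaled_projection N Q c r"
  shows "ip N (app N Q w) (app N Q w) = c * ip N w (app N Q w)"
proof -
  have "ip N (app N Q w) (app N Q w) = ip N w (app N Q (app N Q w))"
    by (simp add: ip_app[OF scaled_projectionD(2)[OF assms]])
  also have "\<dots> = ip N w (\<lambda>i. c * app N Q w i)"
    by (rule ip_cong) (use app_app[OF assms, of w] in \<open>simp add: eig_def\<close>)
  finally show ?thesis by (simp add: ip_scale)
qed

lemma ip_app_nonneg: "scaled_projection N Q c r \<Longrightarrow> 0 \<le> ip N w (app N Q w)"
  using ip_app_app[of N Q c r w] ip_self_nonneg[of N "app N Q w"] scaled_projectionD(1)[of N Q c r]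
  by (simp add: zero_le_mult_iff)

text \<open>As \<open><w,Qw>\<close> equals \<open>|Qw|^2 / c\<close>, an elimination degenerates
  exactly when \<open>w\<close> lies in the kernel.\<close>

lemma ip_app_eq_0:
  assumes "scaled_projection N Q c r"
  shows "ip N w (app N Q w) = 0 \<longleftrightarrow> eig N Q 0 w"
  using ip_app_app[OF assms, of w] ip_self_eq_0[of N "app N Q w"] scaled_projectionD(1)[OF assms]
  by (simp add: eig_def)

text \<open>For \<open>w = std p\<close> and symmetric \<open>Q\<close> this is the Schur complement
  of the entry \<open>(p, p)\<close> multiplied by that entry: one step of Gaussian elimination
  without division.\<close>

definition elim :: "nat \<Rightarrow> (nat \<Rightarrow> real) \<Rightarrow> (nat \<Rightarrow> nat \<Rightarrow> real) \<Rightarrow> nat \<Rightarrow> nat \<Rightarrow> real" where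
  "elim N w Q = (\<lambda>i j. ip N w (app N Q w) * Q i j - app N Q w i * app N Q w j)"

lemma app_elim: "app N (elim N w Q) v i = ip N w (app N Q w) * app N Q v i - app N Q w i * ip N (app N Q w) v"
  unfolding app_def[of N "elim N w Q"]
  by (simp add: elim_def left_diff_distrib sum_subtractf app_def[of N Q v] ip_def[of N _ v]
      sum_distrib_left mult.assoc)

lemma symm_elim: "symm N Q \<Longrightarrow> symm N (elim N w Q)"
  by (simp add: symm_def elim_def mult.commute)

text \<open>Put \<open>q = Qw\<close> and let \<open>a\<close> be \<open><w,Qw>\<close>. From
  \<open>Qq = c q\<close> and \<open>|q|^2 = c a\<close> the cross terms in the square of
  \<open>a Q - q q^T\<close> combine to \<open>c a\<close> times the matrix. The trace loses
  \<open>|q|^2 = c a\<close>, which is one unit of rank.\<close>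

lemma scaled_projection_elim:
  assumes Q: "scaled_projection N Q c r" and w: "ip N w (app N Q w) \<noteq> 0"
  shows "scaled_projection N (elim N w Q) (c * ip N w (app N Q w)) (r - 1)"
proof -
  let ?a = "ip N w (app N Q w)" and ?q = "app N Q w"
  have c: "0 < c" using scaled_projectionD(1)[OF Q] .
  have a: "0 < ?a" using ip_app_nonneg[OF Q, of w] w by simp
  have sym: "symm N Q" using scaled_projectionD(2)[OF Q] .
  have mult: "(\<Sum>l<N. elim N w Q i l * elim N w Q l j) = c * ?a * elim N w Q i j" if ij: "i < N" "j < N" for i j
  proof -
    have Qq: "(\<Sum>l<N. Q i l * ?q l) = c * ?q i" "(\<Sum>l<N. ?q l * Q l j) = c * ?q j"
    proof -
      show "(\<Sum>l<N. Q i l * ?q l) = c * ?q i"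
        using app_app[OF Q, of w] ij by (simp add: eig_def app_def[of N Q "app N Q w"])
      have "(\<Sum>l<N. ?q l * Q l j) = (\<Sum>l<N. Q j l * ?q l)"
        by (intro sum.cong refl) (use sym ij in \<open>simp add: symm_def mult.commute\<close>)
      then show "(\<Sum>l<N. ?q l * Q l j) = c * ?q j"
        using app_app[OF Q, of w] ij by (simp add: eig_def app_def[of N Q "app N Q w"])
    qed
    have qq: "(\<Sum>l<N. ?q l * ?q l) = c * ?a" using ip_app_app[OF Q, of w] by (simp add: ip_def)
    have "(\<Sum>l<N. elim N w Q i l * elim N w Q l j) =
        (\<Sum>l<N. ?a^2 * (Q i l * Q l j) - ?a * ?q j * (Q i l * ?q l) - ?a * ?q i * (?q l * Q l j)
          + ?q i * ?q j * (?q l * ?q l))"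
      by (intro sum.cong refl) (simp add: elim_def algebra_simps power2_eq_square)
    also have "\<dots> = ?a^2 * (c * Q i j) - ?a * ?q j * (c * ?q i) - ?a * ?q i * (c * ?q j) + ?q i * ?q j * (c * ?a)"
      by (simp only: sum.distrib sum_subtractf sum_distrib_left[symmetric] Qq qq scaled_projectionD(4)[OF Q ij])
    finally show ?thesis by (simp add: elim_def algebra_simps power2_eq_square)
  qed
  have "(\<Sum>i<N. elim N w Q i i) = ?a * (c * r) - ip N ?q ?q"
    using scaled_projectionD(3)[OF Q]
    by (simp add: elim_def sum_subtractf sum_distrib_left[symmetric] ip_def[of N "app N Q w" "app N Q w"])
  then have "(\<Sum>i<N. elim N w Q i i) = c * ?a * (r - 1)"
    using ip_app_app[OF Q, of w] by (simp add: algebra_simps)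
  then show ?thesis using c a mult symm_elim[OF sym] by (simp add: scaled_projection_def)
qed

lemma eig_elim:
  assumes "symm N Q" "eig N Q c v" "ip N w v = 0"
  shows "eig N (elim N w Q) (c * ip N w (app N Q w)) v"
proof -
  have "ip N (app N Q w) v = ip N w (app N Q v)" using ip_app[OF assms(1)] by simp
  also have "\<dots> = ip N w (\<lambda>i. c * v i)" by (rule ip_cong) (use assms(2) in \<open>simp add: eig_def\<close>)
  also have "\<dots> = 0" using assms(3) by (simp add: ip_scale)
  finally show ?thesis using assms(2) by (simp add: eig_def app_elim)
qed

lemma eig_elim_0:
  assumes "symm N Q" "eig N Q 0 z"
  shows "eig N (elim N w Q) 0 z"
proof -
  have "ip N (app N Q w) z = ip N w (app N Q z)" using ip_app[OF assms(1)] by simp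
  also have "\<dots> = 0" by (rule ip_eq_0) (use assms(2) in \<open>simp add: eig_def\<close>)
  finally show ?thesis using assms(2) by (simp add: eig_def app_elim)
qed

lemma eig_elim_self: "eig N (elim N w Q) 0 w"
  by (simp add: eig_def app_elim ip_commute)

lemma elim_eq_0:
  assumes "eig N Q 0 w" "i < N" "j < N"
  shows "elim N w Q i j = 0"
proof -
  have "ip N w (app N Q w) = 0" by (rule ip_eq_0) (use assms in \<open>simp add: eig_def\<close>)
  then show ?thesis using assms by (simp add: elim_def eig_def)
qed

definition elims :: "nat \<Rightarrow> (nat \<Rightarrow> real) list \<Rightarrow> (nat \<Rightarrow> nat \<Rightarrow> real) \<Rightarrow> nat \<Rightarrow> nat \<Rightarrow> real" where
  "elims N ws Q = fold (elim N) ws Q"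

lemma elims_simps [simp]: "elims N [] Q = Q" "elims N (w # ws) Q = elims N ws (elim N w Q)"
  "elims N (ws @ vs) Q = elims N vs (elims N ws Q)"
  by (simp_all add: elims_def)

lemma symm_elims: "symm N Q \<Longrightarrow> symm N (elims N ws Q)"
  by (induction ws arbitrary: Q) (auto intro: symm_elim)

lemma eig_elims_0: "symm N Q \<Longrightarrow> eig N Q 0 z \<Longrightarrow> eig N (elims N ws Q) 0 z"
  by (induction ws arbitrary: Q) (auto intro: symm_elim eig_elim_0)

lemma eig_elims_mem: "symm N Q \<Longrightarrow> w \<in> set ws \<Longrightarrow> eig N (elims N ws Q) 0 w"
  by (induction ws arbitrary: Q) (auto intro: symm_elim eig_elims_0 eig_elim_self)

lemma elims_eq_0: "(\<And>i j. i < N \<Longrightarrow> j < N \<Longrightarrow> Q i j = 0) \<Longrightarrow> i < N \<Longrightarrow> j < N \<Longrightarrow> elims N ws Q i j = 0"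
  by (induction ws arbitrary: Q) (auto simp: elim_def app_def)

text \<open>A degenerate elimination produces the zero matrix, which stays zero. A nonzero entry at
  the end therefore certifies that every step lowered the rank by one.\<close>

lemma elims_nonzero:
  assumes "scaled_projection N Q c r" "i < N" "j < N" "elims N ws Q i j \<noteq> 0"
  shows "\<exists>c'. scaled_projection N (elims N ws Q) c' (r - real (length ws)) \<and>
    (\<forall>v. eig N Q c v \<longrightarrow> (\<forall>w\<in>set ws. ip N w v = 0) \<longrightarrow> eig N (elims N ws Q) c' v)"
  using assms
proof (induction ws arbitrary: Q c r)
  case Nil
  then show ?case by auto
next
  case (Cons w ws)
  have sym: "symm N Q" using scaled_projectionD(2)[OF Cons.prems(1)] .
  have "\<not> eig N Q 0 w"
  proof
    assume "eig N Q 0 w"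
    then have "elims N ws (elim N w Q) i j = 0"
      by (intro elims_eq_0 elim_eq_0 Cons.prems(2,3))
    then show False using Cons.prems(4) by simp
  qed
  then have nz: "ip N w (app N Q w) \<noteq> 0" using ip_app_eq_0[OF Cons.prems(1)] by simp
  have "\<exists>c'. scaled_projection N (elims N ws (elim N w Q)) c' ((r - 1) - real (length ws)) \<and>
    (\<forall>v. eig N (elim N w Q) (c * ip N w (app N Q w)) v \<longrightarrow> (\<forall>w\<in>set ws. ip N w v = 0) \<longrightarrow>
       eig N (elims N ws (elim N w Q)) c' v)"
    by (rule Cons.IH[OF scaled_projection_elim[OF Cons.prems(1) nz] Cons.prems(2,3)])
      (use Cons.prems(4) in simp)
  then show ?case using eig_elim[OF sym] by (auto simp: algebra_simps)
qed

text \<open>Inclusion of ranges, for an orthogonal projection \<open>P\<close> without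
  scaling.\<close>

definition range_in :: "nat \<Rightarrow> (nat \<Rightarrow> nat \<Rightarrow> real) \<Rightarrow> (nat \<Rightarrow> nat \<Rightarrow> real) \<Rightarrow> bool" where
  "range_in N P Q \<longleftrightarrow> (\<forall>v. eig N P 1 (app N Q v))"

lemma range_in_elims: "range_in N P Q \<Longrightarrow> range_in N P (elims N ws Q)"
proof (induction ws arbitrary: Q)
  case (Cons w ws)
  have "range_in N P (elim N w Q)" unfolding range_in_def eig_def
  proof (intro allI impI)
    fix v i assume i: "i < N"
    let ?a = "ip N w (app N Q w)" and ?b = "ip N (app N Q w) v"
    have "app N P (app N (elim N w Q) v) i = ?a * app N P (app N Q v) i - ?b * app N P (app N Q w) i"
      unfolding app_def[of N P] app_elim
      by (simp add: sum_subtractf sum_distrib_left algebra_simps)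
    then show "app N P (app N (elim N w Q) v) i = 1 * app N (elim N w Q) v i"
      using Cons.prems i by (simp add: range_in_def eig_def app_elim mult.commute)
  qed
  then show ?case using Cons.IH by simp
qed simp

lemma range_in_self: "scaled_projection N Q 1 r \<Longrightarrow> range_in N Q Q"
  by (simp add: range_in_def app_app)

text \<open>By symmetry the trace of the square is the sum of the squares of the entries, and it is
  a multiple of the trace.\<close>

lemma scaled_projection_rank_0:
  assumes "scaled_projection N Q c 0" "i < N" "j < N"
  shows "Q i j = 0"
proof -
  have "(\<Sum>i<N. \<Sum>l<N. Q i l * Q i l) = (\<Sum>i<N. \<Sum>l<N. Q i l * Q l i)"
    by (intro sum.cong refl) (use scaled_projectionD(2)[OF assms(1)] in \<open>simp add: symm_def\<close>)
  also have "\<dots> = (\<Sum>i<N. c * Q i i)" using scaled_projectionD(4)[OF assms(1)] by simp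
  also have "\<dots> = 0" using scaled_projectionD(3)[OF assms(1)] by (simp flip: sum_distrib_left)
  finally have "(\<Sum>l<N. Q i l * Q i l) = 0"
    using assms(2) by (subst (asm) sum_nonneg_eq_0_iff) (auto intro: sum_nonneg)
  then show ?thesis using assms(3) by (simp add: sum_nonneg_eq_0_iff)
qed

lemma ex_diag_nonzero:
  assumes "scaled_projection N Q c r" "r \<noteq> 0"
  shows "\<exists>i<N. Q i i \<noteq> 0"
proof (rule ccontr)
  assume "\<not> ?thesis"
  then have "(\<Sum>i<N. Q i i) = 0" by simp
  then show False using scaled_projectionD(1,3)[OF assms(1)] assms(2) by simp
qed

lemma diag_0_eig:
  assumes "scaled_projection N Q c r" "i < N"
  shows "Q i i = 0 \<longleftrightarrow> eig N Q 0 (std i)"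
  using ip_app_eq_0[OF assms(1), of "std i"] assms(2) by (simp add: ip_std app_std)

text \<open>Eliminating \<open>v\<close> leaves rank zero, hence the zero matrix, and this is the
  asserted formula.\<close>

lemma scaled_projection_rank_1:
  assumes Q: "scaled_projection N Q c 1" and v: "eig N Q c v" "ip N v v \<noteq> 0" and "i < N" "j < N"
  shows "Q i j = c * v i * v j / ip N v v"
proof -
  have c: "0 < c" using scaled_projectionD(1)[OF Q] .
  have vQ: "ip N v (app N Q v) = c * ip N v v"
    using v(1) by (simp add: eig_def flip: ip_scale cong: ip_cong)
  then have "scaled_projection N (elim N v Q) (c * ip N v (app N Q v)) 0"
    using scaled_projection_elim[OF Q, of v] v(2) c by simp
  then have "elim N v Q i j = 0" by (rule scaled_projection_rank_0) fact+
  then have "c * (ip N v v * Q i j) = c * (c * v i * v j)"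
    using v(1) assms(4,5) by (simp add: elim_def vQ eig_def algebra_simps)
  then show ?thesis using c v(2) by (simp add: field_simps)
qed

definition rank1 :: "nat \<Rightarrow> (nat \<Rightarrow> real) \<Rightarrow> nat \<Rightarrow> nat \<Rightarrow> real" where
  "rank1 N w = (\<lambda>i j. w i * w j / ip N w w)"

lemma app_rank1: "app N (rank1 N w) v i = ip N w v / ip N w w * w i"
  by (simp add: app_def rank1_def ip_def[of N w v] sum_distrib_left sum_divide_distrib algebra_simps)

lemma scaled_projection_rank1:
  assumes "ip N w w \<noteq> 0"
  shows "scaled_projection N (rank1 N w) 1 1"
  unfolding scaled_projection_def
proof (intro conjI allI impI)
  show "symm N (rank1 N w)" by (simp add: symm_def rank1_def mult.commute)
  show "(\<Sum>i<N. rank1 N w i i) = 1 * 1"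
    using assms by (simp add: rank1_def ip_def flip: sum_divide_distrib)
  fix i j assume "i < N" "j < N"
  have "(\<Sum>l<N. rank1 N w i l * rank1 N w l j) = (\<Sum>l<N. w i * w j / (ip N w w)^2 * (w l * w l))"
    by (intro sum.cong refl) (simp add: rank1_def power2_eq_square algebra_simps)
  also have "\<dots> = w i * w j / (ip N w w)^2 * ip N w w"
    unfolding sum_distrib_left[symmetric] by (simp add: ip_def)
  finally show "(\<Sum>l<N. rank1 N w i l * rank1 N w l j) = 1 * rank1 N w i j"
    using assms by (simp add: rank1_def power2_eq_square)
qed simp

text \<open>An echelon family in the range keeps the eliminations of its pivot coordinates from
  degenerating: \<open>v k\<close> vanishes at the earlier pivots, so it remains in the range, and
  its nonzero entry at \<open>p k\<close> shows that \<open>std (p k)\<close> is not in the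
  kernel.\<close>

lemma elims_echelon:
  assumes Q: "scaled_projection N Q c r" and p: "\<And>j. j < k \<Longrightarrow> p j < N"
    and v: "\<And>j. j < k \<Longrightarrow> eig N Q c (v j)" "\<And>j. j < k \<Longrightarrow> v j (p j) \<noteq> 0"
      "\<And>i j. i < j \<Longrightarrow> j < k \<Longrightarrow> v j (p i) = 0"
  shows "\<exists>c'. scaled_projection N (elims N (map (\<lambda>j. std (p j)) [0..<k]) Q) c' (r - real k) \<and>
    (\<forall>u. eig N Q c u \<longrightarrow> (\<forall>j<k. u (p j) = 0) \<longrightarrow> eig N (elims N (map (\<lambda>j. std (p j)) [0..<k]) Q) c' u)"
  using p v
proof (induction k)
  case 0
  then show ?case using Q by auto
next
  case (Suc k)
  let ?Q = "elims N (map (\<lambda>j. std (p j)) [0..<k]) Q"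
  obtain c' where c': "scaled_projection N ?Q c' (r - real k)"
    "\<And>u. eig N Q c u \<Longrightarrow> (\<forall>j<k. u (p j) = 0) \<Longrightarrow> eig N ?Q c' u"
    using Suc.IH Suc.prems by force
  have pk: "p k < N" using Suc.prems(1) by simp
  have vk: "eig N ?Q c' (v k)" using c'(2)[of "v k"] Suc.prems(2,4) by simp
  have "ip N (app N ?Q (std (p k))) (v k) = ip N (std (p k)) (\<lambda>i. c' * v k i)"
    using vk by (simp add: eig_def flip: ip_app[OF scaled_projectionD(2)[OF c'(1)]] cong: ip_cong)
  also have "\<dots> \<noteq> 0"
    using Suc.prems(3)[of k] scaled_projectionD(1)[OF c'(1)] pk by (simp add: ip_std)
  finally have "\<not> eig N ?Q 0 (std (p k))"
    using ip_eq_0[of N "app N ?Q (std (p k))" "v k"] by (auto simp: eig_def ip_commute)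
  then have nz: "ip N (std (p k)) (app N ?Q (std (p k))) \<noteq> 0" using ip_app_eq_0[OF c'(1)] by simp
  show ?case
  proof (intro exI conjI allI impI)
    show "scaled_projection N (elims N (map (\<lambda>j. std (p j)) [0..<Suc k]) Q)
        (c' * ip N (std (p k)) (app N ?Q (std (p k)))) (r - real (Suc k))"
      using scaled_projection_elim[OF c'(1) nz] by (simp add: algebra_simps)
    fix u assume u: "eig N Q c u" "\<forall>j<Suc k. u (p j) = 0"
    then have "eig N ?Q c' u" using c'(2) by simp
    moreover have "ip N (std (p k)) u = 0" using u(2) pk by (simp add: ip_std)
    ultimately show "eig N (elims N (map (\<lambda>j. std (p j)) [0..<Suc k]) Q)
        (c' * ip N (std (p k)) (app N ?Q (std (p k)))) u"
      using eig_elim[OF scaled_projectionD(2)[OF c'(1)]] by simp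
  qed
qed

section \<open>Flags of orthogonal lines\<close>

text \<open>
  A flag of subspaces \<open>0 = Y\<^sub>0 \<subset> Y\<^sub>1 \<subset> \<dots> \<subset> Y\<^sub>m\<close> with \<open>Y\<^sub>k\<^sub>+\<^sub>1 \<subseteq> \<real>\<^bsup>a k\<^esup>\<close> is encoded by the
  orthogonal projections \<open>L k\<close> onto the lines \<open>Y\<^sub>k\<^sub>+\<^sub>1 \<inter> Y\<^sub>k\<^sup>\<bottom>\<close>.
\<close>

definition line_flag :: "nat \<Rightarrow> nat \<Rightarrow> (nat \<Rightarrow> nat) \<Rightarrow> (nat \<Rightarrow> nat \<Rightarrow> nat \<Rightarrow> real) \<Rightarrow> bool" where
  "line_flag N m a L \<longleftrightarrow> (\<forall>k<m. scaled_projection N (L k) 1 1) \<and>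
     (\<forall>k<m. \<forall>l<k. \<forall>i<N. \<forall>j<N. (\<Sum>s<N. L k i s * L l s j) = 0) \<and>
     (\<forall>k<m. \<forall>i<N. a k \<le> i \<longrightarrow> L k i i = 0)"

definition flag_sum :: "(nat \<Rightarrow> nat \<Rightarrow> nat \<Rightarrow> real) \<Rightarrow> nat \<Rightarrow> nat \<Rightarrow> nat \<Rightarrow> real" where
  "flag_sum L k = (\<lambda>i j. \<Sum>l<k. L l i j)"

lemma app_sum: "app N Q (\<lambda>i. \<Sum>l\<in>A. f l i) i = (\<Sum>l\<in>A. app N Q (f l) i)"
  unfolding app_def by (simp add: sum_distrib_left) (rule sum.swap)

lemma app_flag_sum: "app N (flag_sum L k) v i = (\<Sum>l<k. app N (L l) v i)"
  unfolding app_def flag_sum_def by (simp add: sum_distrib_right) (rule sum.swap)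

lemma flag_sum_Suc: "flag_sum L (Suc k) i j = flag_sum L k i j + L k i j"
  by (simp add: flag_sum_def)

lemma line_flag_orth:
  assumes "line_flag N m a L" "k < m" "l < m" "k \<noteq> l" "i < N" "j < N"
  shows "(\<Sum>s<N. L k i s * L l s j) = 0"
proof (cases "l < k")
  case True
  then show ?thesis using assms by (simp add: line_flag_def)
next
  case False
  have sym: "symm N (L k)" "symm N (L l)"
    using assms by (auto simp: line_flag_def intro: scaled_projectionD(2))
  have "(\<Sum>s<N. L k i s * L l s j) = (\<Sum>s<N. L l j s * L k s i)"
    by (intro sum.cong refl) (use sym assms in \<open>simp add: symm_def mult.commute\<close>)
  then show ?thesis using False assms by (simp add: line_flag_def)
qed

lemma line_flag_app_app:
  assumes "line_flag N m a L" "k < m" "l < m" "i < N"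
  shows "app N (L k) (app N (L l) v) i = (if k = l then app N (L l) v i else 0)"
proof (cases "k = l")
  case True
  then show ?thesis
    using app_app[of N "L k" 1 1 v] assms by (simp add: line_flag_def eig_def)
next
  case False
  have "app N (L k) (app N (L l) v) i = (\<Sum>s<N. \<Sum>j<N. L k i s * L l s j * v j)"
    by (simp add: app_def sum_distrib_left mult.assoc)
  also have "\<dots> = (\<Sum>j<N. (\<Sum>s<N. L k i s * L l s j) * v j)"
    by (subst sum.swap) (simp add: sum_distrib_right)
  also have "\<dots> = 0" using line_flag_orth[OF assms(1-3) False assms(4)] by simp
  finally show ?thesis using False by simp
qed

lemma eig_flag_sum_line:
  assumes "line_flag N m a L" "l < k" "k \<le> m"
  shows "eig N (flag_sum L k) 1 (app N (L l) v)"
  unfolding eig_def app_flag_sum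
proof (intro allI impI)
  fix i assume i: "i < N"
  have "(\<Sum>k'<k. app N (L k') (app N (L l) v) i) = (\<Sum>k'<k. if k' = l then app N (L l) v i else 0)"
    by (intro sum.cong refl) (use line_flag_app_app[OF assms(1)] assms i in auto)
  then show "(\<Sum>k'<k. app N (L k') (app N (L l) v) i) = 1 * app N (L l) v i" using assms(2) by simp
qed

lemma scaled_projection_flag_sum:
  assumes L: "line_flag N m a L" and k: "k \<le> m"
  shows "scaled_projection N (flag_sum L k) 1 (real k)"
  unfolding scaled_projection_def
proof (intro conjI allI impI)
  have Lk: "scaled_projection N (L l) 1 1" if "l < k" for l using L k that by (simp add: line_flag_def)
  show "symm N (flag_sum L k)"
    unfolding symm_def flag_sum_def
    by (intro allI impI sum.cong refl) (use scaled_projectionD(2)[OF Lk] in \<open>simp add: symm_def\<close>)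
  have "(\<Sum>i<N. flag_sum L k i i) = (\<Sum>l<k. \<Sum>i<N. L l i i)" unfolding flag_sum_def by (rule sum.swap)
  also have "\<dots> = real k" using scaled_projectionD(3)[OF Lk] by simp
  finally show "(\<Sum>i<N. flag_sum L k i i) = 1 * real k" by simp
  fix i j assume ij: "i < N" "j < N"
  have "(\<Sum>l<N. flag_sum L k i l * flag_sum L k l j) = app N (flag_sum L k) (\<lambda>l. flag_sum L k l j) i"
    by (simp add: app_def)
  also have "\<dots> = (\<Sum>l<k. app N (flag_sum L k) (\<lambda>s. L l s j) i)"
    unfolding app_def flag_sum_def[of L k] by (simp add: sum_distrib_left) (rule sum.swap)
  also have "\<dots> = (\<Sum>l<k. L l i j)"
  proof (intro sum.cong refl)
    fix l assume "l \<in> {..<k}"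
    then have "app N (flag_sum L k) (app N (L l) (std j)) i = app N (L l) (std j) i"
      using eig_flag_sum_line[OF L _ k, of l "std j"] ij by (simp add: eig_def)
    moreover have "app N (L l) (std j) = (\<lambda>s. L l s j)" using ij by (simp add: app_std fun_eq_iff)
    ultimately show "app N (flag_sum L k) (\<lambda>s. L l s j) i = L l i j" by simp
  qed
  finally show "(\<Sum>l<N. flag_sum L k i l * flag_sum L k l j) = 1 * flag_sum L k i j"
    by (simp add: flag_sum_def)
qed simp

text \<open>In a positive semidefinite matrix a vanishing diagonal entry forces its row and column
  to vanish; so the diagonal conditions in \<open>line_flag\<close> confine the line to
  \<open>\<real>^{a l}\<close>.\<close>

lemma line_flag_support:
  assumes "line_flag N m a L" "l < m" "a l \<le> i" "i < N"
  shows "eig N (L l) 0 (std i)" "j < N \<Longrightarrow> L l i j = 0" "j < N \<Longrightarrow> L l j i = 0"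
proof -
  have P: "scaled_projection N (L l) 1 1" using assms by (simp add: line_flag_def)
  show e: "eig N (L l) 0 (std i)"
    using diag_0_eig[OF P assms(4)] assms by (simp add: line_flag_def)
  show "j < N \<Longrightarrow> L l j i = 0" using e assms(4) by (simp add: eig_std_0)
  then show "j < N \<Longrightarrow> L l i j = 0"
    using scaled_projectionD(2)[OF P] assms(4) by (simp add: symm_def)
qed

lemma flag_sum_support:
  assumes "line_flag N m a L" "k \<le> m" "\<And>l. l < k \<Longrightarrow> a l \<le> i" "i < N"
  shows "eig N (flag_sum L k) 0 (std i)"
  unfolding eig_std_0[OF assms(4)] flag_sum_def
  using line_flag_support(3)[OF assms(1) _ assms(3,4)] assms(2) by simp

section \<open>Gram-Schmidt orthogonalization without divisions\<close>

text \<open>Eliminating \<open>v 0, ..., v (k - 1)\<close> from the identity gives, if no step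
  degenerates, a multiple of the projection onto their orthogonal complement.\<close>

definition gs_proj :: "nat \<Rightarrow> (nat \<Rightarrow> nat \<Rightarrow> real) \<Rightarrow> nat \<Rightarrow> nat \<Rightarrow> nat \<Rightarrow> real" where
  "gs_proj N v k = elims N (map v [0..<k]) std"

definition gs_vec :: "nat \<Rightarrow> (nat \<Rightarrow> nat \<Rightarrow> real) \<Rightarrow> nat \<Rightarrow> nat \<Rightarrow> real" where
  "gs_vec N v k = app N (gs_proj N v k) (v k)"

definition gs_line :: "nat \<Rightarrow> (nat \<Rightarrow> nat \<Rightarrow> real) \<Rightarrow> nat \<Rightarrow> nat \<Rightarrow> nat \<Rightarrow> real" where
  "gs_line N v k = rank1 N (gs_vec N v k)"

text \<open>If the earlier vectors are nondegenerate, this is independence of \<open>v k\<close>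
  from them, expressed by a polynomial in the entries.\<close>

definition gs_nondeg :: "nat \<Rightarrow> (nat \<Rightarrow> nat \<Rightarrow> real) \<Rightarrow> nat \<Rightarrow> bool" where
  "gs_nondeg N v k \<longleftrightarrow> ip N (v k) (gs_vec N v k) \<noteq> 0"

lemma gs_proj_Suc: "gs_proj N v (Suc k) = elim N (v k) (gs_proj N v k)"
  by (simp add: gs_proj_def)

lemma scaled_projection_std: "scaled_projection N std 1 (real N)"
  by (auto simp: scaled_projection_def symm_def std_def if_distrib[of "\<lambda>x. x * _"] cong: if_cong)

text \<open>The squared length of \<open>gs_vec N v k\<close> is \<open>c\<close> times its inner
  product with \<open>v k\<close>, so the rank-one term removed in step \<open>k\<close> is exactly
  the new factor times the line \<open>k\<close>. The eliminated identity thus remains a multiple of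
  the identity minus the lines found so far.\<close>

lemma gs_proj_props:
  assumes "\<And>j. j < k \<Longrightarrow> gs_nondeg N v j"
  shows "\<exists>c. scaled_projection N (gs_proj N v k) c (real N - real k) \<and>
    (\<forall>i<N. \<forall>j<N. gs_proj N v k i j = c * (std i j - flag_sum (gs_line N v) k i j))"
  using assms
proof (induction k)
  case 0
  then show ?case using scaled_projection_std[of N]
    by (intro exI[of _ 1]) (simp add: gs_proj_def flag_sum_def)
next
  case (Suc k)
  obtain c where c: "scaled_projection N (gs_proj N v k) c (real N - real k)"
    "\<forall>i<N. \<forall>j<N. gs_proj N v k i j = c * (std i j - flag_sum (gs_line N v) k i j)"
    using Suc by auto
  let ?a = "ip N (v k) (gs_vec N v k)" and ?w = "gs_vec N v k"
  have a: "?a \<noteq> 0" using Suc.prems[of k] by (simp add: gs_nondeg_def)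
  have ww: "ip N ?w ?w = c * ?a" using ip_app_app[OF c(1), of "v k"] by (simp add: gs_vec_def)
  have c0: "c \<noteq> 0" using scaled_projectionD(1)[OF c(1)] by simp
  have "scaled_projection N (gs_proj N v (Suc k)) (c * ?a) (real N - real (Suc k))"
    using scaled_projection_elim[OF c(1), of "v k"] a by (simp add: gs_proj_Suc gs_vec_def algebra_simps)
  moreover have "gs_proj N v (Suc k) i j = c * ?a * (std i j - flag_sum (gs_line N v) (Suc k) i j)"
    if "i < N" "j < N" for i j
  proof -
    have "?w i * ?w j = c * ?a * gs_line N v k i j" using a c0 by (simp add: gs_line_def rank1_def ww)
    moreover have "gs_proj N v k i j = c * (std i j - flag_sum (gs_line N v) k i j)" using c(2) that by blast
    moreover have "gs_proj N v (Suc k) i j = ?a * gs_proj N v k i j - ?w i * ?w j"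
      by (simp add: gs_proj_Suc elim_def gs_vec_def)
    ultimately show ?thesis by (simp only: flag_sum_Suc) (simp add: algebra_simps)
  qed
  ultimately show ?case by blast
qed

lemma app_gs_proj:
  assumes "\<forall>i<N. \<forall>j<N. gs_proj N v k i j = c * (std i j - flag_sum (gs_line N v) k i j)" "i < N"
  shows "app N (gs_proj N v k) u i = c * (u i - app N (flag_sum (gs_line N v) k) u i)"
proof -
  have "app N (gs_proj N v k) u i = (\<Sum>j<N. c * (std i j * u j) - c * (flag_sum (gs_line N v) k i j * u j))"
    unfolding app_def by (intro sum.cong refl) (use assms in \<open>simp add: left_diff_distrib right_diff_distrib mult.assoc\<close>)
  also have "\<dots> = c * ip N (std i) u - c * app N (flag_sum (gs_line N v) k) u i"
    by (simp add: sum_subtractf ip_def app_def flip: sum_distrib_left)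
  finally show ?thesis using assms(2) by (simp add: ip_std algebra_simps)
qed

lemma gs_vec_self:
  assumes "\<And>j. j < k \<Longrightarrow> gs_nondeg N v j"
  shows "\<exists>c>0. ip N (gs_vec N v k) (gs_vec N v k) = c * ip N (v k) (gs_vec N v k)"
  using gs_proj_props[of k N v] assms ip_app_app[of N "gs_proj N v k" _ _ "v k"] scaled_projectionD(1)
  unfolding gs_vec_def by blast

text \<open>Orthogonality: the matrix of step \<open>k\<close> annihilates all earlier
  \<open>gs_vec\<close>, and it is symmetric. Support: for \<open>i \<ge> a k\<close> the vector
  \<open>std i\<close> is orthogonal to everything eliminated before step \<open>k\<close>, hence an
  eigenvector of the matrix, so \<open>gs_vec N v k\<close> has the entry \<open>0\<close> at
  \<open>i\<close> because \<open>v k\<close> has.\<close>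

lemma gs_line_flag:
  assumes nondeg: "\<And>k. k < m \<Longrightarrow> gs_nondeg N v k"
    and supp: "\<And>k i. k < m \<Longrightarrow> a k \<le> i \<Longrightarrow> i < N \<Longrightarrow> v k i = 0"
    and mono: "\<And>j k. j \<le> k \<Longrightarrow> k < m \<Longrightarrow> a j \<le> a k"
  shows "line_flag N m a (gs_line N v)"
proof -
  have ww: "ip N (gs_vec N v k) (gs_vec N v k) \<noteq> 0" if k: "k < m" for k
    using gs_vec_self[of k N v] nondeg[OF k] nondeg k unfolding gs_nondeg_def by fastforce
  have sym: "symm N std" using scaled_projectionD(2)[OF scaled_projection_std] .
  have symk: "symm N (gs_proj N v k)" for k unfolding gs_proj_def by (rule symm_elims[OF sym])
  have kill: "eig N (gs_proj N v (Suc l + d)) 0 (gs_vec N v l)" if l: "l < m" for l d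
  proof (induction d)
    case 0
    obtain c where c: "scaled_projection N (gs_proj N v l) c (real N - real l)"
      using gs_proj_props[of l N v] nondeg l by fastforce
    let ?w = "gs_vec N v l"
    have ww: "ip N ?w ?w = c * ip N (v l) ?w" using ip_app_app[OF c, of "v l"] by (simp add: gs_vec_def)
    show ?case unfolding eig_def
    proof (intro allI impI)
      fix i assume i: "i < N"
      have "app N (gs_proj N v l) ?w i = c * ?w i"
        using app_app[OF c, of "v l"] i by (simp add: eig_def gs_vec_def)
      then show "app N (gs_proj N v (Suc l + 0)) ?w i = 0 * ?w i"
        using ww by (simp add: gs_proj_Suc app_elim flip: gs_vec_def)
    qed
  next
    case (Suc d)
    have "gs_proj N v (Suc l + Suc d) = elim N (v (Suc l + d)) (gs_proj N v (Suc l + d))"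
      using gs_proj_Suc[of N v "Suc l + d"] by simp
    then show ?case using eig_elim_0[OF symk Suc] by (simp only:)
  qed
  have orth: "ip N (gs_vec N v k) (gs_vec N v l) = 0" if "k < m" "l < k" for k l
  proof -
    have "eig N (gs_proj N v k) 0 (gs_vec N v l)" using kill[of l "k - Suc l"] that by simp
    then have "ip N (v k) (app N (gs_proj N v k) (gs_vec N v l)) = 0"
      by (intro ip_eq_0) (simp add: eig_def)
    then show ?thesis using ip_app[OF symk] by (simp add: gs_vec_def)
  qed
  have zero: "gs_vec N v k i = 0" if k: "k < m" and i: "a k \<le> i" "i < N" for k i
  proof -
    have "\<exists>c. eig N (gs_proj N v k') c (std i)" if "k' \<le> k" for k'
      using that
    proof (induction k')
      case 0
      have "eig N (gs_proj N v 0) 1 (std i)" using i by (simp add: gs_proj_def eig_def app_std std_def eq_commute)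
      then show ?case by blast
    next
      case (Suc k')
      then obtain c where "eig N (gs_proj N v k') c (std i)" by auto
      moreover have "ip N (v k') (std i) = 0"
        using supp[of k' i] mono[of k' k] Suc.prems k i by (simp add: ip_commute[of N "v k'"] ip_std)
      ultimately show ?case unfolding gs_proj_Suc using eig_elim[OF symk] by blast
    qed
    then obtain c where c: "eig N (gs_proj N v k) c (std i)" by blast
    have "gs_vec N v k i = ip N (std i) (app N (gs_proj N v k) (v k))" using i by (simp add: ip_std gs_vec_def)
    also have "\<dots> = ip N (v k) (app N (gs_proj N v k) (std i))" using ip_app[OF symk] ip_commute by metis
    also have "\<dots> = ip N (v k) (\<lambda>j. c * std i j)" by (rule ip_cong) (use c in \<open>simp add: eig_def\<close>)
    also have "\<dots> = 0" using supp[OF k i] i by (simp add: ip_scale ip_commute[of N "v k"] ip_std)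
    finally show ?thesis .
  qed
  show ?thesis unfolding line_flag_def
  proof (intro conjI allI impI)
    show "scaled_projection N (gs_line N v k) 1 1" if "k < m" for k
      unfolding gs_line_def by (rule scaled_projection_rank1[OF ww[OF that]])
    show "(\<Sum>s<N. gs_line N v k i s * gs_line N v l s j) = 0" if "k < m" "l < k" for k l i j
    proof -
      let ?w = "gs_vec N v"
      have "(\<Sum>s<N. gs_line N v k i s * gs_line N v l s j) =
        (\<Sum>s<N. ?w k i * ?w l j / (ip N (?w k) (?w k) * ip N (?w l) (?w l)) * (?w k s * ?w l s))"
        by (intro sum.cong refl) (simp add: gs_line_def rank1_def)
      also have "\<dots> = ?w k i * ?w l j / (ip N (?w k) (?w k) * ip N (?w l) (?w l)) * ip N (?w k) (?w l)"
        unfolding sum_distrib_left[symmetric] by (simp add: ip_def)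
      finally show ?thesis using orth[OF that] by simp
    qed
    show "gs_line N v k i i = 0" if "k < m" "i < N" "a k \<le> i" for k i
      using zero[OF that(1,3,2)] by (simp add: gs_line_def rank1_def)
  qed
qed

lemma gs_span:
  assumes nondeg: "\<And>j. j \<le> k \<Longrightarrow> gs_nondeg N v j"
  shows "eig N (flag_sum (gs_line N v) (Suc k)) 1 (v k)"
proof -
  obtain c where c: "scaled_projection N (gs_proj N v k) c (real N - real k)"
    "\<forall>i<N. \<forall>j<N. gs_proj N v k i j = c * (std i j - flag_sum (gs_line N v) k i j)"
    using gs_proj_props[of k N v] nondeg by auto
  let ?w = "gs_vec N v k"
  have c0: "c \<noteq> 0" using scaled_projectionD(1)[OF c(1)] by simp
  have a: "ip N (v k) ?w \<noteq> 0" using nondeg[of k] by (simp add: gs_nondeg_def)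
  have ww: "ip N ?w ?w = c * ip N (v k) ?w" using ip_app_app[OF c(1), of "v k"] by (simp add: gs_vec_def)
  show ?thesis unfolding eig_def
  proof (intro allI impI)
    fix i assume i: "i < N"
    have "app N (gs_line N v k) (v k) i = ?w i / c"
      using a c0 by (simp add: gs_line_def app_rank1 ww ip_commute)
    also have "\<dots> = v k i - app N (flag_sum (gs_line N v) k) (v k) i"
      using app_gs_proj[OF c(2) i, of "v k"] c0 by (simp add: gs_vec_def)
    finally show "app N (flag_sum (gs_line N v) (Suc k)) (v k) i = 1 * v k i"
      by (simp add: app_flag_sum)
  qed
qed

lemma flag_sum_mono_eig:
  assumes "line_flag N m a L" "eig N (flag_sum L j) 1 u" "j \<le> k" "k \<le> m"
  shows "eig N (flag_sum L k) 1 u"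
  unfolding eig_def
proof (intro allI impI)
  fix i assume i: "i < N"
  have "app N (flag_sum L k) u i = app N (flag_sum L k) (app N (flag_sum L j) u) i"
    by (rule app_cong) (use assms(2) in \<open>simp add: eig_def\<close>)
  also have "\<dots> = (\<Sum>l<j. app N (flag_sum L k) (app N (L l) u) i)"
    by (subst app_sum[symmetric]) (simp add: app_flag_sum[abs_def])
  also have "\<dots> = (\<Sum>l<j. app N (L l) u i)"
    by (intro sum.cong refl) (use eig_flag_sum_line[OF assms(1) _ assms(4), of _ u] assms(3) i in \<open>simp add: eig_def\<close>)
  also have "\<dots> = 1 * u i" using assms(2) i by (simp add: eig_def flip: app_flag_sum)
  finally show "app N (flag_sum L k) u i = 1 * u i" .
qed

section \<open>Charts of the variety of flags\<close>

text \<open>Imposing the vanishing of the coordinates \<open>p 0, ..., p (k - 1)\<close> on the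
  member \<open>k + 1\<close> of the flag leaves a line in the nondegenerate case. Its rank-one
  matrix has, as column \<open>p k\<close>, a multiple of the vector \<open>k\<close> of the echelon
  basis with pivots \<open>p\<close>.\<close>

definition chart_matrix ::
  "nat \<Rightarrow> (nat \<Rightarrow> nat \<Rightarrow> nat \<Rightarrow> real) \<Rightarrow> (nat \<Rightarrow> nat) \<Rightarrow> nat \<Rightarrow> nat \<Rightarrow> nat \<Rightarrow> real" where
  "chart_matrix N L p k = elims N (map (\<lambda>j. std (p j)) [0..<k]) (flag_sum L (Suc k))"

text \<open>If \<open>v k\<close> were in the span of its predecessors, eliminating the
  \<open>k\<close> earlier pivots from that span would leave a matrix of rank zero with
  \<open>v k\<close> in its range, contrary to \<open>v k (p k) = 1\<close>.\<close>

lemma chart_nondeg: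
  assumes p: "\<And>k. k < m \<Longrightarrow> p k < N"
    and v: "\<And>k. k < m \<Longrightarrow> v k (p k) = 1" "\<And>j k. j < k \<Longrightarrow> k < m \<Longrightarrow> v k (p j) = 0"
    and k: "k < m"
  shows "gs_nondeg N v k"
  using k
proof (induction k rule: less_induct)
  case (less k)
  have nd: "gs_nondeg N v j" if "j < k" for j using less that by simp
  let ?L = "gs_line N v"
  obtain c where c: "scaled_projection N (gs_proj N v k) c (real N - real k)"
    "\<forall>i<N. \<forall>j<N. gs_proj N v k i j = c * (std i j - flag_sum ?L k i j)"
    using gs_proj_props[of k N v] nd by auto
  show ?case
  proof (rule ccontr)
    assume "\<not> gs_nondeg N v k"
    then have "eig N (gs_proj N v k) 0 (v k)"
      using ip_app_eq_0[OF c(1)] by (simp add: gs_nondeg_def gs_vec_def)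
    then have ek: "eig N (flag_sum ?L k) 1 (v k)"
      using app_gs_proj[OF c(2)] scaled_projectionD(1)[OF c(1)] by (simp add: eig_def)
    have L: "line_flag N k (\<lambda>_. N) ?L" by (rule gs_line_flag) (use nd in auto)
    have ej: "eig N (flag_sum ?L k) 1 (v j)" if "j < k" for j
      by (rule flag_sum_mono_eig[OF L gs_span]) (use nd that in auto)
    let ?Q = "elims N (map (\<lambda>j. std (p j)) [0..<k]) (flag_sum ?L k)"
    obtain c' where c': "scaled_projection N ?Q c' (real k - real k)"
      "\<And>u. eig N (flag_sum ?L k) 1 u \<Longrightarrow> (\<forall>j<k. u (p j) = 0) \<Longrightarrow> eig N ?Q c' u"
      using elims_echelon[OF scaled_projection_flag_sum[OF L order_refl], of k p v] ej p v less.prems by force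
    have "eig N ?Q c' (v k)" using c'(2)[OF ek] v(2) less.prems by simp
    moreover have "app N ?Q (v k) (p k) = 0"
      unfolding app_def using scaled_projection_rank_0[of N ?Q c'] c'(1) p[OF less.prems] by simp
    ultimately show False using v(1)[OF less.prems] p[OF less.prems] scaled_projectionD(1)[OF c'(1)]
      by (simp add: eig_def)
  qed
qed

text \<open>The vector \<open>v k\<close> survives the elimination of the earlier pivots, so it
  spans the remaining line and the matrix is a multiple of \<open>v_k v_k^T\<close>. Hence the
  coordinates of a chart invert its parametrization.\<close>

lemma chart_matrix_gs_line:
  assumes p: "\<And>k. k < m \<Longrightarrow> p k < N"
    and v: "\<And>k. k < m \<Longrightarrow> v k (p k) = 1" "\<And>j k. j < k \<Longrightarrow> k < m \<Longrightarrow> v k (p j) = 0"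
    and k: "k < m"
  shows "chart_matrix N (gs_line N v) p k (p k) (p k) \<noteq> 0"
    and "i < N \<Longrightarrow> chart_matrix N (gs_line N v) p k i (p k) / chart_matrix N (gs_line N v) p k (p k) (p k) = v k i"
proof -
  let ?L = "gs_line N v" and ?Q = "chart_matrix N (gs_line N v) p k"
  have nd: "gs_nondeg N v j" if "j < m" for j by (rule chart_nondeg[where p = p and v = v]) (use p v that in auto)
  have L: "line_flag N (Suc k) (\<lambda>_. N) ?L" by (rule gs_line_flag) (use nd k in auto)
  have ej: "eig N (flag_sum ?L (Suc k)) 1 (v j)" if "j \<le> k" for j
    by (rule flag_sum_mono_eig[OF L gs_span]) (use nd that k in auto)
  obtain c' where c': "scaled_projection N ?Q c' (real (Suc k) - real k)"
    "\<And>u. eig N (flag_sum ?L (Suc k)) 1 u \<Longrightarrow> (\<forall>j<k. u (p j) = 0) \<Longrightarrow> eig N ?Q c' u"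
    using elims_echelon[OF scaled_projection_flag_sum[OF L order_refl], of k p v] ej p v k
    unfolding chart_matrix_def by force
  have ek: "eig N ?Q c' (v k)" using c'(2)[OF ej] v(2) k by simp
  have vk: "ip N (v k) (v k) \<noteq> 0" using v(1)[OF k] p[OF k] by (auto simp: ip_self_eq_0)
  have Q: "?Q i j = c' * v k i * v k j / ip N (v k) (v k)" if "i < N" "j < N" for i j
    by (rule scaled_projection_rank_1[OF _ ek vk that]) (use c'(1) in simp)
  have c0: "c' \<noteq> 0" using scaled_projectionD(1)[OF c'(1)] by simp
  show "?Q (p k) (p k) \<noteq> 0" using Q p[OF k] v(1)[OF k] c0 vk by simp
  show "i < N \<Longrightarrow> ?Q i (p k) / ?Q (p k) (p k) = v k i" using Q p[OF k] v(1)[OF k] c0 vk by simp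
qed

text \<open>The converse: for any flag with nonzero pivot entries the normalized columns form an
  echelon basis of it. Eliminated coordinates and coordinates from \<open>a k\<close> on belong to
  the kernel of the matrix, so by symmetry they vanish in its columns.\<close>

lemma chart_vectors:
  assumes L: "line_flag N m a L" and mono: "\<forall>k<m. \<forall>j\<le>k. a j \<le> a k"
    and p: "\<forall>k<n. p k < N \<and> chart_matrix N L p k (p k) (p k) \<noteq> 0" and n: "n \<le> m"
    and v: "v = (\<lambda>k i. chart_matrix N L p k i (p k) / chart_matrix N L p k (p k) (p k))"
    and k: "k < n"
  shows "v k (p k) = 1" "j < k \<Longrightarrow> v k (p j) = 0" "a k \<le> i \<Longrightarrow> i < N \<Longrightarrow> v k i = 0"
    "eig N (flag_sum L (Suc k)) 1 (v k)"
proof -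
  let ?Q = "chart_matrix N L p k"
  have pk: "p k < N \<and> chart_matrix N L p k (p k) (p k) \<noteq> 0" if "k < n" for k using p that by simp
  have Y: "scaled_projection N (flag_sum L (Suc k)) 1 (real (Suc k))"
    by (rule scaled_projection_flag_sum[OF L]) (use k n in simp)
  note sym = scaled_projectionD(2)[OF Y]
  have symQ: "symm N ?Q" unfolding chart_matrix_def by (rule symm_elims[OF sym])
  show "v k (p k) = 1" using pk[OF k] v by simp
  show "v k (p j) = 0" if "j < k"
  proof -
    have "eig N ?Q 0 (std (p j))" unfolding chart_matrix_def by (rule eig_elims_mem[OF sym]) (use that in auto)
    then have "?Q (p k) (p j) = 0" using pk[of j] pk[of k] k that by (simp add: eig_std_0)
    then have "?Q (p j) (p k) = 0" using symQ pk[of j] pk[of k] k that by (simp add: symm_def)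
    then show ?thesis by (simp add: v)
  qed
  show "v k i = 0" if "a k \<le> i" "i < N"
  proof -
    have "eig N (flag_sum L (Suc k)) 0 (std i)"
    proof (rule flag_sum_support[OF L])
      fix l assume "l < Suc k"
      then have "a l \<le> a k" using mono k n by simp
      then show "a l \<le> i" using that by simp
    qed (use k n that in auto)
    then have "eig N ?Q 0 (std i)" unfolding chart_matrix_def by (rule eig_elims_0[OF sym])
    then have "?Q (p k) i = 0" using pk[of k] k that by (simp add: eig_std_0)
    then have "?Q i (p k) = 0" using symQ pk[of k] k that by (simp add: symm_def)
    then show ?thesis by (simp add: v)
  qed
  have "range_in N (flag_sum L (Suc k)) ?Q"
    unfolding chart_matrix_def by (rule range_in_elims[OF range_in_self[OF Y]])
  then have "eig N (flag_sum L (Suc k)) 1 (app N ?Q (std (p k)))" by (simp add: range_in_def)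
  moreover have "app N ?Q (std (p k)) = (\<lambda>i. ?Q i (p k))"
    using pk[OF k] by (simp add: app_std fun_eq_iff)
  ultimately have e: "app N (flag_sum L (Suc k)) (\<lambda>i. ?Q i (p k)) i = ?Q i (p k)" if "i < N" for i
    using that by (simp add: eig_def)
  have "v k = (\<lambda>i. (1 / ?Q (p k) (p k)) * ?Q i (p k))" by (rule ext) (simp add: v)
  then show "eig N (flag_sum L (Suc k)) 1 (v k)"
    unfolding eig_def using app_scale[of N _ "1 / ?Q (p k) (p k)" "\<lambda>i. ?Q i (p k)"] e by simp
qed

text \<open>Gram-Schmidt recovers a flag from vectors adapted to it, because inductively
  \<open>gs_vec N v k\<close> is a multiple of \<open>L k\<close> applied to \<open>v k\<close>.
  That \<open>v k\<close> leaves the previous member of the flag is offered in two forms: the first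
  is at hand for echelon vectors, the second for columns of the \<open>L k\<close>.\<close>

lemma gs_line_eq:
  assumes L: "line_flag N m a L"
    and span: "\<forall>k<m. eig N (flag_sum L (Suc k)) 1 (v k)"
    and nz: "\<forall>k<m. gs_nondeg N v k \<or> (\<exists>i<N. app N (L k) (v k) i \<noteq> 0)"
    and k: "k < m"
  shows "gs_nondeg N v k \<and> (\<forall>i<N. \<forall>j<N. gs_line N v k i j = L k i j)"
  using k
proof (induction k rule: less_induct)
  case (less k)
  obtain c where c: "scaled_projection N (gs_proj N v k) c (real N - real k)"
    "\<forall>i<N. \<forall>j<N. gs_proj N v k i j = c * (std i j - flag_sum (gs_line N v) k i j)"
    using gs_proj_props[of k N v] less by fastforce
  have c0: "c \<noteq> 0" using scaled_projectionD(1)[OF c(1)] by simp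
  have P: "scaled_projection N (L k) 1 1" using L less.prems by (simp add: line_flag_def)
  have Yeq: "app N (flag_sum (gs_line N v) k) u i = app N (flag_sum L k) u i" if "i < N" for u i
    unfolding app_def flag_sum_def using less that by (intro sum.cong refl) simp
  have w: "gs_vec N v k i = c * app N (L k) (v k) i" if i: "i < N" for i
  proof -
    have "app N (flag_sum L (Suc k)) (v k) i = v k i"
      using span less.prems i by (simp add: eig_def)
    then have "v k i - app N (flag_sum L k) (v k) i = app N (L k) (v k) i" by (simp add: app_flag_sum)
    then show ?thesis using app_gs_proj[OF c(2) i, of "v k"] Yeq[OF i] by (simp add: gs_vec_def)
  qed
  have nd: "gs_nondeg N v k"
  proof (rule ccontr)
    assume n: "\<not> gs_nondeg N v k"
    have "ip N (v k) (gs_vec N v k) = c * ip N (v k) (app N (L k) (v k))"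
      unfolding ip_scale[symmetric] by (rule ip_cong) (rule w)
    then have "eig N (L k) 0 (v k)" using n c0 ip_app_eq_0[OF P] by (simp add: gs_nondeg_def)
    then show False using nz n less.prems by (auto simp: eig_def)
  qed
  have e: "eig N (L k) 1 (gs_vec N v k)"
    unfolding eig_def
  proof (intro allI impI)
    fix i assume i: "i < N"
    have "app N (L k) (gs_vec N v k) i = app N (L k) (\<lambda>i. c * app N (L k) (v k) i) i"
      by (rule app_cong) (rule w)
    then show "app N (L k) (gs_vec N v k) i = 1 * gs_vec N v k i"
      using app_app[OF P, of "v k"] i w[OF i] by (simp add: app_scale eig_def)
  qed
  have ww: "ip N (gs_vec N v k) (gs_vec N v k) \<noteq> 0"
    using gs_vec_self[of k N v] nd less unfolding gs_nondeg_def by fastforce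
  show ?case using nd scaled_projection_rank_1[OF P e ww] by (simp add: gs_line_def rank1_def)
qed

text \<open>After the elimination of the pivots already found, the next member of the flag has rank
  one left, hence a nonzero diagonal entry. Its index is below \<open>a n\<close> and differs from
  the earlier pivots, because all those coordinates lie in the kernel.\<close>

lemma ex_pivots:
  assumes L: "line_flag N m a L" and mono: "\<forall>k<m. \<forall>j\<le>k. a j \<le> a k" and n: "n \<le> m"
  shows "\<exists>p. (\<forall>k<n. p k < N \<and> p k < a k \<and> chart_matrix N L p k (p k) (p k) \<noteq> 0) \<and> inj_on p {..<n}"
  using n
proof (induction n)
  case 0
  show ?case by simp
next
  case (Suc n)
  then obtain p where p: "\<forall>k<n. p k < N \<and> p k < a k \<and> chart_matrix N L p k (p k) (p k) \<noteq> 0"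
    and inj: "inj_on p {..<n}" by auto
  define v where "v = (\<lambda>k i. chart_matrix N L p k i (p k) / chart_matrix N L p k (p k) (p k))"
  have p': "\<forall>k<n. p k < N \<and> chart_matrix N L p k (p k) (p k) \<noteq> 0" using p by simp
  note cv = chart_vectors[OF L mono p' Suc_leD[OF Suc.prems] v_def]
  have Y: "scaled_projection N (flag_sum L (Suc n)) 1 (real (Suc n))"
    by (rule scaled_projection_flag_sum[OF L Suc.prems])
  note sym = scaled_projectionD(2)[OF Y]
  have ej: "eig N (flag_sum L (Suc n)) 1 (v j)" if "j < n" for j
    by (rule flag_sum_mono_eig[OF L cv(4)[OF that]]) (use that Suc.prems in auto)
  let ?Q = "chart_matrix N L p n"
  obtain c' where c': "scaled_projection N ?Q c' (real (Suc n) - real n)"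
    using elims_echelon[OF Y, of n p v] ej p cv(1,2) unfolding chart_matrix_def by force
  obtain i where i: "i < N" "?Q i i \<noteq> 0" using ex_diag_nonzero[OF c'] by auto
  have "i < a n"
  proof (rule ccontr)
    assume "\<not> i < a n"
    then have "eig N (flag_sum L (Suc n)) 0 (std i)"
    proof (intro flag_sum_support[OF L])
      assume i': "\<not> i < a n"
      fix l assume "l < Suc n"
      then have "a l \<le> a n" using mono Suc.prems by simp
      then show "a l \<le> i" using i' by simp
    qed (use Suc.prems i in auto)
    then have "eig N ?Q 0 (std i)" unfolding chart_matrix_def by (rule eig_elims_0[OF sym])
    then show False using i by (simp add: eig_std_0)
  qed
  moreover have "p j \<noteq> i \<and> i \<noteq> p j" if j: "j < n" for j
  proof (rule ccontr)
    assume "\<not> (p j \<noteq> i \<and> i \<noteq> p j)"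
    then have "p j = i" by blast
    have "eig N ?Q 0 (std (p j))" unfolding chart_matrix_def by (rule eig_elims_mem[OF sym]) (use j in auto)
    then show False using i \<open>p j = i\<close> by (simp add: eig_std_0)
  qed
  moreover define q where "q = p(n := i)"
  have q: "q n = i" "\<And>k. k < n \<Longrightarrow> q k = p k" by (simp_all add: q_def)
  have "chart_matrix N L q k = chart_matrix N L p k" if "k \<le> n" for k
  proof -
    have "map (\<lambda>j. std (q j)) [0..<k] = map (\<lambda>j. std (p j)) [0..<k]"
      using that q(2) by (auto intro: map_cong)
    then show ?thesis unfolding chart_matrix_def by (simp only:)
  qed
  ultimately show ?case using p inj i q
    by (intro exI[of _ q]) (auto simp: less_Suc_eq lessThan_Suc inj_on_def)
qed

section \<open>Points encoding tuples of matrices\<close>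

text \<open>Block \<open>0\<close> occupies the first \<open>N^2\<close> coordinates in the
  row-major order of \<open>flatten_mat\<close>, so the projection onto the first factor of the
  ambient space reads off this block.\<close>

definition block :: "nat \<Rightarrow> real vec \<Rightarrow> nat \<Rightarrow> nat \<Rightarrow> nat \<Rightarrow> real" where
  "block N x b i j = x $ (b * N^2 + (i * N + j))"

definition from_blocks :: "nat \<Rightarrow> nat \<Rightarrow> (nat \<Rightarrow> nat \<Rightarrow> nat \<Rightarrow> real) \<Rightarrow> real vec" where
  "from_blocks N B F = vec (B * N^2) (\<lambda>n. F (n div N^2) (n mod N^2 div N) (n mod N))"

lemma matrix_index_less: "i < N \<Longrightarrow> j < N \<Longrightarrow> i * N + j < (N::nat)^2"
proof -
  assume "i < N" "j < N"
  then have "i * N + j < i * N + N" "Suc i * N \<le> N * N" by (simp, intro mult_le_mono1, simp)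
  then show ?thesis by (simp add: power2_eq_square)
qed

lemma block_index_less:
  fixes b B :: nat
  assumes "b < B" "i < N" "j < N"
  shows "b * N^2 + (i * N + j) < B * N^2"
proof -
  have "b * N^2 + (i * N + j) < Suc b * N^2" using matrix_index_less[OF assms(2,3)] by simp
  also have "\<dots> \<le> B * N^2" using assms(1) by (intro mult_le_mono1) simp
  finally show ?thesis .
qed

lemma from_blocks_carrier [simp]: "from_blocks N B F \<in> carrier_vec (B * N^2)"
  by (simp add: from_blocks_def)

lemma block_from_blocks:
  assumes "b < B" "i < N" "j < N"
  shows "block N (from_blocks N B F) b i j = F b i j"
proof -
  let ?n = "b * N^2 + (i * N + j)"
  have r: "i * N + j < N^2" by (rule matrix_index_less[OF assms(2,3)])
  have N: "N \<noteq> 0" using assms(3) by simp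
  have "?n div N^2 = b" "?n mod N^2 = i * N + j"
    using r div_mult_self3[of "N^2" b "i * N + j"] N by simp_all
  moreover have "?n mod N = j" using assms(3) by (simp add: power2_eq_square mod_add_right_eq flip: mult.assoc)
  ultimately show ?thesis
    using block_index_less[OF assms] assms(3) by (simp add: block_def from_blocks_def)
qed

lemma block_index_decomp:
  assumes "n < B * (N::nat)^2"
  shows "n = (n div N^2) * N^2 + ((n mod N^2 div N) * N + n mod N)" "n div N^2 < B" "n mod N^2 div N < N" "n mod N < N"
proof -
  have N: "0 < N" using assms by (cases N) auto
  have "n mod N^2 mod N = n mod N" by (simp add: power2_eq_square mod_mult2_eq)
  then have "n mod N^2 = (n mod N^2 div N) * N + n mod N" by (metis div_mult_mod_eq)
  then show "n = (n div N^2) * N^2 + ((n mod N^2 div N) * N + n mod N)" by (metis div_mult_mod_eq)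
  show "n div N^2 < B" using assms by (simp add: less_mult_imp_div_less)
  have "n mod N^2 < N * N" using N by (simp add: power2_eq_square)
  then show "n mod N^2 div N < N" by (rule less_mult_imp_div_less)
  show "n mod N < N" using N by simp
qed

lemma index_eq_block:
  "n < B * N^2 \<Longrightarrow> x $ n = block N x (n div N^2) (n mod N^2 div N) (n mod N)"
  using block_index_decomp(1)[of n B N] by (simp add: block_def)

lemma eq_from_blocksI:
  assumes "x \<in> carrier_vec (B * N^2)" "\<And>b i j. b < B \<Longrightarrow> i < N \<Longrightarrow> j < N \<Longrightarrow> block N x b i j = F b i j"
  shows "x = from_blocks N B F"
proof (rule eq_vecI)
  fix n assume "n < dim_vec (from_blocks N B F)"
  then have n: "n < B * N^2" by (simp add: from_blocks_def)
  note d = block_index_decomp(2-4)[OF n]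
  have "x $ n = block N x (n div N^2) (n mod N^2 div N) (n mod N)" by (rule index_eq_block[OF n])
  then show "x $ n = from_blocks N B F $ n"
    using assms(2)[OF d] n by (simp add: from_blocks_def)
qed (use assms(1) in \<open>simp add: from_blocks_def\<close>)

lemma sum_lessThan_mult: "(\<Sum>n<B * C. f n) = (\<Sum>b<B. \<Sum>r<C. f (b * C + r :: nat))"
proof (induction B)
  case (Suc B)
  have "(\<Sum>n<Suc B * C. f n) = (\<Sum>n<B * C. f n) + (\<Sum>n\<in>{B * C..<B * C + C}. f n)"
    by (simp add: lessThan_atLeast0 add.commute sum.atLeastLessThan_concat)
  also have "(\<Sum>n\<in>{B * C..<B * C + C}. f n) = (\<Sum>r<C. f (B * C + r))"
    using sum.shift_bounds_nat_ivl[of f 0 "B * C" C] by (simp add: lessThan_atLeast0 add.commute)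
  finally show ?case using Suc by simp
qed simp

lemma sum_squares_blocks:
  "(\<Sum>n<B * N^2. (x $ n)^2) = (\<Sum>b<B. \<Sum>i<N. \<Sum>j<N. (block N x b i j)^2)"
  unfolding sum_lessThan_mult power2_eq_square[of N] by (simp add: block_def power2_eq_square)

lemma polyfun_block: "b < B \<Longrightarrow> i < N \<Longrightarrow> j < N \<Longrightarrow> is_subring K \<Longrightarrow> polyfun K (B * N^2) (\<lambda>x. block N x b i j)"
  unfolding block_def by (intro polyfun_index block_index_less)

section \<open>Rationality of elimination and orthogonalization\<close>

context
  fixes K :: "real set" and n N :: nat
  assumes K: "is_subring K"
begin

lemma polyfun_ip: "(\<And>i. i < N \<Longrightarrow> polyfun K n (\<lambda>x. u x i)) \<Longrightarrow> (\<And>i. i < N \<Longrightarrow> polyfun K n (\<lambda>x. v x i)) \<Longrightarrow>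
  polyfun K n (\<lambda>x. ip N (u x) (v x))"
  unfolding ip_def by (intro polyfun_sum polyfun_mult K) auto

lemma polyfun_app: "(\<And>i j. i < N \<Longrightarrow> j < N \<Longrightarrow> polyfun K n (\<lambda>x. Q x i j)) \<Longrightarrow>
  (\<And>i. i < N \<Longrightarrow> polyfun K n (\<lambda>x. v x i)) \<Longrightarrow> i < N \<Longrightarrow> polyfun K n (\<lambda>x. app N (Q x) (v x) i)"
  unfolding app_def by (intro polyfun_sum polyfun_mult K) auto

lemma polyfun_std: "polyfun K n (\<lambda>x. std i j)"
  unfolding std_def using K by (auto intro: polyfun_01)

lemma polyfun_elims:
  assumes "\<And>w i. w \<in> set ws \<Longrightarrow> i < N \<Longrightarrow> polyfun K n (\<lambda>x. w x i)"
    and "\<And>i j. i < N \<Longrightarrow> j < N \<Longrightarrow> polyfun K n (\<lambda>x. Q x i j)" "i < N" "j < N"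
  shows "polyfun K n (\<lambda>x. elims N (map (\<lambda>w. w x) ws) (Q x) i j)"
  using assms
proof (induction ws arbitrary: Q)
  case (Cons w ws)
  have w: "polyfun K n (\<lambda>x. w x i)" if "i < N" for i using Cons.prems(1) that by simp
  have "polyfun K n (\<lambda>x. elim N (w x) (Q x) i j)" if "i < N" "j < N" for i j
    unfolding elim_def using that
    by (intro polyfun_diff polyfun_mult polyfun_ip polyfun_app w Cons.prems(2) K) auto
  then show ?case using Cons by simp
qed simp

lemma polyfun_gs_proj:
  assumes "\<And>k i. k < m \<Longrightarrow> i < N \<Longrightarrow> polyfun K n (\<lambda>x. v x k i)" "k < m" "i < N" "j < N"
  shows "polyfun K n (\<lambda>x. gs_proj N (v x) k i j)"
proof -
  have "polyfun K n (\<lambda>x. elims N (map (\<lambda>w. w x) (map (\<lambda>j x. v x j) [0..<k])) std i j)"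
    by (rule polyfun_elims) (use assms polyfun_std in auto)
  then show ?thesis by (simp add: gs_proj_def comp_def)
qed

lemma polyfun_gs_vec:
  assumes "\<And>k i. k < m \<Longrightarrow> i < N \<Longrightarrow> polyfun K n (\<lambda>x. v x k i)" "k < m" "i < N"
  shows "polyfun K n (\<lambda>x. gs_vec N (v x) k i)"
  unfolding gs_vec_def by (intro polyfun_app polyfun_gs_proj[of m]) (use assms in auto)

lemma ratfun_gs_line:
  assumes "\<And>k i. k < m \<Longrightarrow> i < N \<Longrightarrow> polyfun K n (\<lambda>x. v x k i)" "k < m" "i < N" "j < N"
    and S: "\<And>x k. x \<in> S \<Longrightarrow> k < m \<Longrightarrow> gs_nondeg N (v x) k"
  shows "ratfun K n S (\<lambda>x. gs_line N (v x) k i j)"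
  unfolding gs_line_def rank1_def
proof (intro ratfun_divide ratfun_mult ratfun_polyfun polyfun_ip polyfun_gs_vec[of m] K)
  fix x assume "x \<in> S"
  then show "ip N (gs_vec N (v x) k) (gs_vec N (v x) k) \<noteq> 0"
    using gs_vec_self[of k N "v x"] S assms(2) unfolding gs_nondeg_def by fastforce
qed (use assms in auto)

lemma polyfun_chart_matrix:
  assumes "\<And>k i j. k < m \<Longrightarrow> i < N \<Longrightarrow> j < N \<Longrightarrow> polyfun K n (\<lambda>x. L x k i j)" "k < m" "i < N" "j < N"
  shows "polyfun K n (\<lambda>x. chart_matrix N (L x) p k i j)"
proof -
  have "polyfun K n (\<lambda>x. flag_sum (L x) (Suc k) i j)" if "i < N" "j < N" for i j
    unfolding flag_sum_def by (intro polyfun_sum assms(1) K) (use assms(2) that in auto)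
  then have "polyfun K n (\<lambda>x. elims N (map (\<lambda>w. w x) (map (\<lambda>j x. std (p j)) [0..<k])) (flag_sum (L x) (Suc k)) i j)"
    by (intro polyfun_elims) (use assms polyfun_std in auto)
  then show ?thesis by (simp add: chart_matrix_def comp_def)
qed

end

section \<open>Dependence on the matrix entries below \<open>N\<close> only\<close>

lemma elims_cong:
  assumes "\<And>i j. i < N \<Longrightarrow> j < N \<Longrightarrow> Q i j = Q' i j" "i < N" "j < N"
  shows "elims N ws Q i j = elims N ws Q' i j"
  using assms
proof (induction ws arbitrary: Q Q')
  case (Cons w ws)
  have app: "app N Q w i = app N Q' w i" if "i < N" for i
    unfolding app_def using Cons.prems(1) that by simp
  then have "ip N w (app N Q w) = ip N w (app N Q' w)" by (rule ip_cong)
  then have "elim N w Q i j = elim N w Q' i j" if "i < N" "j < N" for i j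
    using app that Cons.prems(1) by (simp add: elim_def)
  then show ?case using Cons.IH[of "elim N w Q" "elim N w Q'"] Cons.prems(2,3) by simp
qed simp

lemma chart_matrix_cong:
  assumes "\<And>k i j. k < m \<Longrightarrow> i < N \<Longrightarrow> j < N \<Longrightarrow> L k i j = L' k i j" "k < m" "i < N" "j < N"
  shows "chart_matrix N L p k i j = chart_matrix N L' p k i j"
  unfolding chart_matrix_def by (rule elims_cong) (use assms in \<open>auto simp: flag_sum_def\<close>)

lemma scaled_projection_cong:
  assumes "\<And>i j. i < N \<Longrightarrow> j < N \<Longrightarrow> Q i j = Q' i j" "scaled_projection N Q c r"
  shows "scaled_projection N Q' c r"
proof -
  have "(\<Sum>l<N. Q i l * Q l j) = (\<Sum>l<N. Q' i l * Q' l j)" if "i < N" "j < N" for i j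
    using assms(1) that by simp
  moreover have "(\<Sum>i<N. Q i i) = (\<Sum>i<N. Q' i i)" using assms(1) by simp
  moreover have "Q' i j = Q' j i" if "i < N" "j < N" for i j
    using assms(1)[OF that] assms(1)[OF that(2,1)] scaled_projectionD(2)[OF assms(2)] that
    unfolding symm_def by metis
  ultimately show ?thesis
    using assms(1) scaled_projectionD[OF assms(2)] by (simp add: scaled_projection_def symm_def)
qed

lemma line_flag_cong:
  assumes "\<And>k i j. k < m \<Longrightarrow> i < N \<Longrightarrow> j < N \<Longrightarrow> L k i j = L' k i j" "line_flag N m a L"
  shows "line_flag N m a L'"
  unfolding line_flag_def
proof (intro conjI allI impI)
  fix k assume k: "k < m"
  show "scaled_projection N (L' k) 1 1"
    by (rule scaled_projection_cong[of N "L k"]) (use assms k in \<open>auto simp: line_flag_def\<close>)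
  fix l i j assume "l < k" "i < N" "j < N"
  then show "(\<Sum>s<N. L' k i s * L' l s j) = 0"
    using assms k by (simp add: line_flag_def flip: assms(1))
next
  fix k i assume "k < m" "i < N" "a k \<le> i"
  then show "L' k i i = 0" using assms by (simp add: line_flag_def flip: assms(1))
qed

section \<open>The variety of flags\<close>

text \<open>For a partition, \<open>a k\<close> is \<open>n + Suc k - lam (Suc k)\<close>: its
  strict growth expresses that the parts decrease weakly, and \<open>k < a k\<close> that they are
  at most \<open>n\<close>.\<close>

locale flag_shape =
  fixes N m :: nat and a :: "nat \<Rightarrow> nat"
  assumes a_le: "k < m \<Longrightarrow> a k \<le> N" and a_strict: "j < k \<Longrightarrow> k < m \<Longrightarrow> a j < a k"
    and a_gt: "k < m \<Longrightarrow> k < a k"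
begin

text \<open>The shift leaves block \<open>0\<close> to the projection onto the last member of the
  flag.\<close>

abbreviation "lines x \<equiv> \<lambda>k. block N x (Suc k)"

definition flag_condition :: "real vec \<Rightarrow> bool" where
  "flag_condition x \<longleftrightarrow> line_flag N m a (lines x) \<and>
     (\<forall>i<N. \<forall>j<N. block N x 0 i j = flag_sum (lines x) m i j)"

definition flags :: "real vec set" where
  "flags = {x \<in> carrier_vec (Suc m * N^2). flag_condition x}"

definition flag_point :: "(nat \<Rightarrow> nat \<Rightarrow> nat \<Rightarrow> real) \<Rightarrow> real vec" where
  "flag_point L = from_blocks N (Suc m) (\<lambda>b. if b = 0 then flag_sum L m else L (b - 1))"

text \<open>The echelon vector \<open>k\<close> has \<open>a k\<close> possible entries, of which
  the \<open>k + 1\<close> at the pivots \<open>p 0, ..., p k\<close> are prescribed.\<close>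

definition chart_dim :: nat where
  "chart_dim = (\<Sum>k<m. a k - Suc k)"

lemma a_mono: "\<forall>k<m. \<forall>j\<le>k. a j \<le> a k"
  using a_strict by (auto simp: le_less less_imp_le)

lemma a_le_a: "j \<le> k \<Longrightarrow> k < m \<Longrightarrow> a j \<le> a k"
  using a_mono by blast

lemma rational_condition_flag: "rational_condition (Suc m * N^2) flag_condition"
proof -
  have b: "polyfun \<rat> (Suc m * N^2) (\<lambda>x. block N x b i j)" if "b < Suc m" "i < N" "j < N" for b i j
    by (rule polyfun_block) (use that in auto)
  have "rational_condition (Suc m * N^2) (\<lambda>x. flag_condition x)"
    unfolding flag_condition_def line_flag_def scaled_projection_def symm_def flag_sum_def
    by (intro rational_condition_conj rational_condition_less rational_condition_imp rational_condition_eq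
        polyfun_sum polyfun_mult polyfun_const b)
      (auto simp: rational_condition_True)
  then show ?thesis by simp
qed

lemma flag_point_carrier: "flag_point L \<in> carrier_vec (Suc m * N^2)"
  unfolding flag_point_def by (rule from_blocks_carrier)

lemma lines_flag_point: "k < m \<Longrightarrow> i < N \<Longrightarrow> j < N \<Longrightarrow> lines (flag_point L) k i j = L k i j"
  unfolding flag_point_def by (subst block_from_blocks) auto

lemma block_0_flag_point: "i < N \<Longrightarrow> j < N \<Longrightarrow> block N (flag_point L) 0 i j = flag_sum L m i j"
  unfolding flag_point_def by (subst block_from_blocks) auto

lemma flag_point_in_flags:
  assumes "line_flag N m a L"
  shows "flag_point L \<in> flags"
proof -
  have "line_flag N m a (lines (flag_point L))"
    by (rule line_flag_cong[OF _ assms]) (simp add: lines_flag_point)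
  moreover have "block N (flag_point L) 0 i j = flag_sum (lines (flag_point L)) m i j" if "i < N" "j < N" for i j
    using that by (simp add: block_0_flag_point) (simp add: flag_sum_def lines_flag_point)
  ultimately show ?thesis unfolding flags_def flag_condition_def using flag_point_carrier by blast
qed

lemma flags_eq_flag_point:
  assumes x: "x \<in> flags" and L: "\<And>k i j. k < m \<Longrightarrow> i < N \<Longrightarrow> j < N \<Longrightarrow> lines x k i j = L k i j"
  shows "x = flag_point L"
  unfolding flag_point_def
proof (rule eq_from_blocksI)
  show "x \<in> carrier_vec (Suc m * N^2)" using x by (simp add: flags_def)
  fix b i j assume b: "b < Suc m" "i < N" "j < N"
  show "block N x b i j = (if b = 0 then flag_sum L m else L (b - 1)) i j"
  proof (cases b)
    case 0
    then show ?thesis using x b L by (simp add: flags_def flag_condition_def) (simp add: flag_sum_def)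
  next
    case (Suc k)
    then show ?thesis using L[of k i j] b by simp
  qed
qed

lemma ratfun_flag_point:
  assumes K: "is_subring K"
    and L: "\<And>k i j. k < m \<Longrightarrow> i < N \<Longrightarrow> j < N \<Longrightarrow> ratfun K n S (\<lambda>x. L x k i j)"
    and r: "r < Suc m * N^2"
  shows "ratfun K n S (\<lambda>x. flag_point (L x) $ r)"
proof -
  let ?b = "r div N^2" and ?i = "r mod N^2 div N" and ?j = "r mod N"
  note d = block_index_decomp(2-4)[OF r]
  have eq: "flag_point (L x) $ r = (if ?b = 0 then flag_sum (L x) m ?i ?j else L x (?b - 1) ?i ?j)" for x
    unfolding flag_point_def from_blocks_def using r by simp
  show ?thesis
  proof (cases "?b = 0")
    case True
    have "ratfun K n S (\<lambda>x. flag_sum (L x) m ?i ?j)"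
      unfolding flag_sum_def by (intro ratfun_sum L d K) auto
    then show ?thesis by (simp add: eq True)
  next
    case False
    then have "ratfun K n S (\<lambda>x. L x (?b - 1) ?i ?j)" using d by (intro L) auto
    then show ?thesis by (simp add: eq False)
  qed
qed

definition chart_index_set :: "(nat \<Rightarrow> nat) \<Rightarrow> (nat \<times> nat) set" where
  "chart_index_set p = Sigma {..<m} (\<lambda>k. {..<a k} - p ` {..k})"

definition chart_index :: "(nat \<Rightarrow> nat) \<Rightarrow> nat \<times> nat \<Rightarrow> nat" where
  "chart_index p = (SOME e. bij_betw e (chart_index_set p) {..<chart_dim})"

definition chart_vector :: "(nat \<Rightarrow> nat) \<Rightarrow> real vec \<Rightarrow> nat \<Rightarrow> nat \<Rightarrow> real" where
  "chart_vector p t k i = (if i = p k then 1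
     else if (k, i) \<in> chart_index_set p then t $ chart_index p (k, i) else 0)"

definition chart :: "(nat \<Rightarrow> nat) \<Rightarrow> real vec \<Rightarrow> real vec" where
  "chart p t = flag_point (gs_line N (chart_vector p t))"

definition chart_coord :: "(nat \<Rightarrow> nat) \<Rightarrow> real vec \<Rightarrow> nat \<Rightarrow> real" where
  "chart_coord p x r = (let (k, i) = the_inv_into (chart_index_set p) (chart_index p) r
     in chart_matrix N (lines x) p k i (p k) / chart_matrix N (lines x) p k (p k) (p k))"

definition pivots :: "(nat \<Rightarrow> nat) \<Rightarrow> bool" where
  "pivots p \<longleftrightarrow> (\<forall>k<m. p k < a k) \<and> inj_on p {..<m}"

lemma pivot_less: "pivots p \<Longrightarrow> k < m \<Longrightarrow> p k < N"
  using a_le by (fastforce simp: pivots_def)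

lemma chart_index_bij:
  assumes p: "pivots p"
  shows "bij_betw (chart_index p) (chart_index_set p) {..<chart_dim}"
proof -
  have fin: "finite (chart_index_set p)" unfolding chart_index_set_def by auto
  have "card ({..<a k} - p ` {..k}) = a k - Suc k" if k: "k < m" for k
  proof -
    have "p ` {..k} \<subseteq> {..<a k}"
    proof (rule image_subsetI)
      fix j assume "j \<in> {..k}"
      then have "p j < a j" "a j \<le> a k" using p k a_le_a[of j k] by (simp_all add: pivots_def)
      then show "p j \<in> {..<a k}" by simp
    qed
    moreover have "card (p ` {..k}) = Suc k"
    proof -
      have "{..k} \<subseteq> {..<m}" using k by auto
      then have "inj_on p {..k}" using p inj_on_subset unfolding pivots_def by blast
      then show ?thesis by (simp add: card_image)
    qed
    ultimately show ?thesis by (simp add: card_Diff_subset)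
  qed
  then have "card (chart_index_set p) = chart_dim"
    unfolding chart_index_set_def chart_dim_def by (subst card_SigmaI) auto
  then have "\<exists>e. bij_betw e (chart_index_set p) {..<chart_dim}"
    using ex_bij_betw_finite_nat[OF fin] by (simp add: lessThan_atLeast0)
  then show ?thesis unfolding chart_index_def by (rule someI_ex)
qed

lemma chart_vector_props:
  assumes p: "pivots p" and k: "k < m"
  shows "chart_vector p t k (p k) = 1" "j < k \<Longrightarrow> chart_vector p t k (p j) = 0"
    "a k \<le> i \<Longrightarrow> chart_vector p t k i = 0"
proof -
  show "chart_vector p t k (p k) = 1" by (simp add: chart_vector_def)
  show "chart_vector p t k (p j) = 0" if "j < k"
    using p k that by (auto simp: chart_vector_def chart_index_set_def pivots_def inj_on_def)
  show "chart_vector p t k i = 0" if "a k \<le> i"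
    using p k that by (auto simp: chart_vector_def chart_index_set_def pivots_def)
qed

lemma chart_vector_nondeg: "pivots p \<Longrightarrow> k < m \<Longrightarrow> gs_nondeg N (chart_vector p t) k"
  by (rule chart_nondeg[where p = p and m = m]) (use pivot_less chart_vector_props in auto)

lemma line_flag_chart: "pivots p \<Longrightarrow> line_flag N m a (gs_line N (chart_vector p t))"
  by (rule gs_line_flag[OF _ _ a_le_a]) (simp_all add: chart_vector_nondeg chart_vector_props)

lemma chart_in_flags: "pivots p \<Longrightarrow> chart p t \<in> flags"
  unfolding chart_def by (intro flag_point_in_flags line_flag_chart)

lemma ratfun_chart:
  assumes p: "pivots p" and K: "is_subring K" and r: "r < Suc m * N^2"
  shows "ratfun K chart_dim (carrier_vec chart_dim) (\<lambda>t. chart p t $ r)"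
  unfolding chart_def
proof (intro ratfun_flag_point K r)
  have v: "polyfun K chart_dim (\<lambda>t. chart_vector p t k i)" for k i
  proof (cases "i \<noteq> p k \<and> (k, i) \<in> chart_index_set p")
    case True
    then have "chart_index p (k, i) < chart_dim" using bij_betwE[OF chart_index_bij[OF p]] by blast
    then show ?thesis using True K by (simp add: chart_vector_def polyfun_index)
  next
    case False
    then show ?thesis using K by (cases "i = p k") (simp_all add: chart_vector_def polyfun_01)
  qed
  show "ratfun K chart_dim (carrier_vec chart_dim) (\<lambda>t. gs_line N (chart_vector p t) k i j)"
    if "k < m" "i < N" "j < N" for k i j
    by (rule ratfun_gs_line[OF K, where m = m]) (use v that chart_vector_nondeg[OF p] in auto)
qed

lemma chart_matrix_chart:
  assumes p: "pivots p" and k: "k < m"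
  shows "chart_matrix N (lines (chart p t)) p k (p k) (p k) \<noteq> 0"
    and "i < N \<Longrightarrow> chart_matrix N (lines (chart p t)) p k i (p k) /
      chart_matrix N (lines (chart p t)) p k (p k) (p k) = chart_vector p t k i"
proof -
  have eq: "chart_matrix N (lines (chart p t)) p k i j = chart_matrix N (gs_line N (chart_vector p t)) p k i j"
    if "i < N" "j < N" for i j
    by (rule chart_matrix_cong[where m = m]) (use that k in \<open>auto simp: chart_def lines_flag_point\<close>)
  note g = chart_matrix_gs_line[where p = p and v = "chart_vector p t" and m = m and N = N and k = k]
  have "chart_matrix N (gs_line N (chart_vector p t)) p k (p k) (p k) \<noteq> 0"
    by (rule g(1)) (use pivot_less[OF p] chart_vector_props[OF p] k in auto)
  then show "chart_matrix N (lines (chart p t)) p k (p k) (p k) \<noteq> 0" using eq pivot_less[OF p k] by simp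
  assume i: "i < N"
  have "chart_matrix N (gs_line N (chart_vector p t)) p k i (p k) /
      chart_matrix N (gs_line N (chart_vector p t)) p k (p k) (p k) = chart_vector p t k i"
    by (rule g(2)) (use pivot_less[OF p] chart_vector_props[OF p] k i in auto)
  then show "chart_matrix N (lines (chart p t)) p k i (p k) /
      chart_matrix N (lines (chart p t)) p k (p k) (p k) = chart_vector p t k i"
    using eq pivot_less[OF p k] i by simp
qed

text \<open>The echelon basis read off from \<open>x\<close> by \<open>chart_vectors\<close> is
  adapted to its flag, so by \<open>gs_line_eq\<close> its orthogonalization returns the lines of
  \<open>x\<close>.\<close>

lemma chart_surj:
  assumes p: "pivots p" and x: "x \<in> flags" and nz: "\<forall>k<m. chart_matrix N (lines x) p k (p k) (p k) \<noteq> 0"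
  obtains t where "t \<in> carrier_vec chart_dim" "x = chart p t"
proof
  let ?L = "lines x" and ?e = "chart_index p" and ?T = "chart_index_set p"
  define v where "v = (\<lambda>k i. chart_matrix N ?L p k i (p k) / chart_matrix N ?L p k (p k) (p k))"
  define t where "t = vec chart_dim (\<lambda>r. let (k, i) = the_inv_into ?T ?e r in v k i)"
  show "t \<in> carrier_vec chart_dim" by (simp add: t_def)
  have L: "line_flag N m a ?L" using x by (simp add: flags_def flag_condition_def)
  have nz': "\<forall>k<m. p k < N \<and> chart_matrix N ?L p k (p k) (p k) \<noteq> 0" using nz pivot_less[OF p] by blast
  note cv = chart_vectors[OF L a_mono nz' order_refl v_def]
  have vt: "chart_vector p t k i = v k i" if k: "k < m" and i: "i < N" for k i
  proof (cases "i = p k")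
    case True
    then show ?thesis using cv(1)[OF k] by (simp add: chart_vector_def)
  next
    case False
    show ?thesis
    proof (cases "(k, i) \<in> ?T")
      case True
      have "?e (k, i) < chart_dim" using bij_betwE[OF chart_index_bij[OF p]] True by blast
      moreover have "the_inv_into ?T ?e (?e (k, i)) = (k, i)"
        using the_inv_into_f_f[OF bij_betw_imp_inj_on[OF chart_index_bij[OF p]] True] .
      ultimately show ?thesis using False True by (simp add: chart_vector_def t_def)
    next
      case nT: False
      then have "a k \<le> i \<or> (\<exists>j<k. i = p j)" using False k by (auto simp: chart_index_set_def le_less)
      then have "v k i = 0" using cv(2,3)[OF k] i by blast
      then show ?thesis using False nT by (simp add: chart_vector_def)
    qed
  qed
  have "gs_nondeg N (chart_vector p t) k \<and> (\<forall>i<N. \<forall>j<N. gs_line N (chart_vector p t) k i j = ?L k i j)" if "k < m" for k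
  proof (rule gs_line_eq[OF L _ _ that])
    show "\<forall>k<m. eig N (flag_sum ?L (Suc k)) 1 (chart_vector p t k)"
    proof (intro allI impI)
      fix k assume k: "k < m"
      have "app N (flag_sum ?L (Suc k)) (chart_vector p t k) i = app N (flag_sum ?L (Suc k)) (v k) i" for i
        by (rule app_cong) (rule vt[OF k])
      then show "eig N (flag_sum ?L (Suc k)) 1 (chart_vector p t k)"
        using cv(4)[OF k] vt[OF k] by (simp add: eig_def)
    qed
    show "\<forall>k<m. gs_nondeg N (chart_vector p t) k \<or> (\<exists>i<N. app N (?L k) (chart_vector p t k) i \<noteq> 0)"
      using chart_vector_nondeg[OF p] by blast
  qed
  then show "x = chart p t" unfolding chart_def by (intro flags_eq_flag_point[OF x]) simp
qed

text \<open>Density is the main point. All flags are parametrized by \<open>P\<close> on the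
  principal open set \<open>S\<close> of nondegenerate tuples of vectors with the required supports.
  On \<open>S\<close> the pullback of \<open>f\<close> times the product \<open>E\<close> of the
  pivot entries vanishes, and \<open>E\<close> does not vanish identically there; hence
  \<open>f\<close> vanishes on all flags.\<close>

lemma flags_rational_chart:
  assumes p: "pivots p"
  shows "rational_chart (Suc m * N^2) chart_dim flags (chart p) (chart_coord p)"
proof
  let ?M = "Suc m * N^2"
  show "flags \<subseteq> carrier_vec ?M" by (auto simp: flags_def)
  show "chart p t \<in> flags" for t by (rule chart_in_flags[OF p])
  show "ratfun UNIV chart_dim (carrier_vec chart_dim) (\<lambda>t. chart p t $ i)" if "i < ?M" for i
    by (rule ratfun_chart[OF p is_subring_UNIV that])
  have ki: "\<exists>k i. the_inv_into (chart_index_set p) (chart_index p) r = (k, i) \<and> k < m \<and> i < a k \<and> i \<noteq> p k \<and>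
      (k, i) \<in> chart_index_set p \<and> chart_index p (k, i) = r" if r: "r < chart_dim" for r
  proof -
    note bij = chart_index_bij[OF p]
    let ?ki = "the_inv_into (chart_index_set p) (chart_index p) r"
    have "?ki \<in> chart_index_set p" "chart_index p ?ki = r"
      using the_inv_into_into[OF bij_betw_imp_inj_on[OF bij] _ subset_refl, of r]
        f_the_inv_into_f_bij_betw[OF bij, of r] bij_betw_imp_surj_on[OF bij] r by auto
    then show ?thesis by (cases ?ki) (auto simp: chart_index_set_def)
  qed
  show "ratfun UNIV ?M (chart p ` carrier_vec chart_dim) (\<lambda>x. chart_coord p x r)" if r: "r < chart_dim" for r
  proof -
    obtain k i where ki: "the_inv_into (chart_index_set p) (chart_index p) r = (k, i)" "k < m" "i < a k"
      using ki[OF r] by blast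
    have iN: "i < N" using ki a_le[OF ki(2)] by simp
    have "polyfun UNIV ?M (\<lambda>x. lines x k i j)" if "k < m" "i < N" "j < N" for k i j
      by (rule polyfun_block) (use that in auto)
    then have "polyfun UNIV ?M (\<lambda>x. chart_matrix N (lines x) p k i' j')" if "i' < N" "j' < N" for i' j'
      by (rule polyfun_chart_matrix[OF is_subring_UNIV _ ki(2) that])
    then have "ratfun UNIV ?M (chart p ` carrier_vec chart_dim)
        (\<lambda>x. chart_matrix N (lines x) p k i (p k) / chart_matrix N (lines x) p k (p k) (p k))"
      using chart_matrix_chart(1)[OF p ki(2)] iN pivot_less[OF p ki(2)]
      by (intro ratfun_divide ratfun_polyfun is_subring_UNIV) auto
    then show ?thesis by (simp add: chart_coord_def ki(1))
  qed
  show "chart_coord p (chart p t) r = t $ r" if t: "t \<in> carrier_vec chart_dim" and r: "r < chart_dim" for t r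
  proof -
    obtain k i where ki: "the_inv_into (chart_index_set p) (chart_index p) r = (k, i)" "k < m" "i < a k" "i \<noteq> p k"
      "(k, i) \<in> chart_index_set p" "chart_index p (k, i) = r"
      using ki[OF r] by blast
    then show ?thesis using chart_matrix_chart(2)[OF p ki(2), of i t] a_le[OF ki(2)]
      by (simp add: chart_coord_def chart_vector_def)
  qed
  fix f x
  assume f: "f \<in> polys UNIV ?M" and zero: "\<And>t. t \<in> carrier_vec chart_dim \<Longrightarrow> eval_mpoly f (chart p t) = 0"
    and x: "x \<in> flags"
  \<comment> \<open>Entries from \<open>a k\<close> on are cut off, so that every point of affine
    space gives vectors with the required supports.\<close>
  define v where "v y k i = (if i < a k then y $ (k * N + i) else 0)" for y :: "real vec" and k i
  have vp: "polyfun UNIV (m * N) (\<lambda>y. v y k i)" if "k < m" for k i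
  proof (cases "i < a k")
    case True
    then have "i < N" using a_le[OF that] by simp
    then have "k * N + i < Suc k * N" by simp
    also have "\<dots> \<le> m * N" using that by (intro mult_le_mono1) simp
    finally show ?thesis using True by (simp add: v_def polyfun_index)
  qed (simp add: v_def polyfun_01)
  have "polyfun UNIV (m * N) (\<lambda>y. \<Prod>k<m. ip N (v y k) (gs_vec N (v y) k))"
    by (intro polyfun_prod polyfun_ip polyfun_gs_vec[where m = m] is_subring_UNIV vp) auto
  then obtain h where h: "h \<in> polys UNIV (m * N)" "\<And>y. eval_mpoly h y = (\<Prod>k<m. ip N (v y k) (gs_vec N (v y) k))"
    unfolding polyfun_def by metis
  define S where "S = {y \<in> carrier_vec (m * N). eval_mpoly h y \<noteq> 0}"
  have S: "y \<in> S \<longleftrightarrow> y \<in> carrier_vec (m * N) \<and> (\<forall>k<m. gs_nondeg N (v y) k)" for y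
    by (auto simp: S_def h(2) gs_nondeg_def)
  define P where "P y = flag_point (gs_line N (v y))" for y
  have Pflag: "P y \<in> flags" if "y \<in> S" for y
    unfolding P_def by (intro flag_point_in_flags gs_line_flag) (use that S a_le_a in \<open>auto simp: v_def\<close>)
  have Prat: "ratfun UNIV (m * N) S (\<lambda>y. P y $ r)" if "r < ?M" for r
    unfolding P_def
    by (intro ratfun_flag_point that is_subring_UNIV ratfun_gs_line[where m = m]) (use vp S in auto)
  define E where "E z = (\<Prod>k<m. chart_matrix N (lines z) p k (p k) (p k))" for z
  have "polyfun UNIV ?M E" unfolding E_def
    by (intro polyfun_prod polyfun_chart_matrix[where m = m] is_subring_UNIV polyfun_block)
      (use pivot_less[OF p] in auto)
  then obtain q where q: "q \<in> polys UNIV ?M" "\<And>z. E z = eval_mpoly q z" unfolding polyfun_def by auto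
  have "eval_mpoly f (P y) * eval_mpoly q (P y) = 0" if y: "y \<in> S" for y
  proof (cases "E (P y) = 0")
    case False
    then have "\<forall>k<m. chart_matrix N (lines (P y)) p k (p k) (p k) \<noteq> 0" by (auto simp: E_def)
    then obtain t where "t \<in> carrier_vec chart_dim" "P y = chart p t"
      by (rule chart_surj[OF p Pflag[OF y]])
    then show ?thesis using zero by simp
  qed (simp add: q(2))
  then have "(\<forall>y\<in>S. eval_mpoly f (P y) = 0) \<or> (\<forall>y\<in>S. eval_mpoly q (P y) = 0)"
    by (intro ratfun_mult_eq_0D[OF ratfun_eval[OF f is_subring_UNIV Prat] ratfun_eval[OF q(1) is_subring_UNIV Prat] _ S_def h(1)])
  \<comment> \<open>The echelon vectors with all parameters zero give a point of \<open>S\<close>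
    whose flag has nonzero pivot entries.\<close>
  moreover have "\<exists>y\<in>S. eval_mpoly q (P y) \<noteq> 0"
  proof -
    let ?t = "0\<^sub>v chart_dim :: real vec"
    define y where "y = vec (m * N) (\<lambda>r. chart_vector p ?t (r div N) (r mod N))"
    have vy: "v y k i = chart_vector p ?t k i" if k: "k < m" and i: "i < N" for k i
    proof (cases "i < a k")
      case True
      have "k * N + i < Suc k * N" using i by simp
      also have "\<dots> \<le> m * N" using k by (intro mult_le_mono1) simp
      finally show ?thesis using True i by (simp add: v_def y_def)
    qed (use chart_vector_props(3)[OF p k] in \<open>simp add: v_def\<close>)
    have yp: "v y k (p k) = 1" "j < k \<Longrightarrow> v y k (p j) = 0" if k: "k < m" for j k
      using vy[OF k] chart_vector_props[OF p k] pivot_less[OF p] k by auto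
    have "y \<in> S" unfolding S
      using chart_nondeg[where p = p and v = "v y" and m = m and N = N] yp pivot_less[OF p]
      by (auto simp: y_def)
    moreover have "E (P y) \<noteq> 0"
    proof -
      have "chart_matrix N (lines (P y)) p k (p k) (p k) \<noteq> 0" if k: "k < m" for k
      proof -
        have "chart_matrix N (lines (P y)) p k (p k) (p k) = chart_matrix N (gs_line N (v y)) p k (p k) (p k)"
          by (rule chart_matrix_cong[where m = m]) (use k pivot_less[OF p k] in \<open>auto simp: P_def lines_flag_point\<close>)
        also have "\<dots> \<noteq> 0"
          by (rule chart_matrix_gs_line(1)[where m = m]) (use yp pivot_less[OF p] k in auto)
        finally show ?thesis .
      qed
      then show ?thesis by (simp add: E_def)
    qed
    ultimately show ?thesis by (auto simp: q(2))
  qed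
  ultimately have fS: "eval_mpoly f (P y) = 0" if "y \<in> S" for y using that by blast
  let ?L = "lines x"
  have L: "line_flag N m a ?L" using x by (simp add: flags_def flag_condition_def)
  have P1: "scaled_projection N (?L k) 1 1" if "k < m" for k using L that by (simp add: line_flag_def)
  \<comment> \<open>Every flag is in the image of \<open>P\<close>: a nonzero column of
    \<open>L k\<close> is a vector on the line \<open>k\<close>, and the columns at indices
    \<open>c k\<close> serve as the vectors.\<close>
  have "\<forall>k. \<exists>i. k < m \<longrightarrow> i < N \<and> ?L k i i \<noteq> 0"
    using ex_diag_nonzero[OF P1] by auto
  then obtain c where c: "\<And>k. k < m \<Longrightarrow> c k < N \<and> ?L k (c k) (c k) \<noteq> 0" by metis
  define y where "y = vec (m * N) (\<lambda>r. ?L (r div N) (r mod N) (c (r div N)))"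
  have vy: "v y k i = app N (?L k) (std (c k)) i" if k: "k < m" and i: "i < N" for k i
  proof (cases "i < a k")
    case True
    have "k * N + i < Suc k * N" using i by simp
    also have "\<dots> \<le> m * N" using k by (intro mult_le_mono1) simp
    finally show ?thesis using True i c[OF k] by (simp add: v_def y_def app_std)
  next
    case False
    then show ?thesis using line_flag_support(2)[OF L k _ i] c[OF k] by (simp add: v_def app_std)
  qed
  have app: "app N Q (v y k) i = app N Q (app N (?L k) (std (c k))) i" if "k < m" for Q k i
    by (rule app_cong) (rule vy[OF that])
  have gs: "gs_nondeg N (v y) k \<and> (\<forall>i<N. \<forall>j<N. gs_line N (v y) k i j = ?L k i j)" if "k < m" for k
  proof (rule gs_line_eq[OF L _ _ that])
    show "\<forall>k<m. eig N (flag_sum ?L (Suc k)) 1 (v y k)"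
      using eig_flag_sum_line[OF L] app vy by (simp add: eig_def)
    show "\<forall>k<m. gs_nondeg N (v y) k \<or> (\<exists>i<N. app N (?L k) (v y k) i \<noteq> 0)"
    proof (intro allI impI disjI2)
      fix k assume k: "k < m"
      have "app N (?L k) (v y k) (c k) = ?L k (c k) (c k)"
        using app[OF k] app_app[OF P1[OF k], of "std (c k)"] c[OF k] by (simp add: eig_def app_std)
      then show "\<exists>i<N. app N (?L k) (v y k) i \<noteq> 0" using c[OF k] by metis
    qed
  qed
  then have "x = P y" unfolding P_def by (intro flags_eq_flag_point[OF x]) simp
  moreover have "y \<in> S" unfolding S using gs by (simp add: y_def)
  ultimately show "eval_mpoly f x = 0" using fS by simp
qed

lemma flags_regular_point:
  assumes x: "x \<in> flags"
  shows "regular_point UNIV (Suc m * N^2) flags x"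
proof -
  have L: "line_flag N m a (lines x)" using x by (simp add: flags_def flag_condition_def)
  obtain p where p: "\<forall>k<m. p k < N \<and> p k < a k \<and> chart_matrix N (lines x) p k (p k) (p k) \<noteq> 0" "inj_on p {..<m}"
    using ex_pivots[OF L a_mono order_refl] by blast
  then have piv: "pivots p" by (simp add: pivots_def)
  interpret rational_chart "Suc m * N^2" chart_dim flags "chart p" "chart_coord p"
    by (rule flags_rational_chart[OF piv])
  obtain t where "t \<in> carrier_vec chart_dim" "x = chart p t"
    by (rule chart_surj[OF piv x]) (use p in auto)
  then show ?thesis using regular_point_chart by simp
qed

text \<open>The last coordinate allowed for the line \<open>k\<close>. As the \<open>a j\<close>
  increase strictly, all earlier lines vanish there, which is what allows the lines to be separated
  inside \<open>X\<close>.\<close>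

definition big_cell :: "nat \<Rightarrow> nat" where
  "big_cell k = a k - 1"

lemma pivots_big_cell: "pivots big_cell"
proof -
  have lt: "big_cell j < big_cell k" if "j < k" "k < m" for j k
    using a_strict[OF that] a_gt[of j] that by (simp add: big_cell_def)
  then have "inj_on big_cell {..<m}"
    by (intro inj_onI) (metis lessThan_iff less_irrefl linorder_neqE_nat lt)
  then show ?thesis using a_gt by (fastforce simp: pivots_def big_cell_def)
qed

text \<open>The chart is rational over \<open>\<rat>\<close>, so rational parameters give rational
  points. They are dense: a polynomial vanishing at them pulls back to a quotient whose numerator
  vanishes on a rational grid.\<close>

lemma flags_Q_nonsingular: "Q_nonsingular (Suc m * N^2) flags"
proof (rule Q_nonsingularI)
  let ?p = big_cell
  interpret rational_chart "Suc m * N^2" chart_dim flags "chart ?p" "chart_coord ?p"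
    by (rule flags_rational_chart[OF pivots_big_cell])
  let ?T = "{t \<in> carrier_vec chart_dim. \<forall>i<chart_dim. t $ i \<in> \<rat>}"
  show "algebraic_set \<rat> (Suc m * N^2) flags"
    unfolding flags_def by (rule algebraic_set_rational_condition[OF rational_condition_flag])
  show "regular_point UNIV (Suc m * N^2) flags x" if "x \<in> flags" for x
    by (rule flags_regular_point[OF that])
  show "chart ?p ` ?T \<subseteq> flags" using psi_in by auto
  show "x $ i \<in> \<rat>" if x: "x \<in> chart ?p ` ?T" and i: "i < Suc m * N^2" for x i
  proof -
    obtain t where t: "t \<in> ?T" "x = chart ?p t" using x by blast
    obtain f g where "f \<in> polys \<rat> chart_dim" "g \<in> polys \<rat> chart_dim"
      "\<forall>t\<in>carrier_vec chart_dim. chart ?p t $ i = eval_mpoly f t / eval_mpoly g t"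
      using ratfun_chart[OF pivots_big_cell is_subring_Rats i] unfolding ratfun_def by blast
    then show ?thesis using t eval_mpoly_rational[of f chart_dim t] eval_mpoly_rational[of g chart_dim t] by auto
  qed
  fix f x assume f: "f \<in> polys UNIV (Suc m * N^2)" "\<forall>a\<in>chart ?p ` ?T. eval_mpoly f a = 0" "x \<in> flags"
  have "ratfun UNIV chart_dim (carrier_vec chart_dim) (\<lambda>t. eval_mpoly f (chart ?p t))"
    by (rule ratfun_eval[OF f(1) is_subring_UNIV psi_rat])
  then obtain g q where gq: "g \<in> polys UNIV chart_dim"
    "\<forall>t\<in>carrier_vec chart_dim. eval_mpoly q t \<noteq> 0 \<and> eval_mpoly f (chart ?p t) = eval_mpoly g t / eval_mpoly q t"
    unfolding ratfun_def by blast
  have "Set.range (of_nat :: nat \<Rightarrow> real) \<subseteq> \<rat>" by auto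
  moreover have "infinite (Set.range (of_nat :: nat \<Rightarrow> real))"
    by (rule range_inj_infinite) (simp add: inj_on_def)
  ultimately have "infinite (\<rat> :: real set)" using finite_subset by blast
  then have "g = 0"
    by (rule mpoly_eq_0I[OF gq(1)]) (use f(2) gq(2) in force)
  then show "eval_mpoly f x = 0" using dense[OF f(1) _ f(3)] gq(2) by simp
qed

text \<open>The sum of the squared entries of an orthogonal projection is its rank: \<open>X\<close>
  contributes \<open>m\<close> and each of the \<open>m\<close> lines contributes
  \<open>1\<close>.\<close>

lemma flags_projectively_Q_closed: "projectively_Q_closed (Suc m * N^2) flags"
  unfolding flags_def
proof (rule projectively_Q_closedI[OF rational_condition_flag])
  show "real (2 * m) \<in> \<rat>" by simp
  fix x assume x: "flag_condition x"
  have L: "line_flag N m a (lines x)" using x by (simp add: flag_condition_def)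
  have sq: "(\<Sum>i<N. \<Sum>j<N. (Q i j)^2) = r" if Q: "scaled_projection N Q 1 r" for Q r
  proof -
    have "(\<Sum>i<N. \<Sum>j<N. (Q i j)^2) = (\<Sum>i<N. \<Sum>j<N. Q i j * Q j i)"
      by (intro sum.cong refl) (use scaled_projectionD(2)[OF Q] in \<open>simp add: symm_def power2_eq_square\<close>)
    also have "\<dots> = r" using scaled_projectionD(3,4)[OF Q] by simp
    finally show ?thesis .
  qed
  have "(\<Sum>n<Suc m * N^2. (x $ n)^2) = (\<Sum>i<N. \<Sum>j<N. (block N x 0 i j)^2) + (\<Sum>k<m. \<Sum>i<N. \<Sum>j<N. (lines x k i j)^2)"
    unfolding sum_squares_blocks sum.lessThan_Suc_shift by simp
  also have "(\<Sum>i<N. \<Sum>j<N. (block N x 0 i j)^2) = (\<Sum>i<N. \<Sum>j<N. (flag_sum (lines x) m i j)^2)"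
    using x by (simp add: flag_condition_def)
  also have "\<dots> = real m" by (rule sq[OF scaled_projection_flag_sum[OF L order_refl]])
  also have "(\<Sum>k<m. \<Sum>i<N. \<Sum>j<N. (lines x k i j)^2) = (\<Sum>k<m. 1)"
    by (intro sum.cong refl sq) (use L in \<open>simp add: line_flag_def\<close>)
  finally show "(\<Sum>n<Suc m * N^2. (x $ n)^2) = real (2 * m)" by simp
qed

end

section \<open>Recovering a flag from its last member\<close>

context flag_shape
begin

text \<open>Going down from \<open>m - 1\<close>, the coordinate \<open>big_cell j\<close> is met
  only by line \<open>j\<close> among the lines still present, so its elimination removes exactly
  this line. The result is a multiple of the projection onto the member \<open>k\<close> of the
  flag.\<close>

definition peel :: "nat \<Rightarrow> (nat \<Rightarrow> nat \<Rightarrow> real) \<Rightarrow> nat \<Rightarrow> nat \<Rightarrow> real" where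
  "peel k X = elims N (map (\<lambda>j. std (big_cell j)) (rev [k..<m])) X"

text \<open>A projection of rank one equals \<open>v v^T / |v|^2\<close> for any nonzero column
  \<open>v\<close>; in this quotient the unknown scalar of \<open>peel\<close> cancels.\<close>

definition peel_line :: "(nat \<Rightarrow> nat \<Rightarrow> real) \<Rightarrow> nat \<Rightarrow> nat \<Rightarrow> nat \<Rightarrow> real" where
  "peel_line X k i j = peel (Suc k) X i (big_cell k) * peel (Suc k) X j (big_cell k) /
     (\<Sum>l<N. (peel (Suc k) X l (big_cell k))^2)"

lemma peel_m: "peel m X = X"
  by (simp add: peel_def)

lemma peel_step: "k < m \<Longrightarrow> peel k X = elim N (std (big_cell k)) (peel (Suc k) X)"
  by (simp add: peel_def upt_rec[of k])

lemma big_cell_less: "k < m \<Longrightarrow> big_cell k < N"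
  by (rule pivot_less[OF pivots_big_cell])

lemma a_le_big_cell: "j < k \<Longrightarrow> k < m \<Longrightarrow> a j \<le> big_cell k"
  using a_strict[of j k] by (simp add: big_cell_def)

text \<open>The vanishing of the \<open>2 \<times> 2\<close> minors of a matrix of rank one, since
  eliminating a coordinate leaves rank zero.\<close>

lemma line_minor:
  assumes "scaled_projection N Q 1 1" "i < N" "j < N" "c < N"
  shows "Q i c * Q j c = Q c c * Q i j"
proof -
  have "elim N (std c) Q i j = 0"
  proof (cases "eig N Q 0 (std c)")
    case False
    then have "ip N (std c) (app N Q (std c)) \<noteq> 0" using ip_app_eq_0[OF assms(1)] by simp
    then have "scaled_projection N (elim N (std c) Q) (1 * ip N (std c) (app N Q (std c))) (1 - 1)"
      by (rule scaled_projection_elim[OF assms(1)])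
    then show ?thesis using scaled_projection_rank_0 assms(2,3) by simp
  qed (use elim_eq_0 assms in blast)
  then show ?thesis using assms(4) by (simp add: elim_def ip_std app_std)
qed

lemma flag_sum_big_cell:
  assumes L: "line_flag N m a L" and k: "k < m" and i: "i < N"
  shows "flag_sum L (Suc k) i (big_cell k) = L k i (big_cell k)"
proof -
  have "L l i (big_cell k) = 0" if "l < k" for l
    using line_flag_support(3)[OF L _ a_le_big_cell[OF that k] big_cell_less[OF k] i] that k by simp
  then show ?thesis by (simp add: flag_sum_def)
qed

text \<open>Column \<open>big_cell k\<close> of the remaining sum is that of \<open>L k\<close>, and
  by \<open>line_minor\<close> the elimination cancels \<open>L k\<close> from the sum. The scalar
  passes from \<open>z\<close> to \<open>z * z\<close> times the diagonal entry of
  \<open>L k\<close>, so it is nonzero as long as these entries are.\<close>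

lemma peel_flag_sum:
  assumes L: "line_flag N m a L" and X: "\<forall>i<N. \<forall>j<N. X i j = flag_sum L m i j" and k: "k \<le> m"
  shows "\<exists>z. (\<forall>i<N. \<forall>j<N. peel k X i j = z * flag_sum L k i j) \<and>
    (z \<noteq> 0 \<longleftrightarrow> (\<forall>l. k \<le> l \<longrightarrow> l < m \<longrightarrow> L l (big_cell l) (big_cell l) \<noteq> 0))"
  using k
proof (induction rule: inc_induct)
  case base
  show ?case using X by (intro exI[of _ 1]) (simp add: peel_m)
next
  case (step k)
  then obtain z where z: "\<forall>i<N. \<forall>j<N. peel (Suc k) X i j = z * flag_sum L (Suc k) i j"
    "z \<noteq> 0 \<longleftrightarrow> (\<forall>l. Suc k \<le> l \<longrightarrow> l < m \<longrightarrow> L l (big_cell l) (big_cell l) \<noteq> 0)" by blast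
  have k: "k < m" by fact
  let ?c = "big_cell k"
  have c: "?c < N" by (rule big_cell_less[OF k])
  have P: "scaled_projection N (L k) 1 1" using L k by (simp add: line_flag_def)
  have col: "peel (Suc k) X i ?c = z * L k i ?c" if "i < N" for i
    using z(1) flag_sum_big_cell[OF L k that] that c by simp
  have "peel k X i j = z * z * L k ?c ?c * flag_sum L k i j" if ij: "i < N" "j < N" for i j
  proof -
    have "peel k X i j = peel (Suc k) X ?c ?c * peel (Suc k) X i j - peel (Suc k) X i ?c * peel (Suc k) X j ?c"
      using k c by (simp add: peel_step elim_def ip_std app_std)
    also have "\<dots> = z * L k ?c ?c * (z * flag_sum L (Suc k) i j) - z * z * (L k i ?c * L k j ?c)"
    proof -
      have "peel (Suc k) X i j = z * flag_sum L (Suc k) i j" using z(1) ij by blast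
      then show ?thesis unfolding col[OF c] col[OF ij(1)] col[OF ij(2)] by (simp add: algebra_simps)
    qed
    also have "\<dots> = z * z * L k ?c ?c * (flag_sum L (Suc k) i j - L k i j)"
      unfolding line_minor[OF P ij c] by (simp add: algebra_simps)
    finally show ?thesis by (simp add: flag_sum_Suc)
  qed
  moreover have "z * z * L k ?c ?c \<noteq> 0 \<longleftrightarrow> (\<forall>l. k \<le> l \<longrightarrow> l < m \<longrightarrow> L l (big_cell l) (big_cell l) \<noteq> 0)"
  proof -
    have "k \<le> l \<longleftrightarrow> l = k \<or> Suc k \<le> l" for l by auto
    then show ?thesis using z(2) k by auto
  qed
  ultimately show ?case by blast
qed

lemma peel_line_eq:
  assumes L: "line_flag N m a L" and X: "\<forall>i<N. \<forall>j<N. X i j = flag_sum L m i j"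
    and nz: "\<forall>l<m. L l (big_cell l) (big_cell l) \<noteq> 0" and k: "k < m" and ij: "i < N" "j < N"
  shows "peel_line X k i j = L k i j"
proof -
  let ?c = "big_cell k"
  obtain z where z: "\<forall>i<N. \<forall>j<N. peel (Suc k) X i j = z * flag_sum L (Suc k) i j" "z \<noteq> 0"
    using peel_flag_sum[OF L X, of "Suc k"] nz k by auto
  have c: "?c < N" by (rule big_cell_less[OF k])
  have P: "scaled_projection N (L k) 1 1" using L k by (simp add: line_flag_def)
  have col: "peel (Suc k) X i ?c = z * L k i ?c" if "i < N" for i
    using z(1) flag_sum_big_cell[OF L k that] that c by simp
  have "(\<Sum>l<N. (peel (Suc k) X l ?c)^2) = (\<Sum>l<N. z^2 * (L k ?c l * L k l ?c))"
    by (intro sum.cong refl)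
      (use col c scaled_projectionD(2)[OF P] in \<open>simp add: symm_def power2_eq_square algebra_simps\<close>)
  also have "\<dots> = z^2 * L k ?c ?c"
    unfolding sum_distrib_left[symmetric] using scaled_projectionD(4)[OF P c c] by simp
  finally have "peel_line X k i j = z^2 * (L k i ?c * L k j ?c) / (z^2 * L k ?c ?c)"
    using col ij by (simp add: peel_line_def power2_eq_square)
  then show ?thesis unfolding line_minor[OF P ij c] using z(2) nz k by simp
qed

text \<open>The left side involves \<open>X\<close> alone, so the locus where the flag can be
  recovered is defined by an inequation on the Schubert variety itself.\<close>

lemma peel_nonzero_iff:
  assumes L: "line_flag N m a L" and X: "\<forall>i<N. \<forall>j<N. X i j = flag_sum L m i j"
  shows "(\<forall>k<m. peel (Suc k) X (big_cell k) (big_cell k) \<noteq> 0) \<longleftrightarrow>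
    (\<forall>k<m. L k (big_cell k) (big_cell k) \<noteq> 0)"
proof -
  have "\<exists>z. peel (Suc k) X (big_cell k) (big_cell k) = z * L k (big_cell k) (big_cell k) \<and>
    (z \<noteq> 0 \<longleftrightarrow> (\<forall>l. Suc k \<le> l \<longrightarrow> l < m \<longrightarrow> L l (big_cell l) (big_cell l) \<noteq> 0))" if k: "k < m" for k
    using peel_flag_sum[OF L X, of "Suc k"] k flag_sum_big_cell[OF L k big_cell_less[OF k]] big_cell_less[OF k] by auto
  then obtain z where z: "\<And>k. k < m \<Longrightarrow> peel (Suc k) X (big_cell k) (big_cell k) = z k * L k (big_cell k) (big_cell k)"
    "\<And>k. k < m \<Longrightarrow> z k \<noteq> 0 \<longleftrightarrow> (\<forall>l. Suc k \<le> l \<longrightarrow> l < m \<longrightarrow> L l (big_cell l) (big_cell l) \<noteq> 0)"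
    by metis
  show ?thesis using z by (auto simp: z(1))
qed

text \<open>Coordinate \<open>big_cell k\<close> of the member \<open>k + 1\<close> of the flag is
  carried by the line \<open>k\<close> alone, and this member contains the echelon vector
  \<open>k\<close>, whose entry there is \<open>1\<close>.\<close>

lemma gs_line_big_cell_nonzero:
  assumes k: "k < m"
  shows "gs_line N (chart_vector big_cell t) k (big_cell k) (big_cell k) \<noteq> 0"
proof -
  let ?v = "chart_vector big_cell t" and ?c = "big_cell k"
  note p = pivots_big_cell
  have c: "?c < N" by (rule big_cell_less[OF k])
  have L: "line_flag N m a (gs_line N ?v)" by (rule line_flag_chart[OF p])
  have sp: "eig N (flag_sum (gs_line N ?v) (Suc k)) 1 (?v k)"
    by (rule gs_span) (use chart_vector_nondeg[OF p] k in auto)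
  show ?thesis
  proof
    assume z: "gs_line N ?v k ?c ?c = 0"
    have P: "scaled_projection N (gs_line N ?v k) 1 1" using L k by (simp add: line_flag_def)
    have "eig N (gs_line N ?v k) 0 (std ?c)" using diag_0_eig[OF P c] z by simp
    then have "eig N (flag_sum (gs_line N ?v) (Suc k)) 0 (std ?c)"
      using flag_sum_big_cell[OF L k] c by (simp add: eig_std_0)
    then have "ip N (?v k) (app N (flag_sum (gs_line N ?v) (Suc k)) (std ?c)) = 0"
      by (intro ip_eq_0) (simp add: eig_def)
    moreover have "symm N (flag_sum (gs_line N ?v) (Suc k))"
      using scaled_projectionD(2)[OF scaled_projection_flag_sum[OF L, of "Suc k"]] k by simp
    ultimately have "ip N (std ?c) (app N (flag_sum (gs_line N ?v) (Suc k)) (?v k)) = 0"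
      using ip_app ip_commute by metis
    then have "?v k ?c = 0" using sp c by (simp add: ip_std eig_def)
    then show False using chart_vector_props(1)[OF p k] by simp
  qed
qed

end

section \<open>Incidence conditions\<close>

text \<open>
  A way to say without bases that the range of the orthogonal projection \<open>X\<close> meets \<open>\<real>\<^sup>b\<close> in
  dimension greater than \<open>k\<close>.
\<close>

definition fat :: "nat \<Rightarrow> (nat \<Rightarrow> nat \<Rightarrow> real) \<Rightarrow> nat \<Rightarrow> nat \<Rightarrow> bool" where
  "fat N X b k \<longleftrightarrow> (\<forall>w :: nat \<Rightarrow> nat \<Rightarrow> real. \<exists>u. eig N X 1 u \<and> (\<forall>i<N. b \<le> i \<longrightarrow> u i = 0) \<and>
     (\<exists>i<N. u i \<noteq> 0) \<and> (\<forall>j<k. ip N (w j) u = 0))"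

text \<open>Each condition either holds on the whole range, when \<open>w\<close> lies in the
  kernel, or is imposed by an elimination that costs one unit of rank; rank remains at the
  end.\<close>

lemma ex_orthogonal_eig:
  assumes "scaled_projection N Q c r" "real (length ws) < r"
  shows "\<exists>u. eig N Q c u \<and> (\<exists>i<N. u i \<noteq> 0) \<and> (\<forall>w\<in>set ws. ip N w u = 0)"
  using assms
proof (induction ws arbitrary: Q c r)
  case Nil
  then obtain i where i: "i < N" "Q i i \<noteq> 0" using ex_diag_nonzero[of N Q c r] by auto
  have "app N Q (std i) i \<noteq> 0" using i by (simp add: app_std)
  then show ?case using app_app[OF Nil(1), of "std i"] i(1)
    by (intro exI[of _ "app N Q (std i)"]) (simp del: One_nat_def, blast)
next
  case (Cons w ws)
  have sym: "symm N Q" using scaled_projectionD(2)[OF Cons.prems(1)] .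
  have c0: "c \<noteq> 0" using scaled_projectionD(1)[OF Cons.prems(1)] by simp
  have ortho: "ip N w u = 0" if z: "eig N Q' 0 w" and sym: "symm N Q'" and u: "eig N Q' c' u" "c' \<noteq> 0" for Q' c' u
  proof -
    have "c' * ip N w u = ip N w (app N Q' u)"
      unfolding ip_scale[symmetric] by (rule ip_cong) (use u in \<open>simp add: eig_def\<close>)
    also have "\<dots> = ip N u (app N Q' w)" using ip_app[OF sym] ip_commute by metis
    also have "\<dots> = 0" by (rule ip_eq_0) (use z in \<open>simp add: eig_def\<close>)
    finally show ?thesis using u(2) by simp
  qed
  show ?case
  proof (cases "eig N Q 0 w")
    case True
    have "real (length ws) < r" using Cons.prems(2) by simp
    then obtain u where "eig N Q c u" "\<exists>i<N. u i \<noteq> 0" "\<forall>w\<in>set ws. ip N w u = 0"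
      using Cons.IH[OF Cons.prems(1)] by blast
    then show ?thesis using ortho[OF True sym _ c0] by auto
  next
    case False
    let ?c = "c * ip N w (app N Q w)"
    have nz: "ip N w (app N Q w) \<noteq> 0" using ip_app_eq_0[OF Cons.prems(1)] False by simp
    have "real (length ws) < r - 1" using Cons.prems(2) by simp
    then obtain u where u: "eig N (elim N w Q) ?c u" "\<exists>i<N. u i \<noteq> 0" "\<forall>w\<in>set ws. ip N w u = 0"
      using Cons.IH[OF scaled_projection_elim[OF Cons.prems(1) nz]] by blast
    have wu: "ip N w u = 0"
      by (rule ortho[OF eig_elim_self symm_elim[OF sym] u(1)]) (use c0 nz in simp)
    have "range_in N (\<lambda>i j. Q i j / c) (elim N w Q)"
      using range_in_elims[of N "\<lambda>i j. Q i j / c" Q "[w]"] app_app[OF Cons.prems(1)] c0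
      by (simp add: range_in_def eig_def app_def flip: sum_divide_distrib)
    then have "eig N (\<lambda>i j. Q i j / c) 1 (app N (elim N w Q) u)" by (simp add: range_in_def)
    then have e: "app N Q (app N (elim N w Q) u) i = c * app N (elim N w Q) u i" if "i < N" for i
      using that c0 by (simp add: eig_def app_def field_simps flip: sum_divide_distrib)
    have "eig N Q c u" unfolding eig_def
    proof (intro allI impI)
      fix i assume i: "i < N"
      have "?c * app N Q u i = app N Q (\<lambda>i. ?c * u i) i" by (rule app_scale[symmetric])
      also have "\<dots> = app N Q (app N (elim N w Q) u) i"
        by (rule app_cong) (use u(1) in \<open>simp add: eig_def\<close>)
      also have "\<dots> = ?c * (c * u i)" using e[OF i] u(1) i by (simp add: eig_def)
      finally show "app N Q u i = c * u i" using c0 nz by simp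
    qed
    then show ?thesis using u wu by auto
  qed
qed

text \<open>The range of \<open>Q\<close> provides the witnesses: its dimension exceeds
  \<open>k\<close>, it lies in the range of \<open>X\<close>, and it lies in
  \<open>\<real>^b\<close> because vanishing diagonal entries of \<open>Q\<close> make whole rows
  vanish.\<close>

lemma fatI:
  assumes Q: "scaled_projection N Q c r" "real k < r" and X: "range_in N X Q"
    and diag: "\<And>i. i < N \<Longrightarrow> b \<le> i \<Longrightarrow> Q i i = 0"
  shows "fat N X b k"
  unfolding fat_def
proof
  fix w :: "nat \<Rightarrow> nat \<Rightarrow> real"
  have c0: "c \<noteq> 0" using scaled_projectionD(1)[OF Q(1)] by simp
  obtain u where u: "eig N Q c u" "\<exists>i<N. u i \<noteq> 0" "\<forall>w\<in>set (map w [0..<k]). ip N w u = 0"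
    using ex_orthogonal_eig[OF Q(1), of "map w [0..<k]"] Q(2) by auto
  have "eig N X 1 u" unfolding eig_def
  proof (intro allI impI)
    fix i assume i: "i < N"
    have "c * app N X u i = app N X (\<lambda>i. c * u i) i" by (rule app_scale[symmetric])
    also have "\<dots> = app N X (app N Q u) i" by (rule app_cong) (use u(1) in \<open>simp add: eig_def\<close>)
    also have "\<dots> = c * u i" using X u(1) i by (simp add: range_in_def eig_def)
    finally show "app N X u i = 1 * u i" using c0 by simp
  qed
  moreover have "u i = 0" if "i < N" "b \<le> i" for i
  proof -
    have "eig N Q 0 (std i)" using diag_0_eig[OF Q(1) that(1)] diag[OF that] by simp
    then have "Q j i = 0" if "j < N" for j using that \<open>i < N\<close> by (simp add: eig_std_0)
    then have "app N Q u i = 0"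
      using scaled_projectionD(2)[OF Q(1)] that(1) by (simp add: app_def symm_def)
    then show ?thesis using u(1) that c0 by (simp add: eig_def)
  qed
  ultimately show "\<exists>u. eig N X 1 u \<and> (\<forall>i<N. b \<le> i \<longrightarrow> u i = 0) \<and> (\<exists>i<N. u i \<noteq> 0) \<and> (\<forall>j<k. ip N (w j) u = 0)"
    using u(2,3) by (intro exI[of _ u]) auto
qed

lemma fat_line_flag:
  assumes L: "line_flag N m a L" and X: "\<forall>i<N. \<forall>j<N. X i j = flag_sum L m i j"
    and mono: "\<forall>k<m. \<forall>j\<le>k. a j \<le> a k" and k: "k < m"
  shows "fat N X (a k) k"
proof (rule fatI)
  show P: "scaled_projection N (flag_sum L (Suc k)) 1 (real (Suc k))"
    by (rule scaled_projection_flag_sum[OF L]) (use k in simp)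
  show "real k < real (Suc k)" by simp
  have app: "app N X u i = app N (flag_sum L m) u i" if "i < N" for u i
    unfolding app_def using X that by simp
  have "eig N (flag_sum L m) 1 (app N (flag_sum L (Suc k)) v)" for v
    by (rule flag_sum_mono_eig[OF L app_app[OF P]]) (use k in auto)
  then show "range_in N X (flag_sum L (Suc k))" using app by (simp add: range_in_def eig_def)
  show "flag_sum L (Suc k) i i = 0" if "i < N" "a k \<le> i" for i
  proof -
    have "L l i i = 0" if "l < Suc k" for l
    proof -
      have "a l \<le> a k" using mono k that by simp
      then show ?thesis using L k that \<open>i < N\<close> \<open>a k \<le> i\<close> by (simp add: line_flag_def)
    qed
    then show ?thesis by (simp add: flag_sum_def)
  qed
qed

lemma sum_squares_scaled_projection:
  assumes Q: "scaled_projection N Q 1 r"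
  shows "(\<Sum>i<N. \<Sum>j<N. Q i j * Q i j) = r"
proof -
  have "(\<Sum>i<N. \<Sum>j<N. Q i j * Q i j) = (\<Sum>i<N. \<Sum>j<N. Q i j * Q j i)"
    by (intro sum.cong refl) (use scaled_projectionD(2)[OF Q] in \<open>simp add: symm_def\<close>)
  also have "\<dots> = r" using scaled_projectionD(3,4)[OF Q] by simp
  finally show ?thesis .
qed

text \<open>Fatness, with the earlier \<open>w j\<close> as conditions, yields step by step
  orthogonal vectors of the range of \<open>X\<close> with the required supports. The sum
  \<open>Y\<close> of their lines is a projection of rank \<open>m\<close> with
  \<open>XY = Y\<close>, and \<open>X = Y\<close> follows since the squared norm of
  \<open>X - Y\<close> is \<open>m - 2 * m + m\<close>.\<close>

lemma ex_line_flag: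
  assumes X: "scaled_projection N X 1 (real m)" and fat: "\<And>k. k < m \<Longrightarrow> fat N X (a k) k"
  shows "\<exists>L. line_flag N m a L \<and> (\<forall>i<N. \<forall>j<N. X i j = flag_sum L m i j)"
proof -
  have "\<exists>w. \<forall>k<n. eig N X 1 (w k) \<and> (\<forall>i<N. a k \<le> i \<longrightarrow> w k i = 0) \<and> (\<exists>i<N. w k i \<noteq> 0) \<and>
      (\<forall>j<k. ip N (w j) (w k) = 0)" if "n \<le> m" for n
    using that
  proof (induction n)
    case (Suc n)
    then obtain w where w: "\<forall>k<n. eig N X 1 (w k) \<and> (\<forall>i<N. a k \<le> i \<longrightarrow> w k i = 0) \<and> (\<exists>i<N. w k i \<noteq> 0) \<and>
      (\<forall>j<k. ip N (w j) (w k) = 0)" by auto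
    have "fat N X (a n) n" using fat Suc.prems by simp
    then obtain u where u: "eig N X 1 u" "\<forall>i<N. a n \<le> i \<longrightarrow> u i = 0" "\<exists>i<N. u i \<noteq> 0" "\<forall>j<n. ip N (w j) u = 0"
      unfolding fat_def by blast
    define w' where "w' k = (if k = n then u else w k)" for k
    have "w' n = u" "\<And>k. k < n \<Longrightarrow> w' k = w k" by (simp_all add: w'_def)
    then show ?case using w u by (intro exI[of _ w']) (auto simp: less_Suc_eq)
  qed simp
  from this[OF order_refl] obtain w where "\<forall>k<m. eig N X 1 (w k) \<and> (\<forall>i<N. a k \<le> i \<longrightarrow> w k i = 0) \<and>
      (\<exists>i<N. w k i \<noteq> 0) \<and> (\<forall>j<k. ip N (w j) (w k) = 0)" by blast
  then have w: "k < m \<Longrightarrow> eig N X 1 (w k)" "k < m \<Longrightarrow> i < N \<Longrightarrow> a k \<le> i \<Longrightarrow> w k i = 0"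
      "k < m \<Longrightarrow> \<exists>i<N. w k i \<noteq> 0" "k < m \<Longrightarrow> j < k \<Longrightarrow> ip N (w j) (w k) = 0" for i j k
    by blast+
  define L where "L k = rank1 N (w k)" for k
  have L: "line_flag N m a L" unfolding line_flag_def
  proof (intro conjI allI impI)
    fix k assume k: "k < m"
    have "ip N (w k) (w k) \<noteq> 0" using w(3)[OF k] by (auto simp: ip_self_eq_0)
    then show "scaled_projection N (L k) 1 1" unfolding L_def by (rule scaled_projection_rank1)
    fix l i j assume l: "l < k"
    have "(\<Sum>s<N. L k i s * L l s j) = (\<Sum>s<N. w k i * w l j / (ip N (w k) (w k) * ip N (w l) (w l)) * (w k s * w l s))"
      by (intro sum.cong refl) (simp add: L_def rank1_def)
    also have "\<dots> = w k i * w l j / (ip N (w k) (w k) * ip N (w l) (w l)) * ip N (w l) (w k)"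
      unfolding sum_distrib_left[symmetric] by (simp add: ip_def mult.commute)
    finally show "(\<Sum>s<N. L k i s * L l s j) = 0" using w(4)[OF k l] by simp
  next
    fix k i assume "k < m" "i < N" "a k \<le> i"
    then show "L k i i = 0" using w(2) by (simp add: L_def rank1_def)
  qed
  let ?Y = "flag_sum L m"
  have Y: "scaled_projection N ?Y 1 (real m)" by (rule scaled_projection_flag_sum[OF L order_refl])
  have XL: "(\<Sum>j<N. X i j * L k j l) = L k i l" if "k < m" "i < N" for k i l
  proof -
    have "(\<Sum>j<N. X i j * L k j l) = w k l / ip N (w k) (w k) * app N X (w k) i"
      by (simp add: L_def rank1_def app_def sum_distrib_left algebra_simps)
    then show ?thesis using w(1)[OF that(1)] that(2) by (simp add: eig_def L_def rank1_def)
  qed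
  have XY: "(\<Sum>j<N. X i j * ?Y j l) = ?Y i l" if "i < N" for i l
  proof -
    have "(\<Sum>j<N. X i j * ?Y j l) = (\<Sum>k<m. \<Sum>j<N. X i j * L k j l)"
      unfolding flag_sum_def by (simp add: sum_distrib_left) (rule sum.swap)
    then show ?thesis using XL that by (simp add: flag_sum_def)
  qed
  have "(\<Sum>i<N. \<Sum>j<N. X i j * ?Y i j) = (\<Sum>i<N. \<Sum>j<N. X i j * ?Y j i)"
    by (intro sum.cong refl) (use scaled_projectionD(2)[OF Y] in \<open>simp add: symm_def\<close>)
  also have "\<dots> = real m" using XY scaled_projectionD(3)[OF Y] by simp
  finally have "(\<Sum>i<N. \<Sum>j<N. X i j * ?Y i j) = real m" .
  moreover have "(\<Sum>i<N. \<Sum>j<N. (X i j - ?Y i j)^2) =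
      (\<Sum>i<N. \<Sum>j<N. X i j * X i j) - 2 * (\<Sum>i<N. \<Sum>j<N. X i j * ?Y i j) + (\<Sum>i<N. \<Sum>j<N. ?Y i j * ?Y i j)"
    by (simp add: power2_eq_square algebra_simps sum.distrib sum_subtractf sum_distrib_left)
  ultimately have "(\<Sum>i<N. \<Sum>j<N. (X i j - ?Y i j)^2) = 0"
    using sum_squares_scaled_projection[OF X] sum_squares_scaled_projection[OF Y] by simp
  then have "(X i j - ?Y i j)^2 = 0" if "i < N" "j < N" for i j
    using that by (simp add: sum_nonneg_eq_0_iff sum_nonneg)
  then show ?thesis using L by (intro exI[of _ L]) simp
qed

text \<open>
  The polynomial form of the incidence condition: the range of \<open>X\<close> meets \<open>\<real>\<^sup>b\<close> in dimension
  greater than \<open>m - 1 - l\<close> iff its image in the last \<open>N - b\<close> coordinates has rank at most \<open>l\<close>, that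
  is, iff eliminating any \<open>l\<close> of these coordinates leaves nothing in the others.
\<close>

definition elims_vanish :: "nat \<Rightarrow> (nat \<Rightarrow> nat \<Rightarrow> real) \<Rightarrow> nat \<Rightarrow> nat \<Rightarrow> bool" where
  "elims_vanish N X b l \<longleftrightarrow> (\<forall>js\<in>{js. set js \<subseteq> {b..<N} \<and> length js = l}. \<forall>i\<in>{b..<N}.
     elims N (map std js) X i i = 0)"

text \<open>A nonzero diagonal entry is chosen at each step. The coordinates \<open>ps\<close>
  determine the vectors of the range: one that vanishes at all of them stays in the range when the
  rank has dropped to zero.\<close>

lemma ex_elims_all:
  assumes "scaled_projection N Q c (real r)"
  shows "\<exists>ps. set ps \<subseteq> {..<N} \<and> length ps = r \<and>
    (\<exists>c'. scaled_projection N (elims N (map std ps) Q) c' 0 \<and>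
      (\<forall>u. eig N Q c u \<longrightarrow> (\<forall>p\<in>set ps. u p = 0) \<longrightarrow> eig N (elims N (map std ps) Q) c' u))"
  using assms
proof (induction r arbitrary: Q c)
  case 0
  then show ?case by (intro exI[of _ "[]"]) auto
next
  case (Suc r)
  obtain i where i: "i < N" "Q i i \<noteq> 0" using ex_diag_nonzero[OF Suc.prems] by auto
  have nz: "ip N (std i) (app N Q (std i)) \<noteq> 0" using i by (simp add: ip_std app_std)
  have "scaled_projection N (elim N (std i) Q) (c * ip N (std i) (app N Q (std i))) (real r)"
    using scaled_projection_elim[OF Suc.prems nz] by simp
  from Suc.IH[OF this] obtain ps c' where ps: "set ps \<subseteq> {..<N}" "length ps = r"
    "scaled_projection N (elims N (map std ps) (elim N (std i) Q)) c' 0"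
    "\<forall>u. eig N (elim N (std i) Q) (c * ip N (std i) (app N Q (std i))) u \<longrightarrow> (\<forall>p\<in>set ps. u p = 0) \<longrightarrow>
      eig N (elims N (map std ps) (elim N (std i) Q)) c' u" by blast
  have "eig N (elim N (std i) Q) (c * ip N (std i) (app N Q (std i))) u" if "eig N Q c u" "u i = 0" for u
    using eig_elim[OF scaled_projectionD(2)[OF Suc.prems] that(1), of "std i"] that(2) i(1) by (simp add: ip_std)
  then show ?case using ps i(1) by (intro exI[of _ "i # ps"]) auto
qed

text \<open>If some elimination of \<open>m - Suc k\<close> of the last coordinates left a nonzero
  diagonal entry, it would complete, with one more such coordinate and \<open>k\<close> arbitrary
  ones \<open>ps\<close>, to a set determining the range of \<open>X\<close>; but fatness, with
  \<open>ps\<close> as conditions, yields a nonzero vector vanishing at all of these. Conversely,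
  eliminate last coordinates until their diagonal entries vanish: what remains has rank above
  \<open>k\<close> and range in \<open>\<real>^b\<close>.\<close>

lemma fat_iff_elims_vanish:
  assumes X: "scaled_projection N X 1 (real m)" and k: "k < m"
  shows "fat N X b k \<longleftrightarrow> elims_vanish N X b (m - Suc k)"
proof
  assume fat: "fat N X b k"
  show "elims_vanish N X b (m - Suc k)" unfolding elims_vanish_def
  proof (intro ballI, rule ccontr)
    fix js i assume js: "js \<in> {js. set js \<subseteq> {b..<N} \<and> length js = m - Suc k}" and i: "i \<in> {b..<N}"
      and nz: "elims N (map std js) X i i \<noteq> 0"
    obtain c where c: "scaled_projection N (elims N (map std js) X) c (real m - real (m - Suc k))"
      "\<forall>v. eig N X 1 v \<longrightarrow> (\<forall>w\<in>set (map std js). ip N w v = 0) \<longrightarrow> eig N (elims N (map std js) X) c v"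
      using elims_nonzero[OF X _ _ nz] i js by auto
    have "real m - real (m - Suc k) = real (Suc k)" using k by (simp add: of_nat_diff)
    then have Q: "scaled_projection N (elims N (map std js) X) c (real (Suc k))" using c(1) by simp
    let ?Q = "elim N (std i) (elims N (map std js) X)"
    have inz: "ip N (std i) (app N (elims N (map std js) X) (std i)) \<noteq> 0"
      using nz i by (simp add: ip_std app_std)
    let ?c = "c * ip N (std i) (app N (elims N (map std js) X) (std i))"
    have "scaled_projection N ?Q ?c (real k)"
      using scaled_projection_elim[OF Q inz] by simp
    from ex_elims_all[OF this] obtain ps c' where ps: "set ps \<subseteq> {..<N}" "length ps = k"
      "scaled_projection N (elims N (map std ps) ?Q) c' 0"
      "\<forall>u. eig N ?Q ?c u \<longrightarrow> (\<forall>p\<in>set ps. u p = 0) \<longrightarrow> eig N (elims N (map std ps) ?Q) c' u" by blast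
    obtain u where u: "eig N X 1 u" "\<forall>i<N. b \<le> i \<longrightarrow> u i = 0" "\<exists>i<N. u i \<noteq> 0"
      "\<forall>j<k. ip N (std (ps ! j)) u = 0"
      using fat[unfolded fat_def, rule_format, of "\<lambda>j. std (ps ! j)"] by blast
    have "\<forall>w\<in>set (map std js). ip N w u = 0" using js u(2) by (auto simp: ip_std)
    then have "eig N (elims N (map std js) X) c u" using c(2) u(1) by blast
    then have "eig N ?Q ?c u"
      by (rule eig_elim[OF scaled_projectionD(2)[OF Q]]) (use u(2) i in \<open>simp add: ip_std\<close>)
    moreover have "\<forall>p\<in>set ps. u p = 0"
    proof
      fix p assume p: "p \<in> set ps"
      then obtain j where "j < k" "p = ps ! j" using ps(2) by (auto simp: in_set_conv_nth)
      then have "ip N (std p) u = 0" using u(4) by blast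
      then show "u p = 0" using p ps(1) by (simp add: ip_std subset_iff)
    qed
    ultimately have e: "eig N (elims N (map std ps) ?Q) c' u" using ps(4) by blast
    have "app N (elims N (map std ps) ?Q) u i = 0" if "i < N" for i
      unfolding app_def using scaled_projection_rank_0[OF ps(3) that] by simp
    then have "u i = 0" if "i < N" for i
      using e scaled_projectionD(1)[OF ps(3)] that by (simp add: eig_def)
    then show False using u(3) by blast
  qed
next
  assume van: "elims_vanish N X b (m - Suc k)"
  \<comment> \<open>Greedy elimination: it has either stopped within the allowed number of steps or
    performed \<open>n\<close> nondegenerate ones. After \<open>m - Suc k\<close> steps the
    hypothesis makes it stop.\<close>
  let ?good = "\<lambda>js c. set js \<subseteq> {b..<N} \<and> scaled_projection N (elims N (map std js) X) c (real m - real (length js))"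
  have "(\<exists>js c. ?good js c \<and> length js \<le> m - Suc k \<and> (\<forall>i\<in>{b..<N}. elims N (map std js) X i i = 0)) \<or>
    (\<exists>js c. ?good js c \<and> length js = n)" if "n \<le> m - Suc k" for n
    using that
  proof (induction n)
    case 0
    show ?case using X by (intro disjI2 exI[of _ "[]"] exI[of _ 1]) simp
  next
    case (Suc n)
    then consider "\<exists>js c. ?good js c \<and> length js \<le> m - Suc k \<and> (\<forall>i\<in>{b..<N}. elims N (map std js) X i i = 0)"
      | js c where "?good js c" "length js = n" by fastforce
    then show ?case
    proof cases
      case 2
      show ?thesis
      proof (cases "\<forall>i\<in>{b..<N}. elims N (map std js) X i i = 0")
        case True
        have "length js \<le> m - Suc k" using 2 Suc.prems by simp
        then show ?thesis using 2 True by blast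
      next
        case False
        then obtain i where i: "i \<in> {b..<N}" "elims N (map std js) X i i \<noteq> 0" by blast
        let ?Q = "elims N (map std js) X"
        have "ip N (std i) (app N ?Q (std i)) \<noteq> 0" using i by (simp add: ip_std app_std)
        then have "scaled_projection N (elim N (std i) ?Q) (c * ip N (std i) (app N ?Q (std i)))
            (real m - real (length js) - 1)"
          using 2(1) by (intro scaled_projection_elim) auto
        then have "?good (js @ [i]) (c * ip N (std i) (app N ?Q (std i)))"
          using 2(1) i(1) by (simp add: algebra_simps)
        then show ?thesis using 2(2) by (intro disjI2) (metis length_append_singleton)
      qed
    qed blast
  qed
  from this[of "m - Suc k"] obtain js c where js: "?good js c" "length js \<le> m - Suc k"
    "\<forall>i\<in>{b..<N}. elims N (map std js) X i i = 0"
    using van unfolding elims_vanish_def by fastforce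
  show "fat N X b k"
  proof (rule fatI)
    show "scaled_projection N (elims N (map std js) X) c (real m - real (length js))" using js by blast
    show "real k < real m - real (length js)" using js(2) k by linarith
    show "range_in N X (elims N (map std js) X)" by (rule range_in_elims[OF range_in_self[OF X]])
  qed (use js(3) in auto)
qed

section \<open>The projection of the variety of flags\<close>

lemma vec_first_carrier: "vec_first x n \<in> carrier_vec n"
  by (simp add: vec_first_def)

lemma block_vec_first: "i < N \<Longrightarrow> j < N \<Longrightarrow> block N (vec_first x (N^2)) 0 i j = block N x 0 i j"
  using matrix_index_less[of i N j] by (simp add: block_def vec_first_def)

context flag_shape
begin

definition base :: "real vec set" where
  "base = (\<lambda>x. vec_first x (N^2)) ` flags"

definition base_flag :: "real vec \<Rightarrow> real vec" where
  "base_flag x = flag_point (peel_line (block N x 0))"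

text \<open>The zeros of this polynomial in the entries of \<open>X\<close> are removed to obtain
  the open set over which the projection is inverted by \<open>base_flag\<close>.\<close>

definition cell_value :: "real vec \<Rightarrow> real" where
  "cell_value x = (\<Prod>k<m. peel (Suc k) (block N x 0) (big_cell k) (big_cell k))"

lemma base_carrier: "base \<subseteq> carrier_vec (N^2)"
  using vec_first_carrier by (auto simp: base_def)

lemma flagsD:
  assumes "x \<in> flags"
  shows "line_flag N m a (lines x)" "\<forall>i<N. \<forall>j<N. block N (vec_first x (N^2)) 0 i j = flag_sum (lines x) m i j"
  using assms by (auto simp: flags_def flag_condition_def block_vec_first)

lemma base_flag_vec_first:
  assumes x: "x \<in> flags" and nz: "cell_value (vec_first x (N^2)) \<noteq> 0"
  shows "base_flag (vec_first x (N^2)) = x"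
proof -
  note L = flagsD[OF x]
  have "\<forall>k<m. peel (Suc k) (block N (vec_first x (N^2)) 0) (big_cell k) (big_cell k) \<noteq> 0"
    using nz by (auto simp: cell_value_def)
  then have "\<forall>k<m. lines x k (big_cell k) (big_cell k) \<noteq> 0"
    using peel_nonzero_iff[OF L] by blast
  then have "lines x k i j = peel_line (block N (vec_first x (N^2)) 0) k i j" if "k < m" "i < N" "j < N" for k i j
    using peel_line_eq[OF L _ that] by simp
  then show ?thesis unfolding base_flag_def by (intro flags_eq_flag_point[OF x, symmetric])
qed

lemma cell_value_chart: "cell_value (vec_first (chart big_cell t) (N^2)) \<noteq> 0"
proof -
  let ?x = "chart big_cell t"
  note L = flagsD[OF chart_in_flags[OF pivots_big_cell, of t]]
  have "lines ?x k (big_cell k) (big_cell k) \<noteq> 0" if "k < m" for k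
    using gs_line_big_cell_nonzero[OF that, of t] big_cell_less[OF that] that
    by (simp add: chart_def lines_flag_point)
  then have "\<forall>k<m. peel (Suc k) (block N (vec_first ?x (N^2)) 0) (big_cell k) (big_cell k) \<noteq> 0"
    using peel_nonzero_iff[OF L] by blast
  then show ?thesis by (auto simp: cell_value_def)
qed

lemma polyfun_peel:
  assumes "is_subring K" "i < N" "j < N"
  shows "polyfun K (N^2) (\<lambda>x. peel k (block N x 0) i j)"
proof -
  have b: "polyfun K (N^2) (\<lambda>x. block N x 0 i j)" if "i < N" "j < N" for i j
    using polyfun_block[of 0 1 i N j K] assms(1) that by simp
  have "polyfun K (N^2) (\<lambda>x. elims N (map (\<lambda>w. w x) (map (\<lambda>j x. std (big_cell j)) (rev [k..<m]))) (block N x 0) i j)"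
    by (rule polyfun_elims[OF assms(1)]) (use b assms polyfun_std in auto)
  then show ?thesis by (simp add: peel_def comp_def)
qed

lemma polyfun_cell_value: "polyfun UNIV (N^2) cell_value"
  unfolding cell_value_def by (intro polyfun_prod polyfun_peel) (use big_cell_less in auto)

lemma ratfun_base_flag:
  assumes r: "r < Suc m * N^2" and S: "\<And>x. x \<in> S \<Longrightarrow> cell_value x \<noteq> 0"
  shows "ratfun UNIV (N^2) S (\<lambda>x. base_flag x $ r)"
  unfolding base_flag_def
proof (intro ratfun_flag_point is_subring_UNIV r)
  fix k i j assume k: "k < m" and ij: "i < N" "j < N"
  note c = big_cell_less[OF k]
  show "ratfun UNIV (N^2) S (\<lambda>x. peel_line (block N x 0) k i j)"
    unfolding peel_line_def
  proof (intro ratfun_divide ratfun_mult ratfun_polyfun polyfun_sum polyfun_power polyfun_peel is_subring_UNIV)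
    fix x assume "x \<in> S"
    then have "peel (Suc k) (block N x 0) (big_cell k) (big_cell k) \<noteq> 0"
      using S k by (auto simp: cell_value_def)
    then have "0 < (peel (Suc k) (block N x 0) (big_cell k) (big_cell k))^2" by simp
    also have "\<dots> \<le> (\<Sum>l<N. (peel (Suc k) (block N x 0) l (big_cell k))^2)"
      by (rule member_le_sum[where f = "\<lambda>l. (peel (Suc k) (block N x 0) l (big_cell k))^2"]) (use c in auto)
    finally show "(\<Sum>l<N. (peel (Suc k) (block N x 0) l (big_cell k))^2) \<noteq> 0" by simp
  qed (use ij c in auto)
qed

lemma polyfun_vec_first:
  assumes "polyfun K (N^2) f" "is_subring K"
  shows "polyfun K (Suc m * N^2) (\<lambda>x. f (vec_first x (N^2)))"
  by (rule polyfun_compose[OF assms]) (use assms(2) in \<open>auto simp: vec_first_def intro!: polyfun_index\<close>)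

text \<open>The chart of the flags followed by the projection, inverted through
  \<open>base_flag\<close>; density is inherited by pulling equations back to the flags. This gives
  the Schubert variety the same dimension as the flags and makes its open cell dense.\<close>

lemma base_rational_chart:
  "rational_chart (N^2) chart_dim base (\<lambda>t. vec_first (chart big_cell t) (N^2))
     (\<lambda>x. chart_coord big_cell (base_flag x))"
proof -
  interpret F: rational_chart "Suc m * N^2" chart_dim flags "chart big_cell" "chart_coord big_cell"
    by (rule flags_rational_chart[OF pivots_big_cell])
  let ?psi = "\<lambda>t. vec_first (chart big_cell t) (N^2)"
  have inv: "base_flag (?psi t) = chart big_cell t" for t
    by (rule base_flag_vec_first[OF chart_in_flags[OF pivots_big_cell] cell_value_chart])
  show ?thesis
  proof
    show "base \<subseteq> carrier_vec (N^2)" by (rule base_carrier)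
    show "?psi t \<in> base" for t unfolding base_def using chart_in_flags[OF pivots_big_cell] by blast
    show "ratfun UNIV chart_dim (carrier_vec chart_dim) (\<lambda>t. ?psi t $ i)" if "i < N^2" for i
      using F.psi_rat[of i] that by (simp add: vec_first_def)
    show "ratfun UNIV (N^2) (?psi ` carrier_vec chart_dim) (\<lambda>x. chart_coord big_cell (base_flag x) i)" if "i < chart_dim" for i
    proof (rule ratfun_compose[OF F.phi_rat[OF that] is_subring_UNIV])
      show "ratfun UNIV (N^2) (?psi ` carrier_vec chart_dim) (\<lambda>x. base_flag x $ r)" if "r < Suc m * N^2" for r
        by (rule ratfun_base_flag[OF that]) (use cell_value_chart in auto)
      show "base_flag ` ?psi ` carrier_vec chart_dim \<subseteq> chart big_cell ` carrier_vec chart_dim"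
        using inv by auto
    qed
    show "chart_coord big_cell (base_flag (?psi t)) i = t $ i" if "t \<in> carrier_vec chart_dim" "i < chart_dim" for t i
      using F.phi_psi[OF that] by (simp add: inv)
    fix f x assume f: "f \<in> polys UNIV (N^2)" "\<And>t. t \<in> carrier_vec chart_dim \<Longrightarrow> eval_mpoly f (?psi t) = 0" and x: "x \<in> base"
    obtain y where y: "y \<in> flags" "x = vec_first y (N^2)" using x unfolding base_def by blast
    obtain g where g: "g \<in> polys UNIV (Suc m * N^2)" "\<And>x. eval_mpoly f (vec_first x (N^2)) = eval_mpoly g x"
      using polyfun_vec_first[OF polyfun_eval[OF f(1)] is_subring_UNIV] unfolding polyfun_def by blast
    have "eval_mpoly g y = 0" by (rule F.dense[OF g(1) _ y(1)]) (use f(2) g(2) in auto)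
    then show "eval_mpoly f x = 0" using g(2) y(2) by simp
  qed
qed

lemma birational_projection: "birational_map (Suc m * N^2) (N^2) flags base (\<lambda>x. vec_first x (N^2))"
proof -
  interpret F: rational_chart "Suc m * N^2" chart_dim flags "chart big_cell" "chart_coord big_cell"
    by (rule flags_rational_chart[OF pivots_big_cell])
  interpret B: rational_chart "N^2" chart_dim base "\<lambda>t. vec_first (chart big_cell t) (N^2)"
    "\<lambda>x. chart_coord big_cell (base_flag x)"
    by (rule base_rational_chart)
  let ?pr = "\<lambda>x. vec_first x (N^2)"
  obtain h where h: "h \<in> polys UNIV (N^2)" "\<And>x. cell_value x = eval_mpoly h x"
    using polyfun_cell_value unfolding polyfun_def by blast
  obtain h' where h': "h' \<in> polys UNIV (Suc m * N^2)" "\<And>x. cell_value (?pr x) = eval_mpoly h' x"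
    using polyfun_vec_first[OF polyfun_cell_value is_subring_UNIV] unfolding polyfun_def by blast
  define U' where "U' = {x \<in> flags. cell_value (?pr x) \<noteq> 0}"
  define U where "U = {x \<in> base. cell_value x \<noteq> 0}"
  have U': "zariski_open_in (Suc m * N^2) flags U'" "zariski_dense_in (Suc m * N^2) flags U'"
  proof -
    show "zariski_open_in (Suc m * N^2) flags U'"
      unfolding U'_def h'(2) by (rule zariski_open_in_principal[OF h'(1) F.V_carrier])
    show "zariski_dense_in (Suc m * N^2) flags U'"
      by (rule F.zariski_dense_in_chart) (use F.psi_in cell_value_chart in \<open>auto simp: U'_def\<close>)
  qed
  have U: "zariski_open_in (N^2) base U" "zariski_dense_in (N^2) base U"
  proof -
    show "zariski_open_in (N^2) base U"
      unfolding U_def h(2) by (rule zariski_open_in_principal[OF h(1) B.V_carrier])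
    show "zariski_dense_in (N^2) base U"
      by (rule B.zariski_dense_in_chart) (use B.psi_in cell_value_chart in \<open>auto simp: U_def\<close>)
  qed
  have inv: "base_flag (?pr x) = x" if "x \<in> U'" for x
    using base_flag_vec_first that by (simp add: U'_def)
  have inj: "inj_on ?pr U'" by (rule inj_on_inverseI[where g = base_flag]) (rule inv)
  have img: "?pr ` U' = U" unfolding U'_def U_def base_def by auto
  have the_inv: "the_inv_into U' ?pr x = base_flag x" if x: "x \<in> U" for x
  proof -
    obtain y where y: "y \<in> U'" "x = ?pr y" using x img by blast
    then show ?thesis using the_inv_into_f_f[OF inj y(1)] inv[OF y(1)] by simp
  qed
  have "regular_map (Suc m * N^2) (N^2) U' ?pr"
    unfolding regular_map_def
  proof (intro conjI allI impI regular_function_ratfun)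
    show "?pr ` U' \<subseteq> carrier_vec (N^2)" using vec_first_carrier by blast
    fix i assume "i < N^2"
    then show "ratfun UNIV (Suc m * N^2) U' (\<lambda>x. ?pr x $ i)"
      by (simp add: vec_first_def) (intro ratfun_polyfun polyfun_index is_subring_UNIV, simp)
  qed
  moreover have "regular_map (N^2) (Suc m * N^2) U (the_inv_into U' ?pr)"
    unfolding regular_map_def
  proof (intro conjI allI impI regular_function_ratfun)
    show "the_inv_into U' ?pr ` U \<subseteq> carrier_vec (Suc m * N^2)"
      using the_inv flag_point_carrier by (auto simp: base_flag_def)
    fix i assume i: "i < Suc m * N^2"
    have "ratfun UNIV (N^2) U (\<lambda>x. base_flag x $ i)"
      by (rule ratfun_base_flag[OF i]) (simp add: U_def)
    then show "ratfun UNIV (N^2) U (\<lambda>x. the_inv_into U' ?pr x $ i)"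
      by (subst ratfun_cong[where g = "\<lambda>x. base_flag x $ i"]) (simp_all add: the_inv)
  qed
  moreover have "bij_betw ?pr U' U" using inj img by (simp add: bij_betw_def)
  ultimately have "biregular_iso (Suc m * N^2) (N^2) U' U ?pr" unfolding biregular_iso_def by blast
  then show ?thesis unfolding birational_map_def using U U' by (auto simp: base_def)
qed

theorem Q_desingularization_flags:
  assumes "algebraic_set \<rat> (N^2) base"
  shows "Q_desingularization (N^2) (m * N^2) base flags"
proof -
  interpret F: rational_chart "Suc m * N^2" chart_dim flags "chart big_cell" "chart_coord big_cell"
    by (rule flags_rational_chart[OF pivots_big_cell])
  interpret B: rational_chart "N^2" chart_dim base "\<lambda>t. vec_first (chart big_cell t) (N^2)"
    "\<lambda>x. chart_coord big_cell (base_flag x)"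
    by (rule base_rational_chart)
  have M: "N^2 + m * N^2 = Suc m * N^2" by simp
  have alg: "algebraic_set \<rat> (Suc m * N^2) flags"
    unfolding flags_def by (rule algebraic_set_rational_condition[OF rational_condition_flag])
  have "algebraic_set UNIV (Suc m * N^2) flags"
    using alg polys_UNIV unfolding algebraic_set_def by blast
  moreover have "nonsingular (Suc m * N^2) flags"
    using flags_Q_nonsingular unfolding Q_nonsingular_def by blast
  ultimately show ?thesis
    unfolding Q_desingularization_def desingularization_def M F.alg_dim_eq B.alg_dim_eq
    using assms alg birational_projection flags_Q_nonsingular flags_projectively_Q_closed by blast
qed

end

section \<open>Schubert varieties\<close>

text \<open>Independent subsets have at most as many elements as the dimension of the ambient space,
  so a maximal one exists and is a basis; generation and independence are then restated in
  coordinates.\<close>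

lemma subspace_finite_basis:
  assumes W: "W \<subseteq> carrier_vec N" "0\<^sub>v N \<in> W" "\<forall>u\<in>W. \<forall>v\<in>W. u + v \<in> W" "\<forall>c. \<forall>u\<in>W. c \<cdot>\<^sub>v u \<in> W"
  shows "\<exists>B. finite B \<and> B \<subseteq> W \<and> card B = subspace_dim N W \<and>
    (\<forall>u\<in>W. \<exists>c. \<forall>i<N. u $ i = (\<Sum>b\<in>B. c b * b $ i)) \<and>
    (\<forall>c. (\<forall>i<N. (\<Sum>b\<in>B. c b * b $ i) = 0) \<longrightarrow> (\<forall>b\<in>B. c b = 0))"
proof -
  interpret V: vec_space "TYPE(real)" N .
  have sub: "submodule class_ring W (module_vec TYPE(real) N)"
    using vec_module W by (simp add: submodule_def module_vec_simps)
  have "subspace class_ring W (module_vec TYPE(real) N)"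
    using sub vec_vs[where ?'a = real] by (simp add: subspace_def class_field_def)
  then have vs: "vectorspace class_ring (module_vec TYPE(real) N\<lparr>carrier := W\<rparr>)"
    by (rule V.subspace_is_vs)
  interpret S: vectorspace class_ring "module_vec TYPE(real) N\<lparr>carrier := W\<rparr>" by (rule vs)
  define P where "P A \<longleftrightarrow> A \<subseteq> W \<and> S.lin_indpt A" for A
  have P_li: "finite A \<and> card A \<le> V.dim" if A: "P A" for A
  proof -
    have "V.lin_indpt A" using A V.span_li_not_depend(2)[of A W, OF _ sub] unfolding P_def by blast
    then show ?thesis using V.li_le_dim[OF V.fin_dim, of A] A W(1) unfolding P_def by blast
  qed
  have "P {}" by (simp add: P_def S.lin_dep_def)
  then obtain B where B: "finite B" "maximal B P" using maximal_exists[of P V.dim "{}"] P_li by blast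
  have "S.basis B" using S.max_li_is_basis[of B] B(2) by (simp add: P_def[abs_def])
  then have basis: "S.lin_indpt B" "S.span B = W" "B \<subseteq> W" by (simp_all add: S.basis_def)
  have card: "card B = subspace_dim N W"
    using S.dim_basis[OF B(1) \<open>S.basis B\<close>] by (simp add: subspace_dim_def)
  have li: "\<not> V.lin_dep B" "V.span B = W" using basis V.span_li_not_depend[OF basis(3) sub] by simp_all
  have BN: "B \<subseteq> carrier_vec N" using basis(3) W(1) by blast
  have gen: "\<exists>c. \<forall>i<N. u $ i = (\<Sum>b\<in>B. c b * b $ i)" if u: "u \<in> W" for u
  proof -
    have "u \<in> V.span B" using u li(2) by simp
    then obtain c A where A: "u = V.lincomb c A" "A \<subseteq> B" unfolding V.span_def by blast
    have "u $ i = (\<Sum>b\<in>B. (if b \<in> A then c b else 0) * b $ i)" if i: "i < N" for i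
    proof -
      have "u $ i = (\<Sum>b\<in>A. c b * b $ i)" using V.lincomb_index[OF i, of A c] A BN by auto
      also have "\<dots> = (\<Sum>b\<in>B. (if b \<in> A then c b else 0) * b $ i)"
        by (rule sum.mono_neutral_cong_left) (use A B(1) in auto)
      finally show ?thesis .
    qed
    then show ?thesis by (intro exI[of _ "\<lambda>b. if b \<in> A then c b else 0"]) blast
  qed
  have indep: "\<forall>b\<in>B. c b = 0" if c: "\<forall>i<N. (\<Sum>b\<in>B. c b * b $ i) = 0" for c
  proof (rule ccontr)
    assume "\<not> (\<forall>b\<in>B. c b = 0)"
    then obtain b where b: "b \<in> B" "c b \<noteq> 0" by blast
    have "V.lincomb c B = 0\<^sub>v N"
    proof (rule eq_vecI)
      show "dim_vec (V.lincomb c B) = dim_vec (0\<^sub>v N)" using V.lincomb_dim[OF B(1) BN] by simp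
      fix i assume "i < dim_vec (0\<^sub>v N)"
      then show "V.lincomb c B $ i = 0\<^sub>v N $ i" using V.lincomb_index[OF _ BN] c by simp
    qed
    then have "V.lin_dep B" unfolding V.lin_dep_def using B(1) b by blast
    then show False using li(1) by simp
  qed
  show ?thesis using B(1) basis(3) card gen indep by blast
qed

text \<open>If the dimension exceeds \<open>k\<close>, the \<open>k\<close> conditions are
  homogeneous equations in more unknowns. Otherwise the vectors of a basis can be taken as
  conditions: a vector of \<open>W\<close> that satisfies them is orthogonal to itself.\<close>

lemma less_subspace_dim_iff:
  assumes W: "W \<subseteq> carrier_vec N" "0\<^sub>v N \<in> W" "\<forall>u\<in>W. \<forall>v\<in>W. u + v \<in> W" "\<forall>c. \<forall>u\<in>W. c \<cdot>\<^sub>v u \<in> W"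
  shows "k < subspace_dim N W \<longleftrightarrow>
    (\<forall>w. \<exists>u\<in>W. (\<exists>i<N. u $ i \<noteq> 0) \<and> (\<forall>j<k. ip N (w j) (\<lambda>i. u $ i) = 0))"
proof -
  obtain B where B: "finite B" "B \<subseteq> W" "card B = subspace_dim N W"
    and gen: "\<forall>u\<in>W. \<exists>c. \<forall>i<N. u $ i = (\<Sum>b\<in>B. c b * b $ i)"
    and indep: "\<forall>c. (\<forall>i<N. (\<Sum>b\<in>B. c b * b $ i) = 0) \<longrightarrow> (\<forall>b\<in>B. c b = 0)"
    using subspace_finite_basis[OF W] by blast
  have ip: "ip N w (\<lambda>i. u $ i) = (\<Sum>b\<in>B. c b * ip N w (\<lambda>i. b $ i))"
    if u: "\<forall>i<N. u $ i = (\<Sum>b\<in>B. c b * b $ i)" for w u c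
  proof -
    have "ip N w (\<lambda>i. u $ i) = (\<Sum>i<N. \<Sum>b\<in>B. c b * (w i * b $ i))"
      unfolding ip_def by (rule sum.cong) (use u in \<open>auto simp: sum_distrib_left algebra_simps\<close>)
    also have "\<dots> = (\<Sum>b\<in>B. c b * ip N w (\<lambda>i. b $ i))"
      by (subst sum.swap) (simp add: ip_def sum_distrib_left)
    finally show ?thesis .
  qed
  show ?thesis
  proof
    assume k: "k < subspace_dim N W"
    show "\<forall>w. \<exists>u\<in>W. (\<exists>i<N. u $ i \<noteq> 0) \<and> (\<forall>j<k. ip N (w j) (\<lambda>i. u $ i) = 0)"
    proof
      fix w
      obtain c where c: "\<exists>b\<in>B. c b \<noteq> 0" "\<forall>j\<in>{..<k}. (\<Sum>b\<in>B. c b * ip N (w j) (\<lambda>i. b $ i)) = 0"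
        using ex_nontrivial_solution[of "{..<k}" B "\<lambda>b j. ip N (w j) (\<lambda>i. b $ i)"] B k by auto
      have "\<exists>u\<in>W. \<forall>i<N. u $ i = (\<Sum>b\<in>F. c b * b $ i)" if F: "finite F" "F \<subseteq> B" for F
        using F
      proof (induction rule: finite_induct)
        case empty
        then show ?case using W(2) by (intro bexI[of _ "0\<^sub>v N"]) auto
      next
        case (insert x F)
        then obtain u where u: "u \<in> W" "\<forall>i<N. u $ i = (\<Sum>b\<in>F. c b * b $ i)" by auto
        have x: "x \<in> W" using insert.prems B(2) by auto
        have d: "dim_vec u = N" "dim_vec x = N" using u(1) x W(1) by auto
        have "c x \<cdot>\<^sub>v x + u \<in> W" using W(3,4) u(1) x by blast
        moreover have "\<forall>i<N. (c x \<cdot>\<^sub>v x + u) $ i = (\<Sum>b\<in>insert x F. c b * b $ i)"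
          using insert.hyps u(2) d by simp
        ultimately show ?case by blast
      qed
      then obtain u where u: "u \<in> W" "\<forall>i<N. u $ i = (\<Sum>b\<in>B. c b * b $ i)" using B(1) by blast
      have "\<exists>i<N. u $ i \<noteq> 0"
      proof (rule ccontr)
        assume "\<not> (\<exists>i<N. u $ i \<noteq> 0)"
        then have "\<forall>i<N. (\<Sum>b\<in>B. c b * b $ i) = 0" using u(2) by simp
        then show False using indep c(1) by blast
      qed
      then show "\<exists>u\<in>W. (\<exists>i<N. u $ i \<noteq> 0) \<and> (\<forall>j<k. ip N (w j) (\<lambda>i. u $ i) = 0)"
        using u(1) ip[OF u(2)] c(2) by auto
    qed
  next
    assume r: "\<forall>w. \<exists>u\<in>W. (\<exists>i<N. u $ i \<noteq> 0) \<and> (\<forall>j<k. ip N (w j) (\<lambda>i. u $ i) = 0)"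
    show "k < subspace_dim N W"
    proof (rule ccontr)
      assume "\<not> k < subspace_dim N W"
      then have k: "card B \<le> k" using B(3) by simp
      obtain e where e: "bij_betw e {0..<card B} B" using ex_bij_betw_nat_finite[OF B(1)] by blast
      obtain u where u: "u \<in> W" "\<exists>i<N. u $ i \<noteq> 0" "\<forall>j<k. ip N (\<lambda>i. e j $ i) (\<lambda>i. u $ i) = 0"
        using r[rule_format, of "\<lambda>j i. e j $ i"] by blast
      have orth: "ip N (\<lambda>i. u $ i) (\<lambda>i. b $ i) = 0" if b: "b \<in> B" for b
      proof -
        have "b \<in> e ` {0..<card B}" using e b by (simp add: bij_betw_def)
        then obtain j where "j < card B" "b = e j" by auto
        then show ?thesis using u(3) k ip_commute by simp
      qed
      obtain c where c: "\<forall>i<N. u $ i = (\<Sum>b\<in>B. c b * b $ i)" using gen u(1) by blast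
      have "(\<Sum>i<N. u $ i * u $ i) = 0"
        using ip[OF c, of "\<lambda>i. u $ i"] orth by (simp add: ip_def)
      then have "\<forall>i<N. u $ i = 0" by (simp add: sum_nonneg_eq_0_iff)
      then show False using u(2) by blast
    qed
  qed
qed

lemma mem_coord_subspace_iff:
  assumes b: "b \<le> N"
  shows "u \<in> coord_subspace N b \<longleftrightarrow> u \<in> carrier_vec N \<and> (\<forall>i<N. b \<le> i \<longrightarrow> u $ i = 0)"
proof -
  interpret V: vec_space "TYPE(real)" N .
  let ?U = "{unit_vec N i | i. i < b} :: real vec set"
  have U: "?U \<subseteq> carrier_vec N" by auto
  have fin: "finite ?U" by simp
  show ?thesis
  proof
    assume "u \<in> coord_subspace N b"
    then obtain c A where A: "finite A" "A \<subseteq> ?U" "u = V.lincomb c A"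
      unfolding coord_subspace_def V.span_def by blast
    have AN: "A \<subseteq> carrier_vec N" using A(2) U by blast
    have "u $ i = 0" if i: "i < N" "b \<le> i" for i
    proof -
      have "v $ i = 0" if v: "v \<in> A" for v using A(2) v i by auto
      then show ?thesis using V.lincomb_index[OF i(1) AN] A(3) by simp
    qed
    moreover have "u \<in> carrier_vec N" using V.lincomb_dim[OF A(1) AN] A(3) by (auto intro: carrier_vecI)
    ultimately show "u \<in> carrier_vec N \<and> (\<forall>i<N. b \<le> i \<longrightarrow> u $ i = 0)" by blast
  next
    assume u: "u \<in> carrier_vec N \<and> (\<forall>i<N. b \<le> i \<longrightarrow> u $ i = 0)"
    have inj: "inj_on (\<lambda>i. unit_vec N i :: real vec) {..<b}"
      using b by (auto intro!: inj_onI simp: unit_vec_eq)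
    have U_eq: "?U = unit_vec N ` {..<b}" by auto
    define c where "c v = u $ the_inv_into {..<b} (unit_vec N) v" for v :: "real vec"
    have "u = V.lincomb c ?U"
    proof (rule eq_vecI)
      show dim: "dim_vec u = dim_vec (V.lincomb c ?U)" using V.lincomb_dim[OF fin U, of c] u by auto
      fix j assume "j < dim_vec (V.lincomb c ?U)"
      then have j: "j < N" using dim u by auto
      have "V.lincomb c ?U $ j = (\<Sum>v\<in>unit_vec N ` {..<b}. c v * v $ j)"
        using V.lincomb_index[OF j U, of c] by (simp add: U_eq)
      also have "\<dots> = (\<Sum>i<b. c (unit_vec N i) * unit_vec N i $ j)"
        by (subst sum.reindex[OF inj]) simp
      also have "\<dots> = (\<Sum>i<b. if i = j then u $ i else 0)"
        using b j by (intro sum.cong refl) (auto simp: c_def the_inv_into_f_f[OF inj])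
      also have "\<dots> = u $ j" using u j by (simp add: sum.delta)
      finally show "u $ j = V.lincomb c ?U $ j" by simp
    qed
    then show "u \<in> coord_subspace N b" unfolding coord_subspace_def V.span_def using fin by blast
  qed
qed

lemma mem_mat_image_iff:
  assumes X: "X \<in> carrier_mat N N" "X * X = X"
  shows "u \<in> mat_image X \<longleftrightarrow> u \<in> carrier_vec N \<and> eig N (\<lambda>i j. X $$ (i, j)) 1 (\<lambda>i. u $ i)"
proof -
  have app: "app N (\<lambda>i j. X $$ (i, j)) (\<lambda>i. v $ i) i = (X *\<^sub>v v) $ i" if "v \<in> carrier_vec N" "i < N" for v i
    using that X(1) by (simp add: app_def scalar_prod_def lessThan_atLeast0)
  have "u \<in> mat_image X \<longleftrightarrow> u \<in> carrier_vec N \<and> X *\<^sub>v u = u"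
  proof
    assume "u \<in> mat_image X"
    then obtain v where v: "v \<in> carrier_vec N" "u = X *\<^sub>v v" using X(1) by (auto simp: mat_image_def)
    then have "X *\<^sub>v u = (X * X) *\<^sub>v v" using X(1) by simp
    then show "u \<in> carrier_vec N \<and> X *\<^sub>v u = u" using v X by simp
  next
    assume u: "u \<in> carrier_vec N \<and> X *\<^sub>v u = u"
    then have "u = X *\<^sub>v u" "u \<in> carrier_vec (dim_col X)" using X(1) by auto
    then show "u \<in> mat_image X" unfolding mat_image_def by blast
  qed
  also have "\<dots> \<longleftrightarrow> u \<in> carrier_vec N \<and> (\<forall>i<N. (X *\<^sub>v u) $ i = u $ i)"
  proof
    assume u: "u \<in> carrier_vec N \<and> (\<forall>i<N. (X *\<^sub>v u) $ i = u $ i)"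
    have "X *\<^sub>v u = u" by (rule eq_vecI) (use u X(1) in auto)
    then show "u \<in> carrier_vec N \<and> X *\<^sub>v u = u" using u by blast
  qed simp
  finally show ?thesis using app by (auto simp: eig_def)
qed

lemma less_subspace_dim_iff_fat:
  assumes X: "X \<in> carrier_mat N N" "X * X = X" and b: "b \<le> N"
  shows "k < subspace_dim N (mat_image X \<inter> coord_subspace N b) \<longleftrightarrow> fat N (\<lambda>i j. X $$ (i, j)) b k"
proof -
  let ?W = "mat_image X \<inter> coord_subspace N b" and ?X = "\<lambda>i j. X $$ (i, j)"
  have W: "u \<in> ?W \<longleftrightarrow> u \<in> carrier_vec N \<and> eig N ?X 1 (\<lambda>i. u $ i) \<and> (\<forall>i<N. b \<le> i \<longrightarrow> u $ i = 0)" for u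
    using mem_mat_image_iff[OF X] mem_coord_subspace_iff[OF b] by blast
  have add: "app N ?X (\<lambda>i. (u + v) $ i) i = app N ?X (\<lambda>i. u $ i) i + app N ?X (\<lambda>i. v $ i) i"
    if "u \<in> carrier_vec N" "v \<in> carrier_vec N" for u v i
    using that by (simp add: app_def algebra_simps sum.distrib)
  have smult: "app N ?X (\<lambda>i. (c \<cdot>\<^sub>v u) $ i) i = c * app N ?X (\<lambda>i. u $ i) i"
    if "u \<in> carrier_vec N" for u c i
    using that by (simp add: app_def sum_distrib_left mult.left_commute)
  have "k < subspace_dim N ?W \<longleftrightarrow>
    (\<forall>w. \<exists>u\<in>?W. (\<exists>i<N. u $ i \<noteq> 0) \<and> (\<forall>j<k. ip N (w j) (\<lambda>i. u $ i) = 0))"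
  proof (rule less_subspace_dim_iff)
    show "?W \<subseteq> carrier_vec N" using W by blast
    show "0\<^sub>v N \<in> ?W" unfolding W by (simp add: eig_def app_def)
    show "\<forall>u\<in>?W. \<forall>v\<in>?W. u + v \<in> ?W"
      unfolding W Ball_def using add by (auto simp: eig_def)
    show "\<forall>c. \<forall>u\<in>?W. c \<cdot>\<^sub>v u \<in> ?W"
      unfolding W Ball_def using smult by (auto simp: eig_def)
  qed
  also have "\<dots> \<longleftrightarrow> fat N ?X b k"
    unfolding fat_def
  proof (intro iff_allI iffI)
    fix w :: "nat \<Rightarrow> nat \<Rightarrow> real"
    assume "\<exists>u\<in>?W. (\<exists>i<N. u $ i \<noteq> 0) \<and> (\<forall>j<k. ip N (w j) (\<lambda>i. u $ i) = 0)"
    then obtain u where u: "u \<in> ?W" "\<exists>i<N. u $ i \<noteq> 0" "\<forall>j<k. ip N (w j) (\<lambda>i. u $ i) = 0" by blast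
    then show "\<exists>u. eig N ?X 1 u \<and> (\<forall>i<N. b \<le> i \<longrightarrow> u i = 0) \<and> (\<exists>i<N. u i \<noteq> 0) \<and> (\<forall>j<k. ip N (w j) u = 0)"
      using W[of u] by (intro exI[of _ "\<lambda>i. u $ i"]) blast
  next
    fix w :: "nat \<Rightarrow> nat \<Rightarrow> real"
    assume "\<exists>u. eig N ?X 1 u \<and> (\<forall>i<N. b \<le> i \<longrightarrow> u i = 0) \<and> (\<exists>i<N. u i \<noteq> 0) \<and> (\<forall>j<k. ip N (w j) u = 0)"
    then obtain u where u: "eig N ?X 1 u" "\<forall>i<N. b \<le> i \<longrightarrow> u i = 0" "\<exists>i<N. u i \<noteq> 0" "\<forall>j<k. ip N (w j) u = 0" by blast
    have "app N ?X (\<lambda>i. vec N u $ i) i = app N ?X u i" for i by (simp add: app_def)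
    then have "vec N u \<in> ?W" unfolding W using u(1,2) by (simp add: eig_def)
    moreover have "ip N (w j) (\<lambda>i. vec N u $ i) = ip N (w j) u" for j by (simp add: ip_def)
    ultimately show "\<exists>u\<in>?W. (\<exists>i<N. u $ i \<noteq> 0) \<and> (\<forall>j<k. ip N (w j) (\<lambda>i. u $ i) = 0)"
      using u(3,4) by (intro bexI[of _ "vec N u"]) auto
  qed
  finally show ?thesis .
qed

lemma eig_cong:
  assumes "\<And>i j. i < N \<Longrightarrow> j < N \<Longrightarrow> X i j = Y i j"
  shows "eig N X c u \<longleftrightarrow> eig N Y c u"
  unfolding eig_def app_def using assms by simp

lemma fat_cong:
  assumes "\<And>i j. i < N \<Longrightarrow> j < N \<Longrightarrow> X i j = Y i j"
  shows "fat N X b k \<longleftrightarrow> fat N Y b k"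
  unfolding fat_def using eig_cong[OF assms] by simp

lemma mem_grassmannian_iff:
  "X \<in> grassmannian m n \<longleftrightarrow>
     X \<in> carrier_mat (m + n) (m + n) \<and> scaled_projection (m + n) (\<lambda>i j. X $$ (i, j)) 1 (real m)"
proof (cases "X \<in> carrier_mat (m + n) (m + n)")
  case X: True
  let ?N = "m + n"
  have "transpose_mat X = X \<longleftrightarrow> symm ?N (\<lambda>i j. X $$ (i, j))"
  proof -
    have "transpose_mat X = X \<longleftrightarrow> (\<forall>i<?N. \<forall>j<?N. transpose_mat X $$ (i, j) = X $$ (i, j))"
    proof
      assume "\<forall>i<?N. \<forall>j<?N. transpose_mat X $$ (i, j) = X $$ (i, j)"
      then show "transpose_mat X = X" by (intro eq_matI) (use X in auto)
    qed simp
    then show ?thesis using X by (auto simp: symm_def)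
  qed
  moreover have "X * X = X \<longleftrightarrow> (\<forall>i<?N. \<forall>j<?N. (\<Sum>l<?N. X $$ (i, l) * X $$ (l, j)) = X $$ (i, j))"
  proof -
    have "X * X = X \<longleftrightarrow> (\<forall>i<?N. \<forall>j<?N. (X * X) $$ (i, j) = X $$ (i, j))"
    proof
      assume "\<forall>i<?N. \<forall>j<?N. (X * X) $$ (i, j) = X $$ (i, j)"
      then show "X * X = X" by (intro eq_matI) (use X in auto)
    qed simp
    then show ?thesis using X by (simp add: scalar_prod_def lessThan_atLeast0)
  qed
  moreover have "mat_trace X = (\<Sum>i<?N. X $$ (i, i))" using X by (simp add: mat_trace_def)
  ultimately show ?thesis using X by (auto simp: grassmannian_def scaled_projection_def)
qed (simp add: grassmannian_def)

lemma flag_shape_partition: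
  assumes "rect_partition m n lam"
  shows "flag_shape (m + n) m (\<lambda>k. n + Suc k - lam (Suc k))"
proof
  have le: "lam (Suc k) \<le> n" if "k < m" for k using assms that by (simp add: rect_partition_def)
  fix j k assume k: "k < m"
  show "n + Suc k - lam (Suc k) \<le> m + n" using k by linarith
  show "k < n + Suc k - lam (Suc k)" using le[OF k] by linarith
  assume j: "j < k"
  have "lam (Suc k) \<le> lam (Suc j)" using assms j k by (simp add: rect_partition_def)
  then show "n + Suc j - lam (Suc j) < n + Suc k - lam (Suc k)" using le[of j] le[OF k] j k by linarith
qed

lemma mem_schubert_variety_iff:
  "X \<in> schubert_variety m n lam \<longleftrightarrow> X \<in> carrier_mat (m + n) (m + n) \<and>
     scaled_projection (m + n) (\<lambda>i j. X $$ (i, j)) 1 (real m) \<and>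
     (\<forall>k<m. fat (m + n) (\<lambda>i j. X $$ (i, j)) (n + Suc k - lam (Suc k)) k)"
proof (cases "X \<in> grassmannian m n")
  case True
  then have X: "X \<in> carrier_mat (m + n) (m + n)" "X * X = X" by (simp_all add: grassmannian_def)
  \<comment> \<open>Counting the conditions from \<open>0\<close> turns "at least \<open>k\<close>"
    into "more than \<open>k\<close>", the form used by \<open>fat\<close>.\<close>
  have "(\<forall>k\<in>{1..m}. k \<le> subspace_dim (m + n) (mat_image X \<inter> coord_subspace (m + n) (n + k - lam k))) \<longleftrightarrow>
    (\<forall>k<m. k < subspace_dim (m + n) (mat_image X \<inter> coord_subspace (m + n) (n + Suc k - lam (Suc k))))"
  proof -
    have "{1..m} = Suc ` {..<m}" by (auto simp: image_Suc_lessThan)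
    then show ?thesis by (auto simp: Suc_le_eq)
  qed
  also have "\<dots> \<longleftrightarrow> (\<forall>k<m. fat (m + n) (\<lambda>i j. X $$ (i, j)) (n + Suc k - lam (Suc k)) k)"
  proof -
    have "n + Suc k - lam (Suc k) \<le> m + n" if "k < m" for k using that by linarith
    then show ?thesis using less_subspace_dim_iff_fat[OF X] by blast
  qed
  finally show ?thesis using True mem_grassmannian_iff by (auto simp: schubert_variety_def)
next
  case False
  then show ?thesis using mem_grassmannian_iff[of X m n] by (auto simp: schubert_variety_def)
qed

lemma flatten_mat_carrier: "X \<in> carrier_mat N N \<Longrightarrow> flatten_mat X \<in> carrier_vec (N^2)"
  by (simp add: flatten_mat_def power2_eq_square)

lemma block_flatten_mat:
  assumes "X \<in> carrier_mat N N" "i < N" "j < N"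
  shows "block N (flatten_mat X) 0 i j = X $$ (i, j)"
  using assms matrix_index_less[of i N j] by (simp add: block_def flatten_mat_def power2_eq_square)

lemma flatten_mat_surj:
  assumes "x \<in> carrier_vec (N^2)"
  shows "flatten_mat (mat N N (\<lambda>(i, j). block N x 0 i j)) = x"
proof (rule eq_vecI)
  show "dim_vec (flatten_mat (mat N N (\<lambda>(i, j). block N x 0 i j))) = dim_vec x"
    using assms by (simp add: flatten_mat_def power2_eq_square)
  fix i assume "i < dim_vec x"
  then have i: "i < N * N" using assms by (simp add: power2_eq_square)
  then have "i div N < N" "i mod N < N"
    by (simp add: less_mult_imp_div_less, metis gr0I i less_nat_zero_code mod_less_divisor mult_0)
  then show "flatten_mat (mat N N (\<lambda>(i, j). block N x 0 i j)) $ i = x $ i"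
    using i by (simp add: flatten_mat_def block_def)
qed

lemma flatten_schubert_variety:
  "flatten_mat ` schubert_variety m n lam = {x \<in> carrier_vec ((m + n)^2).
     scaled_projection (m + n) (block (m + n) x 0) 1 (real m) \<and>
     (\<forall>k<m. fat (m + n) (block (m + n) x 0) (n + Suc k - lam (Suc k)) k)}" (is "_ = ?R")
proof (intro Set.set_eqI iffI)
  let ?N = "m + n"
  fix x assume "x \<in> flatten_mat ` schubert_variety m n lam"
  then obtain X where X: "X \<in> schubert_variety m n lam" "x = flatten_mat X" by blast
  note S = X(1)[unfolded mem_schubert_variety_iff]
  have eq: "X $$ (i, j) = block ?N x 0 i j" if "i < ?N" "j < ?N" for i j
    using block_flatten_mat[OF _ that, of X] S X(2) by simp
  show "x \<in> ?R"
    using S X(2) flatten_mat_carrier[of X ?N] scaled_projection_cong[OF eq] fat_cong[OF eq] by simp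
next
  let ?N = "m + n"
  fix x assume x: "x \<in> ?R"
  let ?X = "mat ?N ?N (\<lambda>(i, j). block ?N x 0 i j)"
  have eq: "block ?N x 0 i j = ?X $$ (i, j)" if "i < ?N" "j < ?N" for i j using that by simp
  have "?X \<in> schubert_variety m n lam"
    unfolding mem_schubert_variety_iff
    using x scaled_projection_cong[OF eq] fat_cong[OF eq] by simp
  moreover have "x = flatten_mat ?X" using flatten_mat_surj[of x ?N] x by simp
  ultimately show "x \<in> flatten_mat ` schubert_variety m n lam" by blast
qed

context flag_shape
begin

text \<open>By \<open>ex_line_flag\<close> every point satisfying the incidence conditions carries a
  flag; so the projection of the flags is onto the whole Schubert variety and not merely onto a
  dense part.\<close>

lemma base_eq: "base = {x \<in> carrier_vec (N^2). scaled_projection N (block N x 0) 1 (real m) \<and>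
    (\<forall>k<m. fat N (block N x 0) (a k) k)}" (is "_ = ?R")
proof (intro Set.set_eqI iffI)
  fix x assume "x \<in> base"
  then obtain y where y: "y \<in> flags" "x = vec_first y (N^2)" unfolding base_def by blast
  note L = flagsD[OF y(1), folded y(2)]
  have "scaled_projection N (block N x 0) 1 (real m)"
    by (rule scaled_projection_cong[OF _ scaled_projection_flag_sum[OF L(1) order_refl]]) (use L(2) in simp)
  moreover have "fat N (block N x 0) (a k) k" if k: "k < m" for k
    by (rule fat_line_flag[OF L a_mono k])
  moreover have "x \<in> carrier_vec (N^2)" using y(2) vec_first_carrier by simp
  ultimately show "x \<in> ?R" by blast
next
  fix x assume x: "x \<in> ?R"
  obtain L where L: "line_flag N m a L" "\<forall>i<N. \<forall>j<N. block N x 0 i j = flag_sum L m i j"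
    using ex_line_flag[of N "block N x 0" m a] x by auto
  have "vec_first (flag_point L) (N^2) = x"
  proof (rule eq_vecI)
    show "dim_vec (vec_first (flag_point L) (N^2)) = dim_vec x" using x by (auto simp: vec_first_def)
    fix r assume "r < dim_vec x"
    then have r: "r < N^2" using x by auto
    then have N: "0 < N" by (cases N) auto
    have ij: "r div N < N" "r mod N < N" using r N by (auto simp: less_mult_imp_div_less power2_eq_square)
    have "block N (flag_point L) 0 (r div N) (r mod N) = block N x 0 (r div N) (r mod N)"
      using block_0_flag_point[OF ij] L(2) ij by simp
    then show "vec_first (flag_point L) (N^2) $ r = x $ r"
      using r by (simp add: block_def vec_first_def)
  qed
  then show "x \<in> base" unfolding base_def using flag_point_in_flags[OF L(1)] by blast
qed

text \<open>Fatness quantifies over all real vectors; replacing it by \<open>elims_vanish\<close>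
  leaves finitely many polynomial equations with rational coefficients.\<close>

lemma algebraic_set_base: "algebraic_set \<rat> (N^2) base"
proof -
  have b: "polyfun \<rat> (N^2) (\<lambda>x. block N x 0 i j)" if "i < N" "j < N" for i j
    using polyfun_block[of 0 1 i N j \<rat>] is_subring_Rats that by simp
  have e: "polyfun \<rat> (N^2) (\<lambda>x. elims N (map std js) (block N x 0) i i)"
    if "set js \<subseteq> {b..<N}" "i < N" for js b i
  proof -
    have "polyfun \<rat> (N^2) (\<lambda>x. elims N (map (\<lambda>w. w x) (map (\<lambda>j x. std j) js)) (block N x 0) i i)"
      by (rule polyfun_elims[OF is_subring_Rats]) (use that b polyfun_std is_subring_Rats in auto)
    then show ?thesis by (simp add: comp_def)
  qed
  have fin: "finite {js. set js \<subseteq> {b..<N} \<and> length js = l}" for b l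
    by (rule finite_lists_length_eq) simp
  have "rational_condition (N^2) (\<lambda>x. scaled_projection N (block N x 0) 1 (real m) \<and>
      (\<forall>k<m. elims_vanish N (block N x 0) (a k) (m - Suc k)))"
    unfolding scaled_projection_def symm_def elims_vanish_def
    by (intro rational_condition_conj rational_condition_less rational_condition_ball rational_condition_imp
        rational_condition_eq polyfun_sum polyfun_mult polyfun_const b fin finite_atLeastLessThan e is_subring_Rats)
      (auto simp: rational_condition_True)
  then have "algebraic_set \<rat> (N^2) {x \<in> carrier_vec (N^2). scaled_projection N (block N x 0) 1 (real m) \<and>
      (\<forall>k<m. elims_vanish N (block N x 0) (a k) (m - Suc k))}"
    by (rule algebraic_set_rational_condition)
  also have "\<dots> = base" unfolding base_eq using fat_iff_elims_vanish by blast
  finally show ?thesis .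
qed

end

theorem theorem2p4:
  fixes m n :: nat and lam :: "nat \<Rightarrow> nat"
  assumes "m \<ge> 1" and "n \<ge> 1"
    and "rect_partition m n lam"
  shows "\<exists>r V'. Q_desingularization ((m + n)^2) r (flatten_mat ` schubert_variety m n lam) V'"
proof -
  interpret flag_shape "m + n" m "\<lambda>k. n + Suc k - lam (Suc k)"
    by (rule flag_shape_partition[OF assms(3)])
  have "flatten_mat ` schubert_variety m n lam = base"
    unfolding base_eq flatten_schubert_variety by (rule refl)
  then show ?thesis using Q_desingularization_flags[OF algebraic_set_base] by metis
qed

end
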